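(* Let $T>0$, $\beta\in(0,1)$, $\eta(t)=(T-t)^{(\beta-1)/2}\,T^{-\beta/2}\sqrt{\beta}$ for $t\in[0,T)$, let $g\in L_2(\gamma)$ and $F:=g\bigl(\int_0^T\eta(t)\,dW_t\bigr)$. Let $0<\theta<1$ and suppose $g\in B^{\theta}_{2,2}(\gamma)$. Then there is a constant $c_2>0$, not depending on $n$, such that for every integer $n\ge 1$, with $t_i:=\frac{i}{n}T$ for $i=0,\dots,n$, $$\Bigl\| F-E F-\sum_{i=1}^n \nu_i\,\bigl(W_{t_i}-W_{t_{i-1}}\bigr)\Bigr\|_{L_2}\le c_2\, n^{-\frac{\beta\theta}{2}},$$ where $$\nu_i=(t_i-t_{i-1})^{-1}\int_{t_{i-1}}^{t_i} E\bigl(({}^pDF)_s\,\big|\,\mathcal F_{t_{i-1}}\bigr)\,ds .$$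
   Context: $(W_t)_{t\ge0}$ is a standard Brownian motion on a complete probability space $(\Omega,\mathcal F,P)$, and $(\mathcal F_t)_{t\ge0}$ is the filtration generated by $W$ augmented by the $P$-null sets. $L_2=L_2(\Omega)$ denotes the square integrable random variables. $\gamma$ is the standard Gaussian measure on $\mathbb R$; $L_2(\gamma)$ is the space of (classes of) Borel functions on $\mathbb R$ square integrable with respect to $\gamma$, and $D^{1,2}(\gamma)\subset L_2(\gamma)$ is the Gaussian Sobolev space of $f\in L_2(\gamma)$ with weak derivative $f'\in L_2(\gamma)$, with norm $(\|f\|_{L_2(\gamma)}^2+\|f'\|_{L_2(\gamma)}^2)^{1/2}$. For $0<\theta<1$ and $1\le q\le\infty$, the Besov space is the real interpolation space $B^{\theta}_{2,q}(\gamma)=(L_2(\gamma),D^{1,2}(\gamma))_{\theta,q}$. In particular, $g\in B^{\theta}_{2,2}(\gamma)$ means $\int_0^\infty (t^{-\theta}K(g,t))^2\frac{dt}{t}<\infty$ with $K(g,t)=\inf\{\|g_0\|_{L_2(\gamma)}+t\|g_1\|_{D^{1,2}(\gamma)}: g=g_0+g_1,\ g_0\in L_2(\gamma),\ g_1\in D^{1,2}(\gamma)\}$. The function $\eta$ satisfies $\|\eta\|_{L_2([0,T])}=1$, so $\int_0^T\eta(t)\,dW_t$ is a standard Gaussian variable and $F\in L_2(\Omega,\mathcal F_T,P)$. Let $D^{1,2}\subset L_2(\Omega,\mathcal F_T,P)$ be the space of random variables with square integrable Malliavin derivative $DF=(D_tF)_{t\in[0,T]}$. For $F\in D^{1,2}$,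 ${}^pDF$ denotes the predictable projection of $DF$ (so $({}^pDF)_t=E(D_tF\,|\,\mathcal F_t)$ for a.e. $t$). The operator $F\mapsto{}^pDF$ is extended by closure from $D^{1,2}$ to all of $L_2(\Omega,\mathcal F_T,P)$, with values in the square integrable predictable processes on $\Omega\times[0,T]$, and the same notation ${}^pDF$ is used for the extension. It satisfies $E(F|\mathcal F_b)-E(F|\mathcal F_a)=\int_a^b({}^pDF)_t\,dW_t$ for $0\le a<b\le T$, i.e. ${}^pDF$ is the integrand in the Itô representation $F=EF+\int_0^T({}^pDF)_t\,dW_t$. *)

theory Defs
  imports "HOL-Probability.Probability"
begin

section \<open>Square integrable functions\<close>

text \<open>Elements of \<open>L\<^sub>2\<close> are represented by functions. Since the Bochner integral of a non-integrable
  function is 0, \<open>L2_norm_of\<close> is meaningful only on \<open>L2_space\<close>.\<close>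

definition L2_space :: "'b measure \<Rightarrow> ('b \<Rightarrow> real) set" where
  "L2_space N = {f \<in> borel_measurable N. integrable N (\<lambda>x. (f x)\<^sup>2)}"

definition L2_norm_of :: "'b measure \<Rightarrow> ('b \<Rightarrow> real) \<Rightarrow> real" where
  "L2_norm_of N f = sqrt (\<integral>x. (f x)\<^sup>2 \<partial>N)"

definition L2_tendsto :: "'b measure \<Rightarrow> (nat \<Rightarrow> 'b \<Rightarrow> real) \<Rightarrow> ('b \<Rightarrow> real) \<Rightarrow> bool" where
  "L2_tendsto N f l \<longleftrightarrow> (\<forall>k. f k \<in> L2_space N) \<and> l \<in> L2_space N \<and>
     (\<lambda>k. L2_norm_of N (\<lambda>x. f k x - l x)) \<longlonglongrightarrow> 0"

abbreviation time_measure :: "real \<Rightarrow> real measure" where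
  "time_measure T \<equiv> restrict_space lborel {0..T}"

abbreviation process_measure :: "'a measure \<Rightarrow> real \<Rightarrow> ('a \<times> real) measure" where
  "process_measure M T \<equiv> M \<Otimes>\<^sub>M time_measure T"


section \<open>Gaussian Sobolev and Besov spaces\<close>

definition std_gauss :: "real measure" where
  "std_gauss = density lborel (\<lambda>x. ennreal (std_normal_density x))"

definition test_function :: "(real \<Rightarrow> real) \<Rightarrow> bool" where
  "test_function \<phi> \<longleftrightarrow> (\<forall>k x. (deriv ^^ k) \<phi> differentiable (at x)) \<and>
     (\<exists>R. \<forall>x. \<bar>x\<bar> > R \<longrightarrow> \<phi> x = 0)"

text \<open>The weak derivative is taken with respect to Lebesgue measure; functions in \<open>L\<^sub>2\<close> of the
  Gaussian measure are locally integrable, so both integrals exist.\<close>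

definition gauss_weak_deriv :: "(real \<Rightarrow> real) \<Rightarrow> (real \<Rightarrow> real) \<Rightarrow> bool" where
  "gauss_weak_deriv f d \<longleftrightarrow> f \<in> L2_space std_gauss \<and> d \<in> L2_space std_gauss \<and>
     (\<forall>\<phi>. test_function \<phi> \<longrightarrow>
        (\<integral>x. f x * deriv \<phi> x \<partial>lborel) = - (\<integral>x. d x * \<phi> x \<partial>lborel))"

definition gauss_K :: "(real \<Rightarrow> real) \<Rightarrow> real \<Rightarrow> real" where
  "gauss_K g t = Inf {L2_norm_of std_gauss g0 +
        t * sqrt ((L2_norm_of std_gauss g1)\<^sup>2 + (L2_norm_of std_gauss d)\<^sup>2) | g0 g1 d.
      g0 \<in> L2_space std_gauss \<and> gauss_weak_deriv g1 d \<and>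
      (AE x in std_gauss. g x = g0 x + g1 x)}"

definition gauss_besov_2_2 :: "real \<Rightarrow> (real \<Rightarrow> real) set" where
  "gauss_besov_2_2 \<theta> = {g \<in> L2_space std_gauss.
     (\<integral>\<^sup>+t. ennreal ((t powr (- \<theta>) * gauss_K g t)\<^sup>2 / t) * indicator {0<..} t \<partial>lborel) < \<infinity>}"


section \<open>Brownian motion and Wiener integral\<close>

definition standard_brownian_motion :: "'a measure \<Rightarrow> (real \<Rightarrow> 'a \<Rightarrow> real) \<Rightarrow> bool" where
  "standard_brownian_motion M W \<longleftrightarrow> prob_space M \<and>
     (\<forall>t\<ge>0. W t \<in> borel_measurable M) \<and>
     (AE \<omega> in M. W 0 \<omega> = 0) \<and>
     (AE \<omega> in M. continuous_on {0..} (\<lambda>t. W t \<omega>)) \<and>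
     (\<forall>s t. 0 \<le> s \<and> s < t \<longrightarrow>
        distributed M lborel (\<lambda>\<omega>. W t \<omega> - W s \<omega>) (normal_density 0 (sqrt (t - s)))) \<and>
     (\<forall>(k::nat) \<tau>. (\<forall>j\<le>k. 0 \<le> \<tau> j) \<and> (\<forall>j<k. \<tau> j < \<tau> (Suc j)) \<longrightarrow>
        prob_space.indep_vars M (\<lambda>_. borel) (\<lambda>j \<omega>. W (\<tau> (Suc j)) \<omega> - W (\<tau> j) \<omega>) {..<k})"

definition aug_filtration :: "'a measure \<Rightarrow> (real \<Rightarrow> 'a \<Rightarrow> real) \<Rightarrow> real \<Rightarrow> 'a measure" where
  "aug_filtration M W t = sigma (space M)
     ({W s -` B \<inter> space M | s B. 0 \<le> s \<and> s \<le> t \<and> B \<in> sets borel} \<union> null_sets M)"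

text \<open>\<open>I\<close> is (a version of) the integral over \<open>[0,T]\<close> of the deterministic function \<open>h\<close> against
  \<open>W\<close>: the \<open>L\<^sub>2\<close>-limit of the integrals of step functions converging to \<open>h\<close>.\<close>

definition is_wiener_integral ::
    "'a measure \<Rightarrow> (real \<Rightarrow> 'a \<Rightarrow> real) \<Rightarrow> real \<Rightarrow> (real \<Rightarrow> real) \<Rightarrow> ('a \<Rightarrow> real) \<Rightarrow> bool" where
  "is_wiener_integral M W T h I \<longleftrightarrow> (\<exists>(m :: nat \<Rightarrow> nat) (\<tau> :: nat \<Rightarrow> nat \<Rightarrow> real) (c :: nat \<Rightarrow> nat \<Rightarrow> real).
     (\<forall>k. 0 \<le> \<tau> k 0 \<and> (\<forall>j<m k. \<tau> k j < \<tau> k (Suc j)) \<and> \<tau> k (m k) \<le> T) \<and>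
     L2_tendsto (time_measure T)
       (\<lambda>k t. \<Sum>j<m k. c k j * indicator {\<tau> k j<..\<tau> k (Suc j)} t) h \<and>
     L2_tendsto M
       (\<lambda>k \<omega>. \<Sum>j<m k. c k j * (W (\<tau> k (Suc j)) \<omega> - W (\<tau> k j) \<omega>)) I)"

definition wiener_integral ::
    "'a measure \<Rightarrow> (real \<Rightarrow> 'a \<Rightarrow> real) \<Rightarrow> real \<Rightarrow> (real \<Rightarrow> real) \<Rightarrow> 'a \<Rightarrow> real" where
  "wiener_integral M W T h = (SOME I. is_wiener_integral M W T h I)"


section \<open>Malliavin derivative\<close>

text \<open>A function of \<open>n\<close> real variables is represented by a function on \<open>nat \<Rightarrow> real\<close> depending only
  on the coordinates below \<open>n\<close>; for these, continuity in the product topology is continuity on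
  Euclidean space.\<close>

definition partial_deriv :: "nat \<Rightarrow> ((nat \<Rightarrow> real) \<Rightarrow> real) \<Rightarrow> (nat \<Rightarrow> real) \<Rightarrow> real" where
  "partial_deriv i f x = deriv (\<lambda>y. f (x(i := y))) (x i)"

definition smooth_poly_growth :: "nat \<Rightarrow> ((nat \<Rightarrow> real) \<Rightarrow> real) \<Rightarrow> bool" where
  "smooth_poly_growth n f \<longleftrightarrow>
     (\<forall>x y. (\<forall>j<n. x j = y j) \<longrightarrow> f x = f y) \<and>
     (\<forall>is. set is \<subseteq> {..<n} \<longrightarrow>
        continuous_on UNIV (foldr partial_deriv is f) \<and>
        (\<forall>i<n. \<forall>x. (\<lambda>y. foldr partial_deriv is f (x(i := y))) differentiable (at (x i))) \<and>
        (\<exists>C (p::nat). \<forall>x. \<bar>foldr partial_deriv is f x\<bar> \<le> C * (1 + (\<Sum>j<n. \<bar>x j\<bar>)) ^ p))"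

text \<open>\<open>F\<close> is a smooth functional of Wiener integrals and \<open>u\<close> its Malliavin derivative,
  \<open>u (\<omega>, t)\<close> being the value of \<open>D\<^sub>t F\<close> at \<open>\<omega>\<close>.\<close>

definition smooth_functional_deriv ::
    "'a measure \<Rightarrow> (real \<Rightarrow> 'a \<Rightarrow> real) \<Rightarrow> real \<Rightarrow> ('a \<Rightarrow> real) \<Rightarrow> ('a \<times> real \<Rightarrow> real) \<Rightarrow> bool" where
  "smooth_functional_deriv M W T F u \<longleftrightarrow> (\<exists>n f h.
     smooth_poly_growth n f \<and> (\<forall>j<n. h j \<in> L2_space (time_measure T)) \<and>
     F = (\<lambda>\<omega>. f (\<lambda>j. wiener_integral M W T (h j) \<omega>)) \<and>
     u = (\<lambda>(\<omega>, t). \<Sum>i<n. partial_deriv i f (\<lambda>j. wiener_integral M W T (h j) \<omega>) * h i t))"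

text \<open>The graph of the closed operator \<open>D\<close>; its domain is the space \<open>D\<^sup>1\<^sup>,\<^sup>2\<close>.\<close>

definition malliavin_deriv ::
    "'a measure \<Rightarrow> (real \<Rightarrow> 'a \<Rightarrow> real) \<Rightarrow> real \<Rightarrow> ('a \<Rightarrow> real) \<Rightarrow> ('a \<times> real \<Rightarrow> real) \<Rightarrow> bool" where
  "malliavin_deriv M W T F u \<longleftrightarrow> (\<exists>F' u'.
     (\<forall>k. smooth_functional_deriv M W T (F' k) (u' k)) \<and>
     L2_tendsto M F' F \<and> L2_tendsto (process_measure M T) u' u)"


section \<open>Predictable projection of the Malliavin derivative\<close>

definition predictable_sigma :: "'a measure \<Rightarrow> (real \<Rightarrow> 'a \<Rightarrow> real) \<Rightarrow> real \<Rightarrow> ('a \<times> real) measure" where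
  "predictable_sigma M W T = sigma (space M \<times> {0..T})
     ({A \<times> {s<..t} | A s t. 0 \<le> s \<and> s < t \<and> t \<le> T \<and> A \<in> sets (aug_filtration M W s)} \<union>
      {A \<times> {0} | A. A \<in> sets (aug_filtration M W 0)})"

text \<open>\<open>u\<close> is only a class modulo null sets of \<open>process_measure M T\<close>, and so is its projection;
  it is determined by predictability and its values at almost every time.\<close>

definition predictable_projection ::
    "'a measure \<Rightarrow> (real \<Rightarrow> 'a \<Rightarrow> real) \<Rightarrow> real \<Rightarrow> ('a \<times> real \<Rightarrow> real) \<Rightarrow> ('a \<times> real \<Rightarrow> real) \<Rightarrow> bool" where
  "predictable_projection M W T u v \<longleftrightarrow>
     v \<in> borel_measurable (predictable_sigma M W T) \<and> v \<in> L2_space (process_measure M T) \<and>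
     (AE t in time_measure T. AE \<omega> in M.
        v (\<omega>, t) = real_cond_exp M (aug_filtration M W t) (\<lambda>\<omega>'. u (\<omega>', t)) \<omega>)"

definition is_pD ::
    "'a measure \<Rightarrow> (real \<Rightarrow> 'a \<Rightarrow> real) \<Rightarrow> real \<Rightarrow> ('a \<Rightarrow> real) \<Rightarrow> ('a \<times> real \<Rightarrow> real) \<Rightarrow> bool" where
  "is_pD M W T F v \<longleftrightarrow> v \<in> borel_measurable (predictable_sigma M W T) \<and>
     (\<exists>F' u' v'. (\<forall>k. malliavin_deriv M W T (F' k) (u' k) \<and>
                     predictable_projection M W T (u' k) (v' k)) \<and>
        L2_tendsto M F' F \<and> L2_tendsto (process_measure M T) v' v)"

definition pD ::
    "'a measure \<Rightarrow> (real \<Rightarrow> 'a \<Rightarrow> real) \<Rightarrow> real \<Rightarrow> ('a \<Rightarrow> real) \<Rightarrow> ('a \<times> real \<Rightarrow> real)" where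
  "pD M W T F = (SOME v. is_pD M W T F v)"

text \<open>The conditional expectations of \<open>u (\<cdot>, s)\<close> given \<open>A\<close>, for varying \<open>s\<close>, are chosen jointly
  measurable in \<open>(\<omega>, s)\<close>, so that they can be integrated over \<open>s\<close>. Picking \<open>real_cond_exp\<close>
  separately for each \<open>s\<close> would not guarantee this.\<close>

definition cond_exp_process ::
    "'a measure \<Rightarrow> 'a measure \<Rightarrow> real \<Rightarrow> ('a \<times> real \<Rightarrow> real) \<Rightarrow> ('a \<times> real \<Rightarrow> real)" where
  "cond_exp_process M A T u = (SOME v.
     v \<in> borel_measurable (A \<Otimes>\<^sub>M time_measure T) \<and>
     (AE s in time_measure T. AE \<omega> in M.
        v (\<omega>, s) = real_cond_exp M A (\<lambda>\<omega>'. u (\<omega>', s)) \<omega>))"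

definition hedge_coeff ::
    "'a measure \<Rightarrow> (real \<Rightarrow> 'a \<Rightarrow> real) \<Rightarrow> real \<Rightarrow> ('a \<Rightarrow> real) \<Rightarrow> real \<Rightarrow> real \<Rightarrow> 'a \<Rightarrow> real" where
  "hedge_coeff M W T F a b \<omega> = inverse (b - a) *
     (LINT s:{a..b}|lborel. cond_exp_process M (aug_filtration M W a) T (pD M W T F) (\<omega>, s))"

end

theory Submission imports Defs begin

text \<open>Expand \<open>g\<close> into Hermite polynomials \<open>H k / sqrt (k!)\<close> with coefficients \<open>c k\<close>. With \<open>\<tau>\<close> the primitive of \<open>\<eta>\<^sup>2\<close> and \<open>X\<close> the
  partial Wiener integral, the integrand of \<open>F\<close> is \<open>\<eta> t * m t\<close>, where \<open>m\<close> is the martingale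
  \<open>\<Sum>k. c k * H' k (\<tau> t, X t) / sqrt (k!)\<close>. Hence \<open>\<nu>\<close> is the mean of \<open>\<eta>\<close> over the interval times \<open>m\<close> at its left
  end, and by orthogonality the squared error is \<open>\<Sum>k\<ge>1. (c k)\<^sup>2 * r k\<close> with explicit \<open>r k \<le> 1\<close> and
  \<open>r k \<le> 3 * k * n powr (- \<beta>)\<close>. Since \<open>\<Sum>k. k * (c k)\<^sup>2\<close> is the squared norm of the weak derivative, the first bound
  controls the \<open>L\<^sub>2\<close> part and the second the Sobolev part of a decomposition of \<open>g\<close>, so that the error is at
  most \<open>sqrt 3\<close> times the K-functional of \<open>g\<close> at \<open>n powr (- \<beta> / 2)\<close>, which the Besov norm bounds.

  The integrand is identified without stochastic integrals: it is the only predictable process \<open>v\<close> such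
  that \<open>E (1\<^sub>A (W t - W s) F)\<close> is the integral of \<open>v\<close> over \<open>A \<times> {s<..t}\<close> for all \<open>A\<close> known at time \<open>s\<close>.\<close>

text \<open>Three objects of the statement, the Wiener integral, \<open>pD\<close> and the process
  of conditional expectations, are mere choices; each has to be shown to exist and then to be
  determined up to null sets. This shapes the proof: computations are made for finite Hermite sums,
  where all objects are explicit, and carried over by \<open>L2\<close> limits. The bound on
  \<open>r k\<close> rests on writing 1 as the sum of the increments of \<open>\<tau> ^ k\<close>
  over the grid and comparing each increment with the contribution of the hedge on the same
  interval. As \<eta> increases, its mean over an interval is at least its value at the left end,
  and what remains are differences of squares of \<eta>, which telescope. \<eta> blows up at
  \<open>T\<close>, so the telescoping stops one interval earlier, and the last interval is treated
  by the bound \<open>n powr (- \<beta>)\<close> for the increments of \<tau>. The powers of \<tau>,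
  the telescoped squares of \<eta> and the last interval each cost at most
  \<open>k * n powr (- \<beta>)\<close>, hence the factor 3.\<close>

lemma tendsto_0_upper_bound:
  fixes a e :: "nat \<Rightarrow> real"
  assumes "\<And>k. 0 \<le> a k" "\<And>k. a k \<le> e k" "e \<longlonglongrightarrow> 0"
  shows "a \<longlonglongrightarrow> 0"
  by (rule tendsto_sandwich[of "\<lambda>_. 0" a sequentially e]) (use assms in auto)

section \<open>The space of square integrable functions\<close>

lemma L2_spaceD:
  assumes "f \<in> L2_space N"
  shows "f \<in> borel_measurable N" "integrable N (\<lambda>x. (f x)\<^sup>2)"
  using assms by (auto simp: L2_space_def)

lemma L2_mult_integrable:
  assumes "f \<in> L2_space N" "g \<in> L2_space N"
  shows "integrable N (\<lambda>x. f x * g x)"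
proof (rule Bochner_Integration.integrable_bound)
  show "integrable N (\<lambda>x. (f x)\<^sup>2 + (g x)\<^sup>2)"
    using L2_spaceD[OF assms(1)] L2_spaceD[OF assms(2)] by auto
  show "(\<lambda>x. f x * g x) \<in> borel_measurable N"
    using L2_spaceD[OF assms(1)] L2_spaceD[OF assms(2)] by auto
  have "\<bar>a * b\<bar> \<le> a\<^sup>2 + b\<^sup>2" for a b :: real
  proof -
    have "2 * \<bar>a\<bar> * \<bar>b\<bar> \<le> \<bar>a\<bar>\<^sup>2 + \<bar>b\<bar>\<^sup>2" by (rule sum_squares_bound)
    moreover have "0 \<le> \<bar>a\<bar> * \<bar>b\<bar>" by simp
    ultimately have "\<bar>a\<bar> * \<bar>b\<bar> \<le> \<bar>a\<bar>\<^sup>2 + \<bar>b\<bar>\<^sup>2" by linarith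
    then show ?thesis by (simp add: abs_mult)
  qed
  then show "AE x in N. norm (f x * g x) \<le> norm ((f x)\<^sup>2 + (g x)\<^sup>2)" by auto
qed

lemma L2_space_add:
  assumes "f \<in> L2_space N" "g \<in> L2_space N"
  shows "(\<lambda>x. f x + g x) \<in> L2_space N"
  using L2_spaceD[OF assms(1)] L2_spaceD[OF assms(2)] L2_mult_integrable[OF assms]
  by (auto simp: L2_space_def power2_sum mult.assoc)

lemma L2_space_cmult:
  assumes "f \<in> L2_space N"
  shows "(\<lambda>x. c * f x) \<in> L2_space N"
  using L2_spaceD[OF assms] by (auto simp: L2_space_def power_mult_distrib)

lemma L2_space_diff:
  assumes "f \<in> L2_space N" "g \<in> L2_space N"
  shows "(\<lambda>x. f x - g x) \<in> L2_space N"
  using L2_space_add[OF assms(1) L2_space_cmult[OF assms(2), of "-1"]] by simp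

lemma L2_space_zero: "(\<lambda>x. 0) \<in> L2_space N"
  by (auto simp: L2_space_def)

lemma L2_space_sum:
  assumes "\<And>i. i \<in> I \<Longrightarrow> f i \<in> L2_space N"
  shows "(\<lambda>x. \<Sum>i\<in>I. f i x) \<in> L2_space N"
  using assms by (induction I rule: infinite_finite_induct) (auto simp: L2_space_zero L2_space_add)

lemma L2_space_bounded_mult:
  assumes f: "f \<in> L2_space N" and h: "h \<in> borel_measurable N" "\<And>x. x \<in> space N \<Longrightarrow> \<bar>h x\<bar> \<le> B"
  shows "(\<lambda>x. h x * f x) \<in> L2_space N"
proof -
  have [measurable]: "f \<in> borel_measurable N" "h \<in> borel_measurable N"
    using L2_spaceD[OF f] h by auto
  have "integrable N (\<lambda>x. (h x * f x)\<^sup>2)"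
  proof (rule Bochner_Integration.integrable_bound)
    show "integrable N (\<lambda>x. B\<^sup>2 * (f x)\<^sup>2)" using L2_spaceD[OF f] by auto
    have "(h x * f x)\<^sup>2 \<le> B\<^sup>2 * (f x)\<^sup>2" if "x \<in> space N" for x
    proof -
      have "(h x)\<^sup>2 \<le> B\<^sup>2" using h(2)[OF that] by (metis abs_le_square_iff abs_ge_self order_trans)
      then show ?thesis by (simp add: power_mult_distrib mult_right_mono)
    qed
    then show "AE x in N. norm ((h x * f x)\<^sup>2) \<le> norm (B\<^sup>2 * (f x)\<^sup>2)"
      by auto
  qed auto
  then show ?thesis by (auto simp: L2_space_def)
qed

lemma (in finite_measure) L2_space_bounded:
  assumes "h \<in> borel_measurable M" "\<And>x. x \<in> space M \<Longrightarrow> \<bar>h x\<bar> \<le> B"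
  shows "h \<in> L2_space M"
proof -
  have "(\<lambda>x. 1) \<in> L2_space M" by (auto simp: L2_space_def)
  from L2_space_bounded_mult[OF this assms] show ?thesis by simp
qed

lemma (in finite_measure) L2_space_integrable:
  assumes "f \<in> L2_space M"
  shows "integrable M f"
  using L2_mult_integrable[OF assms L2_space_bounded[of "\<lambda>_. 1" 1]] by simp

lemma L2_space_cong_AE:
  assumes "f \<in> L2_space N" "AE x in N. f x = g x" "g \<in> borel_measurable N"
  shows "g \<in> L2_space N"
proof -
  have [measurable]: "f \<in> borel_measurable N" using assms L2_spaceD by auto
  note [measurable] = assms(3)
  have "integrable N (\<lambda>x. (g x)\<^sup>2)"
    by (rule integrable_cong_AE_imp[OF L2_spaceD(2)[OF assms(1)]]) (use assms(2) in auto)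
  then show ?thesis using assms by (auto simp: L2_space_def)
qed

lemma L2_norm_of_nonneg [simp]: "0 \<le> L2_norm_of N f"
  by (simp add: L2_norm_of_def)

lemma L2_norm_of_power2: "(L2_norm_of N f)\<^sup>2 = (\<integral>x. (f x)\<^sup>2 \<partial>N)"
  by (simp add: L2_norm_of_def)

lemma L2_norm_of_cong_AE:
  assumes "AE x in N. f x = g x" "f \<in> borel_measurable N" "g \<in> borel_measurable N"
  shows "L2_norm_of N f = L2_norm_of N g"
proof -
  note [measurable] = assms(2,3)
  have "(\<integral>x. (f x)\<^sup>2 \<partial>N) = (\<integral>x. (g x)\<^sup>2 \<partial>N)"
    by (rule integral_cong_AE) (use assms(1) in auto)
  then show ?thesis by (simp add: L2_norm_of_def)
qed

lemma L2_norm_of_cmult: "L2_norm_of N (\<lambda>x. c * f x) = \<bar>c\<bar> * L2_norm_of N f"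
  by (simp add: L2_norm_of_def power_mult_distrib real_sqrt_mult)

lemma L2_norm_of_minus_commute: "L2_norm_of N (\<lambda>x. f x - g x) = L2_norm_of N (\<lambda>x. g x - f x)"
  by (simp add: L2_norm_of_def power2_commute)

text \<open>The squared norm of \<open>f - t * g\<close> is a non-negative quadratic polynomial in
  \<open>t\<close>, which bounds its discriminant.\<close>

lemma L2_Cauchy_Schwarz:
  assumes f: "f \<in> L2_space N" and g: "g \<in> L2_space N"
  shows "\<bar>\<integral>x. f x * g x \<partial>N\<bar> \<le> L2_norm_of N f * L2_norm_of N g"
proof -
  define A B C where "A = (\<integral>x. (f x)\<^sup>2 \<partial>N)" and "B = (\<integral>x. (g x)\<^sup>2 \<partial>N)" and "C = (\<integral>x. f x * g x \<partial>N)"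
  note i = L2_spaceD[OF f] L2_spaceD[OF g] L2_mult_integrable[OF f g]
  have q: "0 \<le> A - 2 * t * C + t\<^sup>2 * B" for t
  proof -
    have "0 \<le> (\<integral>x. (f x - t * g x)\<^sup>2 \<partial>N)" by simp
    also have "\<dots> = (\<integral>x. (f x)\<^sup>2 - 2 * t * (f x * g x) + t\<^sup>2 * (g x)\<^sup>2 \<partial>N)"
      by (intro Bochner_Integration.integral_cong) (auto simp: power2_diff power_mult_distrib algebra_simps)
    also have "\<dots> = A - 2 * t * C + t\<^sup>2 * B"
      using i by (simp add: A_def B_def C_def)
    finally show ?thesis .
  qed
  have B0: "0 \<le> B" by (simp add: B_def)
  have "C\<^sup>2 \<le> A * B"
  proof (cases "B = 0")
    case True
    have "C = 0"
    proof (rule ccontr)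
      assume "C \<noteq> 0"
      \<comment> \<open>With \<open>B = 0\<close> the polynomial is affine in \<open>t\<close>; this
        \<open>t\<close> gives it the value -1.\<close>
      have "0 \<le> A - 2 * ((A + 1) / (2 * C)) * C" using q[of "(A + 1) / (2 * C)"] True by simp
      also have "\<dots> = -1" using \<open>C \<noteq> 0\<close> by (simp add: field_simps)
      finally show False by simp
    qed
    then show ?thesis using True by simp
  next
    case False
    then have "0 < B" using B0 by simp
    \<comment> \<open>\<open>C / B\<close> is the minimiser of the quadratic polynomial.\<close>
    have "0 \<le> A - 2 * (C / B) * C + (C / B)\<^sup>2 * B" by (rule q)
    also have "\<dots> = A - C\<^sup>2 / B" using \<open>0 < B\<close> by (simp add: field_simps power2_eq_square)
    finally show ?thesis using \<open>0 < B\<close> by (simp add: field_simps)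
  qed
  then have "sqrt (C\<^sup>2) \<le> sqrt (A * B)" by (rule real_sqrt_le_mono)
  then show ?thesis by (simp add: A_def B_def C_def L2_norm_of_def real_sqrt_mult)
qed

lemma L2_norm_of_triangle:
  assumes f: "f \<in> L2_space N" and g: "g \<in> L2_space N"
  shows "L2_norm_of N (\<lambda>x. f x + g x) \<le> L2_norm_of N f + L2_norm_of N g"
proof -
  note i = L2_spaceD[OF f] L2_spaceD[OF g] L2_mult_integrable[OF f g]
  have "(L2_norm_of N (\<lambda>x. f x + g x))\<^sup>2 = (\<integral>x. (f x)\<^sup>2 + (g x)\<^sup>2 + 2 * (f x * g x) \<partial>N)"
    by (simp add: L2_norm_of_power2 power2_sum algebra_simps)
  also have "\<dots> = (L2_norm_of N f)\<^sup>2 + (L2_norm_of N g)\<^sup>2 + 2 * (\<integral>x. f x * g x \<partial>N)"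
    using i by (simp add: L2_norm_of_power2)
  also have "\<dots> \<le> (L2_norm_of N f + L2_norm_of N g)\<^sup>2"
    using L2_Cauchy_Schwarz[OF f g] by (simp add: power2_sum)
  finally show ?thesis by (rule power2_le_imp_le) simp
qed

lemma L2_norm_of_triangle3:
  assumes "f \<in> L2_space N" "g \<in> L2_space N" "h \<in> L2_space N"
  shows "L2_norm_of N (\<lambda>x. f x - h x) \<le> L2_norm_of N (\<lambda>x. f x - g x) + L2_norm_of N (\<lambda>x. g x - h x)"
  using L2_norm_of_triangle[OF L2_space_diff[OF assms(1,2)] L2_space_diff[OF assms(2,3)]] by simp

lemma L2_norm_of_diff_le:
  assumes "f \<in> L2_space N" "g \<in> L2_space N"
  shows "L2_norm_of N (\<lambda>x. f x - g x) \<le> L2_norm_of N f + L2_norm_of N g"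
  using L2_norm_of_triangle[OF assms(1) L2_space_cmult[OF assms(2), of "-1"]]
  by (simp add: L2_norm_of_def)

lemma L2_norm_of_sum_le:
  assumes "finite I" "\<And>i. i \<in> I \<Longrightarrow> f i \<in> L2_space N"
  shows "L2_norm_of N (\<lambda>x. \<Sum>i\<in>I. f i x) \<le> (\<Sum>i\<in>I. L2_norm_of N (f i))"
  using assms
proof (induction I rule: finite_induct)
  case empty
  then show ?case by (simp add: L2_norm_of_def)
next
  case (insert i I)
  have "L2_norm_of N (\<lambda>x. f i x + (\<Sum>i\<in>I. f i x)) \<le> L2_norm_of N (f i) + L2_norm_of N (\<lambda>x. \<Sum>i\<in>I. f i x)"
    using insert by (intro L2_norm_of_triangle L2_space_sum) auto
  then show ?case using insert by simp
qed

lemma L2_tendstoD: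
  assumes "L2_tendsto N f l"
  shows "f k \<in> L2_space N" "l \<in> L2_space N" "(\<lambda>k. L2_norm_of N (\<lambda>x. f k x - l x)) \<longlonglongrightarrow> 0"
  using assms by (auto simp: L2_tendsto_def)

lemma L2_tendsto_const: "f \<in> L2_space N \<Longrightarrow> L2_tendsto N (\<lambda>_. f) f"
  by (simp add: L2_tendsto_def L2_norm_of_def)

lemma L2_tendstoI_le:
  assumes "\<And>k. f k \<in> L2_space N" "l \<in> L2_space N"
    "\<And>k. L2_norm_of N (\<lambda>x. f k x - l x) \<le> e k" "e \<longlonglongrightarrow> 0"
  shows "L2_tendsto N f l"
  unfolding L2_tendsto_def
  using assms(1,2) tendsto_0_upper_bound[OF _ assms(3,4)] by auto

lemma L2_tendsto_add:
  assumes "L2_tendsto N f l" "L2_tendsto N g m"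
  shows "L2_tendsto N (\<lambda>k x. f k x + g k x) (\<lambda>x. l x + m x)"
proof (rule L2_tendstoI_le)
  note a = L2_tendstoD[OF assms(1)] and b = L2_tendstoD[OF assms(2)]
  show "(\<lambda>x. f k x + g k x) \<in> L2_space N" "(\<lambda>x. l x + m x) \<in> L2_space N" for k
    using a b by (auto intro: L2_space_add)
  show "L2_norm_of N (\<lambda>x. f k x + g k x - (l x + m x))
    \<le> L2_norm_of N (\<lambda>x. f k x - l x) + L2_norm_of N (\<lambda>x. g k x - m x)" for k
    using L2_norm_of_triangle[OF L2_space_diff[OF a(1)[of k] a(2)] L2_space_diff[OF b(1)[of k] b(2)]]
    by (simp add: algebra_simps)
  show "(\<lambda>k. L2_norm_of N (\<lambda>x. f k x - l x) + L2_norm_of N (\<lambda>x. g k x - m x)) \<longlonglongrightarrow> 0"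
    using tendsto_add[OF a(3) b(3)] by simp
qed

lemma L2_tendsto_bounded_mult:
  assumes "L2_tendsto N f l" "h \<in> borel_measurable N" "\<And>x. x \<in> space N \<Longrightarrow> \<bar>h x\<bar> \<le> B"
  shows "L2_tendsto N (\<lambda>k x. h x * f k x) (\<lambda>x. h x * l x)"
proof (rule L2_tendstoI_le)
  note a = L2_tendstoD[OF assms(1)]
  show "(\<lambda>x. h x * f k x) \<in> L2_space N" "(\<lambda>x. h x * l x) \<in> L2_space N" for k
    using a assms by (auto intro: L2_space_bounded_mult)
  show "L2_norm_of N (\<lambda>x. h x * f k x - h x * l x) \<le> \<bar>B\<bar> * L2_norm_of N (\<lambda>x. f k x - l x)" for k
  proof -
    have d: "(\<lambda>x. f k x - l x) \<in> L2_space N" using a by (auto intro: L2_space_diff)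
    have "(L2_norm_of N (\<lambda>x. h x * f k x - h x * l x))\<^sup>2 = (\<integral>x. (h x * (f k x - l x))\<^sup>2 \<partial>N)"
      by (simp add: L2_norm_of_power2 algebra_simps)
    also have "\<dots> \<le> (\<integral>x. B\<^sup>2 * (f k x - l x)\<^sup>2 \<partial>N)"
    proof (rule integral_mono)
      show "integrable N (\<lambda>x. (h x * (f k x - l x))\<^sup>2)"
        using L2_spaceD(2)[OF L2_space_bounded_mult[OF d assms(2,3)]] by simp
      show "integrable N (\<lambda>x. B\<^sup>2 * (f k x - l x)\<^sup>2)" using L2_spaceD(2)[OF d] by simp
      fix x assume x: "x \<in> space N"
      have "(h x)\<^sup>2 \<le> B\<^sup>2" using assms(3)[OF x] by (metis abs_le_square_iff abs_ge_self order_trans)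
      then show "(h x * (f k x - l x))\<^sup>2 \<le> B\<^sup>2 * (f k x - l x)\<^sup>2"
        by (simp add: power_mult_distrib mult_right_mono)
    qed
    also have "\<dots> = (\<bar>B\<bar> * L2_norm_of N (\<lambda>x. f k x - l x))\<^sup>2"
      by (simp add: power_mult_distrib L2_norm_of_power2)
    finally show ?thesis by (rule power2_le_imp_le) simp
  qed
  show "(\<lambda>k. \<bar>B\<bar> * L2_norm_of N (\<lambda>x. f k x - l x)) \<longlonglongrightarrow> 0"
    using tendsto_mult_left[OF a(3), of "\<bar>B\<bar>"] by simp
qed

lemma L2_tendsto_cmult:
  assumes "L2_tendsto N f l"
  shows "L2_tendsto N (\<lambda>k x. c * f k x) (\<lambda>x. c * l x)"
  by (rule L2_tendsto_bounded_mult[OF assms, where B="\<bar>c\<bar>"]) auto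

lemma L2_tendsto_diff:
  assumes "L2_tendsto N f l" "L2_tendsto N g m"
  shows "L2_tendsto N (\<lambda>k x. f k x - g k x) (\<lambda>x. l x - m x)"
  using L2_tendsto_add[OF assms(1) L2_tendsto_cmult[OF assms(2), of "-1"]] by simp

lemma L2_tendsto_sum:
  assumes "\<And>i. i \<in> I \<Longrightarrow> L2_tendsto N (f i) (l i)"
  shows "L2_tendsto N (\<lambda>k x. \<Sum>i\<in>I. f i k x) (\<lambda>x. \<Sum>i\<in>I. l i x)"
  using assms
  by (induction I rule: infinite_finite_induct)
     (auto simp: L2_space_zero L2_tendsto_const intro!: L2_tendsto_add)

lemma L2_tendsto_subseq:
  assumes "L2_tendsto N f l" "strict_mono r"
  shows "L2_tendsto N (\<lambda>k. f (r k)) l"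
  using assms LIMSEQ_subseq_LIMSEQ[OF L2_tendstoD(3)[OF assms(1)] assms(2)]
  by (auto simp: L2_tendsto_def comp_def)

lemma L2_tendsto_cong_AE:
  assumes "L2_tendsto N f l" "\<And>k. AE x in N. f k x = f' k x" "AE x in N. l x = l' x"
    "\<And>k. f' k \<in> borel_measurable N" "l' \<in> borel_measurable N"
  shows "L2_tendsto N f' l'"
proof -
  note a = L2_tendstoD[OF assms(1)]
  have f': "f' k \<in> L2_space N" for k by (rule L2_space_cong_AE[OF a(1) assms(2,4)])
  have l': "l' \<in> L2_space N" by (rule L2_space_cong_AE[OF a(2) assms(3,5)])
  have "L2_norm_of N (\<lambda>x. f k x - l x) = L2_norm_of N (\<lambda>x. f' k x - l' x)" for k
  proof (rule L2_norm_of_cong_AE)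
    show "AE x in N. f k x - l x = f' k x - l' x" using assms(2)[of k] assms(3) by eventually_elim simp
  qed (use L2_spaceD(1)[OF a(1)] L2_spaceD(1)[OF a(2)] assms(4,5) in \<open>auto intro!: borel_measurable_diff\<close>)
  then show ?thesis using f' l' a(3) by (simp add: L2_tendsto_def)
qed

lemma L2_tendsto_inner:
  assumes "L2_tendsto N f l" "L2_tendsto N g m"
  shows "(\<lambda>k. \<integral>x. f k x * g k x \<partial>N) \<longlonglongrightarrow> (\<integral>x. l x * m x \<partial>N)"
proof -
  note a = L2_tendstoD[OF assms(1)] and b = L2_tendstoD[OF assms(2)]
  let ?nf = "\<lambda>k. L2_norm_of N (\<lambda>x. f k x - l x)" and ?ng = "\<lambda>k. L2_norm_of N (\<lambda>x. g k x - m x)"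
  have e: "\<bar>(\<integral>x. f k x * g k x \<partial>N) - (\<integral>x. l x * m x \<partial>N)\<bar>
      \<le> ?nf k * ?ng k + ?nf k * L2_norm_of N m + L2_norm_of N l * ?ng k" for k
  proof -
    have df: "(\<lambda>x. f k x - l x) \<in> L2_space N" and dg: "(\<lambda>x. g k x - m x) \<in> L2_space N"
      using a b by (auto intro: L2_space_diff)
    have "(\<integral>x. f k x * g k x \<partial>N) - (\<integral>x. l x * m x \<partial>N) = (\<integral>x. f k x * g k x - l x * m x \<partial>N)"
      using L2_mult_integrable[OF a(1) b(1)] L2_mult_integrable[OF a(2) b(2)] by simp
    also have "\<dots> = (\<integral>x. (f k x - l x) * (g k x - m x) + (f k x - l x) * m x + l x * (g k x - m x) \<partial>N)"
      by (intro Bochner_Integration.integral_cong) (auto simp: algebra_simps)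
    also have "\<dots> = (\<integral>x. (f k x - l x) * (g k x - m x) \<partial>N) + (\<integral>x. (f k x - l x) * m x \<partial>N) + (\<integral>x. l x * (g k x - m x) \<partial>N)"
      using L2_mult_integrable[OF df dg] L2_mult_integrable[OF df b(2)] L2_mult_integrable[OF a(2) dg]
      by simp
    finally show ?thesis
      using L2_Cauchy_Schwarz[OF df dg] L2_Cauchy_Schwarz[OF df b(2)] L2_Cauchy_Schwarz[OF a(2) dg]
      by linarith
  qed
  have "(\<lambda>k. ?nf k * ?ng k + ?nf k * L2_norm_of N m + L2_norm_of N l * ?ng k)
      \<longlonglongrightarrow> 0 * 0 + 0 * L2_norm_of N m + L2_norm_of N l * 0"
    by (intro tendsto_intros a(3) b(3))
  then have "(\<lambda>k. \<bar>(\<integral>x. f k x * g k x \<partial>N) - (\<integral>x. l x * m x \<partial>N)\<bar>) \<longlonglongrightarrow> 0"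
    using tendsto_0_upper_bound[OF _ e] by simp
  then show ?thesis using LIM_zero_iff tendsto_rabs_zero_iff by blast
qed

lemma L2_tendsto_norm2:
  assumes "L2_tendsto N f l"
  shows "(\<lambda>k. \<integral>x. (f k x)\<^sup>2 \<partial>N) \<longlonglongrightarrow> (\<integral>x. (l x)\<^sup>2 \<partial>N)"
  using L2_tendsto_inner[OF assms assms] by (simp add: power2_eq_square)

lemma L2_norm_of_eq_0_AE:
  assumes "f \<in> L2_space N" "L2_norm_of N f = 0"
  shows "AE x in N. f x = 0"
proof -
  have "(\<integral>x. (f x)\<^sup>2 \<partial>N) = 0" using assms(2) by (simp add: L2_norm_of_def)
  then have "AE x in N. (f x)\<^sup>2 = 0"
    using integral_nonneg_eq_0_iff_AE[OF L2_spaceD(2)[OF assms(1)]] by simp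
  then show ?thesis by auto
qed

lemma L2_tendsto_unique:
  assumes "L2_tendsto N f l" "L2_tendsto N f m"
  shows "AE x in N. l x = m x"
proof -
  have "L2_tendsto N (\<lambda>k x. f k x - f k x) (\<lambda>x. l x - m x)"
    by (rule L2_tendsto_diff[OF assms])
  from L2_tendsto_norm2[OF this] have "(\<integral>x. (l x - m x)\<^sup>2 \<partial>N) = 0"
    by (simp add: LIMSEQ_const_iff)
  then have "AE x in N. l x - m x = 0"
    using L2_tendstoD(2)[OF assms(1)] L2_tendstoD(2)[OF assms(2)]
    by (intro L2_norm_of_eq_0_AE L2_space_diff) (auto simp: L2_norm_of_def)
  then show ?thesis by auto
qed

section \<open>Almost everywhere convergence, completeness and convergence of integrals\<close>

lemma L2_tendsto_AE_subseq:
  assumes "L2_tendsto N f l"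
  obtains r :: "nat \<Rightarrow> nat" where "strict_mono r" "AE x in N. (\<lambda>k. f (r k) x) \<longlonglongrightarrow> l x"
proof -
  note a = L2_tendstoD[OF assms]
  have "(\<lambda>k. (L2_norm_of N (\<lambda>x. f k x - l x))\<^sup>2) \<longlonglongrightarrow> 0\<^sup>2" by (intro tendsto_intros a(3))
  then have "(\<lambda>k. \<integral>x. norm ((f k x - l x)\<^sup>2) \<partial>N) \<longlonglongrightarrow> 0" by (simp add: L2_norm_of_power2)
  from tendsto_L1_AE_subseq[OF _ this] L2_spaceD(2)[OF L2_space_diff[OF a(1) a(2)]]
  obtain r :: "nat \<Rightarrow> nat" where r: "strict_mono r" "AE x in N. (\<lambda>n. (f (r n) x - l x)\<^sup>2) \<longlonglongrightarrow> 0"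
    by auto
  have "AE x in N. (\<lambda>k. f (r k) x) \<longlonglongrightarrow> l x"
    using r(2)
  proof eventually_elim
    case (elim x)
    from tendsto_real_sqrt[OF elim] have "(\<lambda>n. \<bar>f (r n) x - l x\<bar>) \<longlonglongrightarrow> 0" by simp
    then show ?case using LIM_zero_iff tendsto_rabs_zero_iff by blast
  qed
  with r(1) show ?thesis using that by blast
qed

text \<open>Fatou's lemma for the squares: pointwise convergence and bounded norms suffice, without
  a dominating function.\<close>

lemma L2_Fatou:
  assumes X: "\<And>k. X k \<in> L2_space N" and Y[measurable]: "Y \<in> borel_measurable N"
    and C: "\<And>k. (\<integral>x. (X k x)\<^sup>2 \<partial>N) \<le> C"
    and lim: "AE x in N. (\<lambda>k. X k x) \<longlonglongrightarrow> Y x"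
  shows "Y \<in> L2_space N" "(\<integral>x. (Y x)\<^sup>2 \<partial>N) \<le> C"
proof -
  have [measurable]: "X k \<in> borel_measurable N" for k using X L2_spaceD by blast
  have "(\<integral>\<^sup>+x. ennreal ((Y x)\<^sup>2) \<partial>N) = (\<integral>\<^sup>+x. liminf (\<lambda>k. ennreal ((X k x)\<^sup>2)) \<partial>N)"
  proof (rule nn_integral_cong_AE)
    show "AE x in N. ennreal ((Y x)\<^sup>2) = liminf (\<lambda>k. ennreal ((X k x)\<^sup>2))"
      using lim
    proof eventually_elim
      case (elim x)
      have "(\<lambda>k. ennreal ((X k x)\<^sup>2)) \<longlonglongrightarrow> ennreal ((Y x)\<^sup>2)"
        by (intro tendsto_ennrealI tendsto_intros elim)
      then show ?case by (rule lim_imp_Liminf[OF sequentially_bot, symmetric])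
    qed
  qed
  also have "\<dots> \<le> liminf (\<lambda>k. \<integral>\<^sup>+x. ennreal ((X k x)\<^sup>2) \<partial>N)"
    by (rule nn_integral_liminf) auto
  also have "\<dots> \<le> liminf (\<lambda>k. ennreal C)"
  proof (intro Liminf_mono always_eventually allI)
    fix k
    have "(\<integral>\<^sup>+x. ennreal ((X k x)\<^sup>2) \<partial>N) = ennreal (\<integral>x. (X k x)\<^sup>2 \<partial>N)"
      by (intro nn_integral_eq_integral L2_spaceD(2)[OF X]) auto
    then show "(\<integral>\<^sup>+x. ennreal ((X k x)\<^sup>2) \<partial>N) \<le> ennreal C" using C[of k] by (simp add: ennreal_leI)
  qed
  finally have fin: "(\<integral>\<^sup>+x. ennreal ((Y x)\<^sup>2) \<partial>N) \<le> ennreal C" by (simp add: Liminf_const)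
  then have intY: "integrable N (\<lambda>x. (Y x)\<^sup>2)"
    by (intro integrableI_bounded) (auto intro: le_less_trans)
  then show "Y \<in> L2_space N" by (auto simp: L2_space_def)
  have "0 \<le> C" by (rule order_trans[OF _ C[of 0]]) simp
  then show "(\<integral>x. (Y x)\<^sup>2 \<partial>N) \<le> C" using fin nn_integral_eq_integral[OF intY] by simp
qed

text \<open>On a finite measure space an \<open>L2\<close> Cauchy sequence is \<open>L1\<close>
  Cauchy, so a subsequence converges almost everywhere, and Fatou moves the Cauchy estimate to the
  limit. The limit is defined pointwise by \<open>lim\<close>, which keeps it measurable for
  \<open>G\<close> itself; this is how adapted and predictable limits are obtained later.\<close>

lemma (in finite_measure) L2_complete_subalgebra:
  assumes G: "subalgebra M G" and f: "\<And>k. f k \<in> L2_space M" "\<And>k. f k \<in> borel_measurable G"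
    and C: "\<And>e. e > 0 \<Longrightarrow> \<exists>K. \<forall>m\<ge>K. \<forall>n\<ge>K. L2_norm_of M (\<lambda>x. f m x - f n x) \<le> e"
  shows "\<exists>l. L2_tendsto M f l \<and> l \<in> borel_measurable G"
proof -
  have one: "(\<lambda>x. 1) \<in> L2_space M" by (auto simp: L2_space_def)
  \<comment> \<open>The added 1 makes \<open>?c\<close> positive also for the null measure.\<close>
  let ?c = "L2_norm_of M (\<lambda>x. 1) + 1"
  have c: "0 < ?c" by (simp add: add_nonneg_pos)
  obtain r where r: "strict_mono r" "AE x in M. Cauchy (\<lambda>k. f (r k) x)"
  proof (rule cauchy_L1_AE_cauchy_subseq[of M f])
    show "integrable M (f n)" for n by (rule L2_space_integrable[OF f(1)])
    fix e :: real assume "e > 0"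
    then obtain K where K: "\<forall>m\<ge>K. \<forall>n\<ge>K. L2_norm_of M (\<lambda>x. f m x - f n x) \<le> e / 2 / ?c"
      using C[of "e / 2 / ?c"] c by auto
    have "(\<integral>x. norm (f m x - f n x) \<partial>M) < e" if "m \<ge> K" "n \<ge> K" for m n
    proof -
      have d: "(\<lambda>x. \<bar>f m x - f n x\<bar>) \<in> L2_space M"
        using L2_spaceD[OF L2_space_diff[OF f(1) f(1)]] by (auto simp: L2_space_def)
      have "(\<integral>x. norm (f m x - f n x) \<partial>M) \<le> L2_norm_of M (\<lambda>x. f m x - f n x) * L2_norm_of M (\<lambda>x. 1)"
        using L2_Cauchy_Schwarz[OF d one] by (simp add: L2_norm_of_def)
      also have "\<dots> \<le> e / 2 / ?c * ?c"
        using K that divide_pos_pos[OF _ c, of "e / 2"] \<open>e > 0\<close> by (intro mult_mono less_imp_le[of 0 "_ / _"]) auto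
      also have "\<dots> = e / 2" using c by (simp only: nonzero_eq_divide_eq[symmetric])
      also have "\<dots> < e" using \<open>e > 0\<close> by simp
      finally show ?thesis .
    qed
    then show "\<exists>K. \<forall>i\<ge>K. \<forall>j\<ge>K. (\<integral>x. norm (f i x - f j x) \<partial>M) < e" by blast
  qed
  define l where "l x = lim (\<lambda>k. f (r k) x)" for x
  have lG: "l \<in> borel_measurable G"
    unfolding l_def[abs_def] by (rule borel_measurable_lim_metric) (rule f(2))
  have lM: "l \<in> borel_measurable M" by (rule measurable_from_subalg[OF G lG])
  have lim: "AE x in M. (\<lambda>k. f (r k) x) \<longlonglongrightarrow> l x"
    using r(2) by eventually_elim (simp add: l_def Cauchy_convergent_iff convergent_LIMSEQ_iff)
  have est: "\<exists>K. \<forall>m\<ge>K. (\<lambda>x. f m x - l x) \<in> L2_space M \<and> L2_norm_of M (\<lambda>x. f m x - l x) \<le> e" if e: "e > 0" for e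
  proof -
    obtain K where K: "\<forall>m\<ge>K. \<forall>n\<ge>K. L2_norm_of M (\<lambda>x. f m x - f n x) \<le> e" using C[OF e] by blast
    have "(\<lambda>x. f m x - l x) \<in> L2_space M \<and> L2_norm_of M (\<lambda>x. f m x - l x) \<le> e" if m: "m \<ge> K" for m
    proof -
      \<comment> \<open>The shift by \<open>K\<close> puts every index \<open>r (k + K)\<close> into
        the range of the Cauchy estimate.\<close>
      let ?X = "\<lambda>k x. f m x - f (r (k + K)) x"
      have X: "?X k \<in> L2_space M" for k by (intro L2_space_diff f)
      have b: "(\<integral>x. (?X k x)\<^sup>2 \<partial>M) \<le> e\<^sup>2" for k
        unfolding L2_norm_of_power2[symmetric] using K m seq_suble[OF r(1), of "k + K"] by (intro power_mono) auto
      have t: "AE x in M. (\<lambda>k. ?X k x) \<longlonglongrightarrow> f m x - l x"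
        using lim by eventually_elim (intro tendsto_intros LIMSEQ_ignore_initial_segment)
      have ym: "(\<lambda>x. f m x - l x) \<in> borel_measurable M" using L2_spaceD(1)[OF f(1)] lM by simp
      note F = L2_Fatou[OF X ym b t]
      have "L2_norm_of M (\<lambda>x. f m x - l x) \<le> e"
        by (rule power2_le_imp_le) (use F(2) e in \<open>auto simp: L2_norm_of_power2\<close>)
      with F(1) show ?thesis by blast
    qed
    then show ?thesis by blast
  qed
  obtain m where "(\<lambda>x. f m x - l x) \<in> L2_space M" using est[of 1] by auto
  from L2_space_diff[OF f(1)[of m] this] have l: "l \<in> L2_space M" by simp
  have "(\<lambda>k. L2_norm_of M (\<lambda>x. f k x - l x)) \<longlonglongrightarrow> 0"
  proof (rule LIMSEQ_I)
    fix e :: real assume e: "e > 0"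
    obtain K where "\<forall>m\<ge>K. L2_norm_of M (\<lambda>x. f m x - l x) \<le> e / 2" using est[of "e / 2"] e by auto
    then show "\<exists>K. \<forall>n\<ge>K. norm (L2_norm_of M (\<lambda>x. f n x - l x) - 0) < e"
      using e by (intro exI[of _ K]) fastforce
  qed
  then show ?thesis using f l lG by (auto simp: L2_tendsto_def)
qed

lemma L2_tendsto_Cauchy:
  assumes "L2_tendsto N f l" "e > 0"
  shows "\<exists>K. \<forall>m\<ge>K. \<forall>n\<ge>K. L2_norm_of N (\<lambda>x. f m x - f n x) \<le> e"
proof -
  note a = L2_tendstoD[OF assms(1)]
  obtain K where K: "\<forall>m\<ge>K. norm (L2_norm_of N (\<lambda>x. f m x - l x) - 0) < e / 2"
    using LIMSEQ_D[OF a(3), of "e/2"] \<open>e > 0\<close> by auto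
  have "L2_norm_of N (\<lambda>x. f m x - f n x) \<le> e" if "m \<ge> K" "n \<ge> K" for m n
  proof -
    have "L2_norm_of N (\<lambda>x. f m x - l x) < e / 2" "L2_norm_of N (\<lambda>x. l x - f n x) < e / 2"
      using K that L2_norm_of_minus_commute[of N l "f n"] by auto
    then show ?thesis using L2_norm_of_triangle3[OF a(1)[of m] a(2) a(1)[of n]] by linarith
  qed
  then show ?thesis by blast
qed

text \<open>Bounded second moments give uniform integrability. The difference \<open>Z\<close> is
  split by \<open>\<bar>Z\<bar> \<le> min \<bar>Z\<bar> R + Z\<^sup>2 / R\<close>: the truncated
  part tends to 0 by dominated convergence, the rest is at most \<open>4 * C / R\<close>.\<close>

lemma (in finite_measure) tendsto_integral_of_bounded_second_moment:
  assumes X: "\<And>k. X k \<in> L2_space M" and Y[measurable]: "Y \<in> borel_measurable M"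
    and C: "\<And>k. (\<integral>x. (X k x)\<^sup>2 \<partial>M) \<le> C"
    and lim: "AE x in M. (\<lambda>k. X k x) \<longlonglongrightarrow> Y x"
  shows "Y \<in> L2_space M" "(\<lambda>k. \<integral>x. X k x \<partial>M) \<longlonglongrightarrow> (\<integral>x. Y x \<partial>M)"
proof -
  have [measurable]: "X k \<in> borel_measurable M" for k using X L2_spaceD by blast
  note F = L2_Fatou[OF X Y C lim]
  note Y2 = F(1) and YC = F(2)
  show "Y \<in> L2_space M" by (rule Y2)
  have C0: "0 \<le> C" by (rule order_trans[OF _ C[of 0]]) simp
  define Z where "Z k x = X k x - Y x" for k x
  have Z2: "Z k \<in> L2_space M" for k unfolding Z_def by (intro L2_space_diff X Y2)
  have [measurable]: "Z k \<in> borel_measurable M" for k unfolding Z_def by measurable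
  have ZC: "(\<integral>x. (Z k x)\<^sup>2 \<partial>M) \<le> 4 * C" for k
  proof -
    have "L2_norm_of M (Z k) \<le> L2_norm_of M (X k) + L2_norm_of M Y"
      unfolding Z_def by (intro L2_norm_of_diff_le X Y2)
    also have "\<dots> \<le> sqrt C + sqrt C"
      unfolding L2_norm_of_def by (intro add_mono real_sqrt_le_mono C YC)
    finally have "(L2_norm_of M (Z k))\<^sup>2 \<le> (2 * sqrt C)\<^sup>2" by (intro power_mono) auto
    then show ?thesis using C0 by (simp add: L2_norm_of_power2 power_mult_distrib)
  qed
  have lim0: "(\<lambda>k. \<integral>x. min \<bar>Z k x\<bar> R \<partial>M) \<longlonglongrightarrow> 0" if "R > 0" for R
  proof -
    have "(\<lambda>k. \<integral>x. min \<bar>Z k x\<bar> R \<partial>M) \<longlonglongrightarrow> (\<integral>x. 0 \<partial>M)"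
    proof (rule integral_dominated_convergence[where w="\<lambda>_. R"])
      show "AE x in M. (\<lambda>k. min \<bar>Z k x\<bar> R) \<longlonglongrightarrow> 0"
        using lim
      proof eventually_elim
        case (elim x)
        have "(\<lambda>k. min \<bar>X k x - Y x\<bar> R) \<longlonglongrightarrow> min \<bar>Y x - Y x\<bar> R"
          by (intro tendsto_intros elim)
        then show ?case using that by (simp add: Z_def)
      qed
    qed (use that in auto)
    then show ?thesis by simp
  qed
  have "(\<lambda>k. \<integral>x. \<bar>Z k x\<bar> \<partial>M) \<longlonglongrightarrow> 0"
  proof (rule LIMSEQ_I)
    fix e :: real assume e: "e > 0"
    \<comment> \<open>Chosen so that \<open>4 * C / R < e / 2\<close>; the bound
      \<open>4 * C\<close> comes from the triangle inequality for two functions of norm at most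
      \<open>sqrt C\<close>.\<close>
    define R where "R = 8 * C / e + 1"
    have R: "R > 0" "4 * C / R < e / 2 \<or> C = 0"
      using e C0 by (auto simp: R_def field_simps add_nonneg_pos)
    have R2: "4 * C / R < e / 2" using R e by auto
    obtain no where no: "\<forall>n\<ge>no. norm ((\<integral>x. min \<bar>Z n x\<bar> R \<partial>M) - 0) < e / 2"
      using LIMSEQ_D[OF lim0[OF R(1)], of "e/2"] e by auto
    have "norm ((\<integral>x. \<bar>Z n x\<bar> \<partial>M) - 0) < e" if "n \<ge> no" for n
    proof -
      have i: "integrable M (\<lambda>x. min \<bar>Z n x\<bar> R)" "integrable M (\<lambda>x. (Z n x)\<^sup>2 / R)"
        "integrable M (\<lambda>x. \<bar>Z n x\<bar>)"
        using L2_spaceD(2)[OF Z2[of n]] L2_space_integrable[OF Z2[of n]] by auto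
      have "(\<integral>x. \<bar>Z n x\<bar> \<partial>M) \<le> (\<integral>x. min \<bar>Z n x\<bar> R + (Z n x)\<^sup>2 / R \<partial>M)"
      proof (rule integral_mono)
        fix x
        show "\<bar>Z n x\<bar> \<le> min \<bar>Z n x\<bar> R + (Z n x)\<^sup>2 / R"
        proof (cases "\<bar>Z n x\<bar> \<le> R")
          case True then show ?thesis using R(1) by simp
        next
          case False
          then have "R * \<bar>Z n x\<bar> \<le> \<bar>Z n x\<bar> * \<bar>Z n x\<bar>" by (intro mult_right_mono) auto
          then have "\<bar>Z n x\<bar> \<le> (Z n x)\<^sup>2 / R" using R(1) by (simp add: field_simps power2_eq_square)
          then show ?thesis using R(1) by simp
        qed
      qed (use i in auto)
      also have "\<dots> = (\<integral>x. min \<bar>Z n x\<bar> R \<partial>M) + (\<integral>x. (Z n x)\<^sup>2 \<partial>M) / R"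
        using i by simp
      also have "\<dots> < e / 2 + e / 2"
      proof (rule add_strict_mono)
        show "(\<integral>x. min \<bar>Z n x\<bar> R \<partial>M) < e / 2" using no that by auto
        have "(\<integral>x. (Z n x)\<^sup>2 \<partial>M) / R \<le> 4 * C / R" using ZC[of n] R(1) by (intro divide_right_mono) auto
        then show "(\<integral>x. (Z n x)\<^sup>2 \<partial>M) / R < e / 2" using R2 by (rule order_le_less_trans)
      qed
      finally show ?thesis by simp
    qed
    then show "\<exists>no. \<forall>n\<ge>no. norm ((\<integral>x. \<bar>Z n x\<bar> \<partial>M) - 0) < e" by blast
  qed
  then have "(\<lambda>k. \<integral>x. Z k x \<partial>M) \<longlonglongrightarrow> 0"
  proof (rule Lim_null_comparison[rotated])
    show "\<forall>\<^sub>F k in sequentially. norm (\<integral>x. Z k x \<partial>M) \<le> (\<integral>x. \<bar>Z k x\<bar> \<partial>M)"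
      using integral_norm_bound by (intro always_eventually) fastforce
  qed
  moreover have "(\<integral>x. Z k x \<partial>M) = (\<integral>x. X k x \<partial>M) - (\<integral>x. Y x \<partial>M)" for k
    unfolding Z_def using L2_space_integrable[OF X[of k]] L2_space_integrable[OF Y2] by simp
  ultimately show "(\<lambda>k. \<integral>x. X k x \<partial>M) \<longlonglongrightarrow> (\<integral>x. Y x \<partial>M)"
    using LIM_zero_iff by force
qed

section \<open>The standard Gaussian measure\<close>

lemma prob_space_std_gauss: "prob_space std_gauss"
  unfolding std_gauss_def by (rule prob_space_normal_density) simp

interpretation std_gauss: prob_space std_gauss
  by (rule prob_space_std_gauss)

lemma sets_std_gauss [simp, measurable_cong]: "sets std_gauss = sets borel"
  by (simp add: std_gauss_def)

lemma space_std_gauss [simp]: "space std_gauss = UNIV"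
  by (simp add: std_gauss_def)

lemma std_gauss_integral:
  fixes f :: "real \<Rightarrow> real"
  assumes "f \<in> borel_measurable borel"
  shows "(\<integral>x. f x \<partial>std_gauss) = (\<integral>x. std_normal_density x * f x \<partial>lborel)"
  unfolding std_gauss_def by (subst integral_density) (use assms in auto)

lemma std_gauss_integrable_iff:
  fixes f :: "real \<Rightarrow> real"
  assumes "f \<in> borel_measurable borel"
  shows "integrable std_gauss f \<longleftrightarrow> integrable lborel (\<lambda>x. std_normal_density x * f x)"
  unfolding std_gauss_def by (subst integrable_density) (use assms in auto)

lemma integrable_std_gauss_moment: "integrable std_gauss (\<lambda>x. \<bar>x\<bar> ^ k)"
  by (subst std_gauss_integrable_iff) (auto intro: integrable_std_normal_moment_abs)

lemma integrable_std_gauss_poly_weight: "integrable std_gauss (\<lambda>x. (1 + \<bar>x\<bar>) ^ p)"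
proof -
  have "(1 + \<bar>x\<bar>) ^ p = (\<Sum>i\<le>p. of_nat (p choose i) * \<bar>x\<bar> ^ (p - i))" for x :: real
    using binomial_ring[of 1 "\<bar>x\<bar>" p] by simp
  then show ?thesis by (auto intro!: integrable_std_gauss_moment)
qed

lemma integrable_std_gauss_growth:
  assumes [measurable]: "f \<in> borel_measurable borel" and "\<And>x. \<bar>f x\<bar> \<le> C * (1 + \<bar>x\<bar>) ^ p"
  shows "integrable std_gauss f"
proof (rule Bochner_Integration.integrable_bound)
  show "integrable std_gauss (\<lambda>x. C * (1 + \<bar>x\<bar>) ^ p)"
    by (intro integrable_mult_right integrable_std_gauss_poly_weight)
  show "AE x in std_gauss. norm (f x) \<le> norm (C * (1 + \<bar>x\<bar>) ^ p)"
    using assms(2) by (auto intro: order_trans[OF _ abs_ge_self])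
qed simp

lemma growth_mult:
  fixes f g :: "real \<Rightarrow> real"
  assumes "\<And>x. \<bar>f x\<bar> \<le> C * (1 + \<bar>x\<bar>) ^ p" "\<And>x. \<bar>g x\<bar> \<le> D * (1 + \<bar>x\<bar>) ^ q"
  shows "\<bar>f x * g x\<bar> \<le> (C * D) * (1 + \<bar>x\<bar>) ^ (p + q)"
proof -
  have "\<bar>f x\<bar> * \<bar>g x\<bar> \<le> (C * (1 + \<bar>x\<bar>) ^ p) * (D * (1 + \<bar>x\<bar>) ^ q)"
    by (rule mult_mono[OF assms]) (auto intro: order_trans[OF _ assms(1)])
  then show ?thesis by (simp add: abs_mult power_add algebra_simps)
qed

lemma L2_std_gauss_growth:
  assumes [measurable]: "f \<in> borel_measurable borel" and "\<And>x. \<bar>f x\<bar> \<le> C * (1 + \<bar>x\<bar>) ^ p"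
  shows "f \<in> L2_space std_gauss"
proof -
  have "integrable std_gauss (\<lambda>x. f x * f x)"
    by (rule integrable_std_gauss_growth[OF _ growth_mult[OF assms(2) assms(2)]]) simp
  then show ?thesis by (simp add: L2_space_def power2_eq_square)
qed

lemma poly_growth:
  fixes q :: "real poly"
  shows "\<exists>C p. \<forall>x. \<bar>poly q x\<bar> \<le> C * (1 + \<bar>x\<bar>) ^ p"
proof (induction q)
  case 0
  show ?case by (intro exI[of _ 0]) simp
next
  case (pCons a q)
  then obtain C p where C: "\<And>x. \<bar>poly q x\<bar> \<le> C * (1 + \<bar>x\<bar>) ^ p" by blast
  have "\<bar>poly (pCons a q) x\<bar> \<le> (\<bar>a\<bar> + C) * (1 + \<bar>x\<bar>) ^ Suc p" for x
  proof -
    have "\<bar>poly (pCons a q) x\<bar> \<le> \<bar>a\<bar> + \<bar>x\<bar> * \<bar>poly q x\<bar>"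
      by (simp add: abs_mult[symmetric])
    also have "\<dots> \<le> \<bar>a\<bar> * (1 + \<bar>x\<bar>) ^ Suc p + (1 + \<bar>x\<bar>) * (C * (1 + \<bar>x\<bar>) ^ p)"
    proof (intro add_mono mult_mono C)
      have "1 \<le> (1 + \<bar>x\<bar>) ^ Suc p" by (rule one_le_power) simp
      then show "\<bar>a\<bar> \<le> \<bar>a\<bar> * (1 + \<bar>x\<bar>) ^ Suc p"
        using mult_left_mono[of 1 _ "\<bar>a\<bar>"] by simp
    qed auto
    finally show ?thesis by (simp add: algebra_simps)
  qed
  then show ?case by blast
qed

lemma poly_growth_affine:
  fixes q :: "real poly"
  shows "\<exists>C p. \<forall>z. \<bar>poly q (x + \<sigma> * z)\<bar> \<le> C * (1 + \<bar>z\<bar>) ^ p"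
  using poly_growth[of "pcompose q [:x, \<sigma>:]"] by (simp add: poly_pcompose algebra_simps)

lemma borel_measurable_poly [measurable]:
  fixes q :: "real poly"
  shows "poly q \<in> borel_measurable borel"
  by (intro borel_measurable_continuous_onI continuous_intros)

lemma poly_L2_std_gauss:
  fixes q :: "real poly"
  shows "(\<lambda>z. poly q (x + \<sigma> * z)) \<in> L2_space std_gauss"
proof -
  obtain C p where "\<And>z. \<bar>poly q (x + \<sigma> * z)\<bar> \<le> C * (1 + \<bar>z\<bar>) ^ p"
    using poly_growth_affine[of q x \<sigma>] by blast
  then show ?thesis by (intro L2_std_gauss_growth) auto
qed

lemma poly_integrable_std_gauss:
  fixes q :: "real poly"
  shows "integrable std_gauss (\<lambda>z. poly q (x + \<sigma> * z))"
  by (intro std_gauss.L2_space_integrable poly_L2_std_gauss)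

text \<open>Follows from \<open>0 \<le> (\<bar>x\<bar> - 1)\<^sup>2\<close>. The exponent is written
  with \<open>1 + \<bar>x\<bar>\<close> because this is the weight in all polynomial growth
  bounds.\<close>

lemma std_normal_density_le_exp: "std_normal_density x \<le> exp (3/2) * exp (- (1 + \<bar>x\<bar>))"
proof -
  have "0 \<le> (\<bar>x\<bar> - 1)\<^sup>2" by simp
  then have "- x\<^sup>2 / 2 \<le> 3/2 - (1 + \<bar>x\<bar>)" by (simp add: power2_diff)
  then have "exp (- x\<^sup>2 / 2) \<le> exp (3/2 - (1 + \<bar>x\<bar>))" by simp
  also have "\<dots> = exp (3/2) * exp (- (1 + \<bar>x\<bar>))" by (simp add: exp_add[symmetric])
  finally have e: "exp (- x\<^sup>2 / 2) \<le> exp (3/2) * exp (- (1 + \<bar>x\<bar>))" .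
  have "1 \<le> sqrt (2 * pi)" using pi_gt3 by (intro real_le_rsqrt) simp
  then have "std_normal_density x \<le> 1 * exp (- x\<^sup>2 / 2)"
    unfolding std_normal_density_def by (intro mult_right_mono) (auto simp: field_simps)
  with e show ?thesis by simp
qed

text \<open>The filter is left open so that both ends of the real line are instances.\<close>

lemma growth_times_std_normal_density_tendsto_0:
  fixes \<phi> :: "real \<Rightarrow> real"
  assumes "\<And>x. \<bar>\<phi> x\<bar> \<le> C * (1 + \<bar>x\<bar>) ^ p" and lim: "filterlim (\<lambda>x::real. \<bar>x\<bar>) at_top F"
  shows "((\<lambda>x. \<phi> x * std_normal_density x) \<longlongrightarrow> 0) F"
proof -
  have "filterlim (\<lambda>x::real. 1 + \<bar>x\<bar>) at_top F"
    by (rule filterlim_tendsto_add_at_top[OF tendsto_const lim])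
  then have "((\<lambda>x. (1 + \<bar>x\<bar>) ^ p / exp (1 + \<bar>x\<bar>)) \<longlongrightarrow> 0) F"
    by (rule filterlim_compose[OF tendsto_power_div_exp_0])
  then have "((\<lambda>x. (C * exp (3/2)) * ((1 + \<bar>x\<bar>) ^ p / exp (1 + \<bar>x\<bar>))) \<longlongrightarrow> (C * exp (3/2)) * 0) F"
    by (intro tendsto_mult tendsto_const)
  then have l: "((\<lambda>x. (C * exp (3/2)) * ((1 + \<bar>x\<bar>) ^ p / exp (1 + \<bar>x\<bar>))) \<longlongrightarrow> 0) F" by simp
  have b: "norm (\<phi> x * std_normal_density x) \<le> (C * exp (3/2)) * ((1 + \<bar>x\<bar>) ^ p / exp (1 + \<bar>x\<bar>))" for x
  proof -
    have "\<bar>\<phi> x\<bar> * std_normal_density x \<le> (C * (1 + \<bar>x\<bar>) ^ p) * (exp (3/2) * exp (- (1 + \<bar>x\<bar>)))"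
      by (intro mult_mono assms std_normal_density_le_exp) (auto intro: order_trans[OF _ assms(1)])
    then show ?thesis by (simp only: exp_minus) (simp add: abs_mult field_simps)
  qed
  show ?thesis
    by (rule Lim_null_comparison[OF always_eventually l]) (use b in blast)
qed

lemma DERIV_std_normal_density:
  "(std_normal_density has_real_derivative - x * std_normal_density x) (at x)"
  unfolding std_normal_density_def[abs_def]
  by (auto intro!: derivative_eq_intros simp: field_simps)

text \<open>Gaussian integration by parts: the derivative of \<phi> times the density is the
  difference of the two integrands, and polynomial growth makes the boundary terms vanish. It is the
  source of the Hermite identities and, later, of the duality between Brownian increments and the
  Malliavin derivative.\<close>

lemma Stein_std_gauss:
  fixes \<phi> \<phi>' :: "real \<Rightarrow> real"
  assumes d: "\<And>x. (\<phi> has_real_derivative \<phi>' x) (at x)" and c: "continuous_on UNIV \<phi>'"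
    and g: "\<And>x. \<bar>\<phi> x\<bar> \<le> C * (1 + \<bar>x\<bar>) ^ p" and g': "\<And>x. \<bar>\<phi>' x\<bar> \<le> D * (1 + \<bar>x\<bar>) ^ q"
  shows "(\<integral>x. x * \<phi> x \<partial>std_gauss) = (\<integral>x. \<phi>' x \<partial>std_gauss)"
proof -
  have cphi: "continuous_on UNIV \<phi>"
    using d by (meson DERIV_isCont continuous_at_imp_continuous_on)
  have [measurable]: "\<phi> \<in> borel_measurable borel" "\<phi>' \<in> borel_measurable borel"
    using c cphi by (auto intro: borel_measurable_continuous_onI)
  have gx: "\<bar>x * \<phi> x\<bar> \<le> (1 * C) * (1 + \<bar>x\<bar>) ^ (1 + p)" for x
    by (rule growth_mult[OF _ g]) auto
  have i1: "integrable std_gauss (\<lambda>x. x * \<phi> x)"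
    by (rule integrable_std_gauss_growth[OF _ gx]) simp
  have i2: "integrable std_gauss \<phi>'"
    by (rule integrable_std_gauss_growth[OF _ g']) simp
  define F where "F x = \<phi> x * std_normal_density x" for x
  define f where "f x = std_normal_density x * \<phi>' x - std_normal_density x * (x * \<phi> x)" for x
  have intf: "integrable lborel f"
    unfolding f_def using i1 i2 by (auto simp: std_gauss_integrable_iff)
  have dF: "(F has_real_derivative f x) (at x)" for x
    unfolding F_def[abs_def] f_def
    by (rule derivative_eq_intros d DERIV_std_normal_density refl)+ (simp add: algebra_simps)
  have cf: "continuous_on UNIV f"
    unfolding f_def std_normal_density_def by (intro continuous_intros c cphi) auto
  have "(LBINT x=-\<infinity>..\<infinity>. f x) = 0 - 0"
  proof (rule interval_integral_FTC_integrable)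
    show "(F has_vector_derivative f x) (at x)" for x
      using dF by (simp add: has_real_derivative_iff_has_vector_derivative)
    show "isCont f x" for x using cf by (simp add: continuous_on_eq_continuous_at)
    show "set_integrable lborel (einterval (-\<infinity>) \<infinity>) f"
      using intf by (simp add: set_integrable_def)
    show "((F \<circ> real_of_ereal) \<longlongrightarrow> 0) (at_right (-\<infinity>))"
      unfolding ereal_tendsto_simps F_def
      \<comment> \<open>At minus infinity, \<open>\<bar>x\<bar>\<close> tends to infinity as the
        absolute value of \<open>- x\<close>.\<close>
      by (rule growth_times_std_normal_density_tendsto_0[OF g filterlim_abs_real[THEN filterlim_compose, OF filterlim_uminus_at_top_at_bot, simplified]])
    show "((F \<circ> real_of_ereal) \<longlongrightarrow> 0) (at_left \<infinity>)"
      unfolding ereal_tendsto_simps F_def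
      by (rule growth_times_std_normal_density_tendsto_0[OF g filterlim_abs_real])
  qed simp
  then have "(\<integral>x. f x \<partial>lborel) = 0"
    by (simp add: interval_lebesgue_integral_def set_lebesgue_integral_def)
  then show ?thesis
    unfolding f_def using i1 i2
    by (simp add: std_gauss_integral std_gauss_integrable_iff)
qed

lemma Stein_poly:
  fixes q :: "real poly"
  shows "(\<integral>z. (\<sigma> * z) * poly q (x + \<sigma> * z) \<partial>std_gauss) = \<sigma>\<^sup>2 * (\<integral>z. poly (pderiv q) (x + \<sigma> * z) \<partial>std_gauss)"
proof -
  obtain C p where g: "\<And>z. \<bar>poly q (x + \<sigma> * z)\<bar> \<le> C * (1 + \<bar>z\<bar>) ^ p"
    using poly_growth_affine[of q x \<sigma>] by blast
  obtain C' p' where g': "\<And>z. \<bar>poly (smult \<sigma> (pderiv q)) (x + \<sigma> * z)\<bar> \<le> C' * (1 + \<bar>z\<bar>) ^ p'"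
    using poly_growth_affine[of "smult \<sigma> (pderiv q)" x \<sigma>] by blast
  have "(\<integral>z. z * poly q (x + \<sigma> * z) \<partial>std_gauss) = (\<integral>z. poly (smult \<sigma> (pderiv q)) (x + \<sigma> * z) \<partial>std_gauss)"
  proof (rule Stein_std_gauss[OF _ _ g g'])
    show "((\<lambda>z. poly q (x + \<sigma> * z)) has_real_derivative poly (smult \<sigma> (pderiv q)) (x + \<sigma> * z)) (at z)" for z
    proof -
      have "((\<lambda>z. x + \<sigma> * z) has_real_derivative \<sigma>) (at z)" by (auto intro!: derivative_eq_intros)
      from DERIV_chain2[OF poly_DERIV this, of q] show ?thesis by (simp add: mult.commute)
    qed
  qed (intro continuous_intros)
  then show ?thesis
    using poly_integrable_std_gauss[of "pderiv q" x \<sigma>] by (simp add: mult.assoc power2_eq_square)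
qed

section \<open>Hermite polynomials\<close>

text \<open>Normalised so that \<open>herm k s\<close> is orthogonal for the centred Gaussian law of variance \<open>s\<close>
  and has leading coefficient 1.\<close>

primrec herm :: "nat \<Rightarrow> real \<Rightarrow> real poly" where
  "herm 0 s = 1"
| "herm (Suc k) s = [:0, 1:] * herm k s - smult s (pderiv (herm k s))"

text \<open>Differentiating the recursion for \<open>herm (Suc (Suc k))\<close> gives
  \<open>herm (Suc k)\<close> plus \<open>Suc k\<close> times the right side of the recursion one
  degree lower.\<close>

lemma pderiv_herm: "pderiv (herm (Suc k) s) = smult (real (Suc k)) (herm k s)"
proof (induction k)
  case 0
  show ?case by (simp add: pderiv_pCons)
next
  case (Suc k)
  have "pderiv (herm (Suc (Suc k)) s)
      = herm (Suc k) s + [:0, 1:] * pderiv (herm (Suc k) s) - smult s (pderiv (pderiv (herm (Suc k) s)))"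
    by (simp only: herm.simps(2)[of "Suc k"] pderiv_diff pderiv_mult pderiv_smult)
       (simp add: pderiv_pCons algebra_simps)
  also have "\<dots> = herm (Suc k) s + smult (real (Suc k)) ([:0, 1:] * herm k s - smult s (pderiv (herm k s)))"
    unfolding Suc by (simp add: pderiv_smult smult_diff_right algebra_simps)
  also have "\<dots> = smult (real (Suc (Suc k))) (herm (Suc k) s)"
  proof -
    have "real (Suc (Suc k)) = 1 + real (Suc k)" by simp
    then show ?thesis by (simp only: smult_add_left smult_1_left herm.simps(2)[symmetric])
  qed
  finally show ?case .
qed

text \<open>Averaging over independent Gaussian noise of variance \<open>\<sigma>\<^sup>2\<close>
  lowers the variance parameter by that amount; this is what makes Hermite polynomials of a Gaussian
  martingale martingales. By Stein's formula the noise in the factor \<open>x + \<sigma> * z\<close>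
  produces \<open>\<sigma>\<^sup>2\<close> times the derivative, which cancels the same part of the
  recursion. The derivative is therefore carried along in the induction.\<close>

lemma herm_smoothing_aux:
  "(\<integral>z. poly (herm k (s + \<sigma>\<^sup>2)) (x + \<sigma> * z) \<partial>std_gauss) = poly (herm k s) x \<and>
   (\<integral>z. poly (pderiv (herm k (s + \<sigma>\<^sup>2))) (x + \<sigma> * z) \<partial>std_gauss) = poly (pderiv (herm k s)) x"
proof (induction k)
  case 0
  show ?case by (simp add: std_gauss.prob_space[simplified])
next
  case (Suc k)
  let ?H = "herm k (s + \<sigma>\<^sup>2)"
  note [simp] = poly_integrable_std_gauss
  have i: "integrable std_gauss (\<lambda>z. (\<sigma> * z) * poly ?H (x + \<sigma> * z))"
    using L2_mult_integrable[OF poly_L2_std_gauss[of "[:0, 1:]" 0 \<sigma>] poly_L2_std_gauss[of ?H x \<sigma>]] by simp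
  have "(\<integral>z. poly (herm (Suc k) (s + \<sigma>\<^sup>2)) (x + \<sigma> * z) \<partial>std_gauss)
     = (\<integral>z. x * poly ?H (x + \<sigma> * z) + (\<sigma> * z) * poly ?H (x + \<sigma> * z)
          - (s + \<sigma>\<^sup>2) * poly (pderiv ?H) (x + \<sigma> * z) \<partial>std_gauss)"
    by (simp add: algebra_simps)
  also have "\<dots> = x * poly (herm k s) x + \<sigma>\<^sup>2 * poly (pderiv (herm k s)) x - (s + \<sigma>\<^sup>2) * poly (pderiv (herm k s)) x"
    using Suc i by (simp add: Stein_poly)
  also have "\<dots> = poly (herm (Suc k) s) x" by (simp add: algebra_simps)
  \<comment> \<open>By \<open>pderiv_herm\<close>, the second conjunct for \<open>Suc k\<close> is
    \<open>Suc k\<close> times the first one for \<open>k\<close>.\<close>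
  finally show ?case using Suc by (simp only: pderiv_herm) simp
qed

text \<open>Raising the degree of the Hermite polynomial is, up to \<open>\<sigma>\<^sup>2\<close>,
  adjoint to differentiation. Stein's formula for the product \<open>?H * q\<close> gives two terms,
  one of which is removed by the recursion.\<close>

lemma herm_orthogonal_step:
  "(\<integral>z. poly (herm (Suc k) (\<sigma>\<^sup>2)) (\<sigma> * z) * poly q (\<sigma> * z) \<partial>std_gauss)
   = \<sigma>\<^sup>2 * (\<integral>z. poly (herm k (\<sigma>\<^sup>2)) (\<sigma> * z) * poly (pderiv q) (\<sigma> * z) \<partial>std_gauss)"
proof -
  let ?H = "herm k (\<sigma>\<^sup>2)"
  have I: "integrable std_gauss (\<lambda>z. poly r (\<sigma> * z))" for r
    using poly_integrable_std_gauss[of r 0 \<sigma>] by simp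
  note i = I[of "[:0,1:] * (?H * q)"] I[of "pderiv ?H * q"] I[of "?H * pderiv q"]
  have "(\<integral>z. poly (herm (Suc k) (\<sigma>\<^sup>2)) (\<sigma> * z) * poly q (\<sigma> * z) \<partial>std_gauss)
     = (\<integral>z. (\<sigma> * z) * poly (?H * q) (\<sigma> * z) - \<sigma>\<^sup>2 * (poly (pderiv ?H) (\<sigma> * z) * poly q (\<sigma> * z)) \<partial>std_gauss)"
    by (simp add: algebra_simps)
  also have "\<dots> = \<sigma>\<^sup>2 * (\<integral>z. poly (pderiv (?H * q)) (\<sigma> * z) \<partial>std_gauss)
      - \<sigma>\<^sup>2 * (\<integral>z. poly (pderiv ?H) (\<sigma> * z) * poly q (\<sigma> * z) \<partial>std_gauss)"
    using i Stein_poly[of \<sigma> "?H * q" 0] by simp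
  also have "(\<integral>z. poly (pderiv (?H * q)) (\<sigma> * z) \<partial>std_gauss)
     = (\<integral>z. poly ?H (\<sigma> * z) * poly (pderiv q) (\<sigma> * z) + poly (pderiv ?H) (\<sigma> * z) * poly q (\<sigma> * z) \<partial>std_gauss)"
    by (simp add: pderiv_mult algebra_simps)
  also have "\<dots> = (\<integral>z. poly ?H (\<sigma> * z) * poly (pderiv q) (\<sigma> * z) \<partial>std_gauss)
     + (\<integral>z. poly (pderiv ?H) (\<sigma> * z) * poly q (\<sigma> * z) \<partial>std_gauss)"
    using i by simp
  finally show ?thesis by (simp add: algebra_simps)
qed

lemma herm_orthogonal:
  "(\<integral>z. poly (herm k (\<sigma>\<^sup>2)) (\<sigma> * z) * poly (herm j (\<sigma>\<^sup>2)) (\<sigma> * z) \<partial>std_gauss)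
   = (if j = k then fact k * (\<sigma>\<^sup>2) ^ k else 0)"
proof (induction k arbitrary: j)
  case 0
  show ?case
  proof (cases j)
    case 0
    then show ?thesis by (simp add: std_gauss.prob_space[simplified])
  next
    case (Suc j')
    have "(\<integral>z. poly (herm j (\<sigma>\<^sup>2)) (\<sigma> * z) * poly 1 (\<sigma> * z) \<partial>std_gauss) = 0"
      unfolding Suc by (subst herm_orthogonal_step) simp
    then show ?thesis using Suc by (simp del: herm.simps(2))
  qed
next
  case (Suc k)
  show ?case
  proof (cases j)
    case 0
    then show ?thesis by (subst herm_orthogonal_step) simp
  next
    case (Suc j')
    have "(\<integral>z. poly (herm (Suc k) (\<sigma>\<^sup>2)) (\<sigma> * z) * poly (herm j (\<sigma>\<^sup>2)) (\<sigma> * z) \<partial>std_gauss)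
      = \<sigma>\<^sup>2 * (\<integral>z. real (Suc j') * (poly (herm k (\<sigma>\<^sup>2)) (\<sigma> * z) * poly (herm j' (\<sigma>\<^sup>2)) (\<sigma> * z)) \<partial>std_gauss)"
      unfolding Suc by (subst herm_orthogonal_step) (simp only: pderiv_herm poly_smult mult.left_commute)
    also have "\<dots> = \<sigma>\<^sup>2 * (real (Suc j') * (if j' = k then fact k * (\<sigma>\<^sup>2) ^ k else 0))"
      by (simp only: integral_mult_right_zero Suc.IH)
    finally show ?thesis using Suc by (auto simp: algebra_simps)
  qed
qed

definition hermn :: "nat \<Rightarrow> real \<Rightarrow> real" where
  "hermn k x = poly (herm k 1) x / sqrt (fact k)"

lemma hermn_measurable [measurable]: "hermn k \<in> borel_measurable borel"
  unfolding hermn_def[abs_def] by measurable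

lemma hermn_L2: "hermn k \<in> L2_space std_gauss"
  using L2_space_cmult[OF poly_L2_std_gauss[of "herm k 1" 0 1], of "1 / sqrt (fact k)"]
  by (simp add: hermn_def[abs_def])

lemma hermn_orthonormal: "(\<integral>z. hermn k z * hermn j z \<partial>std_gauss) = (if j = k then 1 else 0)"
proof -
  have "(\<integral>z. hermn k z * hermn j z \<partial>std_gauss)
     = (\<integral>z. poly (herm k 1) z * poly (herm j 1) z / (sqrt (fact k) * sqrt (fact j)) \<partial>std_gauss)"
    by (simp add: hermn_def)
  also have "\<dots> = (\<integral>z. poly (herm k 1) z * poly (herm j 1) z \<partial>std_gauss) / (sqrt (fact k) * sqrt (fact j))"
    by simp
  also have "(\<integral>z. poly (herm k 1) z * poly (herm j 1) z \<partial>std_gauss) = (if j = k then fact k else 0)"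
    using herm_orthogonal[of k 1 j] by simp
  finally show ?thesis by simp
qed

definition hcoeff :: "(real \<Rightarrow> real) \<Rightarrow> nat \<Rightarrow> real" where
  "hcoeff g k = (\<integral>z. g z * hermn k z \<partial>std_gauss)"

lemma hermn_sum_norm:
  assumes "finite I"
  shows "(\<integral>z. (\<Sum>k\<in>I. c k * hermn k z)\<^sup>2 \<partial>std_gauss) = (\<Sum>k\<in>I. (c k)\<^sup>2)"
proof -
  have i: "integrable std_gauss (\<lambda>z. hermn k z * hermn j z)" for j k
    by (intro L2_mult_integrable hermn_L2)
  have "(\<integral>z. (\<Sum>k\<in>I. c k * hermn k z)\<^sup>2 \<partial>std_gauss)
     = (\<integral>z. (\<Sum>k\<in>I. \<Sum>j\<in>I. (c k * c j) * (hermn k z * hermn j z)) \<partial>std_gauss)"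
    by (simp add: power2_eq_square sum_product algebra_simps)
  also have "\<dots> = (\<Sum>k\<in>I. \<Sum>j\<in>I. (c k * c j) * (if j = k then 1 else 0))"
    using i by (simp add: hermn_orthonormal)
  also have "\<dots> = (\<Sum>k\<in>I. (c k)\<^sup>2)"
    using assms by (simp add: power2_eq_square if_distrib cong: if_cong)
  finally show ?thesis .
qed

lemma hcoeff_Bessel:
  assumes g: "g \<in> L2_space std_gauss"
  shows "(\<Sum>k<N. (hcoeff g k)\<^sup>2) \<le> (L2_norm_of std_gauss g)\<^sup>2"
proof -
  let ?p = "\<lambda>z. \<Sum>k<N. hcoeff g k * hermn k z"
  have p: "?p \<in> L2_space std_gauss"
    by (intro L2_space_sum L2_space_cmult hermn_L2)
  have gi: "integrable std_gauss (\<lambda>z. g z * hermn k z)" for k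
    by (intro L2_mult_integrable g hermn_L2)
  have gp: "(\<integral>z. g z * ?p z \<partial>std_gauss) = (\<Sum>k<N. (hcoeff g k)\<^sup>2)"
  proof -
    have "(\<integral>z. g z * ?p z \<partial>std_gauss) = (\<integral>z. (\<Sum>k<N. hcoeff g k * (g z * hermn k z)) \<partial>std_gauss)"
      by (simp add: sum_distrib_left algebra_simps)
    also have "\<dots> = (\<Sum>k<N. hcoeff g k * (\<integral>z. g z * hermn k z \<partial>std_gauss))"
      using gi by simp
    finally show ?thesis by (simp add: hcoeff_def power2_eq_square)
  qed
  have "0 \<le> (\<integral>z. (g z - ?p z)\<^sup>2 \<partial>std_gauss)" by simp
  also have "\<dots> = (\<integral>z. (g z)\<^sup>2 - 2 * (g z * ?p z) + (?p z)\<^sup>2 \<partial>std_gauss)"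
    by (intro Bochner_Integration.integral_cong) (auto simp: power2_diff)
  also have "\<dots> = (L2_norm_of std_gauss g)\<^sup>2 - 2 * (\<Sum>k<N. (hcoeff g k)\<^sup>2) + (\<Sum>k<N. (hcoeff g k)\<^sup>2)"
    using L2_spaceD(2)[OF g] L2_spaceD(2)[OF p] L2_mult_integrable[OF g p]
    by (simp add: L2_norm_of_power2 gp hermn_sum_norm)
  finally show ?thesis by simp
qed

lemma hcoeff_summable:
  assumes "g \<in> L2_space std_gauss"
  shows "summable (\<lambda>k. (hcoeff g k)\<^sup>2)"
  by (rule summableI_nonneg_bounded[OF _ hcoeff_Bessel[OF assms]]) simp

section \<open>Completeness of the Hermite polynomials\<close>

text \<open>Completing the square: an exponential factor shifts the mean. This yields the
  exponential moments.\<close>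

lemma std_normal_density_times_exp:
  "std_normal_density x * exp (c * x) = exp (c\<^sup>2 / 2) * normal_density c 1 x"
proof -
  have "- x\<^sup>2 / 2 + c * x = c\<^sup>2 / 2 + - (x - c)\<^sup>2 / 2"
    by (simp add: power2_diff field_simps)
  then have "exp (- x\<^sup>2 / 2) * exp (c * x) = exp (c\<^sup>2 / 2) * exp (- (x - c)\<^sup>2 / 2)"
    by (simp only: exp_add[symmetric])
  then show ?thesis by (simp add: std_normal_density_def normal_density_def)
qed

lemma integrable_std_gauss_exp_abs: "integrable std_gauss (\<lambda>x. exp (c * \<bar>x\<bar>))"
proof (rule Bochner_Integration.integrable_bound)
  have e: "integrable std_gauss (\<lambda>x. exp (c * x))" for c :: real
    by (subst std_gauss_integrable_iff) (auto simp: std_normal_density_times_exp)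
  show "integrable std_gauss (\<lambda>x. exp (c * x) + exp (- c * x))"
    by (intro Bochner_Integration.integrable_add e)
  show "AE x in std_gauss. norm (exp (c * \<bar>x\<bar>)) \<le> norm (exp (c * x) + exp (- c * x))"
  proof (rule AE_I2)
    fix x :: real
    have "exp (c * \<bar>x\<bar>) \<le> exp (c * x) + exp (- c * x)"
      by (cases "x \<ge> 0") (auto simp: abs_if)
    then show "norm (exp (c * \<bar>x\<bar>)) \<le> norm (exp (c * x) + exp (- c * x))"
      by (simp add: order_trans[OF _ abs_ge_self])
  qed
qed simp

lemma exp_abs_L2_std_gauss: "(\<lambda>x. exp (c * \<bar>x\<bar>)) \<in> L2_space std_gauss"
  using integrable_std_gauss_exp_abs[of "2 * c"]
  by (simp add: L2_space_def exp_double[symmetric] mult.assoc)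

text \<open>The partial sums of the exponential series are dominated by
  \<open>exp (\<bar>t\<bar> * \<bar>x\<bar>)\<close>, which is square integrable for the Gaussian
  measure, so its product with \<open>f\<close> is an integrable bound and the series may be
  integrated term by term.\<close>

lemma zero_moments_imp_zero_Fourier:
  assumes f: "f \<in> L2_space std_gauss" and m: "\<And>n. (\<integral>x. f x * x ^ n \<partial>std_gauss) = 0"
  shows "(\<integral>x. complex_of_real (f x) * iexp (t * x) \<partial>std_gauss) = 0"
proof -
  have [measurable]: "f \<in> borel_measurable borel" using L2_spaceD(1)[OF f] by simp
  define S where "S n x = (\<Sum>k\<le>n. complex_of_real (f x * x ^ k) * ((\<i> * t) ^ k / fact k))" for n x
  have xn: "(\<lambda>x. x ^ k) \<in> L2_space std_gauss" for k
    using poly_L2_std_gauss[of "monom 1 k" 0 1] by (simp add: poly_monom)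
  have fi: "integrable std_gauss (\<lambda>x. complex_of_real (f x * x ^ k))" for k
    by (intro integrable_of_real L2_mult_integrable f xn)
  have Seq: "S n x = complex_of_real (f x) * (\<Sum>k\<le>n. (\<i> * (t * x)) ^ k /\<^sub>R fact k)" for n x
    unfolding S_def sum_distrib_left
    by (intro sum.cong) (auto simp: power_mult_distrib scaleR_conv_of_real field_simps)
  have "(\<lambda>n. \<integral>x. S n x \<partial>std_gauss) \<longlonglongrightarrow> (\<integral>x. complex_of_real (f x) * iexp (t * x) \<partial>std_gauss)"
  proof (rule integral_dominated_convergence[where w="\<lambda>x. \<bar>f x\<bar> * exp (\<bar>t\<bar> * \<bar>x\<bar>)"])
    have "(\<lambda>x. \<bar>f x\<bar>) \<in> L2_space std_gauss" using L2_spaceD[OF f] by (simp add: L2_space_def)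
    then show "integrable std_gauss (\<lambda>x. \<bar>f x\<bar> * exp (\<bar>t\<bar> * \<bar>x\<bar>))"
      by (intro L2_mult_integrable exp_abs_L2_std_gauss)
    show "AE x in std_gauss. (\<lambda>n. S n x) \<longlonglongrightarrow> complex_of_real (f x) * iexp (t * x)"
    proof (rule AE_I2)
      fix x
      have "(\<lambda>n. \<Sum>k\<le>n. (\<i> * (t * x)) ^ k /\<^sub>R fact k) \<longlonglongrightarrow> exp (\<i> * (t * x))"
        using exp_converges[of "\<i> * complex_of_real (t * x)"] by (simp add: sums_def_le)
      then show "(\<lambda>n. S n x) \<longlonglongrightarrow> complex_of_real (f x) * iexp (t * x)"
        unfolding Seq by (intro tendsto_mult tendsto_const)
    qed
    show "AE x in std_gauss. norm (S n x) \<le> \<bar>f x\<bar> * exp (\<bar>t\<bar> * \<bar>x\<bar>)" for n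
    proof (rule AE_I2)
      fix x
      have "norm (\<Sum>k\<le>n. (\<i> * complex_of_real (t * x)) ^ k /\<^sub>R fact k) \<le> (\<Sum>k\<le>n. (\<bar>t\<bar> * \<bar>x\<bar>) ^ k /\<^sub>R fact k)"
        by (rule order_trans[OF norm_sum]) (simp add: norm_mult norm_power abs_mult power_mult_distrib)
      also have "\<dots> \<le> (\<Sum>k. (\<bar>t\<bar> * \<bar>x\<bar>) ^ k /\<^sub>R fact k)"
        by (rule sum_le_suminf) (auto intro: summable_exp[unfolded divide_inverse])
      also have "\<dots> = exp (\<bar>t\<bar> * \<bar>x\<bar>)" by (simp add: exp_def)
      finally show "norm (S n x) \<le> \<bar>f x\<bar> * exp (\<bar>t\<bar> * \<bar>x\<bar>)"
        unfolding Seq by (simp add: norm_mult mult_left_mono)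
    qed
  qed (auto simp: S_def)
  moreover have "(\<integral>x. S n x \<partial>std_gauss) = 0" for n
  proof -
    have "(\<integral>x. S n x \<partial>std_gauss) = (\<Sum>k\<le>n. (\<integral>x. complex_of_real (f x * x ^ k) \<partial>std_gauss) * ((\<i> * t) ^ k / fact k))"
      unfolding S_def by (subst Bochner_Integration.integral_sum) (intro integrable_mult_left fi, simp only: integral_mult_left_zero)
    also have "\<dots> = 0"
      by (simp only: integral_complex_of_real m) simp
    finally show ?thesis .
  qed
  ultimately show ?thesis by (simp add: LIMSEQ_const_iff)
qed

text \<open>The uniqueness theorem for characteristic functions speaks of probability laws, so the
  positive and the negative part of \<open>f\<close> are normalised to densities and compared with
  each other. The vanishing Fourier transform of \<open>f\<close> says that their characteristic
  functions agree.\<close>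

lemma zero_moments_imp_AE_zero:
  assumes f: "f \<in> L2_space std_gauss" and m: "\<And>n. (\<integral>x. f x * x ^ n \<partial>std_gauss) = 0"
  shows "AE x in std_gauss. f x = 0"
proof -
  have [measurable]: "f \<in> borel_measurable borel" using L2_spaceD(1)[OF f] by simp
  have fi: "integrable std_gauss f" by (rule std_gauss.L2_space_integrable[OF f])
  define P N where "P x = max 0 (f x)" and "N x = max 0 (- f x)" for x
  have [measurable]: "P \<in> borel_measurable borel" "N \<in> borel_measurable borel"
    unfolding P_def[abs_def] N_def[abs_def] by measurable
  have PN: "f x = P x - N x" "0 \<le> P x" "0 \<le> N x" for x by (auto simp: P_def N_def)
  have Pi: "integrable std_gauss P" "integrable std_gauss N"
    unfolding P_def[abs_def] N_def[abs_def] using fi by auto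
  define c where "c = (\<integral>x. P x \<partial>std_gauss)"
  \<comment> \<open>The moment of order 0 says that both parts have the same mass, so one
    normalisation serves both.\<close>
  have cN: "c = (\<integral>x. N x \<partial>std_gauss)"
    using m[of 0] Pi by (simp add: c_def PN(1))
  show ?thesis
  proof (cases "c = 0")
    case True
    have "AE x in std_gauss. P x = 0" "AE x in std_gauss. N x = 0"
      using integral_nonneg_eq_0_iff_AE[OF Pi(1)] integral_nonneg_eq_0_iff_AE[OF Pi(2)] PN True c_def cN
      by auto
    then show ?thesis by eventually_elim (simp add: PN(1))
  next
    case False
    have "0 \<le> c" unfolding c_def using PN by simp
    with False have c: "0 < c" by simp
    define D where "D h = density std_gauss (\<lambda>x. ennreal (h x / c))" for h :: "real \<Rightarrow> real"
    have rd: "real_distribution (D h)" if h: "integrable std_gauss h" "\<And>x. 0 \<le> h x" "(\<integral>x. h x \<partial>std_gauss) = c" for h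
    proof -
      have [measurable]: "h \<in> borel_measurable borel" using h(1) by auto
      have "prob_space (D h)"
      proof
        have "emeasure (D h) (space (D h)) = (\<integral>\<^sup>+x. ennreal (h x / c) \<partial>std_gauss)"
          unfolding D_def by (simp add: emeasure_density)
        also have "\<dots> = ennreal (\<integral>x. h x / c \<partial>std_gauss)"
          using h c by (intro nn_integral_eq_integral) auto
        also have "\<dots> = 1" using h c by simp
        finally show "emeasure (D h) (space (D h)) = 1" .
      qed
      then show ?thesis by (simp add: real_distribution_def real_distribution_axioms_def D_def)
    qed
    have ch: "char (D h) t = (\<integral>x. complex_of_real (h x) * iexp (t * x) \<partial>std_gauss) / c"
      if h: "h \<in> borel_measurable borel" "\<And>x. 0 \<le> h x" for h t
    proof -
      note [measurable] = h(1)
      have "char (D h) t = (\<integral>x. (h x / c) *\<^sub>R iexp (t * x) \<partial>std_gauss)"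
        unfolding char_def D_def using h c by (subst integral_density) auto
      also have "\<dots> = (\<integral>x. (complex_of_real (h x) * iexp (t * x)) / c \<partial>std_gauss)"
        by (simp add: scaleR_conv_of_real)
      finally show ?thesis by simp
    qed
    have ii: "integrable std_gauss (\<lambda>x. complex_of_real (h x) * iexp (t * x))" if "integrable std_gauss h" for h t
      by (rule Bochner_Integration.integrable_bound[OF integrable_norm[OF that]])
        (use that in \<open>auto simp: norm_mult\<close>)
    have "char (D P) = char (D N)"
    proof
      fix t
      have "0 = (\<integral>x. complex_of_real (f x) * iexp (t * x) \<partial>std_gauss)"
        by (rule zero_moments_imp_zero_Fourier[OF f m, symmetric])
      also have "\<dots> = (\<integral>x. complex_of_real (P x) * iexp (t * x) - complex_of_real (N x) * iexp (t * x) \<partial>std_gauss)"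
        by (simp add: PN(1) algebra_simps)
      also have "\<dots> = (\<integral>x. complex_of_real (P x) * iexp (t * x) \<partial>std_gauss)
         - (\<integral>x. complex_of_real (N x) * iexp (t * x) \<partial>std_gauss)"
        by (rule Bochner_Integration.integral_diff[OF ii[OF Pi(1)] ii[OF Pi(2)]])
      finally have "(\<integral>x. complex_of_real (P x) * iexp (t * x) \<partial>std_gauss)
         = (\<integral>x. complex_of_real (N x) * iexp (t * x) \<partial>std_gauss)"
        by (metis eq_iff_diff_eq_0)
      moreover have "char (D P) t = (\<integral>x. complex_of_real (P x) * iexp (t * x) \<partial>std_gauss) / c"
        by (rule ch) (auto simp: PN(2))
      moreover have "char (D N) t = (\<integral>x. complex_of_real (N x) * iexp (t * x) \<partial>std_gauss) / c"
        by (rule ch) (auto simp: PN(3))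
      ultimately show "char (D P) t = char (D N) t" by simp
    qed
    moreover have "real_distribution (D P)" by (rule rd[OF Pi(1) PN(2) c_def[symmetric]])
    moreover have "real_distribution (D N)" by (rule rd[OF Pi(2) PN(3) cN[symmetric]])
    ultimately have "D P = D N" by (intro Levy_uniqueness)
    then have "AE x in std_gauss. ennreal (P x / c) = ennreal (N x / c)"
      unfolding D_def by (intro std_gauss.density_unique) auto
    then show ?thesis
      by eventually_elim (use PN c in \<open>auto simp: ennreal_inj\<close>)
  qed
qed

text \<open>By the recursion, multiplying \<open>herm k 1\<close> by \<open>x\<close> gives a
  combination of \<open>herm (Suc k) 1\<close> and the derivative of \<open>herm k 1\<close>.
  Induction on \<open>n\<close>, for all \<open>k\<close> at once, makes the integrals of
  \<open>f\<close> against \<open>x ^ n * herm k 1\<close> vanish, and \<open>k = 0\<close> yields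
  the moments.\<close>

lemma zero_hcoeff_imp_AE_zero:
  assumes f: "f \<in> L2_space std_gauss" and h: "\<And>k. hcoeff f k = 0"
  shows "AE x in std_gauss. f x = 0"
proof (rule zero_moments_imp_AE_zero[OF f])
  have fq: "integrable std_gauss (\<lambda>x. f x * poly q x)" for q
    using L2_mult_integrable[OF f poly_L2_std_gauss[of q 0 1]] by simp
  have H: "(\<integral>x. f x * poly (herm k 1) x \<partial>std_gauss) = 0" for k
  proof -
    have "(\<integral>x. f x * poly (herm k 1) x \<partial>std_gauss) = (\<integral>x. sqrt (fact k) * (f x * hermn k x) \<partial>std_gauss)"
      by (simp add: hermn_def)
    also have "\<dots> = 0" using h[of k] by (simp add: hcoeff_def)
    finally show ?thesis .
  qed
  have "(\<integral>x. f x * (x ^ n * poly (herm k 1) x) \<partial>std_gauss) = 0" for n k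
  proof (induction n arbitrary: k)
    case 0
    then show ?case using H by simp
  next
    case (Suc n)
    have e: "x * poly (herm k 1) x = poly (herm (Suc k) 1) x + poly (pderiv (herm k 1)) x" for x
      by simp
    have "(\<integral>x. f x * (x ^ Suc n * poly (herm k 1) x) \<partial>std_gauss)
      = (\<integral>x. f x * (x ^ n * poly (herm (Suc k) 1) x) + f x * (x ^ n * poly (pderiv (herm k 1)) x) \<partial>std_gauss)"
      by (intro Bochner_Integration.integral_cong) (auto simp: algebra_simps)
    also have "\<dots> = (\<integral>x. f x * (x ^ n * poly (herm (Suc k) 1) x) \<partial>std_gauss)
       + (\<integral>x. f x * (x ^ n * poly (pderiv (herm k 1)) x) \<partial>std_gauss)"
      using fq[of "monom 1 n * herm (Suc k) 1"] fq[of "monom 1 n * pderiv (herm k 1)"]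
      by (simp add: poly_monom)
    also have "(\<integral>x. f x * (x ^ n * poly (pderiv (herm k 1)) x) \<partial>std_gauss) = 0"
    proof (cases k)
      case 0
      then show ?thesis by simp
    next
      case (Suc k')
      have "(\<integral>x. f x * (x ^ n * poly (pderiv (herm k 1)) x) \<partial>std_gauss)
        = (\<integral>x. real (Suc k') * (f x * (x ^ n * poly (herm k' 1) x)) \<partial>std_gauss)"
        unfolding Suc pderiv_herm by (simp add: algebra_simps)
      also have "\<dots> = 0" by (simp only: integral_mult_right_zero Suc.IH)
      finally show ?thesis .
    qed
    finally show ?case by (simp only: Suc.IH)
  qed
  from this[of _ 0] show "(\<integral>x. f x * x ^ n \<partial>std_gauss) = 0" for n by simp
qed

text \<open>The two set differences treat both orders of \<open>m\<close> and \<open>n\<close>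
  alike; one of them is always empty.\<close>

lemma sums_small_tail:
  fixes a :: "nat \<Rightarrow> real"
  assumes a: "summable a" "\<And>k. 0 \<le> a k" and e: "e > 0"
  shows "\<exists>K. \<forall>m\<ge>K. \<forall>n\<ge>K. (\<Sum>k\<in>{..<m} - {..<n}. a k) + (\<Sum>k\<in>{..<n} - {..<m}. a k) \<le> e"
proof -
  obtain K where K: "\<And>m n. m \<ge> K \<Longrightarrow> norm (\<Sum>k=m..<n. a k) < e"
    using a(1)[unfolded summable_Cauchy] e by metis
  have "(\<Sum>k\<in>{..<m} - {..<n}. a k) + (\<Sum>k\<in>{..<n} - {..<m}. a k) \<le> e" if "m \<ge> K" "n \<ge> K" for m n
  proof (cases "n \<le> m")
    case True
    then have "{..<m} - {..<n} = {n..<m}" "{..<n} - {..<m} = {}" by auto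
    then show ?thesis using K[OF that(2), of m] by simp
  next
    case False
    then have "{..<n} - {..<m} = {m..<n}" "{..<m} - {..<n} = {}" by auto
    then show ?thesis using K[OF that(1), of n] by simp
  qed
  then show ?thesis by blast
qed

lemma sum_diff_split:
  fixes f :: "nat \<Rightarrow> real"
  shows "(\<Sum>k<m. f k) - (\<Sum>k<n. f k) = (\<Sum>k\<in>{..<m} - {..<n}. f k) - (\<Sum>k\<in>{..<n} - {..<m}. f k)"
proof -
  have "(\<Sum>k<m. f k) = (\<Sum>k\<in>{..<m} - {..<n}. f k) + (\<Sum>k\<in>{..<m} \<inter> {..<n}. f k)"
    by (subst sum.union_disjoint[symmetric]) (auto intro!: sum.cong)
  moreover have "(\<Sum>k<n. f k) = (\<Sum>k\<in>{..<n} - {..<m}. f k) + (\<Sum>k\<in>{..<m} \<inter> {..<n}. f k)"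
    by (subst sum.union_disjoint[symmetric]) (auto intro!: sum.cong)
  ultimately show ?thesis by simp
qed

text \<open>Of orthogonality only the resulting upper bound on the norms of finite sums is assumed.\<close>

lemma orthogonal_series_Cauchy:
  assumes f: "\<And>k. f k \<in> L2_space N"
    and n: "\<And>I. finite I \<Longrightarrow> (\<integral>x. (\<Sum>k\<in>I. f k x)\<^sup>2 \<partial>N) \<le> (\<Sum>k\<in>I. a k)"
    and a: "summable a" "\<And>k. 0 \<le> a k" and e: "e > 0"
  shows "\<exists>K. \<forall>m\<ge>K. \<forall>n\<ge>K. L2_norm_of N (\<lambda>x. (\<Sum>k<m. f k x) - (\<Sum>k<n. f k x)) \<le> e"
proof -
  obtain K where K: "\<forall>m\<ge>K. \<forall>n\<ge>K. (\<Sum>k\<in>{..<m} - {..<n}. a k) + (\<Sum>k\<in>{..<n} - {..<m}. a k) \<le> (e/2)\<^sup>2"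
    using sums_small_tail[OF a, of "(e/2)\<^sup>2"] e by auto
  have "L2_norm_of N (\<lambda>x. (\<Sum>k<m. f k x) - (\<Sum>k<n. f k x)) \<le> e" if mn: "m \<ge> K" "n \<ge> K" for m n
  proof -
    have b: "L2_norm_of N (\<lambda>x. \<Sum>k\<in>I. f k x) \<le> e / 2" if "finite I" "(\<Sum>k\<in>I. a k) \<le> (e/2)\<^sup>2" for I
    proof -
      have "L2_norm_of N (\<lambda>x. \<Sum>k\<in>I. f k x) \<le> sqrt ((e/2)\<^sup>2)"
        unfolding L2_norm_of_def using n[OF that(1)] that(2) by (intro real_sqrt_le_mono) linarith
      then show ?thesis using e by simp
    qed
    have nn: "0 \<le> (\<Sum>k\<in>I. a k)" for I using a(2) by (simp add: sum_nonneg)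
    have "(\<Sum>k\<in>{..<m} - {..<n}. a k) + (\<Sum>k\<in>{..<n} - {..<m}. a k) \<le> (e/2)\<^sup>2" using K mn by blast
    with nn[of "{..<m} - {..<n}"] nn[of "{..<n} - {..<m}"]
    have "(\<Sum>k\<in>{..<m} - {..<n}. a k) \<le> (e/2)\<^sup>2" "(\<Sum>k\<in>{..<n} - {..<m}. a k) \<le> (e/2)\<^sup>2" by linarith+
    then have "L2_norm_of N (\<lambda>x. \<Sum>k\<in>{..<m} - {..<n}. f k x) + L2_norm_of N (\<lambda>x. \<Sum>k\<in>{..<n} - {..<m}. f k x) \<le> e"
      using b[of "{..<m} - {..<n}"] b[of "{..<n} - {..<m}"] by simp
    then show ?thesis
      unfolding sum_diff_split
      using L2_norm_of_diff_le[OF L2_space_sum[where I="{..<m} - {..<n}" and f=f, OF f] L2_space_sum[where I="{..<n} - {..<m}" and f=f, OF f]]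
      by linarith
  qed
  then show ?thesis by blast
qed

text \<open>The partial sums are Cauchy by Bessel's inequality. Their limit has the same
  coefficients as \<open>g\<close>, since a coefficient is continuous in \<open>L2\<close> and
  constant along the sequence from some index on, and completeness identifies the two
  functions.\<close>

lemma Hermite_expansion:
  assumes g: "g \<in> L2_space std_gauss"
  shows "L2_tendsto std_gauss (\<lambda>N x. \<Sum>k<N. hcoeff g k * hermn k x) g"
proof -
  let ?p = "\<lambda>N x. \<Sum>k<N. hcoeff g k * hermn k x"
  have p: "?p N \<in> L2_space std_gauss" for N
    by (intro L2_space_sum L2_space_cmult hermn_L2)
  obtain l where l: "L2_tendsto std_gauss ?p l"
  proof -
    have "\<exists>l. L2_tendsto std_gauss ?p l \<and> l \<in> borel_measurable std_gauss"
    proof (rule std_gauss.L2_complete_subalgebra[OF _ p L2_spaceD(1)[OF p]])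
      show "subalgebra std_gauss std_gauss" by (simp add: subalgebra_def)
      fix e :: real assume e: "e > 0"
      show "\<exists>K. \<forall>m\<ge>K. \<forall>n\<ge>K. L2_norm_of std_gauss (\<lambda>x. ?p m x - ?p n x) \<le> e"
        by (rule orthogonal_series_Cauchy[OF _ _ hcoeff_summable[OF g] _ e])
          (auto intro: L2_space_cmult hermn_L2 simp: hermn_sum_norm)
    qed
    then show ?thesis using that by blast
  qed
  note l2 = L2_tendstoD(2)[OF l]
  have "hcoeff l k = hcoeff g k" for k
  proof -
    have "(\<lambda>N. \<integral>x. ?p N x * hermn k x \<partial>std_gauss) \<longlonglongrightarrow> hcoeff l k"
      unfolding hcoeff_def[of l] by (rule L2_tendsto_inner[OF l L2_tendsto_const[OF hermn_L2]])
    moreover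
    have "\<forall>\<^sub>F N in sequentially. (\<integral>x. ?p N x * hermn k x \<partial>std_gauss) = hcoeff g k"
      using eventually_gt_at_top[of k]
    proof eventually_elim
      case (elim N)
      have i: "integrable std_gauss (\<lambda>x. hermn j x * hermn k x)" for j
        by (intro L2_mult_integrable hermn_L2)
      have "(\<integral>x. ?p N x * hermn k x \<partial>std_gauss) = (\<integral>x. (\<Sum>j<N. hcoeff g j * (hermn j x * hermn k x)) \<partial>std_gauss)"
        by (simp add: sum_distrib_right mult.assoc)
      also have "\<dots> = (\<Sum>j<N. hcoeff g j * (if k = j then 1 else 0))"
        using i by (simp add: hermn_orthonormal)
      also have "\<dots> = hcoeff g k" using elim by (simp add: if_distrib cong: if_cong)
      finally show ?case .
    qed
    then have "(\<lambda>N. \<integral>x. ?p N x * hermn k x \<partial>std_gauss) \<longlonglongrightarrow> hcoeff g k"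
      by (rule tendsto_eventually)
    ultimately show ?thesis by (rule LIMSEQ_unique)
  qed
  then have "hcoeff (\<lambda>x. l x - g x) k = 0" for k
    unfolding hcoeff_def using L2_mult_integrable[OF l2 hermn_L2] L2_mult_integrable[OF g hermn_L2]
    by (simp add: left_diff_distrib)
  then have "AE x in std_gauss. l x - g x = 0"
    by (intro zero_hcoeff_imp_AE_zero L2_space_diff l2 g)
  then have "AE x in std_gauss. l x = g x" by simp
  from L2_tendsto_cong_AE[OF l _ this, of ?p] L2_spaceD(1)[OF g] L2_spaceD(1)[OF p] show ?thesis by simp
qed

section \<open>Hermite coefficients of weak derivatives\<close>

text \<open>The classical smooth function that is flat at 0. Allowing the divisor
  \<open>u ^ m\<close> makes the family closed under differentiation.\<close>

definition flat_exp :: "nat \<Rightarrow> real \<Rightarrow> real" where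
  "flat_exp m u = (if u > 0 then exp (- (1 / u)) / u ^ m else 0)"

lemma flat_exp_shift: "flat_exp m u = u * flat_exp (Suc m) u"
  by (simp add: flat_exp_def)

lemma flat_exp_nonneg: "0 \<le> flat_exp m u"
  by (simp add: flat_exp_def)

text \<open>The exponential series of \<open>1 / u\<close> dominates its single term of order
  \<open>m + 2\<close>. The spare factor \<open>u\<^sup>2\<close> is what makes the derivative at 0
  vanish.\<close>

lemma flat_exp_bound: "flat_exp m u \<le> fact (m + 2) * u\<^sup>2"
proof (cases "u > 0")
  case True
  define K :: real where "K = fact (m + 2)"
  have K: "K > 0" by (simp add: K_def)
  have "(1 / u) ^ (m + 2) /\<^sub>R fact (m + 2) \<le> (\<Sum>k. (1 / u) ^ k /\<^sub>R fact k)"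
    using sum_le_suminf[OF summable_exp_generic[of "1/u"], of "{m + 2}"] True by simp
  then have "(1 / u) ^ (m + 2) / K \<le> exp (1 / u)"
    by (simp only: exp_def K_def divide_inverse real_scaleR_def mult.commute)
  then have "exp (- (1 / u)) \<le> K * u ^ (m + 2)"
    using True K by (simp add: exp_minus field_simps)
  then have "exp (- (1 / u)) / u ^ m \<le> K * u ^ (m + 2) / u ^ m"
    using True by (intro divide_right_mono) auto
  also have "\<dots> = K * u\<^sup>2" using True by (simp add: power_add power2_eq_square)
  finally show ?thesis using True by (simp only: flat_exp_def K_def if_True)
qed (simp add: flat_exp_def)

lemma flat_exp_bound_le_1: "u \<le> 1 \<Longrightarrow> flat_exp m u \<le> fact (m + 2)"
proof (cases "u > 0")
  case True
  assume "u \<le> 1"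
  then have "u\<^sup>2 \<le> 1" using True by (simp add: power_le_one)
  then have "fact (m + 2) * u\<^sup>2 \<le> fact (m + 2)" using mult_left_mono[of "u\<^sup>2" 1 "fact (m + 2)"] by simp
  then show ?thesis using flat_exp_bound[of m u] by linarith
qed (simp add: flat_exp_def)

text \<open>Away from 0 this is the chain rule for \<open>exp (- y) * y ^ m\<close> at
  \<open>y = 1 / u\<close>, or trivial. At 0 the difference quotient is at most a constant times
  \<open>\<bar>h\<bar>\<close> by the quadratic bound.\<close>

lemma DERIV_flat_exp:
  "(flat_exp m has_real_derivative flat_exp (m + 2) u - real m * flat_exp (Suc m) u) (at u)"
proof -
  consider "u > 0" | "u < 0" | "u = 0" by linarith
  then show ?thesis
  proof cases
    case 1
    have "((\<lambda>y. exp (- y) * y ^ m) has_real_derivative - exp (- y) * y ^ m + real m * y ^ (m - 1) * exp (- y)) (at y)" for y :: real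
      by (auto intro!: derivative_eq_intros)
    from DERIV_chain2[OF this DERIV_inverse[of u UNIV]] 1
    have "((\<lambda>u. exp (- inverse u) * inverse u ^ m) has_real_derivative
      (- exp (- inverse u) * inverse u ^ m + real m * inverse u ^ (m - 1) * exp (- inverse u)) * - (inverse u ^ Suc (Suc 0))) (at u)"
      by simp
    also have "(- exp (- inverse u) * inverse u ^ m + real m * inverse u ^ (m - 1) * exp (- inverse u)) * - (inverse u ^ Suc (Suc 0))
      = exp (- inverse u) * inverse u ^ (m + 2) - real m * (exp (- inverse u) * inverse u ^ Suc m)"
      by (cases m) (simp_all add: algebra_simps)
    also have "\<dots> = flat_exp (m + 2) u - real m * flat_exp (Suc m) u"
      using 1 by (simp add: flat_exp_def divide_inverse power_inverse)
    finally show ?thesis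
      by (rule has_field_derivative_transform_within_open[of _ _ _ "{0<..}"])
        (use 1 in \<open>auto simp: flat_exp_def divide_inverse power_inverse\<close>)
  next
    case 2
    have "((\<lambda>u. 0) has_real_derivative flat_exp (m + 2) u - real m * flat_exp (Suc m) u) (at u)"
      using 2 by (simp add: flat_exp_def)
    then show ?thesis
      by (rule has_field_derivative_transform_within_open[of _ _ _ "{..<0}"]) (use 2 in \<open>auto simp: flat_exp_def\<close>)
  next
    case 3
    have "((\<lambda>h. flat_exp m h / h) \<longlongrightarrow> 0) (at 0)"
    proof (rule Lim_null_comparison)
      show "\<forall>\<^sub>F h in at 0. norm (flat_exp m h / h) \<le> fact (m + 2) * \<bar>h\<bar>"
        unfolding eventually_at_filter
      proof (intro always_eventually allI impI)
        fix h :: real assume h: "h \<noteq> 0"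
        have "flat_exp m h \<le> (fact (m + 2) * \<bar>h\<bar>) * \<bar>h\<bar>"
          using flat_exp_bound[of m h] by (simp only: power2_eq_square mult.assoc abs_mult_self_eq)
        moreover have "norm (flat_exp m h / h) = flat_exp m h / \<bar>h\<bar>"
          using flat_exp_nonneg[of m h] by simp
        ultimately show "norm (flat_exp m h / h) \<le> fact (m + 2) * \<bar>h\<bar>"
          using h by (simp only: pos_divide_le_eq zero_less_abs_iff not_False_eq_True)
      qed
      have "((\<lambda>h. fact (m + 2) * \<bar>h\<bar>) \<longlongrightarrow> fact (m + 2) * \<bar>0::real\<bar>) (at 0)"
        by (intro tendsto_intros)
      then show "((\<lambda>h. fact (m + 2) * \<bar>h\<bar>) \<longlongrightarrow> (0::real)) (at 0)" by simp
    qed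
    then have "(flat_exp m has_real_derivative 0) (at 0)"
      unfolding DERIV_def by (simp add: flat_exp_def)
    then show ?thesis using 3 by (simp add: flat_exp_def)
  qed
qed

text \<open>A polynomial times the Gaussian weight, cut off where
  \<open>c * x\<^sup>2 \<ge> 1\<close>. The Gaussian weight turns Lebesgue integrals of the weak
  derivative into Gaussian ones; as \<open>c\<close> tends to 0, the cut-off tends to a
  constant.\<close>

definition bump :: "real \<Rightarrow> real poly \<Rightarrow> nat \<Rightarrow> real \<Rightarrow> real" where
  "bump c p m x = poly p x * exp (- x\<^sup>2 / 2) * flat_exp m (1 - c * x\<^sup>2)"

lemma DERIV_bump:
  "(bump c p m has_real_derivative
     (poly (pderiv p) x - x * poly p x) * exp (- x\<^sup>2 / 2) * flat_exp m (1 - c * x\<^sup>2)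
     - 2 * c * x * poly p x * exp (- x\<^sup>2 / 2)
        * (flat_exp (m + 2) (1 - c * x\<^sup>2) - real m * flat_exp (Suc m) (1 - c * x\<^sup>2))) (at x)"
proof -
  have "((\<lambda>x. 1 - c * x\<^sup>2) has_real_derivative - (2 * c * x)) (at x)"
    by (auto intro!: derivative_eq_intros)
  from DERIV_chain2[OF DERIV_flat_exp this]
  have d: "((\<lambda>x. flat_exp m (1 - c * x\<^sup>2)) has_real_derivative
    (flat_exp (m + 2) (1 - c * x\<^sup>2) - real m * flat_exp (Suc m) (1 - c * x\<^sup>2)) * - (2 * c * x)) (at x)" .
  show ?thesis
    unfolding bump_def[abs_def]
    by (rule derivative_eq_intros d poly_DERIV refl | simp)+ (simp add: algebra_simps)
qed

lemma deriv_bump: "\<exists>p' m'. deriv (bump c p m) = bump c p' m'"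
proof -
  define U :: "real poly" where "U = [:1, 0, -c:]"
  \<comment> \<open>All terms of the derivative are brought to the common factor
    \<open>flat_exp (m + 2)\<close>; each step from \<open>m\<close> to \<open>m + 1\<close> costs
    one factor \<open>U\<close>, that is \<open>1 - c * x\<^sup>2\<close>.\<close>
  define p' where "p' = (pderiv p - [:0, 1:] * p) * U\<^sup>2 + p * [:0, -2 * c:] * (1 - smult (real m) U)"
  have "deriv (bump c p m) = bump c p' (m + 2)"
  proof
    fix x
    let ?u = "1 - c * x\<^sup>2"
    have U: "poly U x = ?u" by (simp add: U_def power2_eq_square algebra_simps)
    have e1: "flat_exp (Suc m) ?u = ?u * flat_exp (m + 2) ?u" using flat_exp_shift[of "Suc m" ?u] by simp
    have e0: "flat_exp m ?u = ?u\<^sup>2 * flat_exp (m + 2) ?u"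
      using flat_exp_shift[of m ?u] e1 by (simp add: power2_eq_square mult.assoc)
    have p': "poly p' x = (poly (pderiv p) x - x * poly p x) * ?u\<^sup>2 + poly p x * (- 2 * c * x) * (1 - real m * ?u)"
      unfolding p'_def by (simp add: U algebra_simps)
    show "deriv (bump c p m) x = bump c p' (m + 2) x"
      unfolding DERIV_imp_deriv[OF DERIV_bump] unfolding bump_def p' e0 e1
      by (simp add: algebra_simps)
  qed
  then show ?thesis by blast
qed

lemma test_function_bump:
  assumes "c > 0"
  shows "test_function (bump c p m)"
proof -
  have it: "\<exists>p' m'. (deriv ^^ k) (bump c p m) = bump c p' m'" for k
  proof (induction k)
    case (Suc k)
    then show ?case using deriv_bump by (metis comp_apply funpow.simps(2))
  qed auto
  have "(deriv ^^ k) (bump c p m) differentiable (at x)" for k x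
    using it[of k] DERIV_bump by (metis real_differentiable_def)
  \<comment> \<open>This radius avoids square roots: beyond it both
    \<open>\<bar>x\<bar> \<ge> 1\<close> and \<open>\<bar>x\<bar> \<ge> 1 / c\<close> hold, hence
    \<open>c * x\<^sup>2 \<ge> 1\<close>.\<close>
  moreover have "bump c p m x = 0" if "\<bar>x\<bar> > 1 + 1 / c" for x
  proof -
    have "1 / c > 0" using assms by simp
    then have "1 \<le> \<bar>x\<bar>" "1 / c \<le> \<bar>x\<bar>" using that by linarith+
    then have "1 / c * 1 \<le> \<bar>x\<bar> * \<bar>x\<bar>" by (intro mult_mono) auto
    then have "1 - c * x\<^sup>2 \<le> 0" using assms by (simp add: field_simps power2_eq_square)
    then show ?thesis by (simp add: bump_def flat_exp_def)
  qed
  ultimately show ?thesis unfolding test_function_def by blast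
qed

lemma continuous_flat_exp: "continuous_on UNIV (flat_exp m)"
  using DERIV_flat_exp by (meson DERIV_isCont continuous_at_imp_continuous_on)

lemma flat_exp_measurable [measurable]: "flat_exp m \<in> borel_measurable borel"
  using continuous_flat_exp by (rule borel_measurable_continuous_onI)

lemma lborel_integral_exp_weight:
  assumes [measurable]: "f \<in> borel_measurable borel"
  shows "(\<integral>x. f x * exp (- x\<^sup>2 / 2) \<partial>lborel) = sqrt (2 * pi) * (\<integral>x. f x \<partial>std_gauss)"
proof -
  have "(\<integral>x. f x \<partial>std_gauss) = (\<integral>x. (1 / sqrt (2 * pi)) * (f x * exp (- x\<^sup>2 / 2)) \<partial>lborel)"
    unfolding std_gauss_integral[OF assms] by (simp add: std_normal_density_def algebra_simps)
  then show ?thesis by simp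
qed

text \<open>The derivative of \<open>herm k 1\<close> times the Gaussian weight is minus
  \<open>herm (Suc k) 1\<close> times the weight, so the identity is the definition of the weak
  derivative for this product. The product has no compact support; it is approximated by the
  functions \<open>bump (c j) ?H 0\<close>, whose cut-off tends to the constant
  \<open>exp (-1)\<close>, which cancels in the end.\<close>

lemma weak_deriv_herm:
  assumes w: "gauss_weak_deriv g d"
  shows "(\<integral>x. g x * poly (herm (Suc k) 1) x \<partial>std_gauss) = (\<integral>x. d x * poly (herm k 1) x \<partial>std_gauss)"
proof -
  have g: "g \<in> L2_space std_gauss" and d: "d \<in> L2_space std_gauss"
    using w by (auto simp: gauss_weak_deriv_def)
  have [measurable]: "g \<in> borel_measurable borel" "d \<in> borel_measurable borel"
    using L2_spaceD(1)[OF g] L2_spaceD(1)[OF d] by auto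
  let ?H = "herm k 1"
  define c where "c j = 1 / real (Suc j)" for j
  have c: "0 < c j" "c j \<le> 1" "c \<longlonglongrightarrow> 0" for j
    unfolding c_def using LIMSEQ_inverse_real_of_nat by (auto simp: divide_simps inverse_eq_divide)
  define q where "q j x = - poly (herm (Suc k) 1) x * flat_exp 0 (1 - c j * x\<^sup>2)
      - 2 * c j * x * poly ?H x * flat_exp 2 (1 - c j * x\<^sup>2)" for j x
  have qm [measurable]: "q j \<in> borel_measurable borel" for j unfolding q_def[abs_def] by measurable
  have D: "deriv (bump (c j) ?H 0) x = q j x * exp (- x\<^sup>2 / 2)" for j x
    unfolding DERIV_imp_deriv[OF DERIV_bump] q_def by (simp add: algebra_simps numeral_2_eq_2)
  have lim: "(\<lambda>j. 1 - c j * x\<^sup>2) \<longlonglongrightarrow> 1" for x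
    using tendsto_diff[OF tendsto_const[of 1] tendsto_mult_left_zero[OF c(3), of "x\<^sup>2"]] by simp
  have flim: "(\<lambda>j. flat_exp m (1 - c j * x\<^sup>2)) \<longlonglongrightarrow> exp (-1)" for m x
  proof -
    have "(\<lambda>j. flat_exp m (1 - c j * x\<^sup>2)) \<longlonglongrightarrow> flat_exp m 1"
      by (rule isCont_tendsto_compose[OF _ lim]) (use DERIV_flat_exp DERIV_isCont in blast)
    then show ?thesis by (simp add: flat_exp_def)
  qed
  have fb: "\<bar>flat_exp m (1 - c j * x\<^sup>2)\<bar> \<le> fact (m + 2)" for m j x
    using flat_exp_bound_le_1[of "1 - c j * x\<^sup>2" m] flat_exp_nonneg[of m "1 - c j * x\<^sup>2"] c(1)[of j] by simp
  \<comment> \<open>The constants of the dominating function come from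
    \<open>flat_exp_bound_le_1\<close>: \<open>flat_exp 0\<close> is at most 2!, and
    \<open>flat_exp 2\<close> is at most 4!, multiplied by \<open>2 * c j \<le> 2\<close>.\<close>
  have 1: "(\<lambda>j. \<integral>x. g x * q j x \<partial>std_gauss) \<longlonglongrightarrow> (\<integral>x. g x * (- poly (herm (Suc k) 1) x * exp (-1)) \<partial>std_gauss)"
  proof (rule integral_dominated_convergence[where w="\<lambda>x. \<bar>g x * poly (herm (Suc k) 1) x\<bar> * 2 + \<bar>g x * poly ([:0,1:] * ?H) x\<bar> * 48"])
    show "integrable std_gauss (\<lambda>x. \<bar>g x * poly (herm (Suc k) 1) x\<bar> * 2 + \<bar>g x * poly ([:0,1:] * ?H) x\<bar> * 48)"
    proof -
      have "integrable std_gauss (\<lambda>x. g x * poly r x)" for r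
        using L2_mult_integrable[OF g poly_L2_std_gauss[of r 0 1]] by simp
      then show ?thesis by (intro Bochner_Integration.integrable_add integrable_mult_left integrable_abs)
    qed
    show "AE x in std_gauss. (\<lambda>j. g x * q j x) \<longlonglongrightarrow> g x * (- poly (herm (Suc k) 1) x * exp (-1))"
    proof (rule AE_I2)
      fix x
      have "(\<lambda>j. g x * q j x) \<longlonglongrightarrow> g x * (- poly (herm (Suc k) 1) x * exp (-1) - 2 * 0 * x * poly ?H x * exp (-1))"
        unfolding q_def by (intro tendsto_intros flim c(3))
      then show "(\<lambda>j. g x * q j x) \<longlonglongrightarrow> g x * (- poly (herm (Suc k) 1) x * exp (-1))" by simp
    qed
    show "AE x in std_gauss. norm (g x * q j x) \<le> \<bar>g x * poly (herm (Suc k) 1) x\<bar> * 2 + \<bar>g x * poly ([:0,1:] * ?H) x\<bar> * 48" for j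
    proof (rule AE_I2)
      fix x
      let ?a = "g x * poly (herm (Suc k) 1) x" and ?b = "g x * poly ([:0,1:] * ?H) x"
      have "g x * q j x = - (?a * flat_exp 0 (1 - c j * x\<^sup>2)) - ?b * (2 * c j * flat_exp 2 (1 - c j * x\<^sup>2))"
        unfolding q_def by (simp add: algebra_simps del: herm.simps)
      then have "\<bar>g x * q j x\<bar> \<le> \<bar>?a\<bar> * \<bar>flat_exp 0 (1 - c j * x\<^sup>2)\<bar> + \<bar>?b\<bar> * \<bar>2 * c j * flat_exp 2 (1 - c j * x\<^sup>2)\<bar>"
        unfolding abs_mult[of ?a, symmetric] abs_mult[of ?b, symmetric] by linarith
      also have "\<dots> \<le> \<bar>?a\<bar> * 2 + \<bar>?b\<bar> * 48"
      proof (intro add_mono mult_left_mono)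
        show "\<bar>flat_exp 0 (1 - c j * x\<^sup>2)\<bar> \<le> 2" using fb[of 0 j x] by (simp add: numeral_2_eq_2)
        have "\<bar>2 * c j\<bar> * \<bar>flat_exp 2 (1 - c j * x\<^sup>2)\<bar> \<le> 2 * 24"
          using fb[of 2 j x] c(1)[of j] c(2)[of j] by (intro mult_mono) (auto simp: fact_numeral)
        then show "\<bar>2 * c j * flat_exp 2 (1 - c j * x\<^sup>2)\<bar> \<le> 48" by (simp add: abs_mult)
      qed auto
      finally show "norm (g x * q j x) \<le> \<bar>?a\<bar> * 2 + \<bar>?b\<bar> * 48" by simp
    qed
  qed auto
  have 2: "(\<lambda>j. \<integral>x. d x * (poly ?H x * flat_exp 0 (1 - c j * x\<^sup>2)) \<partial>std_gauss) \<longlonglongrightarrow> (\<integral>x. d x * (poly ?H x * exp (-1)) \<partial>std_gauss)"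
  proof (rule integral_dominated_convergence[where w="\<lambda>x. \<bar>d x * poly ?H x\<bar> * 2"])
    show "integrable std_gauss (\<lambda>x. \<bar>d x * poly ?H x\<bar> * 2)"
      using L2_mult_integrable[OF d poly_L2_std_gauss[of ?H 0 1]] by simp
    show "AE x in std_gauss. (\<lambda>j. d x * (poly ?H x * flat_exp 0 (1 - c j * x\<^sup>2))) \<longlonglongrightarrow> d x * (poly ?H x * exp (-1))"
      by (intro AE_I2 tendsto_intros flim)
    show "AE x in std_gauss. norm (d x * (poly ?H x * flat_exp 0 (1 - c j * x\<^sup>2))) \<le> \<bar>d x * poly ?H x\<bar> * 2" for j
    proof (rule AE_I2)
      fix x
      have "\<bar>d x * poly ?H x\<bar> * \<bar>flat_exp 0 (1 - c j * x\<^sup>2)\<bar> \<le> \<bar>d x * poly ?H x\<bar> * 2"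
        using fb[of 0 j x] by (intro mult_left_mono) (auto simp: numeral_2_eq_2)
      then show "norm (d x * (poly ?H x * flat_exp 0 (1 - c j * x\<^sup>2))) \<le> \<bar>d x * poly ?H x\<bar> * 2"
        by (simp add: abs_mult mult.assoc)
    qed
  qed auto
  have eq: "(\<integral>x. g x * q j x \<partial>std_gauss) = - (\<integral>x. d x * (poly ?H x * flat_exp 0 (1 - c j * x\<^sup>2)) \<partial>std_gauss)" for j
  proof -
    have "(\<integral>x. g x * deriv (bump (c j) ?H 0) x \<partial>lborel) = - (\<integral>x. d x * bump (c j) ?H 0 x \<partial>lborel)"
      using w test_function_bump[OF c(1)[of j]] by (auto simp: gauss_weak_deriv_def)
    then have "(\<integral>x. (g x * q j x) * exp (- x\<^sup>2 / 2) \<partial>lborel)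
        = - (\<integral>x. (d x * (poly ?H x * flat_exp 0 (1 - c j * x\<^sup>2))) * exp (- x\<^sup>2 / 2) \<partial>lborel)"
      unfolding D bump_def by (simp add: mult_ac)
    then have "sqrt (2 * pi) * (\<integral>x. g x * q j x \<partial>std_gauss)
        = sqrt (2 * pi) * - (\<integral>x. d x * (poly ?H x * flat_exp 0 (1 - c j * x\<^sup>2)) \<partial>std_gauss)"
      by (subst (asm) (1 2) lborel_integral_exp_weight) auto
    then show ?thesis by (simp only: mult_cancel_left) simp
  qed
  have "(\<integral>x. g x * (- poly (herm (Suc k) 1) x * exp (-1)) \<partial>std_gauss) = - (\<integral>x. d x * (poly ?H x * exp (-1)) \<partial>std_gauss)"
    by (rule LIMSEQ_unique[OF 1]) (unfold eq, intro tendsto_minus 2)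
  then have "exp (-1) * (\<integral>x. g x * poly (herm (Suc k) 1) x \<partial>std_gauss) = exp (-1) * (\<integral>x. d x * poly ?H x \<partial>std_gauss)"
    by (simp only: integral_mult_right_zero[symmetric] integral_minus[symmetric])
       (simp add: algebra_simps del: herm.simps)
  then show ?thesis by simp
qed

lemma hcoeff_weak_deriv:
  assumes w: "gauss_weak_deriv g d"
  shows "real (Suc k) * (hcoeff g (Suc k))\<^sup>2 = (hcoeff d k)\<^sup>2"
proof -
  have "hcoeff g (Suc k) = (\<integral>x. g x * poly (herm (Suc k) 1) x \<partial>std_gauss) / sqrt (fact (Suc k))"
    by (simp only: hcoeff_def hermn_def times_divide_eq_right integral_divide_zero)
  also have "\<dots> = (\<integral>x. d x * poly (herm k 1) x \<partial>std_gauss) / sqrt (fact (Suc k))"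
    by (simp only: weak_deriv_herm[OF w])
  also have "(\<integral>x. d x * poly (herm k 1) x \<partial>std_gauss) = sqrt (fact k) * hcoeff d k"
    by (simp add: hcoeff_def hermn_def)
  finally have "hcoeff g (Suc k) = sqrt (fact k) * hcoeff d k / sqrt (fact (Suc k))" .
  then have "(hcoeff g (Suc k))\<^sup>2 = fact k * (hcoeff d k)\<^sup>2 / fact (Suc k)"
    by (simp add: power_divide power_mult_distrib del: fact_Suc of_nat_Suc)
  also have "\<dots> = (hcoeff d k)\<^sup>2 / real (Suc k)"
    by (subst fact_Suc) (simp del: of_nat_Suc)
  finally show ?thesis by (simp del: of_nat_Suc)
qed

text \<open>Bessel's inequality for the weak derivative after an index shift, the term of order 0
  being zero on the left.\<close>

lemma hcoeff_weak_deriv_Bessel: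
  assumes w: "gauss_weak_deriv g d"
  shows "(\<Sum>k<N. real k * (hcoeff g k)\<^sup>2) \<le> (L2_norm_of std_gauss d)\<^sup>2"
proof (cases N)
  case (Suc M)
  have "(\<Sum>k<N. real k * (hcoeff g k)\<^sup>2) = (\<Sum>k<M. real (Suc k) * (hcoeff g (Suc k))\<^sup>2)"
    unfolding Suc by (subst sum.lessThan_Suc_shift) simp
  also have "\<dots> = (\<Sum>k<M. (hcoeff d k)\<^sup>2)" by (simp only: hcoeff_weak_deriv[OF w])
  also have "\<dots> \<le> (L2_norm_of std_gauss d)\<^sup>2"
    using w by (intro hcoeff_Bessel) (simp add: gauss_weak_deriv_def)
  finally show ?thesis .
qed simp

section \<open>Approximation by averages over a uniform grid\<close>

lemma finite_measure_time: "finite_measure (time_measure T)"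
  by (rule finite_measureI) (auto simp: emeasure_restrict_space space_restrict_space emeasure_lborel_Icc_eq)

interpretation time: finite_measure "time_measure T" for T
  by (rule finite_measure_time)

lemma time_measure_integral:
  fixes f :: "real \<Rightarrow> real"
  shows "(\<integral>t. f t \<partial>time_measure T) = (\<integral>t. indicator {0..T} t * f t \<partial>lborel)"
  by (subst integral_restrict_space) auto

lemma time_measure_interval:
  assumes "0 \<le> x" "x \<le> y" "y \<le> T"
  shows "(\<integral>t. indicator {x<..y} t \<partial>time_measure T) = y - x"
proof -
  have "(\<integral>t. indicator {x<..y} t \<partial>time_measure T) = (\<integral>t. indicator {0..T} t * (indicator {x<..y} t :: real) \<partial>lborel)"
    by (rule time_measure_integral)
  also have "(\<lambda>t. indicator {0..T} t * (indicator {x<..y} t :: real)) = (indicator {x<..y} :: real \<Rightarrow> real)"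
    using assms by (auto split: split_indicator)
  also have "(\<integral>t. indicator {x<..y} t \<partial>lborel) = (y - x :: real)" using assms by simp
  finally show ?thesis .
qed

lemma AE_time_measure: "(AE t in time_measure T. P t) \<longleftrightarrow> (AE t in lborel. 0 \<le> t \<longrightarrow> t \<le> T \<longrightarrow> P t)"
  by (subst AE_restrict_space_iff) auto

lemma AE_time_measure_neq: "AE t in time_measure T. t \<noteq> c"
  unfolding AE_time_measure using AE_lborel_singleton[of c] by eventually_elim simp

definition grid :: "real \<Rightarrow> nat \<Rightarrow> nat \<Rightarrow> real" where
  "grid T N l = real l * T / real N"

lemma grid_mono: "0 \<le> T \<Longrightarrow> l \<le> m \<Longrightarrow> grid T N l \<le> grid T N m"
  unfolding grid_def by (intro divide_right_mono mult_right_mono) auto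

lemma grid_nonneg: "0 \<le> T \<Longrightarrow> 0 \<le> grid T N l"
  by (simp add: grid_def)

lemma grid_0 [simp]: "grid T N 0 = 0" by (simp add: grid_def)

lemma grid_end: "N > 0 \<Longrightarrow> grid T N N = T" by (simp add: grid_def)

lemma grid_le: "0 \<le> T \<Longrightarrow> l \<le> N \<Longrightarrow> N > 0 \<Longrightarrow> grid T N l \<le> T"
  using grid_mono[of T l N N] grid_end by simp

lemma grid_Suc: "grid T N (Suc l) = grid T N l + T / real N"
  by (simp add: grid_def field_simps add_divide_distrib)

lemma grid_strict: "0 < T \<Longrightarrow> l < m \<Longrightarrow> N > 0 \<Longrightarrow> grid T N l < grid T N m"
  unfolding grid_def by (intro divide_strict_right_mono mult_strict_right_mono) auto

abbreviation cell :: "real \<Rightarrow> nat \<Rightarrow> nat \<Rightarrow> real set" where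
  "cell T N l \<equiv> {grid T N l<..grid T N (Suc l)}"

definition grid_avg :: "real \<Rightarrow> nat \<Rightarrow> (real \<Rightarrow> real) \<Rightarrow> nat \<Rightarrow> real" where
  "grid_avg T N h l = real N / T * (\<integral>t. indicator (cell T N l) t * h t \<partial>time_measure T)"

text \<open>The orthogonal projection of \<open>h\<close> onto the functions that are constant on
  the cells. It provides one canonical sequence of step functions for every \<open>h\<close>, linear
  in \<open>h\<close>, with which the arbitrary sequences in the definition of the Wiener integral
  can be compared.\<close>

definition grid_step :: "real \<Rightarrow> nat \<Rightarrow> (real \<Rightarrow> real) \<Rightarrow> real \<Rightarrow> real" where
  "grid_step T N h t = (\<Sum>l<N. grid_avg T N h l * indicator (cell T N l) t)"

lemma cell_disjoint:
  assumes "0 \<le> T" "t \<in> cell T N l" "t \<in> cell T N m"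
  shows "l = m"
proof (rule ccontr)
  assume "l \<noteq> m"
  then consider "Suc l \<le> m" | "Suc m \<le> l" by linarith
  then show False
    using assms grid_mono[of T "Suc l" m N] grid_mono[of T "Suc m" l N] by cases auto
qed

lemma cell_cover:
  assumes "0 < T" "0 < t" "t \<le> T" "N > 0"
  obtains l where "l < N" "t \<in> cell T N l"
proof -
  define P where "P l \<longleftrightarrow> t \<le> grid T N l" for l
  have PN: "P N" using assms by (simp add: P_def grid_end)
  define L where "L = (LEAST l. P l)"
  have PL: "P L" unfolding L_def using PN by (rule LeastI)
  have "L \<noteq> 0"
  proof
    assume "L = 0"
    with PL have "P 0" by simp
    then show False using assms by (simp add: P_def)
  qed
  then obtain l where l: "L = Suc l" by (cases L) auto
  have "\<not> P l" using l not_less_Least[of l P] by (auto simp: L_def)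
  moreover have "L \<le> N" unfolding L_def using PN by (rule Least_le)
  ultimately show ?thesis using that[of l] PL l by (auto simp: P_def)
qed

lemma indicator_cell_mult:
  assumes "0 \<le> T"
  shows "indicator (cell T N l) t * indicator (cell T N m) t = (if l = m then indicator (cell T N l) t else (0::real))"
  using cell_disjoint[OF assms, of t N l m] by (auto simp: indicator_def)

lemma grid_step_cell:
  assumes "0 \<le> T" "l < N" "t \<in> cell T N l"
  shows "grid_step T N h t = grid_avg T N h l"
proof -
  have "grid_step T N h t = (\<Sum>m<N. if m = l then grid_avg T N h l else 0)"
    unfolding grid_step_def
  proof (rule sum.cong[OF refl])
    fix m
    show "grid_avg T N h m * indicator (cell T N m) t = (if m = l then grid_avg T N h l else 0)"
    proof (cases "m = l")
      case True
      then show ?thesis using assms(3) by (simp add: indicator_def)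
    next
      case False
      then have "t \<notin> cell T N m" using cell_disjoint[OF assms(1) assms(3)] by blast
      then show ?thesis using False by (simp add: indicator_def)
    qed
  qed
  then show ?thesis using assms by simp
qed

lemma grid_step_measurable [measurable]: "grid_step T N h \<in> borel_measurable borel"
  unfolding grid_step_def[abs_def] by measurable

lemma indicator_L2_time: "B \<in> sets borel \<Longrightarrow> indicator B \<in> L2_space (time_measure T)"
  by (intro time.L2_space_bounded[where B=1]) (auto simp: measurable_restrict_space1 split: split_indicator)

lemma grid_step_L2: "grid_step T N h \<in> L2_space (time_measure T)"
  unfolding grid_step_def[abs_def]
  by (intro L2_space_sum L2_space_cmult indicator_L2_time) auto

lemma grid_avg_add:
  assumes "f \<in> L2_space (time_measure T)" "h \<in> L2_space (time_measure T)"
  shows "grid_avg T N (\<lambda>t. f t + h t) l = grid_avg T N f l + grid_avg T N h l"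
proof -
  have "integrable (time_measure T) (\<lambda>t. indicator (cell T N l) t * k t)" if "k \<in> L2_space (time_measure T)" for k
    by (intro L2_mult_integrable indicator_L2_time that) auto
  then show ?thesis unfolding grid_avg_def using assms by (simp add: distrib_left)
qed

lemma grid_avg_cmult: "grid_avg T N (\<lambda>t. c * h t) l = c * grid_avg T N h l"
  unfolding grid_avg_def by (simp add: mult.left_commute)

lemma grid_step_add:
  assumes "f \<in> L2_space (time_measure T)" "h \<in> L2_space (time_measure T)"
  shows "grid_step T N (\<lambda>t. f t + h t) t = grid_step T N f t + grid_step T N h t"
  unfolding grid_step_def by (simp add: grid_avg_add[OF assms] distrib_right sum.distrib)

lemma grid_step_cmult: "grid_step T N (\<lambda>t. c * h t) t = c * grid_step T N h t"
  unfolding grid_step_def sum_distrib_left by (intro sum.cong refl) (simp only: grid_avg_cmult mult.assoc)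

lemma grid_step_diff:
  assumes "f \<in> L2_space (time_measure T)" "h \<in> L2_space (time_measure T)"
  shows "grid_step T N (\<lambda>t. f t - h t) t = grid_step T N f t - grid_step T N h t"
  using grid_step_add[OF assms(1) L2_space_cmult[OF assms(2), of "-1"], of N t]
    grid_step_cmult[of T N "-1" h t] by simp

text \<open>On each cell the square of the mean is at most the mean of the square, by Cauchy-Schwarz
  against the indicator of the cell; the cells are disjoint.\<close>

lemma grid_step_norm_le:
  assumes T: "0 < T" and h: "h \<in> L2_space (time_measure T)"
  shows "L2_norm_of (time_measure T) (grid_step T N h) \<le> L2_norm_of (time_measure T) h"
proof (cases "N = 0")
  case True
  then show ?thesis by (simp add: grid_step_def L2_norm_of_def)
next
  case False
  then have N: "N > 0" by simp
  let ?M = "time_measure T" and ?c = "\<lambda>l t. indicator (cell T N l) t :: real"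
  have cL: "?c l \<in> L2_space ?M" for l by (rule indicator_L2_time) simp
  have chL: "(\<lambda>t. ?c l t * h t) \<in> L2_space ?M" for l
    by (rule L2_space_bounded_mult[OF h, where B=1]) (auto simp: measurable_restrict_space1 split: split_indicator)
  have ci: "(\<integral>t. ?c l t \<partial>?M) = T / N" if "l < N" for l
    using time_measure_interval[of "grid T N l" "grid T N (Suc l)" T] that T N
      grid_nonneg[of T N l] grid_mono[of T l "Suc l" N] grid_le[of T "Suc l" N] by (simp add: grid_Suc)
  have sq: "(grid_step T N h t)\<^sup>2 = (\<Sum>l<N. (grid_avg T N h l)\<^sup>2 * ?c l t)" for t
  proof -
    have "(grid_step T N h t)\<^sup>2 = (\<Sum>l<N. \<Sum>m<N. grid_avg T N h l * grid_avg T N h m * (?c l t * ?c m t))"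
      unfolding grid_step_def power2_eq_square sum_product by (simp add: algebra_simps)
    also have "\<dots> = (\<Sum>l<N. \<Sum>m<N. if m = l then (grid_avg T N h l)\<^sup>2 * ?c l t else 0)"
      using T by (intro sum.cong refl) (auto simp: indicator_cell_mult power2_eq_square)
    finally show ?thesis by simp
  qed
  have avg: "(grid_avg T N h l)\<^sup>2 * (T / N) \<le> (\<integral>t. ?c l t * (h t)\<^sup>2 \<partial>?M)" if l: "l < N" for l
  proof -
    have cc: "?c l t * (?c l t * h t) = ?c l t * h t" for t by (auto split: split_indicator)
    have "\<bar>\<integral>t. ?c l t * (?c l t * h t) \<partial>?M\<bar> \<le> L2_norm_of ?M (?c l) * L2_norm_of ?M (\<lambda>t. ?c l t * h t)"
      by (rule L2_Cauchy_Schwarz[OF cL chL])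
    then have "\<bar>\<integral>t. ?c l t * h t \<partial>?M\<bar>\<^sup>2 \<le> (L2_norm_of ?M (?c l) * L2_norm_of ?M (\<lambda>t. ?c l t * h t))\<^sup>2"
      unfolding cc by (rule power_mono) simp
    also have "\<dots> = (\<integral>t. (?c l t)\<^sup>2 \<partial>?M) * (\<integral>t. (?c l t * h t)\<^sup>2 \<partial>?M)"
      by (simp only: power_mult_distrib L2_norm_of_power2)
    also have "(\<lambda>t. (?c l t)\<^sup>2) = ?c l" by (auto split: split_indicator)
    also have "(\<lambda>t. (?c l t * h t)\<^sup>2) = (\<lambda>t. ?c l t * (h t)\<^sup>2)" by (auto split: split_indicator)
    finally have le: "(\<integral>t. ?c l t * h t \<partial>?M)\<^sup>2 \<le> T / N * (\<integral>t. ?c l t * (h t)\<^sup>2 \<partial>?M)" using ci[OF l] by simp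
    have "(grid_avg T N h l)\<^sup>2 * (T / N) = (\<integral>t. ?c l t * h t \<partial>?M)\<^sup>2 * (N / T)"
      unfolding grid_avg_def using T N by (simp add: power2_eq_square field_simps)
    also have "\<dots> \<le> (T / N * (\<integral>t. ?c l t * (h t)\<^sup>2 \<partial>?M)) * (N / T)"
      using T by (intro mult_right_mono le) auto
    also have "\<dots> = (\<integral>t. ?c l t * (h t)\<^sup>2 \<partial>?M)" using T N by (simp add: field_simps)
    finally show ?thesis .
  qed
  have hi: "integrable ?M (\<lambda>t. ?c l t * (h t)\<^sup>2)" for l
  proof -
    have "(\<lambda>t. (?c l t * h t)\<^sup>2) = (\<lambda>t. ?c l t * (h t)\<^sup>2)" by (auto split: split_indicator)
    then show ?thesis using L2_spaceD(2)[OF chL[of l]] by simp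
  qed
  have "(L2_norm_of ?M (grid_step T N h))\<^sup>2 = (\<Sum>l<N. (grid_avg T N h l)\<^sup>2 * (\<integral>t. ?c l t \<partial>?M))"
    unfolding L2_norm_of_power2 sq
    using time.L2_space_integrable[OF cL]
    by (subst Bochner_Integration.integral_sum) (auto simp del: Bochner_Integration.integral_indicator intro!: sum.cong)
  also have "\<dots> = (\<Sum>l<N. (grid_avg T N h l)\<^sup>2 * (T / N))" using ci by simp
  also have "\<dots> \<le> (\<Sum>l<N. \<integral>t. ?c l t * (h t)\<^sup>2 \<partial>?M)" using avg by (intro sum_mono) auto
  also have "\<dots> = (\<integral>t. (\<Sum>l<N. ?c l t * (h t)\<^sup>2) \<partial>?M)"
    by (rule Bochner_Integration.integral_sum[symmetric]) (rule hi)
  also have "\<dots> \<le> (\<integral>t. (h t)\<^sup>2 \<partial>?M)"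
  proof (rule integral_mono)
    fix t
    have "(\<Sum>l<N. ?c l t) \<le> 1"
    proof (cases "\<exists>l<N. t \<in> cell T N l")
      case True
      then obtain l where l: "l < N" "t \<in> cell T N l" by blast
      have "(\<Sum>m<N. ?c m t) = (\<Sum>m<N. if m = l then 1 else 0)"
      proof (intro sum.cong refl)
        fix m
        show "?c m t = (if m = l then 1 else 0)"
          using cell_disjoint[OF _ l(2), of m] l(2) T by (cases "m = l") (auto simp: indicator_def)
      qed
      also have "\<dots> = 1" using l(1) by simp
      finally show ?thesis by (simp only: order_refl)
    next
      case False
      then have "(\<Sum>l<N. ?c l t) = 0" by (intro sum.neutral) (auto split: split_indicator)
      then show ?thesis by simp
    qed
    then show "(\<Sum>l<N. ?c l t * (h t)\<^sup>2) \<le> (h t)\<^sup>2"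
      unfolding sum_distrib_right[symmetric] using mult_right_mono[of _ 1 "(h t)\<^sup>2"] by simp
    show "integrable ?M (\<lambda>t. \<Sum>l<N. ?c l t * (h t)\<^sup>2)" by (intro Bochner_Integration.integrable_sum hi)
    show "integrable ?M (\<lambda>t. (h t)\<^sup>2)" by (rule L2_spaceD(2)[OF h])
  qed
  also have "\<dots> = (L2_norm_of ?M h)\<^sup>2" by (simp add: L2_norm_of_power2)
  finally show ?thesis by (rule power2_le_imp_le) simp
qed

text \<open>A predicate, so that its closure under linear combinations and \<open>L2\<close> limits
  can be used in a monotone class argument.\<close>

definition grid_approx :: "real \<Rightarrow> (real \<Rightarrow> real) \<Rightarrow> bool" where
  "grid_approx T h \<longleftrightarrow> L2_tendsto (time_measure T) (\<lambda>N. grid_step T N h) h"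

lemma grid_approx_add:
  assumes "grid_approx T f" "grid_approx T h"
  shows "grid_approx T (\<lambda>t. f t + h t)"
proof -
  have "f \<in> L2_space (time_measure T)" "h \<in> L2_space (time_measure T)"
    using assms unfolding grid_approx_def by (auto dest: L2_tendstoD(2))
  then have "grid_step T N (\<lambda>t. f t + h t) = (\<lambda>t. grid_step T N f t + grid_step T N h t)" for N
    by (intro ext grid_step_add)
  then show ?thesis
    using L2_tendsto_add[OF assms[unfolded grid_approx_def]] by (simp add: grid_approx_def)
qed

lemma grid_approx_cmult:
  assumes "grid_approx T f"
  shows "grid_approx T (\<lambda>t. c * f t)"
proof -
  have "grid_step T N (\<lambda>t. c * f t) = (\<lambda>t. c * grid_step T N f t)" for N
    by (intro ext grid_step_cmult)
  then show ?thesis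
    using L2_tendsto_cmult[OF assms[unfolded grid_approx_def], of c] by (simp add: grid_approx_def)
qed

lemma grid_approx_zero: "grid_approx T (\<lambda>t. 0)"
proof -
  have "grid_step T N (\<lambda>t. 0) = (\<lambda>t. 0)" for N
    by (simp add: grid_step_def[abs_def] grid_avg_def)
  then show ?thesis by (simp add: grid_approx_def L2_tendsto_const L2_space_zero)
qed

lemma grid_approx_sum:
  assumes "\<And>i. i \<in> I \<Longrightarrow> grid_approx T (f i)"
  shows "grid_approx T (\<lambda>t. \<Sum>i\<in>I. f i t)"
  using assms
  by (induction I rule: infinite_finite_induct) (auto simp: grid_approx_zero intro!: grid_approx_add)

text \<open>A three term estimate in which the projections are contractions: the distance between
  the projections of \<open>h\<close> and of \<open>f k\<close> is at most that of the
  functions.\<close>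

lemma grid_approx_limit:
  assumes T: "0 < T" and a: "\<And>k. grid_approx T (f k)" and l: "L2_tendsto (time_measure T) f h"
  shows "grid_approx T h"
proof -
  let ?M = "time_measure T"
  note f = L2_tendstoD[OF a[unfolded grid_approx_def]] and ll = L2_tendstoD[OF l]
  have "(\<lambda>N. L2_norm_of ?M (\<lambda>t. grid_step T N h t - h t)) \<longlonglongrightarrow> 0"
  proof (rule LIMSEQ_I)
    fix e :: real assume e: "e > 0"
    obtain k where k: "L2_norm_of ?M (\<lambda>t. f k t - h t) < e / 4"
      using LIMSEQ_D[OF ll(3), of "e/4"] e by auto
    obtain K where K: "\<And>N. N \<ge> K \<Longrightarrow> L2_norm_of ?M (\<lambda>t. grid_step T N (f k) t - f k t) < e / 4"
      using LIMSEQ_D[OF f(3)[of k], of "e/4"] e by auto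
    have "norm (L2_norm_of ?M (\<lambda>t. grid_step T N h t - h t) - 0) < e" if "N \<ge> K" for N
    proof -
      have "L2_norm_of ?M (\<lambda>t. grid_step T N h t - h t)
        \<le> L2_norm_of ?M (\<lambda>t. grid_step T N h t - grid_step T N (f k) t)
          + L2_norm_of ?M (\<lambda>t. grid_step T N (f k) t - h t)"
        by (intro L2_norm_of_triangle3 grid_step_L2 ll(2))
      also have "L2_norm_of ?M (\<lambda>t. grid_step T N (f k) t - h t)
        \<le> L2_norm_of ?M (\<lambda>t. grid_step T N (f k) t - f k t) + L2_norm_of ?M (\<lambda>t. f k t - h t)"
        by (intro L2_norm_of_triangle3 grid_step_L2 ll(1,2))
      also have "L2_norm_of ?M (\<lambda>t. grid_step T N h t - grid_step T N (f k) t)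
        = L2_norm_of ?M (grid_step T N (\<lambda>t. h t - f k t))"
      proof -
        have "grid_step T N (\<lambda>t. h t - f k t) = (\<lambda>t. grid_step T N h t - grid_step T N (f k) t)"
          by (intro ext grid_step_diff ll)
        then show ?thesis by simp
      qed
      also have "\<dots> \<le> L2_norm_of ?M (\<lambda>t. h t - f k t)"
        by (intro grid_step_norm_le T L2_space_diff ll(1,2))
      also have "\<dots> = L2_norm_of ?M (\<lambda>t. f k t - h t)" by (rule L2_norm_of_minus_commute)
      finally have "L2_norm_of ?M (\<lambda>t. grid_step T N h t - h t) < e" using k K[OF that] e by linarith
      then show ?thesis by simp
    qed
    then show "\<exists>no. \<forall>n\<ge>no. norm (L2_norm_of ?M (\<lambda>t. grid_step T n h t - h t) - 0) < e" by blast
  qed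
  then show ?thesis using grid_step_L2 ll(2) by (simp add: grid_approx_def L2_tendsto_def)
qed

text \<open>The average is exact on every cell that does not contain \<open>x\<close> in its
  interior; on the remaining cell the error is at most 1.\<close>

lemma grid_approx_atMost:
  assumes T: "0 < T"
  shows "grid_approx T (indicator {..x})"
proof -
  let ?M = "time_measure T" and ?h = "indicator {..x} :: real \<Rightarrow> real"
  have hL: "?h \<in> L2_space ?M" by (rule indicator_L2_time) simp
  have b: "L2_norm_of ?M (\<lambda>t. grid_step T N ?h t - ?h t) \<le> sqrt (2 * T / N)" if N: "N > 0" for N
  proof -
    \<comment> \<open>The cell containing \<open>x\<close> lies within distance \<open>T / N\<close>
      of \<open>x\<close>, so the squared error is supported in this interval of length
      \<open>2 * T / N\<close>.\<close>
    let ?J = "{x - T / N<..x + T / N}"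
    have avg01: "0 \<le> grid_avg T N ?h l \<and> grid_avg T N ?h l \<le> 1" if l: "l < N" for l
    proof -
      have i: "integrable ?M (indicator A :: real \<Rightarrow> real)" if "A \<in> sets borel" for A
        by (rule time.L2_space_integrable[OF indicator_L2_time[OF that]])
      have eq: "(\<lambda>t. indicator (cell T N l) t * ?h t) = (indicator (cell T N l \<inter> {..x}) :: real \<Rightarrow> real)"
        by (auto split: split_indicator)
      have "(\<integral>t. indicator (cell T N l \<inter> {..x}) t \<partial>?M) \<le> (\<integral>t. indicator (cell T N l) t \<partial>?M :: real)"
        by (intro integral_mono i) (auto split: split_indicator)
      also have "\<dots> = T / N"
        using time_measure_interval[of "grid T N l" "grid T N (Suc l)" T] l T N
          grid_nonneg[of T N l] grid_mono[of T l "Suc l" N] grid_le[of T "Suc l" N] by (simp add: grid_Suc)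
      finally have le: "(\<integral>t. indicator (cell T N l \<inter> {..x}) t \<partial>?M) \<le> T / N" .
      have "real N / T * (\<integral>t. indicator (cell T N l \<inter> {..x}) t \<partial>?M) \<le> real N / T * (T / N)"
        using T by (intro mult_left_mono le) auto
      moreover have "0 \<le> (\<integral>t. indicator (cell T N l \<inter> {..x}) t \<partial>?M :: real)" by (rule Bochner_Integration.integral_nonneg) auto
      ultimately show ?thesis unfolding grid_avg_def eq using T N by auto
    qed
    have pt: "(grid_step T N ?h t - ?h t)\<^sup>2 \<le> indicator ?J t" if t: "0 < t" "t \<le> T" for t
    proof -
      obtain l where l: "l < N" "t \<in> cell T N l" using cell_cover[OF T t N] by blast
      have st: "grid_step T N ?h t = grid_avg T N ?h l" using grid_step_cell[OF _ l] T by simp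
      consider "grid T N (Suc l) \<le> x" | "x \<le> grid T N l" | "grid T N l < x" "x < grid T N (Suc l)" by linarith
      then show ?thesis
      proof cases
        case 1
        have "(\<lambda>t. indicator (cell T N l) t * ?h t) = (indicator (cell T N l) :: real \<Rightarrow> real)"
          using 1 by (auto split: split_indicator)
        then have "grid_avg T N ?h l = real N / T * (T / N)"
          unfolding grid_avg_def
          using time_measure_interval[of "grid T N l" "grid T N (Suc l)" T] l T N
            grid_nonneg[of T N l] grid_mono[of T l "Suc l" N] grid_le[of T "Suc l" N] by (simp add: grid_Suc)
        then show ?thesis using T N st 1 l by (auto split: split_indicator)
      next
        case 2
        have "(\<lambda>t. indicator (cell T N l) t * ?h t) = (\<lambda>t. 0)"
          using 2 by (auto split: split_indicator)
        then have "grid_avg T N ?h l = 0" unfolding grid_avg_def by simp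
        then show ?thesis using st 2 l by (auto split: split_indicator)
      next
        case 3
        have J: "t \<in> ?J" using 3 l grid_Suc[of T N l] by auto
        have "\<bar>grid_step T N ?h t - ?h t\<bar> \<le> 1" using avg01[OF l(1)] st by (auto split: split_indicator)
        then have "(grid_step T N ?h t - ?h t)\<^sup>2 \<le> 1" by (simp add: abs_square_le_1)
        then show ?thesis using J by simp
      qed
    qed
    have "(\<integral>t. (grid_step T N ?h t - ?h t)\<^sup>2 \<partial>?M) \<le> (\<integral>t. indicator ?J t \<partial>?M)"
    proof (rule integral_mono_AE)
      show "integrable ?M (\<lambda>t. (grid_step T N ?h t - ?h t)\<^sup>2)"
        by (intro L2_spaceD(2) L2_space_diff grid_step_L2 hL)
      show "integrable ?M (indicator ?J :: real \<Rightarrow> real)"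
        by (rule time.L2_space_integrable[OF indicator_L2_time]) simp
      have "AE t in ?M. t \<in> {0..T}" by (rule AE_I2) (simp add: space_restrict_space)
      with AE_time_measure_neq[where c=0 and T=T]
      show "AE t in ?M. (grid_step T N ?h t - ?h t)\<^sup>2 \<le> indicator ?J t"
        by eventually_elim (use pt in auto)
    qed
    also have "\<dots> = (\<integral>t. indicator {0..T} t * indicator ?J t \<partial>lborel)" by (rule time_measure_integral)
    also have "\<dots> \<le> (\<integral>t. indicator ?J t \<partial>lborel)"
    proof (rule integral_mono)
      have "(\<lambda>t. indicator {0..T} t * indicator ?J t) = (indicator ({0..T} \<inter> ?J) :: real \<Rightarrow> real)"
        by (auto split: split_indicator)
      then show "integrable lborel (\<lambda>t. indicator {0..T} t * indicator ?J t :: real)"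
        by (auto intro!: integrable_real_indicator emeasure_bounded_finite bounded_Int)
    qed (auto split: split_indicator intro!: integrable_real_indicator emeasure_bounded_finite)
    also have "\<dots> = 2 * T / N" using T N by simp
    finally show ?thesis unfolding L2_norm_of_def by (rule real_sqrt_le_mono)
  qed
  have "(\<lambda>N. L2_norm_of ?M (\<lambda>t. grid_step T N ?h t - ?h t)) \<longlonglongrightarrow> 0"
  proof (rule Lim_null_comparison)
    show "\<forall>\<^sub>F N in sequentially. norm (L2_norm_of ?M (\<lambda>t. grid_step T N ?h t - ?h t)) \<le> sqrt (2 * T / N)"
      using eventually_gt_at_top[of 0] by eventually_elim (use b in simp)
    have "(\<lambda>N. sqrt (2 * T / real N)) \<longlonglongrightarrow> sqrt 0"
      by (intro tendsto_real_sqrt lim_const_over_n)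
    then show "(\<lambda>N. sqrt (2 * T / real N)) \<longlonglongrightarrow> 0" by simp
  qed
  then show ?thesis using grid_step_L2 hL by (simp add: grid_approx_def L2_tendsto_def)
qed

lemma L2_tendsto_dominated:
  assumes f: "\<And>k. f k \<in> borel_measurable N" and h: "h \<in> borel_measurable N"
    and w: "w \<in> L2_space N" and b: "\<And>k x. x \<in> space N \<Longrightarrow> \<bar>f k x\<bar> \<le> \<bar>w x\<bar>" "\<And>x. x \<in> space N \<Longrightarrow> \<bar>h x\<bar> \<le> \<bar>w x\<bar>"
    and lim: "\<And>x. x \<in> space N \<Longrightarrow> (\<lambda>k. f k x) \<longlonglongrightarrow> h x"
  shows "L2_tendsto N f h"
proof -
  note [measurable] = f h L2_spaceD(1)[OF w]
  have L: "g \<in> L2_space N" if "g \<in> borel_measurable N" "\<And>x. x \<in> space N \<Longrightarrow> \<bar>g x\<bar> \<le> \<bar>w x\<bar>" for g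
  proof -
    have "integrable N (\<lambda>x. (g x)\<^sup>2)"
      by (rule Bochner_Integration.integrable_bound[OF L2_spaceD(2)[OF w]])
        (use that in \<open>auto simp: abs_le_square_iff\<close>)
    then show ?thesis using that by (simp add: L2_space_def)
  qed
  have "(\<lambda>k. \<integral>x. (f k x - h x)\<^sup>2 \<partial>N) \<longlonglongrightarrow> (\<integral>x. 0 \<partial>N)"
  proof (rule integral_dominated_convergence[where w="\<lambda>x. 4 * (w x)\<^sup>2"])
    show "integrable N (\<lambda>x. 4 * (w x)\<^sup>2)" using L2_spaceD(2)[OF w] by simp
    show "AE x in N. (\<lambda>k. (f k x - h x)\<^sup>2) \<longlonglongrightarrow> 0"
    proof (rule AE_I2)
      fix x assume "x \<in> space N"
      then have "(\<lambda>k. (f k x - h x)\<^sup>2) \<longlonglongrightarrow> (h x - h x)\<^sup>2" by (intro tendsto_intros lim)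
      then show "(\<lambda>k. (f k x - h x)\<^sup>2) \<longlonglongrightarrow> 0" by simp
    qed
    show "AE x in N. norm ((f k x - h x)\<^sup>2) \<le> 4 * (w x)\<^sup>2" for k
    proof (rule AE_I2)
      fix x assume "x \<in> space N"
      then have "\<bar>f k x - h x\<bar> \<le> \<bar>2 * w x\<bar>" using b(1)[of x k] b(2)[of x] by (simp add: abs_mult)
      then have "(f k x - h x)\<^sup>2 \<le> (2 * w x)\<^sup>2" by (simp only: abs_le_square_iff)
      then show "norm ((f k x - h x)\<^sup>2) \<le> 4 * (w x)\<^sup>2" by (simp add: power_mult_distrib)
    qed
  qed auto
  then have "(\<lambda>k. sqrt (\<integral>x. (f k x - h x)\<^sup>2 \<partial>N)) \<longlonglongrightarrow> sqrt 0"
    by (intro tendsto_real_sqrt) simp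
  then show ?thesis using L f h b by (auto simp: L2_tendsto_def L2_norm_of_def)
qed

text \<open>Dynkin's lemma with the half-lines as generator: complements need that constants are
  approximated, countable disjoint unions that the class is closed under limits.\<close>

lemma grid_approx_indicator:
  assumes T: "0 < T" and B: "B \<in> sets borel"
  shows "grid_approx T (indicator B)"
proof -
  have gen: "sets borel = sigma_sets UNIV (range (atMost :: real \<Rightarrow> real set))"
    unfolding borel_eq_atMost by simp
  have "Int_stable (range (atMost :: real \<Rightarrow> real set))"
    by (auto simp: Int_stable_def)
  moreover have "range (atMost :: real \<Rightarrow> real set) \<subseteq> Pow UNIV" by simp
  moreover have "B \<in> sigma_sets UNIV (range (atMost :: real \<Rightarrow> real set))" using B gen by simp
  ultimately show ?thesis
  proof (induction rule: sigma_sets_induct_disjoint)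
    case (basic A)
    then show ?case using grid_approx_atMost[OF T] by auto
  next
    case empty
    then show ?case using grid_approx_zero by simp
  next
    case (compl A)
    have "grid_approx T (\<lambda>t. 1)"
    proof -
      have "L2_tendsto (time_measure T) (\<lambda>k. indicator {..real k}) (\<lambda>t. 1)"
      proof (rule L2_tendsto_dominated[where w="\<lambda>_. 1"])
        fix t :: real assume "t \<in> space (time_measure T)"
        obtain K where K: "t \<le> real K" using real_arch_simple by blast
        have "\<forall>\<^sub>F k in sequentially. indicator {..real k} t = (1::real)"
          using eventually_ge_at_top[of K] by eventually_elim (use K in auto)
        then show "(\<lambda>k. indicator {..real k} t :: real) \<longlonglongrightarrow> 1" by (rule tendsto_eventually)
      qed (auto simp: measurable_restrict_space1 L2_space_def split: split_indicator)
      from grid_approx_limit[OF T grid_approx_atMost[OF T] this] show ?thesis .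
    qed
    from grid_approx_add[OF this grid_approx_cmult[OF compl(2), of "-1"]]
    have "grid_approx T (\<lambda>t. 1 + -1 * indicator A t)" .
    also have "(\<lambda>t. 1 + -1 * indicator A t) = (indicator (UNIV - A) :: real \<Rightarrow> real)"
      by (auto split: split_indicator)
    finally show ?case .
  next
    case (union A)
    have A: "A i \<in> sets borel" for i using union(2) gen by auto
    have dis: "(\<Sum>i<k. indicator (A i) t) = (indicator (\<Union>i<k. A i) t :: real)" for k t
      using union(1) by (subst indicator_UN_disjoint) (auto simp: disjoint_family_on_def)
    have "L2_tendsto (time_measure T) (\<lambda>k t. \<Sum>i<k. indicator (A i) t) (indicator (\<Union>i. A i))"
    proof (rule L2_tendsto_dominated[where w="\<lambda>_. 1"])
      show "(\<lambda>t. \<Sum>i<k. indicator (A i) t :: real) \<in> borel_measurable (time_measure T)" for k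
        using A by (intro measurable_restrict_space1 borel_measurable_sum) auto
      show "(indicator (\<Union>i. A i) :: real \<Rightarrow> real) \<in> borel_measurable (time_measure T)"
        using A by (intro measurable_restrict_space1) auto
      show "(\<lambda>k. \<Sum>i<k. indicator (A i) t) \<longlonglongrightarrow> (indicator (\<Union>i. A i) t :: real)" for t
        unfolding dis by (rule LIMSEQ_indicator_UN)
    qed (auto simp: dis L2_space_def split: split_indicator)
    then show ?case by (rule grid_approx_limit[OF T grid_approx_sum[OF union(3)]])
  qed
qed

theorem grid_approx_L2:
  assumes T: "0 < T" and h: "h \<in> L2_space (time_measure T)"
  shows "grid_approx T h"
proof -
  let ?M = "time_measure T"
  have [measurable]: "h \<in> borel_measurable ?M" using L2_spaceD(1)[OF h] .
  obtain f where f': "\<forall>i. simple_function ?M (f i)" "\<forall>x\<in>space ?M. (\<lambda>i. f i x) \<longlonglongrightarrow> h x"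
    "\<forall>i. \<forall>x\<in>space ?M. dist (f i x) 0 \<le> 2 * dist (h x) 0"
    using borel_measurable_implies_sequence_metric[of h ?M 0] \<open>h \<in> borel_measurable ?M\<close> by blast
  have f: "simple_function ?M (f i)" "x \<in> space ?M \<Longrightarrow> (\<lambda>i. f i x) \<longlonglongrightarrow> h x"
    "x \<in> space ?M \<Longrightarrow> dist (f i x) 0 \<le> 2 * dist (h x) 0" for i x
    using f' by blast+
  have lim: "L2_tendsto ?M f h"
  proof (rule L2_tendsto_dominated[where w="\<lambda>x. 2 * h x"])
    show "f k \<in> borel_measurable ?M" for k using f(1) by (rule borel_measurable_simple_function)
    show "\<bar>f k x\<bar> \<le> \<bar>2 * h x\<bar>" if "x \<in> space ?M" for k x using f(3)[OF that, of k] by (simp add: abs_mult)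
  qed (use f h in \<open>auto simp: abs_mult intro: L2_space_cmult\<close>)
  have "grid_approx T (f k)" for k
  proof -
    \<comment> \<open>\<open>f k\<close> is known only on the interval from 0 to \<open>T\<close>.
      Its canonical form \<open>?g\<close> agrees with it there, and the cell averages see nothing
      else.\<close>
    let ?g = "\<lambda>t. \<Sum>y\<in>f k ` space ?M. y * indicator (f k -` {y} \<inter> space ?M) t"
    have fin: "finite (f k ` space ?M)" using f(1) by (auto simp: simple_function_def)
    have "f k -` {y} \<inter> space ?M \<in> sets borel" for y
    proof -
      have m: "f k \<in> borel_measurable ?M" using f(1) by (rule borel_measurable_simple_function)
      have "f k -` {y} \<inter> space ?M \<in> sets ?M" by (rule measurable_sets[OF m]) simp
      then show ?thesis by (subst (asm) sets_restrict_space_iff) auto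
    qed
    then have g: "grid_approx T ?g"
      by (intro grid_approx_sum grid_approx_cmult grid_approx_indicator T)
    have eq: "f k t = ?g t" if "t \<in> space ?M" for t
    proof -
      have "?g t = (\<Sum>y\<in>f k ` space ?M. if y = f k t then y else 0)"
        using that by (intro sum.cong) (auto split: split_indicator)
      then show ?thesis using fin that by simp
    qed
    have avg: "grid_avg T N (f k) l = grid_avg T N ?g l" for N l
      unfolding grid_avg_def
      by (intro arg_cong2[where f=times] refl Bochner_Integration.integral_cong) (simp only: eq)
    have "grid_step T N (f k) = grid_step T N ?g" for N
      unfolding grid_step_def[abs_def] avg ..
    moreover have "L2_tendsto ?M (\<lambda>N. grid_step T N ?g) (f k)"
    proof (rule L2_tendsto_cong_AE[OF g[unfolded grid_approx_def]])
      show "AE t in ?M. ?g t = f k t" by (intro AE_I2) (rule eq[symmetric])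
      show "f k \<in> borel_measurable ?M" using f(1) by (rule borel_measurable_simple_function)
    qed (auto simp: measurable_restrict_space1)
    ultimately show ?thesis by (simp add: grid_approx_def)
  qed
  from grid_approx_limit[OF T this lim] show ?thesis .
qed

section \<open>Gaussian variables independent of a sub-sigma-algebra\<close>

lemma Int_stable_vimage: "Int_stable {X -` A \<inter> S |A. A \<in> sets N}"
proof (rule Int_stableI)
  fix x y assume "x \<in> {X -` A \<inter> S |A. A \<in> sets N}" "y \<in> {X -` A \<inter> S |A. A \<in> sets N}"
  then obtain A B where "A \<in> sets N" "B \<in> sets N" "x = X -` A \<inter> S" "y = X -` B \<inter> S" by auto
  then have "A \<inter> B \<in> sets N" "x \<inter> y = X -` (A \<inter> B) \<inter> S" by auto
  then show "x \<inter> y \<in> {X -` A \<inter> S |A. A \<in> sets N}" by blast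
qed

text \<open>\<open>V\<close> is independent of \<open>G\<close> and centred Gaussian with standard
  deviation \<sigma>. The law is the image of \<open>std_gauss\<close> under scaling instead of a
  density, which includes the degenerate case \<open>\<sigma> = 0\<close>.\<close>

definition gauss_indep :: "'a measure \<Rightarrow> 'a measure \<Rightarrow> ('a \<Rightarrow> real) \<Rightarrow> real \<Rightarrow> bool" where
  "gauss_indep M G V \<sigma> \<longleftrightarrow> V \<in> borel_measurable M \<and> (\<forall>A\<in>sets G. \<forall>B\<in>sets borel.
     measure M (A \<inter> (V -` B \<inter> space M)) = measure M A * measure std_gauss ((\<lambda>z. \<sigma> * z) -` B))"

abbreviation gauss_law :: "real \<Rightarrow> real measure" where
  "gauss_law \<sigma> \<equiv> distr std_gauss borel (\<lambda>z. \<sigma> * z)"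

lemma prob_space_gauss_law: "prob_space (gauss_law \<sigma>)"
  by (rule std_gauss.prob_space_distr) simp

lemma measure_gauss_law: "B \<in> sets borel \<Longrightarrow> measure (gauss_law \<sigma>) B = measure std_gauss ((\<lambda>z. \<sigma> * z) -` B)"
  by (subst measure_distr) auto

lemma char_gauss_law: "char (gauss_law \<sigma>) u = complex_of_real (exp (- ((u * \<sigma>)\<^sup>2) / 2))"
proof -
  have "char (gauss_law \<sigma>) u = char std_gauss (u * \<sigma>)"
    unfolding char_def by (subst integral_distr) (auto simp: mult.assoc)
  also have "\<dots> = complex_of_real (exp (- ((u * \<sigma>)\<^sup>2) / 2))"
    unfolding std_gauss_def char_std_normal_distribution ..
  finally show ?thesis .
qed

context prob_space
begin

lemma gauss_indep_law:
  assumes G: "subalgebra M G" and V: "gauss_indep M G V \<sigma>"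
  shows "distr M borel V = gauss_law \<sigma>"
proof (rule measure_eqI)
  fix B assume "B \<in> sets (distr M borel V)"
  then have B: "B \<in> sets borel" by simp
  have [measurable]: "V \<in> borel_measurable M" using V by (simp add: gauss_indep_def)
  have "space M \<in> sets G" using G by (metis sets.top subalgebra_def)
  then have "prob (space M \<inter> (V -` B \<inter> space M)) = prob (space M) * measure std_gauss ((\<lambda>z. \<sigma> * z) -` B)"
    using V B by (auto simp: gauss_indep_def)
  then have "measure (distr M borel V) B = measure (gauss_law \<sigma>) B"
    using B by (simp add: measure_distr prob_space Int_absorb1 measure_gauss_law)
  moreover interpret D: prob_space "distr M borel V" by (rule prob_space_distr) simp
  interpret L: prob_space "gauss_law \<sigma>" by (rule prob_space_gauss_law)
  show "emeasure (distr M borel V) B = emeasure (gauss_law \<sigma>) B"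
    using calculation by (simp add: D.emeasure_eq_measure L.emeasure_eq_measure)
qed simp

text \<open>The first component is the sample point itself, seen through \<open>G\<close>; in this
  way every \<open>G\<close>-measurable dependence on the sample point is covered by one product
  measure.\<close>

lemma gauss_indep_pair:
  assumes G: "subalgebra M G" and V: "gauss_indep M G V \<sigma>"
  shows "distr M (G \<Otimes>\<^sub>M borel) (\<lambda>w. (w, V w)) = distr M G (\<lambda>w. w) \<Otimes>\<^sub>M gauss_law \<sigma>"
proof -
  have [measurable]: "V \<in> borel_measurable M" using V by (simp add: gauss_indep_def)
  have sp: "space G = space M" and sb: "sets G \<subseteq> sets M" using G by (auto simp: subalgebra_def)
  have idm: "(\<lambda>w. w) \<in> measurable M G"
    by (rule measurableI) (use sp sb sets.sets_into_space in auto)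
  interpret P: prob_space "distr M G (\<lambda>w. w)" by (rule prob_space_distr[OF idm])
  interpret L: prob_space "gauss_law \<sigma>" by (rule prob_space_gauss_law)
  have pm: "(\<lambda>w. (w, V w)) \<in> measurable M (G \<Otimes>\<^sub>M borel)"
    using idm by measurable
  have "distr M G (\<lambda>w. w) \<Otimes>\<^sub>M gauss_law \<sigma> = distr M (G \<Otimes>\<^sub>M borel) (\<lambda>w. (w, V w))"
  proof (rule pair_measure_eqI)
    show "sigma_finite_measure (distr M G (\<lambda>w. w))" "sigma_finite_measure (gauss_law \<sigma>)" by unfold_locales
    show "sets (distr M G (\<lambda>w. w) \<Otimes>\<^sub>M gauss_law \<sigma>) = sets (distr M (G \<Otimes>\<^sub>M borel) (\<lambda>w. (w, V w)))"
      by (simp cong: sets_pair_measure_cong)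
    fix A B assume "A \<in> sets (distr M G (\<lambda>w. w))" "B \<in> sets (gauss_law \<sigma>)"
    then have A: "A \<in> sets G" and B: "B \<in> sets borel" by auto
    have AM: "A \<in> events" using A sb by auto
    have "emeasure (distr M G (\<lambda>w. w)) A = ennreal (prob A)"
      using A AM sets.sets_into_space[OF AM]
      by (subst emeasure_distr[OF idm A]) (simp add: Int_absorb2 emeasure_eq_measure)
    moreover have "emeasure (gauss_law \<sigma>) B = ennreal (measure std_gauss ((\<lambda>z. \<sigma> * z) -` B))"
      unfolding L.emeasure_eq_measure measure_gauss_law[OF B] ..
    moreover have "emeasure (distr M (G \<Otimes>\<^sub>M borel) (\<lambda>w. (w, V w))) (A \<times> B) = ennreal (prob (A \<inter> (V -` B \<inter> space M)))"
    proof -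
      have "(\<lambda>w. (w, V w)) -` (A \<times> B) \<inter> space M = A \<inter> (V -` B \<inter> space M)" by auto
      then show ?thesis using A B
        by (subst emeasure_distr[OF pm]) (auto simp: emeasure_eq_measure)
    qed
    moreover have "prob (A \<inter> (V -` B \<inter> space M)) = prob A * measure std_gauss ((\<lambda>z. \<sigma> * z) -` B)"
      using V A B by (auto simp: gauss_indep_def)
    ultimately show "emeasure (distr M G (\<lambda>w. w)) A * emeasure (gauss_law \<sigma>) B
        = emeasure (distr M (G \<Otimes>\<^sub>M borel) (\<lambda>w. (w, V w))) (A \<times> B)"
      by (simp add: ennreal_mult)
  qed
  then show ?thesis by simp
qed

text \<open>The freezing argument: what is known to \<open>G\<close> is kept fixed, and the
  independent variable is integrated out against its law.\<close>

lemma gauss_indep_Fubini: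
  fixes \<Phi> :: "'a \<times> real \<Rightarrow> 'b :: {banach, second_countable_topology}"
  assumes G: "subalgebra M G" and V: "gauss_indep M G V \<sigma>"
    and \<Phi>: "\<Phi> \<in> borel_measurable (G \<Otimes>\<^sub>M borel)" and i: "integrable M (\<lambda>w. \<Phi> (w, V w))"
  shows "(\<integral>w. \<Phi> (w, V w) \<partial>M) = (\<integral>w. (\<integral>z. \<Phi> (w, \<sigma> * z) \<partial>std_gauss) \<partial>M)"
    and "integrable M (\<lambda>w. \<integral>z. \<Phi> (w, \<sigma> * z) \<partial>std_gauss)"
    and "(\<lambda>w. \<integral>z. \<Phi> (w, \<sigma> * z) \<partial>std_gauss) \<in> borel_measurable G"
proof -
  have [measurable]: "V \<in> borel_measurable M" using V by (simp add: gauss_indep_def)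
  have sp: "space G = space M" and sb: "sets G \<subseteq> sets M" using G by (auto simp: subalgebra_def)
  have idm[measurable]: "(\<lambda>w. w) \<in> measurable M G"
    by (rule measurableI) (use sp sb sets.sets_into_space in auto)
  let ?P = "distr M G (\<lambda>w. w)"
  interpret P: prob_space ?P by (rule prob_space_distr) simp
  interpret L: prob_space "gauss_law \<sigma>" by (rule prob_space_gauss_law)
  interpret PL: pair_sigma_finite ?P "gauss_law \<sigma>" ..
  note [measurable] = \<Phi>
  have pm: "(\<lambda>w. (w, V w)) \<in> measurable M (G \<Otimes>\<^sub>M borel)" by measurable
  have ip: "integrable (?P \<Otimes>\<^sub>M gauss_law \<sigma>) \<Phi>"
    unfolding gauss_indep_pair[OF G V, symmetric] by (subst integrable_distr_eq[OF pm]) (use i in auto)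
  have inner: "(\<integral>y. \<Phi> (w, y) \<partial>gauss_law \<sigma>) = (\<integral>z. \<Phi> (w, \<sigma> * z) \<partial>std_gauss)" if "w \<in> space M" for w
    by (rule integral_distr) (use that sp in auto)
  have m: "(\<lambda>w. \<integral>z. \<Phi> (w, \<sigma> * z) \<partial>std_gauss) \<in> borel_measurable G"
    by (rule std_gauss.borel_measurable_lebesgue_integral) measurable
  then show "(\<lambda>w. \<integral>z. \<Phi> (w, \<sigma> * z) \<partial>std_gauss) \<in> borel_measurable G" .
  have "integrable ?P (\<lambda>w. \<integral>y. \<Phi> (w, y) \<partial>gauss_law \<sigma>)"
    using PL.integrable_fst'[OF ip] .
  then have "integrable ?P (\<lambda>w. \<integral>z. \<Phi> (w, \<sigma> * z) \<partial>std_gauss)"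
    by (rule Bochner_Integration.integrable_cong[OF refl, THEN iffD1, rotated]) (use inner sp in auto)
  then show "integrable M (\<lambda>w. \<integral>z. \<Phi> (w, \<sigma> * z) \<partial>std_gauss)"
    by (subst (asm) integrable_distr_eq[OF idm m])
  have "(\<integral>w. \<Phi> (w, V w) \<partial>M) = (\<integral>x. \<Phi> x \<partial>(?P \<Otimes>\<^sub>M gauss_law \<sigma>))"
    unfolding gauss_indep_pair[OF G V, symmetric] by (subst integral_distr[OF pm]) auto
  also have "\<dots> = (\<integral>w. (\<integral>y. \<Phi> (w, y) \<partial>gauss_law \<sigma>) \<partial>?P)"
    using PL.integral_fst'[OF ip] by simp
  also have "\<dots> = (\<integral>w. (\<integral>z. \<Phi> (w, \<sigma> * z) \<partial>std_gauss) \<partial>?P)"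
    by (rule Bochner_Integration.integral_cong) (use inner sp in auto)
  also have "\<dots> = (\<integral>w. (\<integral>z. \<Phi> (w, \<sigma> * z) \<partial>std_gauss) \<partial>M)"
    by (rule integral_distr[OF idm m])
  finally show "(\<integral>w. \<Phi> (w, V w) \<partial>M) = (\<integral>w. (\<integral>z. \<Phi> (w, \<sigma> * z) \<partial>std_gauss) \<partial>M)" .
qed

lemma gauss_indep_integral:
  fixes f :: "real \<Rightarrow> real"
  assumes G: "subalgebra M G" and V: "gauss_indep M G V \<sigma>" and f: "f \<in> borel_measurable borel"
  shows "(\<integral>w. f (V w) \<partial>M) = (\<integral>z. f (\<sigma> * z) \<partial>std_gauss)"
    and "integrable M (\<lambda>w. f (V w)) \<longleftrightarrow> integrable std_gauss (\<lambda>z. f (\<sigma> * z))"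
proof -
  have [measurable]: "V \<in> borel_measurable M" using V by (simp add: gauss_indep_def)
  note [measurable] = f
  have "(\<integral>w. f (V w) \<partial>M) = (\<integral>x. f x \<partial>distr M borel V)" by (subst integral_distr) auto
  also have "\<dots> = (\<integral>z. f (\<sigma> * z) \<partial>std_gauss)" unfolding gauss_indep_law[OF G V] by (subst integral_distr) auto
  finally show "(\<integral>w. f (V w) \<partial>M) = (\<integral>z. f (\<sigma> * z) \<partial>std_gauss)" .
  have "integrable M (\<lambda>w. f (V w)) \<longleftrightarrow> integrable (distr M borel V) f"
    by (subst integrable_distr_eq) auto
  also have "\<dots> \<longleftrightarrow> integrable std_gauss (\<lambda>z. f (\<sigma> * z))"
    unfolding gauss_indep_law[OF G V] by (subst integrable_distr_eq) auto
  finally show "integrable M (\<lambda>w. f (V w)) \<longleftrightarrow> integrable std_gauss (\<lambda>z. f (\<sigma> * z))" .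
qed

text \<open>For an event \<open>A\<close> of positive probability, the hypothesis says that under
  the conditional measure given \<open>A\<close> the characteristic function of \<open>V\<close> is
  Gaussian; uniqueness then gives the law of \<open>V\<close> on \<open>A\<close>.\<close>

lemma gauss_indepI_char:
  assumes G: "subalgebra M G" and V[measurable]: "V \<in> borel_measurable M"
    and c: "\<And>A u. A \<in> sets G \<Longrightarrow> (\<integral>w. indicator A w *\<^sub>R iexp (u * V w) \<partial>M) = complex_of_real (prob A * exp (- ((u * \<sigma>)\<^sup>2) / 2))"
  shows "gauss_indep M G V \<sigma>"
  unfolding gauss_indep_def
proof (intro conjI V ballI)
  fix A and B :: "real set" assume A: "A \<in> sets G" and B: "B \<in> sets borel"
  have AM[measurable]: "A \<in> events" using A G by (auto simp: subalgebra_def)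
  show "prob (A \<inter> (V -` B \<inter> space M)) = prob A * measure std_gauss ((\<lambda>z. \<sigma> * z) -` B)"
  proof (cases "prob A = 0")
    case True
    have "prob (A \<inter> (V -` B \<inter> space M)) \<le> prob A" by (rule finite_measure_mono) auto
    then show ?thesis using True by (simp add: measure_le_0_iff)
  next
    case False
    then have p: "prob A > 0" by (simp add: zero_less_measure_iff)
    define D where "D = density M (\<lambda>w. ennreal (indicator A w / prob A))"
    interpret D: prob_space D
    proof
      have "emeasure D (space D) = (\<integral>\<^sup>+w. ennreal (indicator A w / prob A) \<partial>M)"
        unfolding D_def by (simp add: emeasure_density)
      also have "\<dots> = ennreal (\<integral>w. indicator A w / prob A \<partial>M)"
        by (rule nn_integral_eq_integral[OF integrable_divide_zero]) (auto simp: emeasure_eq_measure)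
      also have "\<dots> = 1" using p by simp
      finally show "emeasure D (space D) = 1" .
    qed
    have Vd[measurable]: "V \<in> borel_measurable D" unfolding D_def by simp
    have "distr D borel V = gauss_law \<sigma>"
    proof (rule Levy_uniqueness)
      show "real_distribution (distr D borel V)" by (rule D.real_distribution_distr) simp
      show "real_distribution (gauss_law \<sigma>)" by (rule std_gauss.real_distribution_distr) simp
      show "char (distr D borel V) = char (gauss_law \<sigma>)"
      proof
        fix u
        have "char (distr D borel V) u = (\<integral>w. iexp (u * V w) \<partial>D)"
          unfolding char_def by (subst integral_distr) auto
        also have "\<dots> = (\<integral>w. (indicator A w / prob A) *\<^sub>R iexp (u * V w) \<partial>M)"
          unfolding D_def by (subst integral_density) auto
        also have "\<dots> = (\<integral>w. (1 / prob A) *\<^sub>R (indicator A w *\<^sub>R iexp (u * V w)) \<partial>M)"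
          by (intro Bochner_Integration.integral_cong) auto
        also have "\<dots> = (1 / prob A) *\<^sub>R complex_of_real (prob A * exp (- ((u * \<sigma>)\<^sup>2) / 2))"
          by (simp only: integral_scaleR_right c[OF A])
        also have "\<dots> = char (gauss_law \<sigma>) u"
          using p by (simp add: char_gauss_law scaleR_conv_of_real)
        finally show "char (distr D borel V) u = char (gauss_law \<sigma>) u" .
      qed
    qed
    then have "measure (distr D borel V) B = measure std_gauss ((\<lambda>z. \<sigma> * z) -` B)"
      using B by (simp add: measure_gauss_law)
    moreover have "measure (distr D borel V) B = measure D (V -` B \<inter> space M)"
      using B by (subst measure_distr) (auto simp: D_def)
    moreover have "measure D (V -` B \<inter> space M) = prob (A \<inter> (V -` B \<inter> space M)) / prob A"
    proof -
      have S[measurable]: "V -` B \<inter> space M \<in> events" using B by measurable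
      have "emeasure D (V -` B \<inter> space M) = (\<integral>\<^sup>+w. ennreal (indicator (A \<inter> (V -` B \<inter> space M)) w / prob A) \<partial>M)"
        unfolding D_def by (subst emeasure_density) (auto intro!: nn_integral_cong split: split_indicator)
      also have "\<dots> = ennreal (\<integral>w. indicator (A \<inter> (V -` B \<inter> space M)) w / prob A \<partial>M)"
        by (rule nn_integral_eq_integral[OF integrable_divide_zero]) (auto simp: emeasure_eq_measure)
      also have "\<dots> = ennreal (prob (A \<inter> (V -` B \<inter> space M)) / prob A)"
        by (simp add: Int_absorb2 sets.sets_into_space)
      finally show ?thesis by (simp add: measure_def)
    qed
    ultimately show ?thesis using p by (simp add: field_simps)
  qed
qed

text \<open>The converse direction with a complex factor \<open>Z\<close>: it lets independent
  increments be added one at a time, \<open>Z\<close> collecting the exponentials of the earlier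
  ones.\<close>

lemma gauss_indep_char:
  assumes G: "subalgebra M G" and V: "gauss_indep M G V \<sigma>"
    and Z: "Z \<in> borel_measurable G" "\<And>w. norm (Z w) \<le> 1"
  shows "(\<integral>w. Z w * iexp (u * V w) \<partial>M) = (\<integral>w. Z w \<partial>M) * exp (- ((u * \<sigma>)\<^sup>2) / 2)"
proof -
  have [measurable]: "V \<in> borel_measurable M" using V by (simp add: gauss_indep_def)
  have ZM[measurable]: "Z \<in> borel_measurable M" by (rule measurable_from_subalg[OF G Z(1)])
  note [measurable] = Z(1)
  let ?\<Phi> = "\<lambda>(w, v). Z w * iexp (u * v)"
  have "(\<integral>w. ?\<Phi> (w, V w) \<partial>M) = (\<integral>w. (\<integral>z. ?\<Phi> (w, \<sigma> * z) \<partial>std_gauss) \<partial>M)"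
  proof (rule gauss_indep_Fubini(1)[OF G V])
    show "?\<Phi> \<in> borel_measurable (G \<Otimes>\<^sub>M borel)" by measurable
    show "integrable M (\<lambda>w. ?\<Phi> (w, V w))"
      by (rule integrable_const_bound[where B=1]) (auto simp: norm_mult Z)
  qed
  also have "\<dots> = (\<integral>w. Z w * char (gauss_law \<sigma>) u \<partial>M)"
  proof (intro Bochner_Integration.integral_cong refl)
    fix w
    have "char (gauss_law \<sigma>) u = (\<integral>z. iexp (u * (\<sigma> * z)) \<partial>std_gauss)"
      unfolding char_def by (subst integral_distr) auto
    then show "(\<integral>z. ?\<Phi> (w, \<sigma> * z) \<partial>std_gauss) = Z w * char (gauss_law \<sigma>) u"
      by simp
  qed
  finally show ?thesis by (simp add: char_gauss_law)
qed

end

section \<open>Brownian increments\<close>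

locale brownian_motion =
  fixes M :: "'a measure" and W :: "real \<Rightarrow> 'a \<Rightarrow> real"
  assumes bm: "standard_brownian_motion M W"

sublocale brownian_motion \<subseteq> prob_space M
  using bm by (simp add: standard_brownian_motion_def)

context brownian_motion
begin

lemma W_measurable: "0 \<le> t \<Longrightarrow> W t \<in> borel_measurable M"
  and W_0: "AE w in M. W 0 w = 0"
  and W_continuous: "AE w in M. continuous_on {0..} (\<lambda>t. W t w)"
  and W_increment: "0 \<le> s \<Longrightarrow> s < t \<Longrightarrow> distributed M lborel (\<lambda>w. W t w - W s w) (normal_density 0 (sqrt (t - s)))"
  using bm by (auto simp: standard_brownian_motion_def)

lemma W_indep_increments:
  fixes \<tau> :: "nat \<Rightarrow> real"
  assumes "\<And>j. j \<le> k \<Longrightarrow> 0 \<le> \<tau> j" "\<And>j. j < k \<Longrightarrow> \<tau> j < \<tau> (Suc j)"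
  shows "indep_vars (\<lambda>_. borel) (\<lambda>j w. W (\<tau> (Suc j)) w - W (\<tau> j) w) {..<k}"
  using bm assms unfolding standard_brownian_motion_def by blast

abbreviation \<F> :: "real \<Rightarrow> 'a measure" where "\<F> \<equiv> aug_filtration M W"

text \<open>Everything that is independent of \<open>W b - W a\<close>: the path up to time \<open>a\<close> and the increments after
  time \<open>b\<close>.\<close>

definition outside :: "real \<Rightarrow> real \<Rightarrow> 'a measure" where
  "outside a b = sigma (space M)
     ({W s -` B \<inter> space M | s B. 0 \<le> s \<and> s \<le> a \<and> B \<in> sets borel} \<union>
      {(\<lambda>w. W s w - W b w) -` B \<inter> space M | s B. b \<le> s \<and> B \<in> sets borel} \<union> null_sets M)"

lemma increment_law:
  assumes "0 \<le> a" "a < b"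
  shows "distr M borel (\<lambda>w. W b w - W a w) = gauss_law (sqrt (b - a))"
proof -
  let ?V = "\<lambda>w. W b w - W a w" and ?s = "sqrt (b - a)"
  have s: "?s > 0" using assms by simp
  have [measurable]: "W a \<in> borel_measurable M" "W b \<in> borel_measurable M"
    using W_measurable assms by auto
  have "distributed M lborel (\<lambda>w. 0 + (1 / ?s) * ?V w) (normal_density (0 + (1 / ?s) * 0) (\<bar>1 / ?s\<bar> * ?s))"
    by (rule normal_density_affine[OF W_increment[OF assms]]) (use s in auto)
  then have "distributed M lborel (\<lambda>w. (1 / ?s) * ?V w) std_normal_density" using s by simp
  then have Z: "distr M lborel (\<lambda>w. (1 / ?s) * ?V w) = std_gauss"
    unfolding std_gauss_def by (rule distributed_distr_eq_density)
  have "gauss_law ?s = distr M borel ((\<lambda>z. ?s * z) \<circ> (\<lambda>w. (1 / ?s) * ?V w))"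
    unfolding Z[symmetric] by (subst distr_distr) auto
  also have "(\<lambda>z. ?s * z) \<circ> (\<lambda>w. (1 / ?s) * ?V w) = ?V" using s by auto
  finally show ?thesis by simp
qed

text \<open>Only increments over consecutive times are known to be independent. All times involved
  are sorted into one list; since none lies strictly between \<open>a\<close> and \<open>b\<close>,
  the increment \<open>W b - W a\<close> is one of the consecutive ones, and all other quantities
  are sums of the remaining ones.\<close>

lemma increment_indep_cylinder:
  assumes ab: "0 \<le> a" "a < b" and J: "finite J" "J \<subseteq> {0..a} \<union> {b..}"
    and B: "\<And>r. B r \<in> sets borel" and C: "C \<in> sets borel"
  shows "prob ({w\<in>space M. \<forall>r\<in>J. (if r \<le> a then W r w else W r w - W b w) \<in> B r}
           \<inter> ((\<lambda>w. W b w - W a w) -` C \<inter> space M))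
       = prob {w\<in>space M. \<forall>r\<in>J. (if r \<le> a then W r w else W r w - W b w) \<in> B r}
           * prob ((\<lambda>w. W b w - W a w) -` C \<inter> space M)"
proof -
  define X where "X r w = (if r \<le> a then W r w else W r w - W b w)" for r w
  \<comment> \<open>0 is added as the starting point of the telescoping sums, \<open>a\<close> and
    \<open>b\<close> so that \<open>W b - W a\<close> occurs among the increments.\<close>
  define K where "K = J \<union> {0, a, b}"
  have K: "finite K" "\<And>r. r \<in> K \<Longrightarrow> 0 \<le> r" "\<And>r. r \<in> K \<Longrightarrow> r \<le> a \<or> b \<le> r"
    using J ab by (auto simp: K_def)
  define l where "l = sorted_list_of_set K"
  have setl: "set l = K" using K by (simp add: l_def)
  define n where "n = length l"
  have lt: "l ! i < l ! j" if "i < j" "j < n" for i j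
    using that sorted_wrt_nth_less[OF strict_sorted_list_of_set[of K]] by (simp add: l_def n_def)
  have inK: "l ! i \<in> K" if "i < n" for i using that setl nth_mem by (auto simp: n_def)
  obtain p where p: "p < n" "l ! p = a" using setl by (metis K_def UnCI in_set_conv_nth insertCI n_def)
  obtain q where q: "q < n" "l ! q = b" using setl by (metis K_def UnCI in_set_conv_nth insertCI n_def)
  obtain z where z: "z < n" "l ! z = 0" using setl by (metis K_def UnCI in_set_conv_nth insertCI n_def)
  have l0: "l ! 0 = 0"
  proof (cases "z = 0")
    case False
    then have "l ! 0 < 0" using lt[of 0 z] z by simp
    moreover have "0 \<le> l ! 0" using K(2) inK[of 0] z by simp
    ultimately show ?thesis by simp
  qed (use z in simp)
  \<comment> \<open>No element of \<open>K\<close> lies strictly between \<open>a\<close> and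
    \<open>b\<close>, so they are neighbours in the sorted list.\<close>
  have pq: "q = Suc p"
  proof (rule ccontr)
    assume ne: "q \<noteq> Suc p"
    have "p < q" using lt[of q p] p q ab by (cases p q rule: linorder_cases) auto
    then have "Suc p < q" using ne by simp
    then have "a < l ! Suc p" "l ! Suc p < b" "l ! Suc p \<in> K"
      using lt[of p "Suc p"] lt[of "Suc p" q] p q inK[of "Suc p"] by auto
    then show False using K(3) by force
  qed
  define m where "m = n - 1"
  have nm: "n = Suc m" using p by (simp add: m_def)
  have pm: "p < m" using pq q nm by simp
  define D where "D j w = W (l ! Suc j) w - W (l ! j) w" for j w
  have ind: "indep_vars (\<lambda>_. borel) D {..<m}"
    unfolding D_def[abs_def]
    by (rule W_indep_increments) (use nm inK K(2) lt in auto)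
  define I where "I = {..<m} - {p}"
  let ?PI = "PiM I (\<lambda>_. borel :: real measure)" and ?Pp = "PiM {p} (\<lambda>_. borel :: real measure)"
  let ?RI = "\<lambda>w. restrict (\<lambda>i. D i w) I" and ?Rp = "\<lambda>w. restrict (\<lambda>i. D i w) {p}"
  have iv: "indep_var ?Pp ?Rp ?PI ?RI"
    by (rule indep_var_restrict[OF ind]) (use pm in \<open>auto simp: I_def\<close>)
  \<comment> \<open>Recovers the value at the \<open>i\<close>-th time from the increments without
    the \<open>p\<close>-th one: up to \<open>a\<close> by summing from time 0, from
    \<open>b\<close> on by summing from the index \<open>Suc p\<close> of \<open>b\<close>, which
    gives the increment since \<open>b\<close>.\<close>
  define Y where "Y i v = (if i \<le> p then \<Sum>j<i. v j else \<Sum>j\<in>{Suc p..<i}. v j)" for i and v :: "nat \<Rightarrow> real"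
  define Q where "Q = {i. i < n \<and> l ! i \<in> J}"
  have Qf: "finite Q" by (simp add: Q_def)
  have Ym: "Y i \<in> borel_measurable ?PI" if "i < n" for i
  proof (cases "i \<le> p")
    case True
    then have "(\<lambda>v. \<Sum>j<i. v j) \<in> borel_measurable ?PI"
      using pm by (intro borel_measurable_sum measurable_component_singleton) (auto simp: I_def)
    then show ?thesis using True by (simp add: Y_def[abs_def])
  next
    case False
    then have "(\<lambda>v. \<Sum>j\<in>{Suc p..<i}. v j) \<in> borel_measurable ?PI"
      using pm that nm by (intro borel_measurable_sum measurable_component_singleton) (auto simp: I_def)
    then show ?thesis using False by (simp add: Y_def[abs_def])
  qed
  define CI where "CI = {v\<in>space ?PI. \<forall>i\<in>Q. Y i v \<in> B (l ! i)}"
  have CI: "CI \<in> sets ?PI"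
    unfolding CI_def
  proof (rule sets.sets_Collect_finite_All[OF _ Qf])
    fix i assume "i \<in> Q"
    then have [measurable]: "Y i \<in> borel_measurable ?PI" using Ym by (simp add: Q_def)
    have [measurable]: "B (l ! i) \<in> sets borel" by (rule B)
    show "{v \<in> space ?PI. Y i v \<in> B (l ! i)} \<in> sets ?PI" by measurable
  qed
  define Cp where "Cp = {v\<in>space ?Pp. v p \<in> C}"
  have Cp: "Cp \<in> sets ?Pp"
  proof -
    have [measurable]: "(\<lambda>v. v p) \<in> borel_measurable ?Pp" by (rule measurable_component_singleton) simp
    note [measurable] = C
    show ?thesis unfolding Cp_def by measurable
  qed
  have eqp: "?Rp -` Cp \<inter> space M = (\<lambda>w. W b w - W a w) -` C \<inter> space M"
    using p q pq by (auto simp: Cp_def D_def space_PiM)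
  have Wm: "W r \<in> borel_measurable M" if "r \<in> K" for r using W_measurable K(2)[OF that] by simp
  have bK: "b \<in> K" and JK: "J \<subseteq> K" by (auto simp: K_def)
  define E where "E = {w\<in>space M. \<forall>r\<in>J. X r w \<in> B r}"
  have E: "E \<in> events"
    unfolding E_def
  proof (rule sets.sets_Collect_finite_All[OF _ J(1)])
    fix r assume r: "r \<in> J"
    have [measurable]: "W r \<in> borel_measurable M" "W b \<in> borel_measurable M" "B r \<in> sets borel"
      using Wm JK bK r B by auto
    show "{w \<in> space M. X r w \<in> B r} \<in> events" unfolding X_def by measurable
  qed
  have E': "?RI -` CI \<inter> space M \<in> events"
    using iv CI unfolding indep_var_eq by (auto intro: measurable_sets)
  \<comment> \<open>The two events agree only almost surely, because \<open>W 0 = 0\<close> holds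
    only almost surely.\<close>
  have AEE: "AE w in M. w \<in> ?RI -` CI \<inter> space M \<longleftrightarrow> w \<in> E"
    using W_0 AE_space
  proof eventually_elim
    case (elim w)
    have YX: "Y i (?RI w) = X (l ! i) w" if i: "i \<in> Q" for i
    proof (cases "i \<le> p")
      case True
      have "Y i (?RI w) = (\<Sum>j<i. D j w)"
        using True pm by (auto simp: Y_def I_def intro!: sum.cong)
      also have "\<dots> = W (l ! i) w - W (l ! 0) w"
        unfolding D_def by (rule sum_lessThan_telescope)
      also have "\<dots> = X (l ! i) w"
      proof -
        have "l ! i \<le> a" using True lt[of i p] p by (cases "i = p") auto
        then show ?thesis using elim l0 by (simp add: X_def)
      qed
      finally show ?thesis .
    next
      case False
      have "Y i (?RI w) = (\<Sum>j=Suc p..<i. D j w)"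
        using False pm i nm by (auto simp: Y_def I_def Q_def intro!: sum.cong)
      also have "\<dots> = W (l ! i) w - W (l ! Suc p) w"
        unfolding D_def by (rule sum_Suc_diff') (use False in simp)
      also have "\<dots> = X (l ! i) w"
      proof -
        have "a < l ! i" using False lt[of p i] p i by (simp add: Q_def)
        then show ?thesis using q pq by (simp add: X_def)
      qed
      finally show ?thesis .
    qed
    have "(\<forall>i\<in>Q. Y i (?RI w) \<in> B (l ! i)) \<longleftrightarrow> (\<forall>r\<in>J. X r w \<in> B r)"
    proof
      assume h: "\<forall>i\<in>Q. Y i (?RI w) \<in> B (l ! i)"
      show "\<forall>r\<in>J. X r w \<in> B r"
      proof
        fix r assume r: "r \<in> J"
        then have "r \<in> set l" using JK setl by auto
        then obtain i where "i < n" "l ! i = r" unfolding n_def by (metis in_set_conv_nth)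
        then have "i \<in> Q" "l ! i = r" using r by (auto simp: Q_def)
        then show "X r w \<in> B r" using h YX by metis
      qed
    next
      assume h: "\<forall>r\<in>J. X r w \<in> B r"
      show "\<forall>i\<in>Q. Y i (?RI w) \<in> B (l ! i)"
      proof
        fix i assume "i \<in> Q"
        then show "Y i (?RI w) \<in> B (l ! i)" using h YX[of i] by (simp add: Q_def)
      qed
    qed
    then show ?case using elim by (auto simp: CI_def E_def space_PiM)
  qed
  have V: "(\<lambda>w. W b w - W a w) -` C \<inter> space M \<in> events"
  proof -
    have [measurable]: "W a \<in> borel_measurable M" "W b \<in> borel_measurable M" using W_measurable ab by auto
    show ?thesis using C by measurable
  qed
  have "prob (E \<inter> ((\<lambda>w. W b w - W a w) -` C \<inter> space M))
      = prob ((\<lambda>w. (?Rp w, ?RI w)) -` (Cp \<times> CI) \<inter> space M)"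
  proof (rule measure_eq_AE)
    show "AE w in M. w \<in> E \<inter> ((\<lambda>w. W b w - W a w) -` C \<inter> space M)
        \<longleftrightarrow> w \<in> (\<lambda>w. (?Rp w, ?RI w)) -` (Cp \<times> CI) \<inter> space M"
      using AEE unfolding eqp[symmetric] by eventually_elim auto
    show "E \<inter> ((\<lambda>w. W b w - W a w) -` C \<inter> space M) \<in> events" using E V by auto
    have "(\<lambda>w. (?Rp w, ?RI w)) -` (Cp \<times> CI) \<inter> space M = (?Rp -` Cp \<inter> space M) \<inter> (?RI -` CI \<inter> space M)" by auto
    then show "(\<lambda>w. (?Rp w, ?RI w)) -` (Cp \<times> CI) \<inter> space M \<in> events"
      using E' V unfolding eqp by auto
  qed
  also have "\<dots> = prob (?Rp -` Cp \<inter> space M) * prob (?RI -` CI \<inter> space M)"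
    by (rule indep_varD[OF iv Cp CI])
  also have "prob (?RI -` CI \<inter> space M) = prob E"
    by (rule measure_eq_AE[OF AEE E' E])
  finally show ?thesis unfolding E_def X_def eqp by (simp only: mult.commute)
qed

lemma outside_gen_events:
  assumes "0 \<le> b"
  shows "{W s -` B \<inter> space M | s B. 0 \<le> s \<and> s \<le> a \<and> B \<in> sets borel} \<union>
      {(\<lambda>w. W s w - W b w) -` B \<inter> space M | s B. b \<le> s \<and> B \<in> sets borel} \<union> null_sets M \<subseteq> events"
  using assms by (auto intro!: measurable_sets[OF W_measurable] measurable_sets[OF borel_measurable_diff[OF W_measurable W_measurable]])

lemma outside_subalgebra:
  assumes "0 \<le> b"
  shows "subalgebra M (outside a b)"
proof -
  note g = outside_gen_events[OF assms, of a]
  then have "sets (outside a b) = sigma_sets (space M) ({W s -` B \<inter> space M | s B. 0 \<le> s \<and> s \<le> a \<and> B \<in> sets borel} \<union>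
      {(\<lambda>w. W s w - W b w) -` B \<inter> space M | s B. b \<le> s \<and> B \<in> sets borel} \<union> null_sets M)"
    unfolding outside_def by (intro sets_measure_of) (use sets.sets_into_space in blast)
  also have "\<dots> \<subseteq> events" by (rule sets.sigma_sets_subset[OF g])
  finally show ?thesis unfolding subalgebra_def by (simp add: outside_def space_measure_of_conv)
qed

text \<open>Cylinder events together with the null sets form an intersection stable generator of
  \<open>outside a b\<close>; including the null sets accounts for the augmentation of the
  filtration. Independence extends from there.\<close>

lemma increment_gauss_indep:
  assumes ab: "0 \<le> a" "a < b"
  shows "gauss_indep M (outside a b) (\<lambda>w. W b w - W a w) (sqrt (b - a))"
proof -
  let ?V = "\<lambda>w. W b w - W a w"
  have Vm[measurable]: "?V \<in> borel_measurable M" using W_measurable ab by simp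
  define cyl where "cyl J B = {w\<in>space M. \<forall>r\<in>J. (if r \<le> a then W r w else W r w - W b w) \<in> B r}" for J and B :: "real \<Rightarrow> real set"
  define E where "E = {cyl J B | J B. finite J \<and> J \<subseteq> {0..a} \<union> {b..} \<and> (\<forall>r. B r \<in> sets borel)}"
  let ?B = "{?V -` B \<inter> space M |B. B \<in> sets borel}"
  have Ee: "E \<subseteq> events"
  proof -
    have "cyl J B \<in> events" if J: "finite J" "J \<subseteq> {0..a} \<union> {b..}" and B: "\<forall>r. B r \<in> sets borel" for J B
      unfolding cyl_def
    proof (rule sets.sets_Collect_finite_All[OF _ J(1)])
      fix r assume r: "r \<in> J"
      have [measurable]: "W r \<in> borel_measurable M" "W b \<in> borel_measurable M" "B r \<in> sets borel"
        using W_measurable J(2) ab r B by auto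
      show "{w \<in> space M. (if r \<le> a then W r w else W r w - W b w) \<in> B r} \<in> events" by measurable
    qed
    then show ?thesis by (auto simp: E_def)
  qed
  have "indep_set (E \<union> null_sets M) ?B"
  proof (rule indep_setI)
    show "E \<union> null_sets M \<subseteq> events" using Ee by auto
    show "?B \<subseteq> events" by auto
    fix x y assume x: "x \<in> E \<union> null_sets M" and "y \<in> ?B"
    then obtain C where C: "C \<in> sets borel" "y = ?V -` C \<inter> space M" by auto
    then have ye: "y \<in> events" by simp
    from x show "prob (x \<inter> y) = prob x * prob y"
    proof
      assume "x \<in> E"
      then obtain J B where "x = cyl J B" "finite J" "J \<subseteq> {0..a} \<union> {b..}" "\<And>r. B r \<in> sets borel"
        by (auto simp: E_def)
      then show ?thesis using increment_indep_cylinder[OF ab, of J B C] C by (simp add: cyl_def)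
    next
      assume n: "x \<in> null_sets M"
      then have "x \<inter> y \<in> null_sets M" using null_set_Int2[OF _ ye] by blast
      then show ?thesis using n by (simp add: measure_eq_0_null_sets)
    qed
  qed
  then have ind: "indep_set (sigma_sets (space M) (E \<union> null_sets M)) (sigma_sets (space M) ?B)"
  proof (rule indep_set_sigma_sets)
    show "Int_stable (E \<union> null_sets M)"
    proof (rule Int_stableI)
      fix x y assume xy: "x \<in> E \<union> null_sets M" "y \<in> E \<union> null_sets M"
      then have ev: "x \<in> events" "y \<in> events" using Ee by auto
      consider "x \<in> E" "y \<in> E" | "x \<in> null_sets M" | "y \<in> null_sets M" using xy by blast
      then show "x \<inter> y \<in> E \<union> null_sets M"
      proof cases
        case 1
        then obtain J B J' B' where e: "x = cyl J B" "finite J" "J \<subseteq> {0..a} \<union> {b..}" "\<forall>r. B r \<in> sets borel"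
          "y = cyl J' B'" "finite J'" "J' \<subseteq> {0..a} \<union> {b..}" "\<forall>r. B' r \<in> sets borel"
          unfolding E_def by blast
        \<comment> \<open>Over the union of both index sets, a time that is absent from one of them
          imposes no condition there.\<close>
        define C where "C r = (if r \<in> J then B r else UNIV) \<inter> (if r \<in> J' then B' r else UNIV)" for r
        have mem: "v \<in> C r \<longleftrightarrow> (r \<in> J \<longrightarrow> v \<in> B r) \<and> (r \<in> J' \<longrightarrow> v \<in> B' r)" for v r by (auto simp: C_def)
        have "x \<inter> y = cyl (J \<union> J') C" unfolding e cyl_def mem by blast
        moreover have "\<forall>r. C r \<in> sets borel" using e by (auto simp: C_def)
        ultimately have "x \<inter> y \<in> E" unfolding E_def using e
          by (intro CollectI exI[of _ "J \<union> J'"] exI[of _ C]) auto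
        then show ?thesis by simp
      next
        case 2 then show ?thesis using null_set_Int2[OF _ ev(2)] by blast
      next
        case 3 then show ?thesis using null_set_Int1[OF _ ev(1)] by blast
      qed
    qed
    show "Int_stable ?B" by (rule Int_stable_vimage)
  qed
  have sub: "sets (outside a b) \<subseteq> sigma_sets (space M) (E \<union> null_sets M)"
  proof -
    let ?G = "{W s -` B \<inter> space M | s B. 0 \<le> s \<and> s \<le> a \<and> B \<in> sets borel} \<union>
      {(\<lambda>w. W s w - W b w) -` B \<inter> space M | s B. b \<le> s \<and> B \<in> sets borel} \<union> null_sets M"
    have "?G \<subseteq> Pow (space M)" using outside_gen_events[of b a] ab sets.sets_into_space by fastforce
    then have s: "sets (outside a b) = sigma_sets (space M) ?G"
      unfolding outside_def by (rule sets_measure_of)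
    have "?G \<subseteq> E \<union> null_sets M"
    proof -
      have "W s -` B \<inter> space M \<in> E" if "0 \<le> s" "s \<le> a" "B \<in> sets borel" for s B
      proof -
        have "W s -` B \<inter> space M = cyl {s} (\<lambda>_. B)" using that by (auto simp: cyl_def)
        then show ?thesis unfolding E_def using that by (intro CollectI exI[of _ "{s}"] exI[of _ "\<lambda>_. B"]) auto
      qed
      moreover have "(\<lambda>w. W s w - W b w) -` B \<inter> space M \<in> E" if "b \<le> s" "B \<in> sets borel" for s B
      proof -
        have "(\<lambda>w. W s w - W b w) -` B \<inter> space M = cyl {s} (\<lambda>_. B)" using that ab by (auto simp: cyl_def)
        then show ?thesis unfolding E_def using that by (intro CollectI exI[of _ "{s}"] exI[of _ "\<lambda>_. B"]) auto
      qed
      ultimately show ?thesis by auto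
    qed
    then show ?thesis unfolding s by (rule sigma_sets_mono')
  qed
  show ?thesis
    unfolding gauss_indep_def
  proof (intro conjI Vm ballI)
    fix A and B :: "real set" assume A: "A \<in> sets (outside a b)" and B: "B \<in> sets borel"
    have "prob (A \<inter> (?V -` B \<inter> space M)) = prob A * prob (?V -` B \<inter> space M)"
      by (rule indep_setD[OF ind]) (use A sub B in auto)
    also have "prob (?V -` B \<inter> space M) = measure (distr M borel ?V) B"
      using B by (subst measure_distr) auto
    finally show "prob (A \<inter> (?V -` B \<inter> space M)) = prob A * measure std_gauss ((\<lambda>z. sqrt (b - a) * z) -` B)"
      unfolding increment_law[OF ab] using B by (simp only: measure_gauss_law)
  qed
qed

lemma gauss_indep_mono:
  "sets G' \<subseteq> sets G \<Longrightarrow> gauss_indep M G V \<sigma> \<Longrightarrow> gauss_indep M G' V \<sigma>"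
  by (auto simp: gauss_indep_def)

text \<open>\<open>gauss_indep\<close> on the preimages under \<open>Z\<close> is ordinary
  independence of \<open>Z\<close> and \<open>V\<close>, so expectations factorise for every
  integrable \<open>Z\<close>.\<close>

lemma gauss_indep_product:
  fixes Z :: "'a \<Rightarrow> real" and f :: "real \<Rightarrow> real"
  assumes G: "subalgebra M G" and V: "gauss_indep M G V \<sigma>"
    and Z: "Z \<in> borel_measurable G" "integrable M Z"
    and f: "f \<in> borel_measurable borel" "integrable std_gauss (\<lambda>z. f (\<sigma> * z))"
  shows "integrable M (\<lambda>w. Z w * f (V w))"
    and "(\<integral>w. Z w * f (V w) \<partial>M) = (\<integral>w. Z w \<partial>M) * (\<integral>z. f (\<sigma> * z) \<partial>std_gauss)"
proof -
  have Vm: "V \<in> borel_measurable M" using V by (simp add: gauss_indep_def)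
  have sp: "space G = space M" and sb: "sets G \<subseteq> sets M" using G by (auto simp: subalgebra_def)
  have Vl: "prob (V -` B \<inter> space M) = measure std_gauss ((\<lambda>z. \<sigma> * z) -` B)" if "B \<in> sets borel" for B
    using measure_distr[OF Vm that] that by (simp add: gauss_indep_law[OF G V] measure_gauss_law)
  have "indep_var borel Z borel V"
    unfolding indep_var_eq
  proof (intro conjI Vm indep_set_sigma_sets Int_stable_vimage indep_setI)
    show "Z \<in> borel_measurable M" using Z(2) by simp
    fix x y assume "x \<in> {Z -` A \<inter> space M |A. A \<in> sets borel}" "y \<in> {V -` A \<inter> space M |A. A \<in> sets borel}"
    then obtain A B where A: "A \<in> sets borel" "x = Z -` A \<inter> space M" and B: "B \<in> sets borel" "y = V -` B \<inter> space M" by auto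
    have "x \<in> sets G" using measurable_sets[OF Z(1) A(1)] A(2) sp by simp
    then show "prob (x \<inter> y) = prob x * prob y" using V B by (simp add: gauss_indep_def Vl)
  qed (use measurable_sets[OF Vm] measurable_sets[of Z M borel] Z(2) in auto)
  from indep_var_compose[OF this, of "\<lambda>x. x" borel f borel] f(1)
  have iv: "indep_var borel Z borel (\<lambda>w. f (V w))" by (simp add: comp_def)
  have i: "integrable M (\<lambda>w. f (V w))" using gauss_indep_integral(2)[OF G V f(1)] f(2) by simp
  show "integrable M (\<lambda>w. Z w * f (V w))" by (rule indep_var_integrable[OF iv Z(2) i])
  show "(\<integral>w. Z w * f (V w) \<partial>M) = (\<integral>w. Z w \<partial>M) * (\<integral>z. f (\<sigma> * z) \<partial>std_gauss)"
    using indep_var_lebesgue_integral[OF iv Z(2) i] gauss_indep_integral(1)[OF G V f(1)] by simp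
qed

end

section \<open>Gaussian moments and clipped intervals\<close>

lemma std_gauss_moments:
  "integrable std_gauss (\<lambda>z. z)" "(\<integral>z. z \<partial>std_gauss) = 0"
  "integrable std_gauss (\<lambda>z. z\<^sup>2)" "(\<integral>z. z\<^sup>2 \<partial>std_gauss) = 1"
proof -
  show "integrable std_gauss (\<lambda>z. z)" using poly_integrable_std_gauss[of "[:0,1:]" 0 1] by simp
  show "integrable std_gauss (\<lambda>z. z\<^sup>2)"
    using poly_integrable_std_gauss[of "[:0,0,1:]" 0 1] by (simp add: power2_eq_square)
  show "(\<integral>z. z \<partial>std_gauss) = 0" using Stein_poly[of 1 1 0] by simp
  show "(\<integral>z. z\<^sup>2 \<partial>std_gauss) = 1"
    using Stein_poly[of 1 "[:0,1:]" 0] by (simp add: power2_eq_square pderiv_pCons std_gauss.prob_space[simplified])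
qed

lemma L2_diff_expand:
  assumes "f \<in> L2_space N" "g \<in> L2_space N"
  shows "(\<integral>x. (f x - g x)\<^sup>2 \<partial>N) = (\<integral>x. f x * f x \<partial>N) - 2 * (\<integral>x. f x * g x \<partial>N) + (\<integral>x. g x * g x \<partial>N)"
proof -
  have "(\<integral>x. (f x - g x)\<^sup>2 \<partial>N) = (\<integral>x. f x * f x - 2 * (f x * g x) + g x * g x \<partial>N)"
    by (intro Bochner_Integration.integral_cong) (auto simp: power2_eq_square algebra_simps)
  then show ?thesis using L2_mult_integrable[OF assms] L2_mult_integrable[OF assms(1,1)] L2_mult_integrable[OF assms(2,2)]
    by simp
qed

text \<open>The projection of a point onto the interval from \<open>a\<close> to \<open>b\<close>.
  Clipping the grid points turns a sum over all cells into the sum over their parts inside the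
  interval; cells outside collapse to a point.\<close>

definition clip :: "real \<Rightarrow> real \<Rightarrow> real \<Rightarrow> real" where
  "clip a b x = max a (min b x)"

lemma clip_mono: "x \<le> y \<Longrightarrow> clip a b x \<le> clip a b y"
  by (auto simp: clip_def)

lemma clip_bounds: "a \<le> b \<Longrightarrow> a \<le> clip a b x" "a \<le> b \<Longrightarrow> clip a b x \<le> b"
  by (auto simp: clip_def)

lemma indicator_clip:
  "a \<le> b \<Longrightarrow> indicator {clip a b x<..clip a b y} t = (indicator {a<..b} t * indicator {x<..y} t :: real)"
  by (auto simp: clip_def split: split_indicator)

context brownian_motion
begin

section \<open>The filtration\<close>

lemma F_sets: "sets (\<F> t) = sigma_sets (space M)
     ({W s -` B \<inter> space M | s B. 0 \<le> s \<and> s \<le> t \<and> B \<in> sets borel} \<union> null_sets M)"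
  unfolding aug_filtration_def
  by (rule sets_measure_of) (use sets.sets_into_space in auto)

lemma F_space [simp]: "space (\<F> t) = space M"
  by (simp add: aug_filtration_def space_measure_of_conv)

lemma F_subalgebra: "subalgebra M (\<F> t)"
proof -
  have "sets (\<F> t) \<subseteq> events"
    unfolding F_sets by (rule sets.sigma_sets_subset) (auto intro!: measurable_sets[OF W_measurable])
  then show ?thesis by (simp add: subalgebra_def)
qed

lemma F_mono: "s \<le> t \<Longrightarrow> sets (\<F> s) \<subseteq> sets (\<F> t)"
  unfolding F_sets by (rule sigma_sets_mono') fastforce

lemma F_measurable_mono: "s \<le> t \<Longrightarrow> f \<in> measurable (\<F> s) N \<Longrightarrow> f \<in> measurable (\<F> t) N"
  by (rule measurable_from_subalg[of "\<F> t" "\<F> s"]) (simp_all add: subalgebra_def F_mono)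

lemma F_measurable_M: "f \<in> measurable (\<F> s) N \<Longrightarrow> f \<in> measurable M N"
  by (rule measurable_from_subalg[OF F_subalgebra])

lemma W_F: "0 \<le> s \<Longrightarrow> s \<le> t \<Longrightarrow> W s \<in> borel_measurable (\<F> t)"
  by (rule measurableI) (auto simp: F_sets)

lemma outside_sets:
  assumes "0 \<le> b"
  shows "sets (outside a b) = sigma_sets (space M)
     ({W s -` B \<inter> space M | s B. 0 \<le> s \<and> s \<le> a \<and> B \<in> sets borel} \<union>
      {(\<lambda>w. W s w - W b w) -` B \<inter> space M | s B. b \<le> s \<and> B \<in> sets borel} \<union> null_sets M)"
  unfolding outside_def
  by (rule sets_measure_of) (use outside_gen_events[OF assms, of a] sets.sets_into_space in fastforce)

lemma outside_space [simp]: "space (outside a b) = space M"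
  by (simp add: outside_def space_measure_of_conv)

lemma F_outside: "0 \<le> b \<Longrightarrow> s \<le> a \<Longrightarrow> sets (\<F> s) \<subseteq> sets (outside a b)"
  unfolding F_sets outside_sets
proof (rule sigma_sets_mono', rule subsetI)
  fix x assume s: "s \<le> a" and x: "x \<in> {W r -` B \<inter> space M |r B. 0 \<le> r \<and> r \<le> s \<and> B \<in> sets borel} \<union> null_sets M"
  then consider r B where "x = W r -` B \<inter> space M" "0 \<le> r" "r \<le> s" "B \<in> sets borel" | "x \<in> null_sets M"
    by blast
  then show "x \<in> {W s -` B \<inter> space M |s B. 0 \<le> s \<and> s \<le> a \<and> B \<in> sets borel} \<union>
      {(\<lambda>w. W s w - W b w) -` B \<inter> space M |s B. b \<le> s \<and> B \<in> sets borel} \<union> null_sets M"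
  proof cases
    case 1
    then have "r \<le> a" using s by simp
    then show ?thesis using 1 by blast
  qed blast
qed

lemma F_measurable_outside: "0 \<le> b \<Longrightarrow> s \<le> a \<Longrightarrow> f \<in> measurable (\<F> s) N \<Longrightarrow> f \<in> measurable (outside a b) N"
  by (rule measurable_from_subalg[of "outside a b" "\<F> s"]) (simp_all add: subalgebra_def F_outside)

lemma increment_outside: "0 \<le> b \<Longrightarrow> b \<le> s \<Longrightarrow> (\<lambda>w. W s w - W b w) \<in> borel_measurable (outside a b)"
  by (rule measurableI) (auto simp: outside_sets)

lemma increment_F: "0 \<le> a \<Longrightarrow> a < b \<Longrightarrow> gauss_indep M (\<F> a) (\<lambda>w. W b w - W a w) (sqrt (b - a))"
  by (rule gauss_indep_mono[OF F_outside increment_gauss_indep]) auto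

lemma increment_L2: "0 \<le> a \<Longrightarrow> a \<le> b \<Longrightarrow> (\<lambda>w. W b w - W a w) \<in> L2_space M"
proof (cases "a = b")
  case False
  assume "0 \<le> a" "a \<le> b"
  with False have ab: "0 \<le> a" "a < b" by auto
  have "integrable M (\<lambda>w. (W b w - W a w)\<^sup>2)"
    by (subst gauss_indep_integral(2)[OF F_subalgebra increment_F[OF ab], of "\<lambda>x. x\<^sup>2"])
      (auto simp: power_mult_distrib intro: std_gauss_moments)
  then show ?thesis using W_measurable ab by (simp add: L2_space_def)
qed (simp add: L2_space_zero)

lemma increment_norm:
  assumes "0 \<le> s" "0 \<le> t"
  shows "(\<integral>w. (W t w - W s w)\<^sup>2 \<partial>M) = \<bar>t - s\<bar>" "integrable M (\<lambda>w. (W t w - W s w)\<^sup>2)"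
proof -
  have lt: "(\<integral>w. (W t w - W s w)\<^sup>2 \<partial>M) = t - s \<and> integrable M (\<lambda>w. (W t w - W s w)\<^sup>2)" if st: "0 \<le> s" "s < t" for s t
    using gauss_indep_integral(1)[OF F_subalgebra increment_F[OF st], of "\<lambda>x. x\<^sup>2"] L2_spaceD(2)[OF increment_L2[of s t]] st
    by (simp add: power_mult_distrib std_gauss_moments)
  consider "s < t" | "t < s" | "s = t" by linarith
  then have "(\<integral>w. (W t w - W s w)\<^sup>2 \<partial>M) = \<bar>t - s\<bar> \<and> integrable M (\<lambda>w. (W t w - W s w)\<^sup>2)"
    using lt[of s t] lt[of t s] assms by cases (auto simp: power2_commute[of "W t _"])
  then show "(\<integral>w. (W t w - W s w)\<^sup>2 \<partial>M) = \<bar>t - s\<bar>" "integrable M (\<lambda>w. (W t w - W s w)\<^sup>2)" by auto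
qed

text \<open>Polarisation: the product is a combination of squares of differences of two values of
  \<open>W\<close>, whose means are distances of times. No case distinction on the relative position
  of the intervals is made on the side of \<open>W\<close>.\<close>

lemma increment_covariance:
  assumes "0 \<le> x" "x \<le> y" "0 \<le> x'" "x' \<le> y'"
  shows "(\<integral>w. (W y w - W x w) * (W y' w - W x' w) \<partial>M)
    = (\<integral>t. indicator {x<..y} t * indicator {x'<..y'} t \<partial>lborel)"
proof -
  have "(\<integral>w. (W y w - W x w) * (W y' w - W x' w) \<partial>M)
     = (\<integral>w. ((W y w - W x' w)\<^sup>2 + (W x w - W y' w)\<^sup>2 - (W y w - W y' w)\<^sup>2 - (W x w - W x' w)\<^sup>2) / 2 \<partial>M)"
    by (intro Bochner_Integration.integral_cong) (auto simp: power2_eq_square algebra_simps)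
  also have "\<dots> = (\<bar>y - x'\<bar> + \<bar>x - y'\<bar> - \<bar>y - y'\<bar> - \<bar>x - x'\<bar>) / 2"
    using assms by (simp add: increment_norm)
  also have "\<dots> = (\<integral>t. indicator {max x x'<..min y y'} t \<partial>lborel)"
  proof (cases "max x x' \<le> min y y'")
    case False
    then have e: "{max x x'<..min y y'} = {}" by auto
    show ?thesis unfolding e using assms False by (auto simp: max_def min_def split: if_splits)
  qed (use assms in \<open>auto simp: max_def min_def split: if_splits\<close>)
  also have "(\<lambda>t. indicator {max x x'<..min y y'} t) = (\<lambda>t. indicator {x<..y} t * indicator {x'<..y'} t :: real)"
    by (auto split: split_indicator)
  finally show ?thesis .
qed

lemma step_covariance:
  assumes I: "finite I" "\<And>i. i \<in> I \<Longrightarrow> 0 \<le> x i" "\<And>i. i \<in> I \<Longrightarrow> x i \<le> y i"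
    and J: "finite J" "\<And>j. j \<in> J \<Longrightarrow> 0 \<le> x' j" "\<And>j. j \<in> J \<Longrightarrow> x' j \<le> y' j"
  shows "(\<integral>w. (\<Sum>i\<in>I. c i * (W (y i) w - W (x i) w)) * (\<Sum>j\<in>J. d j * (W (y' j) w - W (x' j) w)) \<partial>M)
    = (\<integral>t. (\<Sum>i\<in>I. c i * indicator {x i<..y i} t) * (\<Sum>j\<in>J. d j * indicator {x' j<..y' j} t) \<partial>lborel)"
proof -
  have iM: "integrable M (\<lambda>w. (W (y i) w - W (x i) w) * (W (y' j) w - W (x' j) w))" if "i \<in> I" "j \<in> J" for i j
    using that I J by (intro L2_mult_integrable increment_L2) auto
  have iL: "integrable lborel (\<lambda>t. indicator {x i<..y i} t * indicator {x' j<..y' j} t :: real)" for i j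
  proof -
    have "(\<lambda>t. indicator {x i<..y i} t * indicator {x' j<..y' j} t :: real) = indicator ({x i<..y i} \<inter> {x' j<..y' j})"
      by (auto split: split_indicator)
    then show ?thesis by (auto intro!: integrable_real_indicator emeasure_bounded_finite bounded_Int)
  qed
  have "(\<integral>w. (\<Sum>i\<in>I. c i * (W (y i) w - W (x i) w)) * (\<Sum>j\<in>J. d j * (W (y' j) w - W (x' j) w)) \<partial>M)
    = (\<integral>w. (\<Sum>i\<in>I. \<Sum>j\<in>J. (c i * d j) * ((W (y i) w - W (x i) w) * (W (y' j) w - W (x' j) w))) \<partial>M)"
    unfolding sum_product by (simp only: mult_ac)
  also have "\<dots> = (\<Sum>i\<in>I. \<Sum>j\<in>J. (c i * d j) * (\<integral>w. (W (y i) w - W (x i) w) * (W (y' j) w - W (x' j) w) \<partial>M))"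
    using iM by simp
  also have "\<dots> = (\<Sum>i\<in>I. \<Sum>j\<in>J. (c i * d j) * (\<integral>t. indicator {x i<..y i} t * indicator {x' j<..y' j} t \<partial>lborel))"
    using I J by (intro sum.cong refl) (simp only: increment_covariance)
  also have "\<dots> = (\<integral>t. (\<Sum>i\<in>I. \<Sum>j\<in>J. (c i * d j) * (indicator {x i<..y i} t * indicator {x' j<..y' j} t)) \<partial>lborel)"
    by (subst Bochner_Integration.integral_sum, intro Bochner_Integration.integrable_sum integrable_mult_right iL,
        intro sum.cong refl, subst Bochner_Integration.integral_sum, intro integrable_mult_right iL,
        intro sum.cong refl, rule integral_mult_right_zero[symmetric])
  also have "\<dots> = (\<integral>t. (\<Sum>i\<in>I. c i * indicator {x i<..y i} t) * (\<Sum>j\<in>J. d j * indicator {x' j<..y' j} t) \<partial>lborel)"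
    unfolding sum_product by (simp only: mult_ac)
  finally show ?thesis .
qed

lemma step_indicator_L2:
  fixes x y :: "'i \<Rightarrow> real"
  shows "(\<lambda>t. \<Sum>i\<in>I. c i * indicator {x i<..y i} t) \<in> L2_space lborel"
proof (intro L2_space_sum L2_space_cmult)
  fix i
  have "(\<lambda>t. (indicator {x i<..y i} t)\<^sup>2 :: real) = indicator {x i<..y i}" by (auto split: split_indicator)
  then show "indicator {x i<..y i} \<in> L2_space lborel"
  proof -
    assume sq: "(\<lambda>t. (indicator {x i<..y i} t)\<^sup>2 :: real) = indicator {x i<..y i}"
    have "bounded {x i<..y i}" by (rule bounded_subset[of "{x i..y i}"]) auto
    then have "integrable lborel (indicator {x i<..y i} :: real \<Rightarrow> real)"
      by (intro integrable_real_indicator emeasure_bounded_finite) auto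
    then show ?thesis by (simp add: L2_space_def sq)
  qed
qed

lemma step_increments_L2:
  assumes "\<And>i. i \<in> I \<Longrightarrow> 0 \<le> x i" "\<And>i. i \<in> I \<Longrightarrow> x i \<le> y i"
  shows "(\<lambda>w. \<Sum>i\<in>I. c i * (W (y i) w - W (x i) w)) \<in> L2_space M"
  using assms by (intro L2_space_sum L2_space_cmult increment_L2) auto

text \<open>The isometry for a difference of step functions on two unrelated partitions. Expanding
  the squares reduces it to covariances of pairs of intervals, so no common refinement is
  formed.\<close>

lemma step_isometry:
  assumes I: "finite I" "\<And>i. i \<in> I \<Longrightarrow> 0 \<le> x i" "\<And>i. i \<in> I \<Longrightarrow> x i \<le> y i"
    and J: "finite J" "\<And>j. j \<in> J \<Longrightarrow> 0 \<le> x' j" "\<And>j. j \<in> J \<Longrightarrow> x' j \<le> y' j"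
  shows "(\<integral>w. ((\<Sum>i\<in>I. c i * (W (y i) w - W (x i) w)) - (\<Sum>j\<in>J. d j * (W (y' j) w - W (x' j) w)))\<^sup>2 \<partial>M)
    = (\<integral>t. ((\<Sum>i\<in>I. c i * indicator {x i<..y i} t) - (\<Sum>j\<in>J. d j * indicator {x' j<..y' j} t))\<^sup>2 \<partial>lborel)"
proof -
  have a: "(\<lambda>w. \<Sum>i\<in>I. c i * (W (y i) w - W (x i) w)) \<in> L2_space M"
    by (rule step_increments_L2) (use I in auto)
  have b: "(\<lambda>w. \<Sum>j\<in>J. d j * (W (y' j) w - W (x' j) w)) \<in> L2_space M"
    by (rule step_increments_L2) (use J in auto)
  have ta: "(\<lambda>t. \<Sum>i\<in>I. c i * indicator {x i<..y i} t) \<in> L2_space lborel"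
    by (rule step_indicator_L2)
  have tb: "(\<lambda>t. \<Sum>j\<in>J. d j * indicator {x' j<..y' j} t) \<in> L2_space lborel"
    by (rule step_indicator_L2)
  show ?thesis
    unfolding L2_diff_expand[OF a b] L2_diff_expand[OF ta tb]
    by (simp only: step_covariance[where x=x and y=y and x'=x and y'=y, OF I I]
        step_covariance[where x=x and y=y and x'=x' and y'=y', OF I J]
        step_covariance[where x=x' and y=y' and x'=x' and y'=y', OF J J])
qed

section \<open>Wiener integrals of grid averages\<close>

definition stepI :: "real \<Rightarrow> nat \<Rightarrow> (nat \<Rightarrow> real) \<Rightarrow> real \<Rightarrow> real \<Rightarrow> 'a \<Rightarrow> real" where
  "stepI T N c a b w = (\<Sum>l<N. c l * (W (clip a b (grid T N (Suc l))) w - W (clip a b (grid T N l)) w))"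

definition step_var :: "real \<Rightarrow> nat \<Rightarrow> (nat \<Rightarrow> real) \<Rightarrow> real \<Rightarrow> real \<Rightarrow> real" where
  "step_var T N c a b = (\<Sum>l<N. (c l)\<^sup>2 * (clip a b (grid T N (Suc l)) - clip a b (grid T N l)))"

lemma stepI_F:
  assumes "0 \<le> a" "a \<le> b"
  shows "stepI T N c a b \<in> borel_measurable (\<F> b)"
  unfolding stepI_def[abs_def]
  using assms clip_bounds[OF assms(2)]
  by (intro borel_measurable_sum borel_measurable_times borel_measurable_diff borel_measurable_const W_F)
    (auto intro: order_trans)

lemma step_var_nonneg: "0 \<le> T \<Longrightarrow> 0 \<le> step_var T N c a b"
  unfolding step_var_def
  by (intro sum_nonneg mult_nonneg_nonneg) (auto intro!: clip_mono grid_mono)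

text \<open>Induction over the cells: given everything before it, each increment multiplies the
  characteristic function by a Gaussian factor. Starting from the indicator of an event in
  \<open>\<F> a\<close>, this yields independence and the law at once.\<close>

lemma stepI_gauss_indep:
  assumes T: "0 < T" and ab: "0 \<le> a" "a \<le> b"
  shows "gauss_indep M (\<F> a) (stepI T N c a b) (sqrt (step_var T N c a b))"
proof (rule gauss_indepI_char[OF F_subalgebra F_measurable_M[OF stepI_F[OF ab]]])
  fix A u assume A: "A \<in> sets (\<F> a)"
  let ?g = "\<lambda>l. clip a b (grid T N l)"
  define S where "S m w = (\<Sum>l<m. c l * (W (?g (Suc l)) w - W (?g l) w))" for m w
  define v where "v m = (\<Sum>l<m. (c l)\<^sup>2 * (?g (Suc l) - ?g l))" for m
  have g: "a \<le> ?g l" "?g l \<le> ?g (Suc l)" for l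
    using clip_bounds[OF ab(2)] clip_mono[OF grid_mono[of T l "Suc l" N]] T by auto
  have gm: "?g l \<le> ?g m" if "l \<le> m" for l m
    using clip_mono[OF grid_mono[of T l m N]] T that by auto
  have Sm: "S m \<in> borel_measurable (\<F> (?g m))" for m
    unfolding S_def[abs_def]
  proof (intro borel_measurable_sum borel_measurable_times borel_measurable_diff borel_measurable_const W_F)
    fix l assume "l \<in> {..<m}"
    then show "0 \<le> ?g (Suc l)" "?g (Suc l) \<le> ?g m" "0 \<le> ?g l" "?g l \<le> ?g m"
      using g(1)[of l] g(1)[of "Suc l"] ab gm by auto
  qed
  have "(\<integral>w. indicator A w *\<^sub>R iexp (u * S m w) \<partial>M) = complex_of_real (prob A * exp (- (u\<^sup>2 * v m) / 2))" for m
  proof (induction m)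
    case 0
    have "A \<in> events" using A F_subalgebra by (auto simp: subalgebra_def)
    then have "(\<integral>w. indicator A w *\<^sub>R (1 :: complex) \<partial>M) = prob A" by (simp add: scaleR_conv_of_real)
    then show ?case by (simp add: S_def v_def)
  next
    case (Suc m)
    show ?case
    proof (cases "?g m = ?g (Suc m)")
      case True
      \<comment> \<open>A cell clipped to a point contributes nothing; the other case has the strict
        inequality that \<open>increment_F\<close> requires.\<close>
      then have "S (Suc m) = S m" "v (Suc m) = v m" by (auto simp: S_def v_def)
      then show ?thesis using Suc by simp
    next
      case False
      then have lt: "?g m < ?g (Suc m)" using g(2)[of m] by simp
      have g0: "0 \<le> ?g m" using g(1)[of m] ab by simp
      let ?Z = "\<lambda>w. indicator A w *\<^sub>R iexp (u * S m w)"
      have Z: "?Z \<in> borel_measurable (\<F> (?g m))"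
      proof -
        have [measurable]: "A \<in> sets (\<F> (?g m))" using A F_mono[OF g(1)[of m]] by blast
        note [measurable] = Sm[of m]
        show ?thesis by measurable
      qed
      have "(\<integral>w. ?Z w * iexp ((u * c m) * (W (?g (Suc m)) w - W (?g m) w)) \<partial>M)
        = (\<integral>w. ?Z w \<partial>M) * exp (- (((u * c m) * sqrt (?g (Suc m) - ?g m))\<^sup>2) / 2)"
        by (rule gauss_indep_char[OF F_subalgebra increment_F[OF g0 lt] Z]) (auto split: split_indicator)
      also have "\<dots> = complex_of_real (prob A * exp (- (u\<^sup>2 * v m) / 2) * exp (- (((u * c m) * sqrt (?g (Suc m) - ?g m))\<^sup>2) / 2))"
        unfolding Suc by simp
      also have "prob A * exp (- (u\<^sup>2 * v m) / 2) * exp (- (((u * c m) * sqrt (?g (Suc m) - ?g m))\<^sup>2) / 2)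
        = prob A * exp (- (u\<^sup>2 * v m) / 2 + - (((u * c m) * sqrt (?g (Suc m) - ?g m))\<^sup>2) / 2)"
        by (simp only: exp_add mult.assoc)
      also have "- (u\<^sup>2 * v m) / 2 + - (((u * c m) * sqrt (?g (Suc m) - ?g m))\<^sup>2) / 2 = - (u\<^sup>2 * v (Suc m)) / 2"
        using lt by (simp add: v_def power_mult_distrib algebra_simps add_divide_distrib diff_divide_distrib)
      finally have "(\<integral>w. ?Z w * iexp ((u * c m) * (W (?g (Suc m)) w - W (?g m) w)) \<partial>M)
        = complex_of_real (prob A * exp (- (u\<^sup>2 * v (Suc m)) / 2))" .
      moreover have "(\<lambda>w. ?Z w * iexp ((u * c m) * (W (?g (Suc m)) w - W (?g m) w))) = (\<lambda>w. indicator A w *\<^sub>R iexp (u * S (Suc m) w))"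
        by (rule ext) (simp add: S_def exp_add[symmetric] algebra_simps)
      ultimately show ?thesis by (simp only:)
    qed
  qed
  from this[of N] show "(\<integral>w. indicator A w *\<^sub>R iexp (u * stepI T N c a b w) \<partial>M)
     = complex_of_real (prob A * exp (- ((u * sqrt (step_var T N c a b))\<^sup>2) / 2))"
    using step_var_nonneg[of T N c a b] T
    by (simp add: S_def stepI_def v_def step_var_def power_mult_distrib)
qed

lemma stepI_grid_avg_indicator:
  assumes "a \<le> b"
  shows "(\<Sum>l<N. grid_avg T N h l * indicator {clip a b (grid T N l)<..clip a b (grid T N (Suc l))} t)
    = indicator {a<..b} t * grid_step T N h t"
  unfolding indicator_clip[OF assms] grid_step_def sum_distrib_left
  by (intro sum.cong refl) simp

lemma stepI_L2:
  assumes "0 < T" "0 \<le> a" "a \<le> b"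
  shows "stepI T N c a b \<in> L2_space M"
  unfolding stepI_def[abs_def]
  by (rule step_increments_L2)
    (use assms clip_bounds[OF assms(3)] in \<open>auto intro!: clip_mono grid_mono intro: order_trans\<close>)

lemma interval_lborel_time:
  assumes "0 \<le> a" "b \<le> T"
  shows "(\<integral>t. indicator {a<..b} t * f t \<partial>lborel) = (\<integral>t. indicator {a<..b} t * (f t :: real) \<partial>time_measure T)"
  unfolding time_measure_integral
  using assms by (intro Bochner_Integration.integral_cong) (auto split: split_indicator)

lemma stepI_isometry:
  assumes T: "0 < T" and ab: "0 \<le> a" "a \<le> b" "b \<le> T"
  shows "(\<integral>w. (stepI T N (grid_avg T N h) a b w - stepI T N' (grid_avg T N' h') a b w)\<^sup>2 \<partial>M)
    = (\<integral>t. indicator {a<..b} t * (grid_step T N h t - grid_step T N' h' t)\<^sup>2 \<partial>time_measure T)"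
proof -
  have cl: "0 \<le> clip a b x" for x using clip_bounds(1)[OF ab(2), of x] ab by linarith
  have cm: "clip a b (grid T N l) \<le> clip a b (grid T N (Suc l))" for N l
    using T by (intro clip_mono grid_mono) auto
  have "(\<integral>w. (stepI T N (grid_avg T N h) a b w - stepI T N' (grid_avg T N' h') a b w)\<^sup>2 \<partial>M)
    = (\<integral>t. (indicator {a<..b} t * grid_step T N h t - indicator {a<..b} t * grid_step T N' h' t)\<^sup>2 \<partial>lborel)"
    unfolding stepI_def stepI_grid_avg_indicator[OF ab(2), symmetric]
    by (rule step_isometry) (use cl cm in auto)
  also have "(\<lambda>t. (indicator {a<..b} t * grid_step T N h t - indicator {a<..b} t * grid_step T N' h' t)\<^sup>2)
    = (\<lambda>t. indicator {a<..b} t * (grid_step T N h t - grid_step T N' h' t)\<^sup>2)"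
    by (auto split: split_indicator)
  finally show ?thesis using interval_lborel_time[OF ab(1,3)] by simp
qed

lemma interval_mult_L2: "f \<in> L2_space (time_measure T) \<Longrightarrow> (\<lambda>t. indicator {a<..b} t * f t) \<in> L2_space (time_measure T)"
  by (rule L2_space_bounded_mult[where B=1]) (auto simp: measurable_restrict_space1 split: split_indicator)

lemma interval_L2_norm_le:
  assumes "f \<in> L2_space (time_measure T)"
  shows "(\<integral>t. indicator {a<..b} t * (f t)\<^sup>2 \<partial>time_measure T) \<le> (L2_norm_of (time_measure T) f)\<^sup>2"
proof -
  have "(\<lambda>t. (indicator {a<..b} t * f t)\<^sup>2) = (\<lambda>t. indicator {a<..b} t * (f t)\<^sup>2)"
    by (auto split: split_indicator)
  then have "integrable (time_measure T) (\<lambda>t. indicator {a<..b} t * (f t)\<^sup>2)"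
    using L2_spaceD(2)[OF interval_mult_L2[OF assms, of a b]] by simp
  then show ?thesis
    unfolding L2_norm_of_power2 using L2_spaceD(2)[OF assms]
    by (intro integral_mono) (auto split: split_indicator)
qed

lemma stepI_diff_norm_le:
  assumes T: "0 < T" and ab: "0 \<le> a" "a \<le> b" "b \<le> T"
  shows "L2_norm_of M (\<lambda>w. stepI T N (grid_avg T N h) a b w - stepI T N' (grid_avg T N' h) a b w)
    \<le> L2_norm_of (time_measure T) (\<lambda>t. grid_step T N h t - grid_step T N' h t)"
proof -
  have "(L2_norm_of M (\<lambda>w. stepI T N (grid_avg T N h) a b w - stepI T N' (grid_avg T N' h) a b w))\<^sup>2
    \<le> (L2_norm_of (time_measure T) (\<lambda>t. grid_step T N h t - grid_step T N' h t))\<^sup>2"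
    unfolding L2_norm_of_power2[of M] stepI_isometry[OF T ab]
    by (rule interval_L2_norm_le) (intro L2_space_diff grid_step_L2)
  then show ?thesis by (rule power2_le_imp_le) simp
qed

text \<open>The Wiener integral of \<open>h\<close> over the interval from \<open>a\<close> to
  \<open>b\<close>, in a version that is measurable for \<open>\<F> b\<close>. It is built from the
  canonical step functions, so that its law and its additivity can be read off from sums.\<close>

definition winc :: "real \<Rightarrow> (real \<Rightarrow> real) \<Rightarrow> real \<Rightarrow> real \<Rightarrow> 'a \<Rightarrow> real" where
  "winc T h a b = (SOME X. L2_tendsto M (\<lambda>N. stepI T N (grid_avg T N h) a b) X \<and> X \<in> borel_measurable (\<F> b))"

lemma winc:
  assumes T: "0 < T" and h: "h \<in> L2_space (time_measure T)" and ab: "0 \<le> a" "a \<le> b" "b \<le> T"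
  shows winc_tendsto: "L2_tendsto M (\<lambda>N. stepI T N (grid_avg T N h) a b) (winc T h a b)"
    and winc_F: "winc T h a b \<in> borel_measurable (\<F> b)"
proof -
  have "\<exists>X. L2_tendsto M (\<lambda>N. stepI T N (grid_avg T N h) a b) X \<and> X \<in> borel_measurable (\<F> b)"
  proof (rule L2_complete_subalgebra[OF F_subalgebra stepI_L2[OF T ab(1,2)] stepI_F[OF ab(1,2)]])
    fix e :: real assume "e > 0"
    from L2_tendsto_Cauchy[OF grid_approx_L2[OF T h, unfolded grid_approx_def] this]
    obtain K where K: "\<forall>m\<ge>K. \<forall>n\<ge>K. L2_norm_of (time_measure T) (\<lambda>t. grid_step T m h t - grid_step T n h t) \<le> e"
      by blast
    show "\<exists>K. \<forall>m\<ge>K. \<forall>n\<ge>K. L2_norm_of M (\<lambda>w. stepI T m (grid_avg T m h) a b w - stepI T n (grid_avg T n h) a b w) \<le> e"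
      using K stepI_diff_norm_le[OF T ab] by (intro exI[of _ K]) (meson order_trans)
  qed
  from someI_ex[OF this]
  show "L2_tendsto M (\<lambda>N. stepI T N (grid_avg T N h) a b) (winc T h a b)"
    "winc T h a b \<in> borel_measurable (\<F> b)"
    unfolding winc_def[symmetric] by auto
qed

definition wvar :: "real \<Rightarrow> (real \<Rightarrow> real) \<Rightarrow> real \<Rightarrow> real \<Rightarrow> real" where
  "wvar T h a b = (\<integral>t. indicator {a<..b} t * (h t)\<^sup>2 \<partial>time_measure T)"

lemma wvar_nonneg: "0 \<le> wvar T h a b"
  unfolding wvar_def by (rule Bochner_Integration.integral_nonneg) (auto split: split_indicator)

text \<open>Both sides are the second moment of the step integral, computed from its Gaussian law
  and from the isometry. The isometry is applied against the empty grid, whose integral is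
  0.\<close>

lemma step_var_grid_avg:
  assumes T: "0 < T" and ab: "0 \<le> a" "a \<le> b" "b \<le> T"
  shows "step_var T N (grid_avg T N h) a b = (\<integral>t. indicator {a<..b} t * (grid_step T N h t)\<^sup>2 \<partial>time_measure T)"
proof -
  have "(\<integral>w. (stepI T N (grid_avg T N h) a b w)\<^sup>2 \<partial>M)
    = (\<integral>z. (sqrt (step_var T N (grid_avg T N h) a b) * z)\<^sup>2 \<partial>std_gauss)"
    by (rule gauss_indep_integral(1)[OF F_subalgebra stepI_gauss_indep[OF T ab(1,2)]]) simp
  also have "\<dots> = step_var T N (grid_avg T N h) a b"
    using step_var_nonneg[of T N "grid_avg T N h" a b] T by (simp add: power_mult_distrib std_gauss_moments)
  finally show ?thesis
    using stepI_isometry[OF T ab, of N h 0 h] by (simp add: stepI_def[of _ 0] grid_step_def[of _ 0])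
qed

text \<open>The characteristic functions of the step integrals, tested on \<open>A\<close>, converge
  along an almost surely convergent subsequence, while the variances converge with the norms of the
  step functions.\<close>

lemma winc_gauss_indep:
  assumes T: "0 < T" and h: "h \<in> L2_space (time_measure T)" and ab: "0 \<le> a" "a \<le> b" "b \<le> T"
  shows "gauss_indep M (\<F> a) (winc T h a b) (sqrt (wvar T h a b))"
proof (rule gauss_indepI_char[OF F_subalgebra F_measurable_M[OF winc_F[OF assms]]])
  fix A u assume A: "A \<in> sets (\<F> a)"
  then have AM[measurable]: "A \<in> events" using F_subalgebra by (auto simp: subalgebra_def)
  let ?X = "\<lambda>N. stepI T N (grid_avg T N h) a b"
  note lim = winc_tendsto[OF assms]
  have [measurable]: "?X N \<in> borel_measurable M" "winc T h a b \<in> borel_measurable M" for N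
    using F_measurable_M[OF winc_F[OF assms]] F_measurable_M[OF stepI_F[OF ab(1,2)]] by auto
  obtain r where r: "strict_mono r" "AE w in M. (\<lambda>k. ?X (r k) w) \<longlonglongrightarrow> winc T h a b w"
    using L2_tendsto_AE_subseq[OF lim] by blast
  have 1: "(\<lambda>k. \<integral>w. indicator A w *\<^sub>R iexp (u * ?X (r k) w) \<partial>M) \<longlonglongrightarrow> (\<integral>w. indicator A w *\<^sub>R iexp (u * winc T h a b w) \<partial>M)"
  proof (rule integral_dominated_convergence[where w="\<lambda>_. 1"])
    show "AE w in M. (\<lambda>k. indicator A w *\<^sub>R iexp (u * ?X (r k) w)) \<longlonglongrightarrow> indicator A w *\<^sub>R iexp (u * winc T h a b w)"
      using r(2) by eventually_elim (intro tendsto_intros)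
    show "AE w in M. norm (indicator A w *\<^sub>R iexp (u * ?X (r k) w)) \<le> 1" for k
      by (intro AE_I2) (auto split: split_indicator)
  qed auto
  have v: "(\<lambda>N. step_var T N (grid_avg T N h) a b) \<longlonglongrightarrow> wvar T h a b"
  proof -
    have "L2_tendsto (time_measure T) (\<lambda>N t. indicator {a<..b} t * grid_step T N h t) (\<lambda>t. indicator {a<..b} t * h t)"
      by (rule L2_tendsto_bounded_mult[OF grid_approx_L2[OF T h, unfolded grid_approx_def], where B=1])
        (auto simp: measurable_restrict_space1 split: split_indicator)
    from L2_tendsto_norm2[OF this]
    have "(\<lambda>N. \<integral>t. (indicator {a<..b} t * grid_step T N h t)\<^sup>2 \<partial>time_measure T) \<longlonglongrightarrow> (\<integral>t. (indicator {a<..b} t * h t)\<^sup>2 \<partial>time_measure T)" .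
    moreover have "(\<lambda>t. (indicator {a<..b} t * f t)\<^sup>2) = (\<lambda>t. indicator {a<..b} t * (f t :: real)\<^sup>2)" for f
      by (auto split: split_indicator)
    ultimately show ?thesis by (simp add: step_var_grid_avg[OF T ab] wvar_def)
  qed
  have "(\<lambda>k. complex_of_real (prob A * exp (- (u\<^sup>2 * step_var T (r k) (grid_avg T (r k) h) a b) / 2)))
      \<longlonglongrightarrow> complex_of_real (prob A * exp (- (u\<^sup>2 * wvar T h a b) / 2))"
    using LIMSEQ_subseq_LIMSEQ[OF v r(1)] by (intro tendsto_intros) (auto simp: comp_def)
  moreover have "(\<integral>w. indicator A w *\<^sub>R iexp (u * ?X N w) \<partial>M)
     = complex_of_real (prob A * exp (- (u\<^sup>2 * step_var T N (grid_avg T N h) a b) / 2))" for N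
  proof -
    have Am: "(\<lambda>w. complex_of_real (indicator A w)) \<in> borel_measurable (\<F> a)" using A by measurable
    have "(\<integral>w. complex_of_real (indicator A w) * iexp (u * ?X N w) \<partial>M)
      = (\<integral>w. complex_of_real (indicator A w) \<partial>M) * exp (- ((u * sqrt (step_var T N (grid_avg T N h) a b))\<^sup>2) / 2)"
      by (rule gauss_indep_char[OF F_subalgebra stepI_gauss_indep[OF T ab(1,2)] Am]) (auto split: split_indicator)
    moreover have "(\<integral>w. complex_of_real (indicator A w) \<partial>M) = complex_of_real (prob A)"
      by (simp add: Int_absorb2 sets.sets_into_space)
    ultimately show ?thesis
      using step_var_nonneg[of T N "grid_avg T N h" a b] T by (simp add: scaleR_conv_of_real power_mult_distrib)
  qed
  ultimately have 2: "(\<lambda>k. \<integral>w. indicator A w *\<^sub>R iexp (u * ?X (r k) w) \<partial>M)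
     \<longlonglongrightarrow> complex_of_real (prob A * exp (- (u\<^sup>2 * wvar T h a b) / 2))" by simp
  have "(\<integral>w. indicator A w *\<^sub>R iexp (u * winc T h a b w) \<partial>M) = complex_of_real (prob A * exp (- (u\<^sup>2 * wvar T h a b) / 2))"
    by (rule LIMSEQ_unique[OF 1 2])
  then show "(\<integral>w. indicator A w *\<^sub>R iexp (u * winc T h a b w) \<partial>M)
      = complex_of_real (prob A * exp (- ((u * sqrt (wvar T h a b))\<^sup>2) / 2))"
    using wvar_nonneg by (simp add: power_mult_distrib)
qed

text \<open>At every grid point, \<open>W\<close> at the point clipped to the whole interval is the
  sum of \<open>W\<close> at the points clipped to its two parts, minus \<open>W a\<close>; the last
  term cancels in the increments.\<close>

lemma stepI_split:
  assumes T: "0 < T" and a: "0 \<le> a" "a \<le> b"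
  shows "stepI T N c 0 b w = stepI T N c 0 a w + stepI T N c a b w"
proof -
  have e: "W (clip 0 b x) w = W (clip 0 a x) w + W (clip a b x) w - W a w" if "0 \<le> x" for x
    using that a by (cases "x \<le> a") (auto simp: clip_def)
  have "0 \<le> grid T N l" for l using T by (intro grid_nonneg) simp
  then show ?thesis
    unfolding stepI_def sum.distrib[symmetric] by (intro sum.cong refl) (simp add: e algebra_simps)
qed

lemma winc_split:
  assumes T: "0 < T" and h: "h \<in> L2_space (time_measure T)" and a: "0 \<le> a" "a \<le> b" "b \<le> T"
  shows "AE w in M. winc T h 0 b w = winc T h 0 a w + winc T h a b w"
proof -
  have "L2_tendsto M (\<lambda>N. stepI T N (grid_avg T N h) 0 b) (winc T h 0 b)"
    using T a by (intro winc_tendsto h) auto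
  moreover have "L2_tendsto M (\<lambda>N. stepI T N (grid_avg T N h) 0 b) (\<lambda>w. winc T h 0 a w + winc T h a b w)"
    using L2_tendsto_add[OF winc_tendsto[OF T h] winc_tendsto[OF T h], of 0 a a b] a
    by (simp add: stepI_split[OF T a(1,2), symmetric])
  ultimately show ?thesis by (rule L2_tendsto_unique)
qed

lemma stepI_full:
  assumes T: "0 < T"
  shows "stepI T N c 0 T w = (\<Sum>l<N. c l * (W (grid T N (Suc l)) w - W (grid T N l) w))"
  unfolding stepI_def
proof (rule sum.cong[OF refl])
  fix l assume l: "l \<in> {..<N}"
  have "clip 0 T (grid T N m) = grid T N m" if "m \<le> N" for m
    using grid_nonneg[of T N m] grid_le[of T m N] that l T by (auto simp: clip_def)
  then show "c l * (W (clip 0 T (grid T N (Suc l))) w - W (clip 0 T (grid T N l)) w) = c l * (W (grid T N (Suc l)) w - W (grid T N l) w)"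
    using l by simp
qed

section \<open>Identification of the chosen Wiener integral\<close>

lemma is_wiener_integral_winc:
  assumes T: "0 < T" and h: "h \<in> L2_space (time_measure T)"
  shows "is_wiener_integral M W T h (winc T h 0 T)"
  unfolding is_wiener_integral_def
proof (rule exI[of _ "\<lambda>k. k"], rule exI[of _ "grid T"], rule exI[of _ "\<lambda>k. grid_avg T k h"], intro conjI allI)
  fix k
  show "0 \<le> grid T k 0" by simp
  show "j < k \<longrightarrow> grid T k j < grid T k (Suc j)" for j using T by (auto intro: grid_strict)
  show "grid T k k \<le> T" using T grid_end[of k T] by (cases "k = 0") auto
next
  show "L2_tendsto (time_measure T) (\<lambda>k t. \<Sum>j<k. grid_avg T k h j * indicator {grid T k j<..grid T k (Suc j)} t) h"
    using grid_approx_L2[OF T h] by (simp add: grid_approx_def grid_step_def[abs_def])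
  have "L2_tendsto M (\<lambda>N. stepI T N (grid_avg T N h) 0 T) (winc T h 0 T)"
    using T by (intro winc_tendsto h) auto
  moreover have "stepI T k c 0 T = (\<lambda>w. \<Sum>j<k. c j * (W (grid T k (Suc j)) w - W (grid T k j) w))" for k c
    by (rule ext) (rule stepI_full[OF T])
  ultimately show "L2_tendsto M (\<lambda>k w. \<Sum>j<k. grid_avg T k h j * (W (grid T k (Suc j)) w - W (grid T k j) w)) (winc T h 0 T)"
    by (simp only:)
qed

text \<open>By the isometry, the integrals of any admissible sequence of step functions are as close
  to the canonical ones as the step functions themselves, and both sequences of step functions
  converge to \<open>h\<close>. Hence every choice in \<open>wiener_integral\<close> has the same
  class.\<close>

lemma is_wiener_integral_tendsto:
  assumes T: "0 < T" and h: "h \<in> L2_space (time_measure T)" and I: "is_wiener_integral M W T h I"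
  shows "L2_tendsto M (\<lambda>N. stepI T N (grid_avg T N h) 0 T) I"
proof -
  obtain m :: "nat \<Rightarrow> nat" and \<tau> c :: "nat \<Rightarrow> nat \<Rightarrow> real" where
    \<tau>: "\<And>k. 0 \<le> \<tau> k 0" "\<And>k j. j < m k \<Longrightarrow> \<tau> k j < \<tau> k (Suc j)" "\<And>k. \<tau> k (m k) \<le> T"
    and t: "L2_tendsto (time_measure T) (\<lambda>k t. \<Sum>j<m k. c k j * indicator {\<tau> k j<..\<tau> k (Suc j)} t) h"
    and S: "L2_tendsto M (\<lambda>k w. \<Sum>j<m k. c k j * (W (\<tau> k (Suc j)) w - W (\<tau> k j) w)) I"
    using I unfolding is_wiener_integral_def by blast
  let ?\<phi> = "\<lambda>k t. \<Sum>j<m k. c k j * indicator {\<tau> k j<..\<tau> k (Suc j)} t :: real"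
  let ?S = "\<lambda>k w. \<Sum>j<m k. c k j * (W (\<tau> k (Suc j)) w - W (\<tau> k j) w)"
  let ?X = "\<lambda>N. stepI T N (grid_avg T N h) 0 T"
  have mono: "\<tau> k i \<le> \<tau> k j" if "i \<le> j" "j \<le> m k" for k i j
    using that
  proof (induction j)
    case (Suc j)
    then show ?case using \<tau>(2)[of j k] by (cases "i = Suc j") auto
  qed auto
  have bd: "0 \<le> \<tau> k j" "\<tau> k j \<le> T" if "j \<le> m k" for k j
    using mono[of 0 j k] mono[of j "m k" k] \<tau>(1)[of k] \<tau>(3)[of k] that by auto
  have iso: "L2_norm_of M (\<lambda>w. ?X k w - ?S k w) = L2_norm_of (time_measure T) (\<lambda>t. grid_step T k h t - ?\<phi> k t)" for k
  proof -
    have "(\<integral>w. (?X k w - ?S k w)\<^sup>2 \<partial>M) = (\<integral>t. (grid_step T k h t - ?\<phi> k t)\<^sup>2 \<partial>lborel)"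
      unfolding stepI_full[OF T] grid_step_def
    proof (rule step_isometry)
      show "0 \<le> grid T k i" "grid T k i \<le> grid T k (Suc i)" for i
        using T by (auto intro: grid_nonneg grid_mono)
    qed (use bd \<tau>(2) in \<open>auto intro: less_imp_le\<close>)
    \<comment> \<open>Both step functions vanish outside the interval from 0 to \<open>T\<close>,
      which permits the change from Lebesgue measure to \<open>time_measure T\<close>.\<close>
    also have "\<dots> = (\<integral>t. indicator {0<..T} t * (grid_step T k h t - ?\<phi> k t)\<^sup>2 \<partial>lborel)"
    proof (intro Bochner_Integration.integral_cong refl)
      fix t
      have "grid_step T k h t = 0 \<and> ?\<phi> k t = 0" if "t \<notin> {0<..T}"
      proof
        show "grid_step T k h t = 0"
          unfolding grid_step_def
        proof (intro sum.neutral ballI)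
          fix l assume "l \<in> {..<k}"
          then show "grid_avg T k h l * indicator (cell T k l) t = 0"
            using that grid_nonneg[of T k l] grid_le[of T "Suc l" k] T by (auto split: split_indicator)
        qed
        show "?\<phi> k t = 0"
        proof (intro sum.neutral ballI)
          fix j assume "j \<in> {..<m k}"
          then show "c k j * indicator {\<tau> k j<..\<tau> k (Suc j)} t = 0"
            using that bd[of j k] bd[of "Suc j" k] by (auto split: split_indicator)
        qed
      qed
      then show "(grid_step T k h t - ?\<phi> k t)\<^sup>2 = indicator {0<..T} t * (grid_step T k h t - ?\<phi> k t)\<^sup>2"
        by (cases "t \<in> {0<..T}") auto
    qed
    also have "\<dots> = (\<integral>t. indicator {0<..T} t * (grid_step T k h t - ?\<phi> k t)\<^sup>2 \<partial>time_measure T)"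
      by (rule interval_lborel_time) auto
    also have "\<dots> = (\<integral>t. (grid_step T k h t - ?\<phi> k t)\<^sup>2 \<partial>time_measure T)"
    proof (rule integral_cong_AE)
      have "AE t in time_measure T. t \<in> {0..T}" by (rule AE_I2) (simp add: space_restrict_space)
      with AE_time_measure_neq[where c=0 and T=T]
      show "AE t in time_measure T. indicator {0<..T} t * (grid_step T k h t - ?\<phi> k t)\<^sup>2 = (grid_step T k h t - ?\<phi> k t)\<^sup>2"
        by eventually_elim auto
      show "(\<lambda>t. indicator {0<..T} t * (grid_step T k h t - ?\<phi> k t)\<^sup>2) \<in> borel_measurable (time_measure T)"
        by (rule measurable_restrict_space1) measurable
      show "(\<lambda>t. (grid_step T k h t - ?\<phi> k t)\<^sup>2) \<in> borel_measurable (time_measure T)"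
        by (rule measurable_restrict_space1) measurable
    qed
    finally show ?thesis by (simp only: L2_norm_of_def)
  qed
  have "L2_tendsto (time_measure T) (\<lambda>k t. grid_step T k h t - ?\<phi> k t) (\<lambda>t. h t - h t)"
    by (rule L2_tendsto_diff[OF grid_approx_L2[OF T h, unfolded grid_approx_def] t])
  then have "(\<lambda>k. L2_norm_of (time_measure T) (\<lambda>t. grid_step T k h t - ?\<phi> k t)) \<longlonglongrightarrow> 0"
    using L2_tendstoD(3) by fastforce
  then have "L2_tendsto M (\<lambda>k w. ?X k w - ?S k w) (\<lambda>w. 0)"
    using stepI_L2[OF T order_refl] T L2_tendstoD(1)[OF S] unfolding iso[symmetric] L2_tendsto_def
    by (auto simp: L2_space_zero intro: L2_space_diff)
  from L2_tendsto_add[OF this S] show ?thesis by simp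
qed

lemma wiener_integral_tendsto:
  assumes T: "0 < T" and h: "h \<in> L2_space (time_measure T)"
  shows "L2_tendsto M (\<lambda>N. stepI T N (grid_avg T N h) 0 T) (wiener_integral M W T h)"
proof -
  have "is_wiener_integral M W T h (wiener_integral M W T h)"
    unfolding wiener_integral_def by (rule someI[where P="is_wiener_integral M W T h", OF is_wiener_integral_winc[OF assms]])
  then show ?thesis by (rule is_wiener_integral_tendsto[OF assms])
qed

lemma wiener_integral_winc:
  assumes T: "0 < T" and h: "h \<in> L2_space (time_measure T)"
  shows "AE w in M. wiener_integral M W T h w = winc T h 0 T w"
  by (rule L2_tendsto_unique[OF wiener_integral_tendsto[OF assms]]) (use T in \<open>auto intro!: winc_tendsto h\<close>)

end

section \<open>Smooth functions of several variables along a line\<close>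

lemma tendsto_fun_pointwise:
  fixes f :: "'a \<Rightarrow> 'b \<Rightarrow> 'c :: topological_space"
  assumes "\<And>j. ((\<lambda>a. f a j) \<longlongrightarrow> l j) F"
  shows "(f \<longlongrightarrow> l) F"
proof -
  have "limitin (product_topology (\<lambda>i. euclidean) UNIV) f l F"
    unfolding limitin_componentwise using assms by simp
  then show ?thesis by (simp add: euclidean_product_topology)
qed

text \<open>\<open>a\<close> and \<open>b\<close> may come in any order or coincide; the bound on
  \<xi> is what the later passage to the limit needs.\<close>

lemma MVT_between:
  fixes \<phi> \<phi>' :: "real \<Rightarrow> real"
  assumes "\<And>s. (\<phi> has_real_derivative \<phi>' s) (at s)"
  shows "\<exists>\<xi>. \<bar>\<xi> - a\<bar> \<le> \<bar>b - a\<bar> \<and> \<phi> b - \<phi> a = (b - a) * \<phi>' \<xi>"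
proof -
  consider "a < b" | "b < a" | "a = b" by linarith
  then show ?thesis
  proof cases
    case 1
    from MVT2[OF 1, of \<phi> \<phi>'] assms obtain z where "z > a" "z < b" "\<phi> b - \<phi> a = (b - a) * \<phi>' z" by blast
    then show ?thesis by (intro exI[of _ z]) auto
  next
    case 2
    from MVT2[OF 2, of \<phi> \<phi>'] assms obtain z where "z > b" "z < a" "\<phi> a - \<phi> b = (a - b) * \<phi>' z" by blast
    then show ?thesis by (intro exI[of _ z]) (auto simp: algebra_simps)
  qed auto
qed

lemma smooth_poly_growthD:
  assumes "smooth_poly_growth n f"
  shows "(\<And>j. j < n \<Longrightarrow> x j = y j) \<Longrightarrow> f x = f y"
    and "continuous_on UNIV f"
    and "i < n \<Longrightarrow> continuous_on UNIV (partial_deriv i f)"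
    and "i < n \<Longrightarrow> ((\<lambda>s. f (z(i := s))) has_real_derivative partial_deriv i f (z(i := s))) (at s)"
    and "\<exists>C p. \<forall>x. \<bar>f x\<bar> \<le> C * (1 + (\<Sum>j<n. \<bar>x j\<bar>)) ^ p"
    and "i < n \<Longrightarrow> \<exists>C p. \<forall>x. \<bar>partial_deriv i f x\<bar> \<le> C * (1 + (\<Sum>j<n. \<bar>x j\<bar>)) ^ p"
proof -
  have dep: "\<forall>x y. (\<forall>j<n. x j = y j) \<longrightarrow> f x = f y"
    and it: "\<And>ks. set ks \<subseteq> {..<n} \<Longrightarrow> continuous_on UNIV (foldr partial_deriv ks f) \<and>
        (\<forall>i<n. \<forall>x. (\<lambda>y. foldr partial_deriv ks f (x(i := y))) differentiable (at (x i))) \<and>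
        (\<exists>C (p::nat). \<forall>x. \<bar>foldr partial_deriv ks f x\<bar> \<le> C * (1 + (\<Sum>j<n. \<bar>x j\<bar>)) ^ p)"
    using assms unfolding smooth_poly_growth_def by blast+
  show "(\<And>j. j < n \<Longrightarrow> x j = y j) \<Longrightarrow> f x = f y" using dep by blast
  show "continuous_on UNIV f" using it[of "[]"] by simp
  show "i < n \<Longrightarrow> continuous_on UNIV (partial_deriv i f)" using it[of "[i]"] by simp
  show "\<exists>C p. \<forall>x. \<bar>f x\<bar> \<le> C * (1 + (\<Sum>j<n. \<bar>x j\<bar>)) ^ p" using it[of "[]"] by simp
  show "i < n \<Longrightarrow> \<exists>C p. \<forall>x. \<bar>partial_deriv i f x\<bar> \<le> C * (1 + (\<Sum>j<n. \<bar>x j\<bar>)) ^ p" using it[of "[i]"] by simp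
  assume i: "i < n"
  have "(\<lambda>y. f ((z(i := s))(i := y))) differentiable (at ((z(i := s)) i))"
    using it[of "[]"] i by (simp only: foldr.simps id_apply list.set empty_subsetI)
  then have "(\<lambda>y. f (z(i := y))) differentiable (at s)" by simp
  then have "((\<lambda>y. f (z(i := y))) has_real_derivative deriv (\<lambda>y. f (z(i := y))) s) (at s)"
    using DERIV_deriv_iff_real_differentiable by blast
  then show "((\<lambda>s. f (z(i := s))) has_real_derivative partial_deriv i f (z(i := s))) (at s)"
    by (simp add: partial_deriv_def)
qed

text \<open>The coordinates are moved one at a time and the mean value theorem is applied to each.
  The intermediate points tend to the base point coordinatewise, that is in the product topology, in
  which the partial derivatives are continuous.\<close>

lemma smooth_line_derivative:
  fixes f :: "(nat \<Rightarrow> real) \<Rightarrow> real"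
  assumes f: "smooth_poly_growth n f"
  shows "((\<lambda>v. f (\<lambda>j. x j + \<alpha> j * v)) has_real_derivative
     (\<Sum>i<n. \<alpha> i * partial_deriv i f (\<lambda>j. x j + \<alpha> j * v))) (at v)"
proof -
  define y where "y j = x j + \<alpha> j * v" for j
  \<comment> \<open>The point at which the coordinates below \<open>i\<close> have been moved and
    the others not yet.\<close>
  define Y where "Y i e j = (if j < i then y j + \<alpha> j * e else y j)" for i :: nat and e and j :: nat
  have "\<exists>\<xi>. \<bar>\<xi> - y i\<bar> \<le> \<bar>(y i + \<alpha> i * e) - y i\<bar> \<and>
     f ((Y i e)(i := y i + \<alpha> i * e)) - f ((Y i e)(i := y i)) = ((y i + \<alpha> i * e) - y i) * partial_deriv i f ((Y i e)(i := \<xi>))"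
    if "i < n" for i e
    by (rule MVT_between) (rule smooth_poly_growthD(4)[OF f that])
  then obtain \<xi> where \<xi>: "\<And>i e. i < n \<Longrightarrow> \<bar>\<xi> i e - y i\<bar> \<le> \<bar>\<alpha> i * e\<bar>"
    "\<And>i e. i < n \<Longrightarrow> f ((Y i e)(i := y i + \<alpha> i * e)) - f ((Y i e)(i := y i)) = \<alpha> i * e * partial_deriv i f ((Y i e)(i := \<xi> i e))"
    by (simp, metis)
  have Ys: "(Y i e)(i := y i + \<alpha> i * e) = Y (Suc i) e" "(Y i e)(i := y i) = Y i e" for i e
    by (auto simp: Y_def fun_eq_iff less_Suc_eq)
  have tel: "f (\<lambda>j. y j + \<alpha> j * e) - f y = (\<Sum>i<n. \<alpha> i * e * partial_deriv i f ((Y i e)(i := \<xi> i e)))" for e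
  proof -
    \<comment> \<open>The two points differ from coordinate \<open>n\<close> on, where
      \<open>f\<close> does not depend on its argument.\<close>
    have "f (\<lambda>j. y j + \<alpha> j * e) = f (Y n e)"
      by (rule smooth_poly_growthD(1)[OF f]) (simp add: Y_def)
    moreover have "f y = f (Y 0 e)" by (rule arg_cong[where f=f]) (simp add: Y_def fun_eq_iff)
    ultimately have "f (\<lambda>j. y j + \<alpha> j * e) - f y = (\<Sum>i<n. f (Y (Suc i) e) - f (Y i e))"
      by (simp only: sum_lessThan_telescope[of "\<lambda>i. f (Y i e)"])
    also have "\<dots> = (\<Sum>i<n. \<alpha> i * e * partial_deriv i f ((Y i e)(i := \<xi> i e)))"
    proof (rule sum.cong[OF refl])
      fix i assume "i \<in> {..<n}"
      then have i: "i < n" by simp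
      show "f (Y (Suc i) e) - f (Y i e) = \<alpha> i * e * partial_deriv i f ((Y i e)(i := \<xi> i e))"
        using \<xi>(2)[OF i, of e] unfolding Ys .
    qed
    finally show ?thesis .
  qed
  have lim: "((\<lambda>e. (Y i e)(i := \<xi> i e)) \<longlongrightarrow> y) (at 0)" if i: "i < n" for i
  proof (rule tendsto_fun_pointwise)
    fix j
    have "((\<lambda>e. \<bar>\<alpha> j\<bar> * \<bar>e\<bar>) \<longlongrightarrow> \<bar>\<alpha> j\<bar> * \<bar>0\<bar>) (at 0)" by (intro tendsto_intros)
    then have l0: "((\<lambda>e. \<bar>\<alpha> j\<bar> * \<bar>e\<bar>) \<longlongrightarrow> 0) (at 0)" by simp
    have "\<bar>((Y i e)(i := \<xi> i e)) j - y j\<bar> \<le> \<bar>\<alpha> j\<bar> * \<bar>e\<bar>" for e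
      using \<xi>(1)[OF i, of e] by (cases "j = i") (auto simp: Y_def abs_mult)
    then have "((\<lambda>e. ((Y i e)(i := \<xi> i e)) j - y j) \<longlongrightarrow> 0) (at 0)"
      by (intro Lim_null_comparison[OF _ l0] always_eventually) simp
    then show "((\<lambda>e. ((Y i e)(i := \<xi> i e)) j) \<longlongrightarrow> y j) (at 0)" by (rule LIM_zero_cancel)
  qed
  have "((\<lambda>e. \<Sum>i<n. \<alpha> i * partial_deriv i f ((Y i e)(i := \<xi> i e))) \<longlongrightarrow> (\<Sum>i<n. \<alpha> i * partial_deriv i f y)) (at 0)"
  proof (intro tendsto_sum tendsto_mult tendsto_const)
    fix i assume "i \<in> {..<n}"
    then have i: "i < n" by simp
    have "isCont (partial_deriv i f) y"
      using smooth_poly_growthD(3)[OF f i] by (simp add: continuous_on_eq_continuous_at)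
    then show "((\<lambda>e. partial_deriv i f ((Y i e)(i := \<xi> i e))) \<longlongrightarrow> partial_deriv i f y) (at 0)"
      using lim[OF i] by (rule isCont_tendsto_compose)
  qed
  then have "((\<lambda>e. (f (\<lambda>j. y j + \<alpha> j * e) - f y) / e) \<longlongrightarrow> (\<Sum>i<n. \<alpha> i * partial_deriv i f y)) (at 0)"
  proof (rule Lim_transform_eventually)
    show "\<forall>\<^sub>F e in at 0. (\<Sum>i<n. \<alpha> i * partial_deriv i f ((Y i e)(i := \<xi> i e))) = (f (\<lambda>j. y j + \<alpha> j * e) - f y) / e"
      unfolding tel by (auto simp: eventually_at_filter sum_divide_distrib intro!: always_eventually sum.cong)
  qed
  then show ?thesis
    unfolding DERIV_def y_def by (simp add: algebra_simps)
qed

lemma poly_weight_line: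
  fixes x \<alpha> :: "nat \<Rightarrow> real"
  shows "(1 + (\<Sum>j<n. \<bar>x j + \<alpha> j * v\<bar>)) ^ p \<le> (1 + (\<Sum>j<n. \<bar>x j\<bar>) + (\<Sum>j<n. \<bar>\<alpha> j\<bar>)) ^ p * (1 + \<bar>v\<bar>) ^ p"
proof -
  let ?a = "\<Sum>j<n. \<bar>x j\<bar>" and ?b = "\<Sum>j<n. \<bar>\<alpha> j\<bar>"
  have "(\<Sum>j<n. \<bar>x j + \<alpha> j * v\<bar>) \<le> (\<Sum>j<n. \<bar>x j\<bar> + \<bar>\<alpha> j\<bar> * \<bar>v\<bar>)"
    by (intro sum_mono) (auto simp: abs_mult[symmetric])
  also have "\<dots> = ?a + ?b * \<bar>v\<bar>" by (simp add: sum.distrib sum_distrib_right)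
  finally have "1 + (\<Sum>j<n. \<bar>x j + \<alpha> j * v\<bar>) \<le> 1 + (?a + ?b * \<bar>v\<bar>)" by simp
  also have "\<dots> \<le> (1 + ?a + ?b) * (1 + \<bar>v\<bar>)"
    by (simp add: algebra_simps sum_nonneg mult_nonneg_nonneg add_nonneg_nonneg)
  finally have "(1 + (\<Sum>j<n. \<bar>x j + \<alpha> j * v\<bar>)) ^ p \<le> ((1 + ?a + ?b) * (1 + \<bar>v\<bar>)) ^ p"
    by (intro power_mono) (auto intro!: add_nonneg_nonneg sum_nonneg)
  then show ?thesis by (simp only: power_mult_distrib)
qed

text \<open>Gaussian integration by parts in one direction \<alpha>. The growth bounds for
  \<open>f\<close> and its partial derivatives are inherited by their restrictions to the line, with
  constants depending on \<open>x\<close> and \<alpha>.\<close>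

lemma Stein_line:
  fixes f :: "(nat \<Rightarrow> real) \<Rightarrow> real"
  assumes f: "smooth_poly_growth n f"
  shows "(\<integral>z. (\<sigma> * z) * f (\<lambda>j. x j + \<alpha> j * (\<sigma> * z)) \<partial>std_gauss)
     = \<sigma>\<^sup>2 * (\<integral>z. (\<Sum>i<n. \<alpha> i * partial_deriv i f (\<lambda>j. x j + \<alpha> j * (\<sigma> * z))) \<partial>std_gauss)"
proof -
  let ?D = "\<lambda>z. \<Sum>i<n. (\<alpha> i * \<sigma>) * partial_deriv i f (\<lambda>j. x j + (\<alpha> j * \<sigma>) * z)"
  obtain C p where C: "\<And>x. \<bar>f x\<bar> \<le> C * (1 + (\<Sum>j<n. \<bar>x j\<bar>)) ^ p"
    using smooth_poly_growthD(5)[OF f] by blast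
  have "\<exists>C p. \<forall>x. \<bar>partial_deriv i f x\<bar> \<le> C * (1 + (\<Sum>j<n. \<bar>x j\<bar>)) ^ p" if "i < n" for i
    using smooth_poly_growthD(6)[OF f that] .
  then obtain C' p' where C': "\<And>i x. i < n \<Longrightarrow> \<bar>partial_deriv i f x\<bar> \<le> C' i * (1 + (\<Sum>j<n. \<bar>x j\<bar>)) ^ p' i"
    by metis
  let ?K = "1 + (\<Sum>j<n. \<bar>x j\<bar>) + (\<Sum>j<n. \<bar>\<alpha> j * \<sigma>\<bar>)"
  have C0: "0 \<le> C" using C[of "\<lambda>_. 0"] by (auto intro: order_trans[OF abs_ge_zero])
  have C'0: "0 \<le> C' i" if "i < n" for i using C'[OF that, of "\<lambda>_. 0"] by (auto intro: order_trans[OF abs_ge_zero])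
  \<comment> \<open>A common exponent, at least as large as each \<open>p' i\<close>.\<close>
  define q where "q = (\<Sum>i<n. p' i)"
  have "(\<integral>z. z * f (\<lambda>j. x j + (\<alpha> j * \<sigma>) * z) \<partial>std_gauss) = (\<integral>z. ?D z \<partial>std_gauss)"
  proof (rule Stein_std_gauss)
    show "((\<lambda>z. f (\<lambda>j. x j + (\<alpha> j * \<sigma>) * z)) has_real_derivative ?D z) (at z)" for z
      by (rule smooth_line_derivative[OF f])
    show "continuous_on UNIV ?D"
    proof (intro continuous_intros)
      fix i assume "i \<in> {..<n}"
      then have c: "continuous_on UNIV (partial_deriv i f)" using smooth_poly_growthD(3)[OF f] by simp
      show "continuous_on UNIV (\<lambda>z. partial_deriv i f (\<lambda>j. x j + (\<alpha> j * \<sigma>) * z))"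
        by (rule continuous_on_compose2[OF c]) (auto intro!: continuous_intros)
    qed
    show "\<bar>f (\<lambda>j. x j + (\<alpha> j * \<sigma>) * z)\<bar> \<le> (C * ?K ^ p) * (1 + \<bar>z\<bar>) ^ p" for z
      using order_trans[OF C mult_left_mono[OF poly_weight_line C0], of x "\<lambda>j. \<alpha> j * \<sigma>" z]
      by (simp add: mult.assoc)
    show "\<bar>?D z\<bar> \<le> (\<Sum>i<n. \<bar>\<alpha> i * \<sigma>\<bar> * (C' i * ?K ^ p' i)) * (1 + \<bar>z\<bar>) ^ q" for z
    proof -
      have "\<bar>?D z\<bar> \<le> (\<Sum>i<n. \<bar>\<alpha> i * \<sigma>\<bar> * \<bar>partial_deriv i f (\<lambda>j. x j + (\<alpha> j * \<sigma>) * z)\<bar>)"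
        by (rule order_trans[OF sum_abs]) (simp add: abs_mult)
      also have "\<dots> \<le> (\<Sum>i<n. \<bar>\<alpha> i * \<sigma>\<bar> * ((C' i * ?K ^ p' i) * (1 + \<bar>z\<bar>) ^ q))"
      proof (intro sum_mono mult_left_mono)
        fix i assume "i \<in> {..<n}"
        then have i: "i < n" by simp
        have "p' i \<le> q" unfolding q_def using i by (intro member_le_sum) auto
        then have pq: "(1 + \<bar>z\<bar>) ^ p' i \<le> (1 + \<bar>z\<bar>) ^ q" by (intro power_increasing) auto
        have "\<bar>partial_deriv i f (\<lambda>j. x j + (\<alpha> j * \<sigma>) * z)\<bar> \<le> C' i * (?K ^ p' i * (1 + \<bar>z\<bar>) ^ p' i)"
          using order_trans[OF C'[OF i] mult_left_mono[OF poly_weight_line C'0[OF i]], of x "\<lambda>j. \<alpha> j * \<sigma>" z] .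
        also have "\<dots> \<le> C' i * (?K ^ p' i * (1 + \<bar>z\<bar>) ^ q)"
          by (intro mult_left_mono pq C'0 i) (auto intro!: add_nonneg_nonneg sum_nonneg)
        finally show "\<bar>partial_deriv i f (\<lambda>j. x j + (\<alpha> j * \<sigma>) * z)\<bar> \<le> (C' i * ?K ^ p' i) * (1 + \<bar>z\<bar>) ^ q"
          by (simp only: mult.assoc)
      qed auto
      also have "\<dots> = (\<Sum>i<n. \<bar>\<alpha> i * \<sigma>\<bar> * (C' i * ?K ^ p' i)) * (1 + \<bar>z\<bar>) ^ q"
        by (simp only: sum_distrib_right mult.assoc)
      finally show ?thesis .
    qed
  qed
  moreover have "(\<integral>z. (\<sigma> * z) * f (\<lambda>j. x j + \<alpha> j * (\<sigma> * z)) \<partial>std_gauss) = \<sigma> * (\<integral>z. z * f (\<lambda>j. x j + (\<alpha> j * \<sigma>) * z) \<partial>std_gauss)"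
    by (simp add: mult.assoc)
  moreover have "(\<integral>z. ?D z \<partial>std_gauss) = \<sigma> * (\<integral>z. (\<Sum>i<n. \<alpha> i * partial_deriv i f (\<lambda>j. x j + \<alpha> j * (\<sigma> * z))) \<partial>std_gauss)"
  proof -
    have "?D z = \<sigma> * (\<Sum>i<n. \<alpha> i * partial_deriv i f (\<lambda>j. x j + \<alpha> j * (\<sigma> * z)))" for z
      by (simp add: sum_distrib_left mult_ac)
    then show ?thesis by (simp only: integral_mult_right_zero)
  qed
  ultimately show ?thesis by (simp only: power2_eq_square mult.assoc)
qed

text \<open>With \<open>B\<close> the largest of 1 and the \<open>\<bar>x j\<bar>\<close>, the left
  side is at most \<open>((m + 1) * B) ^ p\<close>, and \<open>B ^ p\<close> is one of the terms on
  the right. Powers of single variables can then be estimated one by one.\<close>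

lemma poly_weight_le_sum:
  fixes x :: "nat \<Rightarrow> real"
  shows "(1 + (\<Sum>j<m. \<bar>x j\<bar>)) ^ p \<le> (real m + 1) ^ p * (1 + (\<Sum>j<m. \<bar>x j\<bar> ^ p))"
proof -
  define B where "B = Max (insert 1 ((\<lambda>j. \<bar>x j\<bar>) ` {..<m}))"
  have fin: "finite (insert 1 ((\<lambda>j. \<bar>x j\<bar>) ` {..<m}))" by simp
  have B1: "1 \<le> B" and Bx: "j < m \<Longrightarrow> \<bar>x j\<bar> \<le> B" for j unfolding B_def by (auto intro!: Max_ge)
  have "(\<Sum>j<m. \<bar>x j\<bar>) \<le> (\<Sum>j<m. B)" using Bx by (intro sum_mono) auto
  then have "1 + (\<Sum>j<m. \<bar>x j\<bar>) \<le> (real m + 1) * B" using B1 by (simp add: algebra_simps)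
  then have "(1 + (\<Sum>j<m. \<bar>x j\<bar>)) ^ p \<le> ((real m + 1) * B) ^ p"
    by (intro power_mono) (auto intro!: add_nonneg_nonneg sum_nonneg)
  also have "\<dots> = (real m + 1) ^ p * B ^ p" by (rule power_mult_distrib)
  also have "B ^ p \<le> 1 + (\<Sum>j<m. \<bar>x j\<bar> ^ p)"
  proof -
    have "B \<in> insert 1 ((\<lambda>j. \<bar>x j\<bar>) ` {..<m})" unfolding B_def by (rule Max_in) auto
    then consider "B = 1" | j where "j < m" "B = \<bar>x j\<bar>" by auto
    then show ?thesis
    proof cases
      case 1 then show ?thesis by (simp add: sum_nonneg)
    next
      case 2
      have "\<bar>x j\<bar> ^ p \<le> (\<Sum>j<m. \<bar>x j\<bar> ^ p)" using 2 by (intro member_le_sum) auto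
      then show ?thesis using 2 by simp
    qed
  qed
  finally show ?thesis by (simp add: mult_left_mono)
qed

context brownian_motion
begin

lemma gauss_power_L2:
  assumes V: "gauss_indep M (\<F> a) V \<sigma>" and \<sigma>: "0 \<le> \<sigma>" "\<sigma> \<le> K"
  shows "(\<lambda>w. \<bar>V w\<bar> ^ p) \<in> L2_space M"
    "L2_norm_of M (\<lambda>w. \<bar>V w\<bar> ^ p) \<le> sqrt (K ^ (2 * p) * (\<integral>z. \<bar>z\<bar> ^ (2 * p) \<partial>std_gauss))"
proof -
  have [measurable]: "V \<in> borel_measurable M" using V by (simp add: gauss_indep_def)
  have sq: "(\<bar>V w\<bar> ^ p)\<^sup>2 = \<bar>V w\<bar> ^ (2 * p)" for w by (simp add: power_mult[symmetric] mult.commute)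
  have i: "integrable std_gauss (\<lambda>z. \<bar>\<sigma> * z\<bar> ^ (2 * p))"
    by (simp only: abs_mult power_mult_distrib) (intro integrable_mult_right integrable_std_gauss_moment)
  have "integrable M (\<lambda>w. \<bar>V w\<bar> ^ (2 * p))"
    by (subst gauss_indep_integral(2)[OF F_subalgebra V, of "\<lambda>x. \<bar>x\<bar> ^ (2 * p)"]) (use i in auto)
  then show "(\<lambda>w. \<bar>V w\<bar> ^ p) \<in> L2_space M" unfolding L2_space_def mem_Collect_eq sq by auto
  have "(\<integral>w. \<bar>V w\<bar> ^ (2 * p) \<partial>M) = (\<integral>z. \<bar>\<sigma> * z\<bar> ^ (2 * p) \<partial>std_gauss)"
    by (rule gauss_indep_integral(1)[OF F_subalgebra V]) simp
  also have "\<dots> = \<sigma> ^ (2 * p) * (\<integral>z. \<bar>z\<bar> ^ (2 * p) \<partial>std_gauss)"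
    using \<sigma> by (simp only: abs_mult power_mult_distrib abs_of_nonneg integral_mult_right_zero)
  also have "\<dots> \<le> K ^ (2 * p) * (\<integral>z. \<bar>z\<bar> ^ (2 * p) \<partial>std_gauss)"
    using \<sigma> by (intro mult_right_mono power_mono Bochner_Integration.integral_nonneg) auto
  finally show "L2_norm_of M (\<lambda>w. \<bar>V w\<bar> ^ p) \<le> sqrt (K ^ (2 * p) * (\<integral>z. \<bar>z\<bar> ^ (2 * p) \<partial>std_gauss))"
    unfolding L2_norm_of_def sq by (rule real_sqrt_le_mono)
qed

text \<open>The joint law of the variables \<open>X j\<close> does not enter: the growth bound is
  split into powers of single variables, and the triangle inequality is used. The resulting bound
  depends only on the number of variables, the growth and \<open>K\<close>, so it is uniform along
  sequences with bounded variances.\<close>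

lemma gauss_growth_L2:
  fixes X :: "nat \<Rightarrow> 'a \<Rightarrow> real"
  assumes X: "\<And>j. j < m \<Longrightarrow> \<exists>a \<sigma>. gauss_indep M (\<F> a) (X j) \<sigma> \<and> 0 \<le> \<sigma> \<and> \<sigma> \<le> K"
    and Y: "Y \<in> borel_measurable M" "\<And>w. \<bar>Y w\<bar> \<le> C * (1 + (\<Sum>j<m. \<bar>X j w\<bar>)) ^ p" and C: "0 \<le> C"
  shows "Y \<in> L2_space M"
    "L2_norm_of M Y \<le> C * ((real m + 1) ^ p * (1 + real m * sqrt (K ^ (2 * p) * (\<integral>z. \<bar>z\<bar> ^ (2 * p) \<partial>std_gauss))))"
proof -
  let ?q = "sqrt (K ^ (2 * p) * (\<integral>z. \<bar>z\<bar> ^ (2 * p) \<partial>std_gauss))"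
  have pw: "(\<lambda>w. \<bar>X j w\<bar> ^ p) \<in> L2_space M" "L2_norm_of M (\<lambda>w. \<bar>X j w\<bar> ^ p) \<le> ?q" if "j < m" for j
    using X[OF that] gauss_power_L2 by blast+
  have one: "(\<lambda>_. 1) \<in> L2_space M" by (simp add: L2_space_def)
  have n1: "L2_norm_of M (\<lambda>_. 1) = 1" by (simp add: L2_norm_of_def prob_space)
  define Z where "Z w = C * ((real m + 1) ^ p * (1 + (\<Sum>j<m. \<bar>X j w\<bar> ^ p)))" for w
  have sL: "(\<lambda>w. \<Sum>j<m. \<bar>X j w\<bar> ^ p) \<in> L2_space M" by (intro L2_space_sum pw) simp
  have ZL: "Z \<in> L2_space M"
    unfolding Z_def[abs_def] by (intro L2_space_cmult L2_space_add one sL)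
  have YZ: "\<bar>Y w\<bar> \<le> Z w" for w
    using Y(2)[of w] mult_left_mono[OF poly_weight_le_sum[of "\<lambda>j. X j w" m p] C] unfolding Z_def by linarith
  then have YZ2: "(Y w)\<^sup>2 \<le> (Z w)\<^sup>2" for w
    by (metis abs_ge_zero abs_le_square_iff abs_of_nonneg order_trans)
  have iY: "integrable M (\<lambda>w. (Y w)\<^sup>2)"
    by (rule Bochner_Integration.integrable_bound[OF L2_spaceD(2)[OF ZL]]) (use Y(1) YZ2 in auto)
  then show "Y \<in> L2_space M" using Y(1) by (simp add: L2_space_def)
  have "L2_norm_of M Y \<le> L2_norm_of M Z"
    unfolding L2_norm_of_def by (intro real_sqrt_le_mono integral_mono iY L2_spaceD(2)[OF ZL] YZ2)
  also have "\<dots> = C * ((real m + 1) ^ p * L2_norm_of M (\<lambda>w. 1 + (\<Sum>j<m. \<bar>X j w\<bar> ^ p)))"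
    unfolding Z_def[abs_def] using C by (simp add: L2_norm_of_cmult)
  also have "\<dots> \<le> C * ((real m + 1) ^ p * (1 + real m * ?q))"
  proof (intro mult_left_mono C)
    have "L2_norm_of M (\<lambda>w. 1 + (\<Sum>j<m. \<bar>X j w\<bar> ^ p)) \<le> 1 + L2_norm_of M (\<lambda>w. \<Sum>j<m. \<bar>X j w\<bar> ^ p)"
      using L2_norm_of_triangle[OF one sL] n1 by simp
    also have "L2_norm_of M (\<lambda>w. \<Sum>j<m. \<bar>X j w\<bar> ^ p) \<le> (\<Sum>j<m. L2_norm_of M (\<lambda>w. \<bar>X j w\<bar> ^ p))"
      by (intro L2_norm_of_sum_le) (auto intro: pw)
    also have "\<dots> \<le> (\<Sum>j<m. ?q)" by (intro sum_mono pw) simp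
    finally show "L2_norm_of M (\<lambda>w. 1 + (\<Sum>j<m. \<bar>X j w\<bar> ^ p)) \<le> 1 + real m * ?q" by simp
  qed simp
  finally show "L2_norm_of M Y \<le> C * ((real m + 1) ^ p * (1 + real m * ?q))" .
qed

text \<open>Setting the coordinates from \<open>n\<close> on to 0 allows passing to the limit in
  \<open>f\<close> when only the first \<open>n\<close> coordinates are known to converge.\<close>

lemma smooth_depends:
  assumes "smooth_poly_growth n f"
  shows "f (\<lambda>j. if j < n then x j else 0) = f x"
    and "i < n \<Longrightarrow> partial_deriv i f (\<lambda>j. if j < n then x j else 0) = partial_deriv i f x"
proof -
  show "f (\<lambda>j. if j < n then x j else 0) = f x"
    by (rule smooth_poly_growthD(1)[OF assms]) simp
  assume i: "i < n"
  have "(\<lambda>y. f ((\<lambda>j. if j < n then x j else 0)(i := y))) = (\<lambda>y. f (x(i := y)))"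
    by (rule ext, rule smooth_poly_growthD(1)[OF assms]) simp
  then show "partial_deriv i f (\<lambda>j. if j < n then x j else 0) = partial_deriv i f x"
    using i by (simp add: partial_deriv_def)
qed

section \<open>Integration by parts\<close>

lemma step_functional_L2:
  fixes h :: "(nat \<Rightarrow> real) \<Rightarrow> real"
  assumes T: "0 < T" and h: "continuous_on UNIV h" "\<exists>C p. \<forall>x. \<bar>h x\<bar> \<le> C * (1 + (\<Sum>j<n. \<bar>x j\<bar>)) ^ p"
  shows "(\<lambda>w. h (\<lambda>j. stepI T N (c j) 0 T w)) \<in> L2_space M"
proof -
  let ?S = "\<lambda>j. stepI T N (c j) 0 T"
  have Sg: "gauss_indep M (\<F> 0) (?S j) (sqrt (step_var T N (c j) 0 T))" for j
    using T by (intro stepI_gauss_indep) auto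
  have Sm: "?S j \<in> borel_measurable M" for j using Sg[of j] by (simp add: gauss_indep_def)
  define K where "K = Max (insert 0 ((\<lambda>j. sqrt (step_var T N (c j) 0 T)) ` {..<n}))"
  have "\<exists>a \<sigma>. gauss_indep M (\<F> a) (?S j) \<sigma> \<and> 0 \<le> \<sigma> \<and> \<sigma> \<le> K" if "j < n" for j
  proof -
    have "sqrt (step_var T N (c j) 0 T) \<le> K" unfolding K_def using that by (intro Max_ge) auto
    then show ?thesis using Sg[of j] step_var_nonneg[of T N "c j" 0 T] T
      by (intro exI[of _ 0] exI[of _ "sqrt (step_var T N (c j) 0 T)"]) auto
  qed
  moreover have "(\<lambda>w. h (\<lambda>j. ?S j w)) \<in> borel_measurable M"
  proof -
    have "(\<lambda>w j. ?S j w) \<in> borel_measurable M"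
      by (rule measurable_coordinatewise_then_product) (rule Sm)
    from measurable_compose[OF this borel_measurable_continuous_onI[OF h(1)]] show ?thesis .
  qed
  moreover obtain C p where C: "\<And>x. \<bar>h x\<bar> \<le> C * (1 + (\<Sum>j<n. \<bar>x j\<bar>)) ^ p" using h(2) by blast
  moreover have "0 \<le> C" using C[of "\<lambda>_. 0"] by (auto intro: order_trans[OF abs_ge_zero])
  ultimately show ?thesis by (intro gauss_growth_L2(1)[of n "\<lambda>j. ?S j" K]) auto
qed

lemma indicator_F_mult_L2:
  assumes "A \<in> sets (\<F> s)" "f \<in> L2_space M"
  shows "(\<lambda>w. indicator A w * f w) \<in> L2_space M"
proof (rule L2_space_bounded_mult[OF assms(2), of _ 1])
  show "indicator A \<in> borel_measurable M"
    using assms(1) F_subalgebra by (intro borel_measurable_indicator) (auto simp: subalgebra_def)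
qed (auto split: split_indicator)

text \<open>Integration by parts with respect to one increment. As the interval from
  \<open>x\<close> to \<open>y\<close> lies in the cell \<open>l\<close>, every step integral is
  \<open>c j l\<close> times the increment plus a part \<open>R j\<close> known to
  \<open>outside x y\<close>; with that part frozen, \<open>Stein_line\<close> in the direction
  \<open>c j l\<close> applies.\<close>

lemma step_cell_duality:
  assumes T: "0 < T" and f: "smooth_poly_growth n f"
    and xy: "0 \<le> x" "x < y" "grid T N l \<le> x" "y \<le> grid T N (Suc l)" "l < N" and A: "A \<in> sets (\<F> x)"
  shows "(\<integral>w. indicator A w * ((W y w - W x w) * f (\<lambda>j. stepI T N (c j) 0 T w)) \<partial>M)
    = (\<Sum>i<n. c i l * (y - x) * (\<integral>w. indicator A w * partial_deriv i f (\<lambda>j. stepI T N (c j) 0 T w) \<partial>M))"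
proof -
  have N: "N > 0" using xy by simp
  have yT: "y \<le> T" using xy grid_le[of T "Suc l" N] T by simp
  let ?G = "outside x y" and ?V = "\<lambda>w. W y w - W x w" and ?s = "sqrt (y - x)"
  have sub: "subalgebra M ?G" using xy by (intro outside_subalgebra) simp
  have V: "gauss_indep M ?G ?V ?s" by (rule increment_gauss_indep[OF xy(1,2)])
  let ?S = "\<lambda>j w. stepI T N (c j) 0 T w"
  \<comment> \<open>The step integral without the contribution of the increment
    \<open>?V\<close>.\<close>
  define R where "R j w = ?S j w - c j l * ?V w" for j w
  have Wlow: "W t \<in> borel_measurable ?G" if "0 \<le> t" "t \<le> x" for t
    by (rule F_measurable_outside[OF _ order_refl]) (use xy that W_F in auto)
  have g0: "0 \<le> grid T N k" for k using T by (intro grid_nonneg) simp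
  have Rm: "R j \<in> borel_measurable ?G" for j
  proof -
    have "R j w = (\<Sum>k<N. c j k * (W (grid T N (Suc k)) w - W (grid T N k) w - (if k = l then ?V w else 0)))" for w
    proof -
      have "(\<Sum>k<N. c j k * (if k = l then ?V w else 0)) = c j l * ?V w"
        using xy(5) by (simp add: if_distrib cong: if_cong)
      then show ?thesis unfolding R_def stepI_full[OF T] by (simp add: right_diff_distrib sum_subtractf)
    qed
    moreover have "(\<lambda>w. W (grid T N (Suc k)) w - W (grid T N k) w - (if k = l then ?V w else 0)) \<in> borel_measurable ?G"
      if "k < N" for k
    proof -
      consider "k < l" | "k = l" | "l < k" by linarith
      then show ?thesis
      proof cases
        case 1
        then have "grid T N (Suc k) \<le> x" "grid T N k \<le> x"
          using grid_mono[of T "Suc k" l N] grid_mono[of T k l N] xy T by auto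
        then have "W (grid T N (Suc k)) \<in> borel_measurable ?G" "W (grid T N k) \<in> borel_measurable ?G"
          using Wlow g0 by auto
        then show ?thesis using 1 by simp
      next
        case 2
        \<comment> \<open>Inside the cell \<open>l\<close>, removing \<open>?V\<close> leaves an
          increment after \<open>y\<close> and one before \<open>x\<close>, both known to
          \<open>?G\<close>.\<close>
        have "(\<lambda>w. (W (grid T N (Suc l)) w - W y w) + (W x w - W (grid T N l) w)) \<in> borel_measurable ?G"
          using increment_outside[of y "grid T N (Suc l)" x] Wlow[of x] Wlow[of "grid T N l"] xy g0 by auto
        then show ?thesis using 2 by (simp add: algebra_simps)
      next
        case 3
        then have "y \<le> grid T N (Suc k)" "y \<le> grid T N k"
          using grid_mono[of T "Suc l" k N] grid_mono[of T "Suc l" "Suc k" N] xy T by auto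
        then have "(\<lambda>w. (W (grid T N (Suc k)) w - W y w) - (W (grid T N k) w - W y w)) \<in> borel_measurable ?G"
          using xy by (intro borel_measurable_diff[of "\<lambda>w. W (grid T N (Suc k)) w - W y w" _ "\<lambda>w. W (grid T N k) w - W y w"] increment_outside) auto
        then show ?thesis using 3 by simp
      qed
    qed
    ultimately show ?thesis
      by (simp only: cong: measurable_cong) (intro borel_measurable_sum borel_measurable_times borel_measurable_const, auto)
  qed
  have Am: "indicator A \<in> borel_measurable ?G"
    using A F_outside[of y x x] xy by (intro borel_measurable_indicator) auto
  have SR: "?S j w = R j w + c j l * ?V w" for j w by (simp add: R_def)
  have comp: "(\<lambda>(w, v). h (\<lambda>j. R j w + c j l * v)) \<in> borel_measurable (?G \<Otimes>\<^sub>M borel)"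
    if "continuous_on UNIV h" for h :: "(nat \<Rightarrow> real) \<Rightarrow> real"
  proof -
    note [measurable] = Rm
    have "(\<lambda>p j. R j (fst p) + c j l * snd p) \<in> borel_measurable (?G \<Otimes>\<^sub>M borel)"
      by (rule measurable_coordinatewise_then_product) measurable
    from measurable_compose[OF this borel_measurable_continuous_onI[OF that]] show ?thesis
      by (simp add: case_prod_beta')
  qed
  have VL: "?V \<in> L2_space M" using xy by (intro increment_L2) auto
  have AVL: "(\<lambda>w. indicator A w * ?V w) \<in> L2_space M" by (rule indicator_F_mult_L2[OF A VL])
  have fL': "(\<lambda>w. f (\<lambda>j. ?S j w)) \<in> L2_space M"
    by (rule step_functional_L2[OF T smooth_poly_growthD(2)[OF f] smooth_poly_growthD(5)[OF f]])
  have dL: "(\<lambda>w. partial_deriv i f (\<lambda>j. ?S j w)) \<in> L2_space M" if "i < n" for i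
    by (rule step_functional_L2[OF T smooth_poly_growthD(3)[OF f that] smooth_poly_growthD(6)[OF f that]])
  have AdI: "integrable M (\<lambda>w. indicator A w * partial_deriv i f (\<lambda>j. ?S j w))" if "i < n" for i
    by (rule L2_space_integrable[OF indicator_F_mult_L2[OF A dL[OF that]]])
  let ?\<Phi> = "\<lambda>(w, v). indicator A w * (v * f (\<lambda>j. R j w + c j l * v))"
  let ?\<Psi> = "\<lambda>(w, v). indicator A w * (\<Sum>i<n. c i l * partial_deriv i f (\<lambda>j. R j w + c j l * v))"
  have "(\<integral>w. indicator A w * (?V w * f (\<lambda>j. ?S j w)) \<partial>M) = (\<integral>w. ?\<Phi> (w, ?V w) \<partial>M)"
    by (simp add: SR)
  also have "\<dots> = (\<integral>w. (\<integral>z. ?\<Phi> (w, ?s * z) \<partial>std_gauss) \<partial>M)"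
  proof (rule gauss_indep_Fubini(1)[OF sub V])
    note [measurable] = Am comp[OF smooth_poly_growthD(2)[OF f]]
    show "?\<Phi> \<in> borel_measurable (?G \<Otimes>\<^sub>M borel)" by measurable
    show "integrable M (\<lambda>w. ?\<Phi> (w, ?V w))"
      using L2_mult_integrable[OF AVL fL'] by (simp add: SR mult.assoc)
  qed
  also have "\<dots> = (\<integral>w. (y - x) * (\<integral>z. ?\<Psi> (w, ?s * z) \<partial>std_gauss) \<partial>M)"
  proof (intro Bochner_Integration.integral_cong refl)
    fix w
    have "(\<integral>z. ?\<Phi> (w, ?s * z) \<partial>std_gauss) = indicator A w * (\<integral>z. (?s * z) * f (\<lambda>j. R j w + c j l * (?s * z)) \<partial>std_gauss)"
      by (simp only: prod.case integral_mult_right_zero)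
    also have "\<dots> = indicator A w * (?s\<^sup>2 * (\<integral>z. (\<Sum>i<n. c i l * partial_deriv i f (\<lambda>j. R j w + c j l * (?s * z))) \<partial>std_gauss))"
      by (simp only: Stein_line[OF f])
    also have "\<dots> = (y - x) * (\<integral>z. ?\<Psi> (w, ?s * z) \<partial>std_gauss)"
      using xy by (simp only: prod.case integral_mult_right_zero) simp
    finally show "(\<integral>z. ?\<Phi> (w, ?s * z) \<partial>std_gauss) = (y - x) * (\<integral>z. ?\<Psi> (w, ?s * z) \<partial>std_gauss)" .
  qed
  also have "\<dots> = (y - x) * (\<integral>w. ?\<Psi> (w, ?V w) \<partial>M)"
  proof -
    have "(\<integral>w. ?\<Psi> (w, ?V w) \<partial>M) = (\<integral>w. (\<integral>z. ?\<Psi> (w, ?s * z) \<partial>std_gauss) \<partial>M)"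
    proof (rule gauss_indep_Fubini(1)[OF sub V])
      have m: "(\<lambda>(w, v). \<Sum>i<n. c i l * partial_deriv i f (\<lambda>j. R j w + c j l * v)) \<in> borel_measurable (?G \<Otimes>\<^sub>M borel)"
        unfolding case_prod_beta'
        using comp[OF smooth_poly_growthD(3)[OF f]] by (intro borel_measurable_sum borel_measurable_times) (auto simp: case_prod_beta')
      note [measurable] = Am m
      show "?\<Psi> \<in> borel_measurable (?G \<Otimes>\<^sub>M borel)" by measurable
      have "integrable M (\<lambda>w. \<Sum>i<n. c i l * (indicator A w * partial_deriv i f (\<lambda>j. ?S j w)))"
        using AdI by (intro Bochner_Integration.integrable_sum integrable_mult_right) auto
      then show "integrable M (\<lambda>w. ?\<Psi> (w, ?V w))"
        by (simp add: SR[symmetric] sum_distrib_left mult.left_commute)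
    qed
    then show ?thesis by simp
  qed
  also have "(\<integral>w. ?\<Psi> (w, ?V w) \<partial>M) = (\<integral>w. (\<Sum>i<n. c i l * (indicator A w * partial_deriv i f (\<lambda>j. ?S j w))) \<partial>M)"
    by (simp add: SR[symmetric] sum_distrib_left mult.left_commute)
  also have "\<dots> = (\<Sum>i<n. c i l * (\<integral>w. indicator A w * partial_deriv i f (\<lambda>j. ?S j w) \<partial>M))"
    using AdI by (subst Bochner_Integration.integral_sum) auto
  finally show ?thesis by (simp add: sum_distrib_left mult_ac)
qed

end

lemma (in pair_sigma_finite) integral_product_function:
  fixes a :: "'a \<Rightarrow> real" and b :: "'b \<Rightarrow> real"
  assumes a: "integrable M1 a" and b: "integrable M2 b"
  shows "integrable (M1 \<Otimes>\<^sub>M M2) (\<lambda>p. a (fst p) * b (snd p))"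
    and "(\<integral>p. a (fst p) * b (snd p) \<partial>(M1 \<Otimes>\<^sub>M M2)) = (\<integral>x. a x \<partial>M1) * (\<integral>y. b y \<partial>M2)"
proof -
  have [measurable]: "a \<in> borel_measurable M1" "b \<in> borel_measurable M2" using a b by auto
  show i: "integrable (M1 \<Otimes>\<^sub>M M2) (\<lambda>p. a (fst p) * b (snd p))"
    by (rule Fubini_integrable) (use a b in \<open>auto simp: abs_mult\<close>)
  show "(\<integral>p. a (fst p) * b (snd p) \<partial>(M1 \<Otimes>\<^sub>M M2)) = (\<integral>x. a x \<partial>M1) * (\<integral>y. b y \<partial>M2)"
    using integral_fst'[OF i] by simp
qed

lemma common_AE_subseq:
  assumes "\<And>j. j < (n::nat) \<Longrightarrow> L2_tendsto N (f j) (l j)"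
  shows "\<exists>r::nat \<Rightarrow> nat. strict_mono r \<and> (AE x in N. \<forall>j<n. (\<lambda>k. f j (r k) x) \<longlonglongrightarrow> l j x)"
  using assms
proof (induction n)
  case 0
  show ?case by (intro exI[of _ id]) (simp add: strict_mono_id)
next
  case (Suc n)
  then obtain r :: "nat \<Rightarrow> nat" where r: "strict_mono r" "AE x in N. \<forall>j<n. (\<lambda>k. f j (r k) x) \<longlonglongrightarrow> l j x" by auto
  obtain r' :: "nat \<Rightarrow> nat" where r': "strict_mono r'" "AE x in N. (\<lambda>k. f n (r (r' k)) x) \<longlonglongrightarrow> l n x"
    using L2_tendsto_AE_subseq[OF L2_tendsto_subseq[OF Suc.prems[of n] r(1)]] by auto
  have "AE x in N. \<forall>j<Suc n. (\<lambda>k. f j ((r \<circ> r') k) x) \<longlonglongrightarrow> l j x"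
    using r(2) r'(2)
  proof eventually_elim
    case (elim x)
    show ?case
    proof (intro allI impI)
      fix j assume "j < Suc n"
      then consider "j < n" | "j = n" by linarith
      then show "(\<lambda>k. f j ((r \<circ> r') k) x) \<longlonglongrightarrow> l j x"
      proof cases
        case 1
        then show ?thesis using LIMSEQ_subseq_LIMSEQ[of "\<lambda>k. f j (r k) x" "l j x" r'] elim r'(1) by (simp add: comp_def)
      qed (use elim in simp)
    qed
  qed
  then show ?case using strict_mono_o[OF r(1) r'(1)] by blast
qed

context brownian_motion
begin

lemma telescope_clip:
  assumes "0 < T" "0 < N" "0 \<le> s" "s \<le> t" "t \<le> T"
  shows "(\<Sum>l<N. h (clip s t (grid T N (Suc l))) - h (clip s t (grid T N l))) = h t - (h s :: real)"
  unfolding sum_lessThan_telescope[of "\<lambda>l. h (clip s t (grid T N l))"]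
  using assms by (simp add: grid_end clip_def)

lemma clip_inside_cell:
  assumes "s \<le> t" "clip s t x < clip s t y" "x \<le> y"
  shows "x \<le> clip s t x" "clip s t y \<le> y"
  using assms by (auto simp: clip_def min_def max_def split: if_splits)

text \<open>The increment from \<open>s\<close> to \<open>t\<close> is cut at the grid points so
  that each piece lies in one cell. The event \<open>A\<close> is known at time \<open>s\<close>,
  hence also at the start of every piece.\<close>

lemma step_duality:
  assumes T: "0 < T" and N: "0 < N" and f: "smooth_poly_growth n f"
    and st: "0 \<le> s" "s \<le> t" "t \<le> T" and A: "A \<in> sets (\<F> s)"
  shows "(\<integral>w. indicator A w * ((W t w - W s w) * f (\<lambda>j. stepI T N (c j) 0 T w)) \<partial>M)
    = (\<Sum>i<n. (\<Sum>l<N. c i l * (clip s t (grid T N (Suc l)) - clip s t (grid T N l)))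
        * (\<integral>w. indicator A w * partial_deriv i f (\<lambda>j. stepI T N (c j) 0 T w) \<partial>M))"
proof -
  let ?g = "\<lambda>l. clip s t (grid T N l)"
  let ?f = "\<lambda>w. f (\<lambda>j. stepI T N (c j) 0 T w)"
  have gm: "grid T N l \<le> grid T N (Suc l)" for l using T by (intro grid_mono) auto
  have gs: "s \<le> ?g l" for l using clip_bounds(1)[OF st(2)] .
  have gg: "?g l \<le> ?g (Suc l)" for l by (rule clip_mono[OF gm])
  have fL: "?f \<in> L2_space M"
    by (rule step_functional_L2[OF T smooth_poly_growthD(2)[OF f] smooth_poly_growthD(5)[OF f]])
  have i: "integrable M (\<lambda>w. indicator A w * ((W (?g (Suc l)) w - W (?g l) w) * ?f w))" for l
  proof -
    have "(\<lambda>w. indicator A w * (W (?g (Suc l)) w - W (?g l) w)) \<in> L2_space M"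
      by (rule indicator_F_mult_L2[OF A]) (use gs[of l] st gg in \<open>auto intro!: increment_L2\<close>)
    from L2_mult_integrable[OF this fL] show ?thesis by (simp add: mult.assoc)
  qed
  have "(\<integral>w. indicator A w * ((W t w - W s w) * ?f w) \<partial>M)
     = (\<integral>w. (\<Sum>l<N. indicator A w * ((W (?g (Suc l)) w - W (?g l) w) * ?f w)) \<partial>M)"
    unfolding sum_distrib_left[symmetric] sum_distrib_right[symmetric]
    by (simp only: telescope_clip[OF T N st, of "\<lambda>x. W x _"])
  also have "\<dots> = (\<Sum>l<N. \<integral>w. indicator A w * ((W (?g (Suc l)) w - W (?g l) w) * ?f w) \<partial>M)"
    by (rule Bochner_Integration.integral_sum[OF i])
  also have "\<dots> = (\<Sum>l<N. \<Sum>i<n. c i l * (?g (Suc l) - ?g l) * (\<integral>w. indicator A w * partial_deriv i f (\<lambda>j. stepI T N (c j) 0 T w) \<partial>M))"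
  proof (rule sum.cong[OF refl])
    fix l assume "l \<in> {..<N}"
    then have l: "l < N" by simp
    show "(\<integral>w. indicator A w * ((W (?g (Suc l)) w - W (?g l) w) * ?f w) \<partial>M)
      = (\<Sum>i<n. c i l * (?g (Suc l) - ?g l) * (\<integral>w. indicator A w * partial_deriv i f (\<lambda>j. stepI T N (c j) 0 T w) \<partial>M))"
    proof (cases "?g l = ?g (Suc l)")
      case True
      then show ?thesis by simp
    next
      case False
      then have lt: "?g l < ?g (Suc l)" using gg[of l] by simp
      have g0: "0 \<le> ?g l" using gs[of l] st by simp
      have A': "A \<in> sets (\<F> (?g l))" using A F_mono[OF gs[of l]] by blast
      show ?thesis
        by (rule step_cell_duality[OF T f g0 lt clip_inside_cell(1)[OF st(2) lt gm] clip_inside_cell(2)[OF st(2) lt gm] l A'])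
    qed
  qed
  also have "\<dots> = (\<Sum>i<n. (\<Sum>l<N. c i l * (?g (Suc l) - ?g l)) * (\<integral>w. indicator A w * partial_deriv i f (\<lambda>j. stepI T N (c j) 0 T w) \<partial>M))"
    by (subst sum.swap) (simp only: sum_distrib_right)
  finally show ?thesis .
qed

lemma grid_avg_clip_sum:
  assumes T: "0 < T" and st: "0 \<le> s" "s \<le> t" "t \<le> T"
  shows "(\<Sum>l<N. grid_avg T N h l * (clip s t (grid T N (Suc l)) - clip s t (grid T N l)))
    = (\<integral>r. indicator {s<..t} r * grid_step T N h r \<partial>time_measure T)"
proof -
  let ?g = "\<lambda>l. clip s t (grid T N l)"
  have gm: "?g l \<le> ?g (Suc l)" for l using T by (intro clip_mono grid_mono) auto
  have b: "0 \<le> ?g l" "?g l \<le> T" for l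
    using clip_bounds[OF st(2), of "grid T N l"] st by auto
  have "(\<integral>r. indicator {s<..t} r * grid_step T N h r \<partial>time_measure T)
    = (\<integral>r. (\<Sum>l<N. grid_avg T N h l * indicator {?g l<..?g (Suc l)} r) \<partial>time_measure T)"
    by (simp only: stepI_grid_avg_indicator[OF st(2)])
  also have "\<dots> = (\<Sum>l<N. \<integral>r. grid_avg T N h l * indicator {?g l<..?g (Suc l)} r \<partial>time_measure T)"
    by (rule Bochner_Integration.integral_sum)
       (rule integrable_mult_right, rule time.L2_space_integrable[OF indicator_L2_time], simp)
  also have "\<dots> = (\<Sum>l<N. grid_avg T N h l * (?g (Suc l) - ?g l))"
    by (rule sum.cong[OF refl]) (simp only: integral_mult_right_zero time_measure_interval[OF b(1) gm b(2)])
  finally show ?thesis by simp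
qed

text \<open>Since grid averaging is a contraction, the standard deviations are bounded uniformly in
  the mesh, as the limit of functionals requires.\<close>

lemma step_sigma_le:
  assumes T: "0 < T" and h: "h \<in> L2_space (time_measure T)"
  shows "sqrt (step_var T N (grid_avg T N h) 0 T) \<le> L2_norm_of (time_measure T) h"
proof -
  have "step_var T N (grid_avg T N h) 0 T \<le> (L2_norm_of (time_measure T) (grid_step T N h))\<^sup>2"
    using step_var_grid_avg[OF T order_refl] interval_L2_norm_le[OF grid_step_L2] T by simp
  also have "\<dots> \<le> (L2_norm_of (time_measure T) h)\<^sup>2"
    by (intro power_mono grid_step_norm_le T h) simp
  finally have "sqrt (step_var T N (grid_avg T N h) 0 T) \<le> sqrt ((L2_norm_of (time_measure T) h)\<^sup>2)"
    by (rule real_sqrt_le_mono)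
  then show ?thesis by simp
qed

text \<open>Along the subsequence the functionals converge almost surely by continuity and have
  bounded second moments, because the variances of all Gaussian variables involved stay bounded.
  Dominating \<open>Z\<close> by \<open>1 + \<bar>V\<bar>\<close> covers an indicator as well as an
  indicator times an increment.\<close>

lemma functional_limit:
  fixes q :: "(nat \<Rightarrow> real) \<Rightarrow> real"
  assumes T: "0 < T" and h: "\<And>j. h j \<in> L2_space (time_measure T)"
    and V: "gauss_indep M (\<F> a) V \<sigma>" "0 \<le> \<sigma>" and Z: "Z \<in> borel_measurable M" "\<And>w. \<bar>Z w\<bar> \<le> 1 + \<bar>V w\<bar>"
    and q: "continuous_on UNIV q" "\<And>x. q (\<lambda>j. if j < n then x j else 0) = q x"
      "\<exists>C p. \<forall>x. \<bar>q x\<bar> \<le> C * (1 + (\<Sum>j<n. \<bar>x j\<bar>)) ^ p"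
    and r: "AE w in M. \<forall>j<n. (\<lambda>k. stepI T (r k) (grid_avg T (r k) (h j)) 0 T w) \<longlonglongrightarrow> wiener_integral M W T (h j) w"
  shows "(\<lambda>w. Z w * q (\<lambda>j. wiener_integral M W T (h j) w)) \<in> L2_space M"
    and "(\<lambda>k. \<integral>w. Z w * q (\<lambda>j. stepI T (r k) (grid_avg T (r k) (h j)) 0 T w) \<partial>M)
       \<longlonglongrightarrow> (\<integral>w. Z w * q (\<lambda>j. wiener_integral M W T (h j) w) \<partial>M)"
proof -
  let ?S = "\<lambda>k j. stepI T (r k) (grid_avg T (r k) (h j)) 0 T" and ?I = "\<lambda>j. wiener_integral M W T (h j)"
  obtain C p where C: "\<And>x. \<bar>q x\<bar> \<le> C * (1 + (\<Sum>j<n. \<bar>x j\<bar>)) ^ p" using q(3) by blast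
  have C0: "0 \<le> C" using C[of "\<lambda>_. 0"] by (auto intro: order_trans[OF abs_ge_zero])
  define K where "K = \<sigma> + (\<Sum>j<n. L2_norm_of (time_measure T) (h j))"
  define B where "B = C * ((real (Suc n) + 1) ^ Suc p * (1 + real (Suc n) * sqrt (K ^ (2 * Suc p) * (\<integral>z. \<bar>z\<bar> ^ (2 * Suc p) \<partial>std_gauss))))"
  have Sg: "gauss_indep M (\<F> 0) (?S k j) (sqrt (step_var T (r k) (grid_avg T (r k) (h j)) 0 T))" for k j
    using T by (intro stepI_gauss_indep) auto
  have Sm: "?S k j \<in> borel_measurable M" for k j using Sg[of k j] by (simp add: gauss_indep_def)
  have Vm: "V \<in> borel_measurable M" using V by (simp add: gauss_indep_def)
  have Im: "?I j \<in> borel_measurable M" for j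
    using L2_tendstoD(2)[OF wiener_integral_tendsto[OF T h]] L2_spaceD(1) by blast
  have qm: "(\<lambda>w. q (\<lambda>j. X j w)) \<in> borel_measurable M" if "\<And>j. X j \<in> borel_measurable M" for X
  proof -
    have "(\<lambda>w j. X j w) \<in> borel_measurable M"
      by (rule measurable_coordinatewise_then_product) (rule that)
    from measurable_compose[OF this borel_measurable_continuous_onI[OF q(1)]] show ?thesis .
  qed
  have bound: "(\<lambda>w. Z w * q (\<lambda>j. ?S k j w)) \<in> L2_space M \<and> L2_norm_of M (\<lambda>w. Z w * q (\<lambda>j. ?S k j w)) \<le> B" for k
  proof -
    \<comment> \<open>\<open>V\<close> joins the step integrals as variable number \<open>n\<close>;
      the factor \<open>Z\<close> then merely raises the exponent of the growth bound by
      one.\<close>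
    define X where "X j = (if j < n then ?S k j else V)" for j
    have X: "\<exists>a \<sigma>. gauss_indep M (\<F> a) (X j) \<sigma> \<and> 0 \<le> \<sigma> \<and> \<sigma> \<le> K" if "j < Suc n" for j
    proof (cases "j < n")
      case True
      have "sqrt (step_var T (r k) (grid_avg T (r k) (h j)) 0 T) \<le> L2_norm_of (time_measure T) (h j)"
        by (rule step_sigma_le[OF T h])
      also have "\<dots> \<le> (\<Sum>j<n. L2_norm_of (time_measure T) (h j))" using True by (intro member_le_sum) auto
      also have "\<dots> \<le> K" using V(2) by (simp add: K_def)
      finally show ?thesis
        using Sg[of k j] True step_var_nonneg[of T "r k" "grid_avg T (r k) (h j)" 0 T] T unfolding X_def
        by (intro exI[of _ 0] exI[of _ "sqrt (step_var T (r k) (grid_avg T (r k) (h j)) 0 T)"]) auto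
    next
      case False
      have "\<sigma> \<le> K" by (simp add: K_def sum_nonneg)
      then show ?thesis using V False unfolding X_def by (intro exI[of _ a] exI[of _ \<sigma>]) auto
    qed
    have m: "(\<lambda>w. Z w * q (\<lambda>j. ?S k j w)) \<in> borel_measurable M"
      by (intro borel_measurable_times Z(1) qm Sm)
    have b: "\<bar>Z w * q (\<lambda>j. ?S k j w)\<bar> \<le> C * (1 + (\<Sum>j<Suc n. \<bar>X j w\<bar>)) ^ Suc p" for w
    proof -
      let ?s = "\<Sum>j<n. \<bar>?S k j w\<bar>"
      have s0: "0 \<le> ?s" by (simp add: sum_nonneg)
      have Xs: "(\<Sum>j<Suc n. \<bar>X j w\<bar>) = ?s + \<bar>V w\<bar>" by (simp add: X_def)
      have "\<bar>Z w\<bar> * \<bar>q (\<lambda>j. ?S k j w)\<bar> \<le> (1 + \<bar>V w\<bar>) * (C * (1 + ?s) ^ p)"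
        by (intro mult_mono Z(2) C) auto
      also have "\<dots> \<le> (1 + (?s + \<bar>V w\<bar>)) * (C * (1 + (?s + \<bar>V w\<bar>)) ^ p)"
        using s0 C0 by (intro mult_mono mult_left_mono power_mono) auto
      finally show ?thesis unfolding Xs by (simp add: abs_mult mult_ac)
    qed
    show ?thesis using gauss_growth_L2[OF X m b C0] unfolding B_def by auto
  qed
  have lim: "AE w in M. (\<lambda>k. Z w * q (\<lambda>j. ?S k j w)) \<longlonglongrightarrow> Z w * q (\<lambda>j. ?I j w)"
    using r
  proof eventually_elim
    case (elim w)
    have "(\<lambda>k. (\<lambda>j. if j < n then ?S k j w else 0)) \<longlonglongrightarrow> (\<lambda>j. if j < n then ?I j w else 0)"
      by (rule tendsto_fun_pointwise) (use elim in auto)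
    moreover have "isCont q (\<lambda>j. if j < n then ?I j w else 0)"
      using q(1) by (simp add: continuous_on_eq_continuous_at)
    ultimately have "(\<lambda>k. q (\<lambda>j. if j < n then ?S k j w else 0)) \<longlonglongrightarrow> q (\<lambda>j. if j < n then ?I j w else 0)"
      by (intro isCont_tendsto_compose[of _ q])
    then show ?case unfolding q(2) by (intro tendsto_mult tendsto_const)
  qed
  have B0: "0 \<le> B" using bound[of 0] L2_norm_of_nonneg order_trans by blast
  have "(\<integral>w. (Z w * q (\<lambda>j. ?S k j w))\<^sup>2 \<partial>M) \<le> B\<^sup>2" for k
    unfolding L2_norm_of_power2[symmetric] using bound[of k] by (intro power_mono) auto
  note t = tendsto_integral_of_bounded_second_moment[OF conjunct1[OF bound] borel_measurable_times[OF Z(1) qm[OF Im]] this lim]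
  show "(\<lambda>w. Z w * q (\<lambda>j. ?I j w)) \<in> L2_space M" by (rule t(1))
  show "(\<lambda>k. \<integral>w. Z w * q (\<lambda>j. ?S k j w) \<partial>M) \<longlonglongrightarrow> (\<integral>w. Z w * q (\<lambda>j. ?I j w) \<partial>M)" by (rule t(2))
qed

text \<open>The limit of \<open>step_duality\<close> along one subsequence that serves all
  \<open>n\<close> integrals at once. The first index is left out because a nonempty grid is
  required.\<close>

lemma wiener_duality:
  assumes T: "0 < T" and h: "\<And>j. h j \<in> L2_space (time_measure T)" and f: "smooth_poly_growth n f"
    and st: "0 \<le> s" "s \<le> t" "t \<le> T" and A: "A \<in> sets (\<F> s)"
  shows "(\<integral>w. indicator A w * ((W t w - W s w) * f (\<lambda>j. wiener_integral M W T (h j) w)) \<partial>M)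
    = (\<Sum>i<n. (\<integral>r. indicator {s<..t} r * h i r \<partial>time_measure T)
        * (\<integral>w. indicator A w * partial_deriv i f (\<lambda>j. wiener_integral M W T (h j) w) \<partial>M))"
    and "i < n \<Longrightarrow> integrable M (\<lambda>w. indicator A w * partial_deriv i f (\<lambda>j. wiener_integral M W T (h j) w))"
proof -
  let ?S = "\<lambda>N j. stepI T N (grid_avg T N (h j)) 0 T" and ?I = "\<lambda>j. wiener_integral M W T (h j)"
  have "\<exists>r::nat \<Rightarrow> nat. strict_mono r \<and> (AE w in M. \<forall>j<n. (\<lambda>k. ?S (r k) j w) \<longlonglongrightarrow> ?I j w)"
    by (rule common_AE_subseq[of n M "\<lambda>j N. ?S N j"]) (rule wiener_integral_tendsto[OF T h])
  then obtain r :: "nat \<Rightarrow> nat" where r: "strict_mono r" "AE w in M. \<forall>j<n. (\<lambda>k. ?S (r k) j w) \<longlonglongrightarrow> ?I j w"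
    by blast
  have AM[measurable]: "A \<in> events" using A F_subalgebra by (auto simp: subalgebra_def)
  \<comment> \<open>A degenerate Gaussian variable, so that \<open>functional_limit\<close> applies
    to the bare indicator of \<open>A\<close>.\<close>
  have V0: "gauss_indep M (\<F> s) (winc T (\<lambda>_. 0) s s) (sqrt (wvar T (\<lambda>_. 0) s s))"
    using T st by (intro winc_gauss_indep L2_space_zero) auto
  have I: "(\<lambda>w. indicator A w * partial_deriv i f (\<lambda>j. ?I j w)) \<in> L2_space M"
    "(\<lambda>k. \<integral>w. indicator A w * partial_deriv i f (\<lambda>j. ?S (r k) j w) \<partial>M) \<longlonglongrightarrow> (\<integral>w. indicator A w * partial_deriv i f (\<lambda>j. ?I j w) \<partial>M)"
    if i: "i < n" for i
    by (rule functional_limit[OF T h V0 _ _ _ smooth_poly_growthD(3)[OF f i] smooth_depends(2)[OF f i] smooth_poly_growthD(6)[OF f i] r(2)],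
        use wvar_nonneg in \<open>auto split: split_indicator\<close>)+
  show "i < n \<Longrightarrow> integrable M (\<lambda>w. indicator A w * partial_deriv i f (\<lambda>j. ?I j w))"
    using I(1) L2_space_integrable by blast
  have c: "(\<lambda>N. \<integral>u. indicator {s<..t} u * grid_step T N (h i) u \<partial>time_measure T) \<longlonglongrightarrow> (\<integral>u. indicator {s<..t} u * h i u \<partial>time_measure T)" for i
    by (rule L2_tendsto_inner[OF L2_tendsto_const[OF indicator_L2_time] grid_approx_L2[OF T h, unfolded grid_approx_def]]) simp
  have R: "(\<lambda>k. \<Sum>i<n. (\<integral>u. indicator {s<..t} u * grid_step T (r k) (h i) u \<partial>time_measure T)
        * (\<integral>w. indicator A w * partial_deriv i f (\<lambda>j. ?S (r k) j w) \<partial>M))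
     \<longlonglongrightarrow> (\<Sum>i<n. (\<integral>u. indicator {s<..t} u * h i u \<partial>time_measure T)
        * (\<integral>w. indicator A w * partial_deriv i f (\<lambda>j. ?I j w) \<partial>M))"
    using LIMSEQ_subseq_LIMSEQ[OF c r(1)] I(2) by (intro tendsto_sum tendsto_mult) (auto simp: comp_def)
  have L: "(\<lambda>k. \<integral>w. indicator A w * ((W t w - W s w) * f (\<lambda>j. ?S (r k) j w)) \<partial>M)
    \<longlonglongrightarrow> (\<integral>w. indicator A w * ((W t w - W s w) * f (\<lambda>j. ?I j w)) \<partial>M)"
  proof (cases "s = t")
    case True
    then show ?thesis by simp
  next
    case False
    then have lt: "s < t" using st by simp
    have [measurable]: "W t \<in> borel_measurable M" "W s \<in> borel_measurable M" using W_measurable st by auto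
    have Zm: "(\<lambda>w. indicator A w * (W t w - W s w)) \<in> borel_measurable M" by measurable
    have Zb: "\<bar>indicator A w * (W t w - W s w)\<bar> \<le> 1 + \<bar>W t w - W s w\<bar>" for w
      by (auto split: split_indicator)
    have s0: "0 \<le> sqrt (t - s)" using lt by simp
    show ?thesis
      using functional_limit(2)[OF T h increment_F[OF st(1) lt] s0 Zm Zb smooth_poly_growthD(2)[OF f] smooth_depends(1)[OF f] smooth_poly_growthD(5)[OF f] r(2)]
      by (simp only: mult.assoc)
  qed
  have "\<forall>\<^sub>F k in sequentially. (\<integral>w. indicator A w * ((W t w - W s w) * f (\<lambda>j. ?S (r k) j w)) \<partial>M)
      = (\<Sum>i<n. (\<integral>u. indicator {s<..t} u * grid_step T (r k) (h i) u \<partial>time_measure T)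
        * (\<integral>w. indicator A w * partial_deriv i f (\<lambda>j. ?S (r k) j w) \<partial>M))"
    using eventually_gt_at_top[of 0]
  proof eventually_elim
    case (elim k)
    then have "0 < r k" using seq_suble[OF r(1), of k] by simp
    from step_duality[OF T this f st A, of "\<lambda>i. grid_avg T (r k) (h i)"] show ?case
      by (simp only: grid_avg_clip_sum[OF T st])
  qed
  from Lim_transform_eventually[OF L this] R
  show "(\<integral>w. indicator A w * ((W t w - W s w) * f (\<lambda>j. ?I j w)) \<partial>M)
    = (\<Sum>i<n. (\<integral>r. indicator {s<..t} r * h i r \<partial>time_measure T)
        * (\<integral>w. indicator A w * partial_deriv i f (\<lambda>j. ?I j w) \<partial>M))"
    by (rule LIMSEQ_unique)
qed

section \<open>The predictable projection of the Malliavin derivative\<close>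

sublocale proc: pair_sigma_finite M "time_measure T" for T
  by unfold_locales

sublocale proc: finite_measure "process_measure M T" for T
  by (rule finite_measure_pair_measure) unfold_locales

text \<open>The property that pins down the integrand in the Ito representation of \<open>F\<close> without
  stochastic integrals; it survives every closure in the definition of \<open>is_pD\<close>.\<close>

definition dual :: "real \<Rightarrow> ('a \<Rightarrow> real) \<Rightarrow> ('a \<times> real \<Rightarrow> real) \<Rightarrow> bool" where
  "dual T F v \<longleftrightarrow> F \<in> L2_space M \<and> v \<in> L2_space (process_measure M T) \<and>
     (\<forall>s t A. 0 \<le> s \<longrightarrow> s \<le> t \<longrightarrow> t \<le> T \<longrightarrow> A \<in> sets (\<F> s) \<longrightarrow>
        (\<integral>w. indicator A w * ((W t w - W s w) * F w) \<partial>M)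
        = (\<integral>p. indicator (A \<times> {s<..t}) p * v p \<partial>process_measure M T))"

lemma dual_limit:
  assumes d: "\<And>k. dual T (F' k) (v' k)" and F: "L2_tendsto M F' F" and v: "L2_tendsto (process_measure M T) v' v"
  shows "dual T F v"
  unfolding dual_def
proof (intro conjI allI impI)
  show "F \<in> L2_space M" "v \<in> L2_space (process_measure M T)"
    using L2_tendstoD(2)[OF F] L2_tendstoD(2)[OF v] by auto
  fix s t A assume st: "0 \<le> s" "s \<le> t" "t \<le> T" and A: "A \<in> sets (\<F> s)"
  then have AM: "A \<in> events" using F_subalgebra by (auto simp: subalgebra_def)
  have G: "(\<lambda>w. indicator A w * (W t w - W s w)) \<in> L2_space M"
    by (rule indicator_F_mult_L2[OF A increment_L2[OF st(1,2)]])
  have "{s<..t} \<in> sets (time_measure T)"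
    using st by (subst sets_restrict_space_iff) auto
  then have "A \<times> {s<..t} \<in> sets (process_measure M T)" using AM by auto
  then have E: "indicator (A \<times> {s<..t}) \<in> L2_space (process_measure M T)"
    by (intro proc.L2_space_bounded[of _ _ 1]) (auto split: split_indicator)
  have 1: "(\<lambda>k. \<integral>w. (indicator A w * (W t w - W s w)) * F' k w \<partial>M) \<longlonglongrightarrow> (\<integral>w. (indicator A w * (W t w - W s w)) * F w \<partial>M)"
    by (rule L2_tendsto_inner[OF L2_tendsto_const[OF G] F])
  have 2: "(\<lambda>k. \<integral>p. indicator (A \<times> {s<..t}) p * v' k p \<partial>process_measure M T) \<longlonglongrightarrow> (\<integral>p. indicator (A \<times> {s<..t}) p * v p \<partial>process_measure M T)"
    by (rule L2_tendsto_inner[OF L2_tendsto_const[OF E] v])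
  have "(\<integral>w. (indicator A w * (W t w - W s w)) * F' k w \<partial>M) = (\<integral>p. indicator (A \<times> {s<..t}) p * v' k p \<partial>process_measure M T)" for k
    using d[of k] st A unfolding dual_def by (simp add: mult.assoc)
  with LIMSEQ_unique[OF 1] 2
  show "(\<integral>w. indicator A w * ((W t w - W s w) * F w) \<partial>M) = (\<integral>p. indicator (A \<times> {s<..t}) p * v p \<partial>process_measure M T)"
    by (simp add: mult.assoc)
qed

text \<open>The integrand is a finite sum of products of a function of the sample point and a
  function of time, so its integral over a rectangle factorises into the terms of
  \<open>wiener_duality\<close>.\<close>

lemma dual_smooth:
  assumes T: "0 < T" and S: "smooth_functional_deriv M W T F u"
    and F: "F \<in> L2_space M" and u: "u \<in> L2_space (process_measure M T)"
  shows "dual T F u"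
  unfolding dual_def
proof (intro conjI allI impI F u)
  fix s t A assume st: "0 \<le> s" "s \<le> t" "t \<le> T" and A: "A \<in> sets (\<F> s)"
  obtain n f h where f: "smooth_poly_growth n f" and h: "\<And>j. j < n \<Longrightarrow> h j \<in> L2_space (time_measure T)"
    and Fe: "F = (\<lambda>w. f (\<lambda>j. wiener_integral M W T (h j) w))"
    and ue: "u = (\<lambda>(w, t). \<Sum>i<n. partial_deriv i f (\<lambda>j. wiener_integral M W T (h j) w) * h i t)"
    using S unfolding smooth_functional_deriv_def by blast
  \<comment> \<open>The integrands from \<open>n\<close> on are arbitrary functions; replacing them
    by 0 makes all of them square integrable without changing the functional.\<close>
  define h' where "h' j = (if j < n then h j else (\<lambda>_. 0))" for j
  have h': "h' j \<in> L2_space (time_measure T)" for j using h by (auto simp: h'_def L2_space_zero)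
  have fe: "f (\<lambda>j. wiener_integral M W T (h j) w) = f (\<lambda>j. wiener_integral M W T (h' j) w)" for w
    by (rule smooth_poly_growthD(1)[OF f]) (simp add: h'_def)
  have pe: "partial_deriv i f (\<lambda>j. wiener_integral M W T (h j) w) = partial_deriv i f (\<lambda>j. wiener_integral M W T (h' j) w)"
    if "i < n" for i w
    using smooth_depends(2)[OF f that, of "\<lambda>j. wiener_integral M W T (h j) w"]
      smooth_depends(2)[OF f that, of "\<lambda>j. wiener_integral M W T (h' j) w"] by (simp add: h'_def cong: if_cong)
  let ?d = "\<lambda>i w. indicator A w * partial_deriv i f (\<lambda>j. wiener_integral M W T (h' j) w)"
  let ?b = "\<lambda>i r. indicator {s<..t} r * h' i r"
  note D = wiener_duality[OF T h' f st A]
  have di: "integrable M (?d i)" if "i < n" for i using D(2)[OF that] .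
  have bi: "integrable (time_measure T) (?b i)" for i
    by (rule time.L2_space_integrable[OF interval_mult_L2[OF h']])
  have "(\<integral>p. indicator (A \<times> {s<..t}) p * u p \<partial>process_measure M T) = (\<integral>p. (\<Sum>i<n. ?d i (fst p) * ?b i (snd p)) \<partial>process_measure M T)"
    by (intro Bochner_Integration.integral_cong refl)
      (auto simp: ue case_prod_beta' sum_distrib_left pe h'_def indicator_times mult_ac intro!: sum.cong)
  also have "\<dots> = (\<Sum>i<n. \<integral>p. ?d i (fst p) * ?b i (snd p) \<partial>process_measure M T)"
    by (rule Bochner_Integration.integral_sum) (use proc.integral_product_function(1)[OF di bi] in auto)
  also have "\<dots> = (\<Sum>i<n. (\<integral>w. ?d i w \<partial>M) * (\<integral>r. ?b i r \<partial>time_measure T))"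
    by (rule sum.cong[OF refl]) (use proc.integral_product_function(2)[OF di bi] in auto)
  also have "\<dots> = (\<integral>w. indicator A w * ((W t w - W s w) * F w) \<partial>M)"
    unfolding Fe fe D(1) by (simp only: mult.commute)
  finally show "(\<integral>w. indicator A w * ((W t w - W s w) * F w) \<partial>M) = (\<integral>p. indicator (A \<times> {s<..t}) p * u p \<partial>process_measure M T)"
    by simp
qed

lemma dual_malliavin:
  assumes T: "0 < T" and D: "malliavin_deriv M W T F u"
  shows "dual T F u"
proof -
  obtain F' u' where S: "\<And>k. smooth_functional_deriv M W T (F' k) (u' k)"
    and F: "L2_tendsto M F' F" and u: "L2_tendsto (process_measure M T) u' u"
    using D unfolding malliavin_deriv_def by blast
  have "dual T (F' k) (u' k)" for k
    by (rule dual_smooth[OF T S L2_tendstoD(1)[OF F] L2_tendstoD(1)[OF u]])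
  from dual_limit[OF this F u] show ?thesis .
qed

lemma F_sigma_finite_subalgebra: "sigma_finite_subalgebra M (\<F> t)"
  by (rule finite_measure_subalgebra_is_sigma_finite)
    (simp add: finite_measure_subalgebra_def finite_measure_subalgebra_axioms_def F_subalgebra finite_measure_axioms)

lemma real_cond_exp_test:
  assumes A: "A \<in> sets (\<F> t)" and f: "integrable M f"
  shows "(\<integral>w. indicator A w * real_cond_exp M (\<F> t) f w \<partial>M) = (\<integral>w. indicator A w * f w \<partial>M)"
proof -
  interpret S: sigma_finite_subalgebra M "\<F> t" by (rule F_sigma_finite_subalgebra)
  show ?thesis using S.real_cond_exp_intA[OF f A] by (simp add: set_lebesgue_integral_def)
qed

lemma rectangle_integral:
  assumes y: "y \<in> L2_space (process_measure M T)" and st: "0 \<le> s" "t \<le> T" and A: "A \<in> events"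
  shows "(\<integral>p. indicator (A \<times> {s<..t}) p * y p \<partial>process_measure M T)
      = (\<integral>r. indicator {s<..t} r * (\<integral>w. indicator A w * y (w, r) \<partial>M) \<partial>time_measure T)"
    and "(\<lambda>r. indicator {s<..t} r * (\<integral>w. indicator A w * y (w, r) \<partial>M)) \<in> borel_measurable (time_measure T)"
proof -
  have E: "A \<times> {s<..t} \<in> sets (process_measure M T)"
    using A st by (auto intro!: pair_measureI simp: sets_restrict_space_iff)
  have i: "integrable (process_measure M T) (\<lambda>(w, r). indicator (A \<times> {s<..t}) (w, r) * y (w, r))"
    using integrable_mult_indicator[OF E proc.L2_space_integrable[OF y]] by (simp add: case_prod_beta')
  have e: "(\<integral>w. indicator (A \<times> {s<..t}) (w, r) * y (w, r) \<partial>M) = indicator {s<..t} r * (\<integral>w. indicator A w * y (w, r) \<partial>M)" for r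
    by (simp add: indicator_times mult.assoc mult.left_commute[of "indicator A _"])
  show "(\<integral>p. indicator (A \<times> {s<..t}) p * y p \<partial>process_measure M T)
      = (\<integral>r. indicator {s<..t} r * (\<integral>w. indicator A w * y (w, r) \<partial>M) \<partial>time_measure T)"
    using proc.integral_snd[OF i] unfolding e by (simp add: case_prod_beta')
  show "(\<lambda>r. indicator {s<..t} r * (\<integral>w. indicator A w * y (w, r) \<partial>M)) \<in> borel_measurable (time_measure T)"
    using proc.integrable_snd[OF i] unfolding e by simp
qed

text \<open>At a time \<open>r > s\<close> the event \<open>A\<close> belongs to
  \<open>\<F> r\<close>, so conditioning on \<open>\<F> r\<close> does not change the integral of
  the section over \<open>A\<close>. Integrating over \<open>r\<close> gives the rectangle.\<close>

lemma dual_projection: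
  assumes D: "dual T F u" and P: "predictable_projection M W T u v"
  shows "dual T F v"
  unfolding dual_def
proof (intro conjI allI impI)
  show "F \<in> L2_space M" using D by (simp add: dual_def)
  have u: "u \<in> L2_space (process_measure M T)" using D by (simp add: dual_def)
  show v: "v \<in> L2_space (process_measure M T)" using P by (simp add: predictable_projection_def)
  fix s t A assume st: "0 \<le> s" "s \<le> t" "t \<le> T" and A: "A \<in> sets (\<F> s)"
  then have AM: "A \<in> events" using F_subalgebra by (auto simp: subalgebra_def)
  note Fub = rectangle_integral(1)[OF _ st(1,3) AM] and Fm = rectangle_integral(2)[OF _ st(1,3) AM]
  have Fi: "AE r in time_measure T. integrable M (\<lambda>w. y (w, r))" if "y \<in> L2_space (process_measure M T)" for y
    using proc.AE_integrable_snd[where f="\<lambda>w r. y (w, r)" and T=T] proc.L2_space_integrable[OF that] by simp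
  have pr: "AE r in time_measure T. AE w in M. v (w, r) = real_cond_exp M (\<F> r) (\<lambda>w'. u (w', r)) w"
    using P by (simp add: predictable_projection_def)
  have "(\<integral>r. indicator {s<..t} r * (\<integral>w. indicator A w * v (w, r) \<partial>M) \<partial>time_measure T)
    = (\<integral>r. indicator {s<..t} r * (\<integral>w. indicator A w * u (w, r) \<partial>M) \<partial>time_measure T)"
  proof (rule integral_cong_AE[OF Fm[OF v] Fm[OF u]])
    show "AE r in time_measure T. indicator {s<..t} r * (\<integral>w. indicator A w * v (w, r) \<partial>M)
      = indicator {s<..t} r * (\<integral>w. indicator A w * u (w, r) \<partial>M)"
      using pr Fi[OF u] Fi[OF v]
    proof eventually_elim
    case (elim r)
    show ?case
    proof (cases "r \<in> {s<..t}")
      case True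
      have Ar: "A \<in> sets (\<F> r)" using A F_mono[of s r] True by auto
      have "(\<integral>w. indicator A w * v (w, r) \<partial>M) = (\<integral>w. indicator A w * real_cond_exp M (\<F> r) (\<lambda>w'. u (w', r)) w \<partial>M)"
      proof (rule integral_cong_AE)
        show "AE w in M. indicator A w * v (w, r) = indicator A w * real_cond_exp M (\<F> r) (\<lambda>w'. u (w', r)) w"
          using elim(1) by eventually_elim simp
        show "(\<lambda>w. indicator A w * v (w, r)) \<in> borel_measurable M"
          using AM elim(3) by (intro borel_measurable_times) auto
        show "(\<lambda>w. indicator A w * real_cond_exp M (\<F> r) (\<lambda>w'. u (w', r)) w) \<in> borel_measurable M"
          using AM by (intro borel_measurable_times) auto
      qed
      also have "\<dots> = (\<integral>w. indicator A w * u (w, r) \<partial>M)"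
        by (rule real_cond_exp_test[OF Ar elim(2)])
      finally show ?thesis by simp
    qed simp
    qed
  qed
  then show "(\<integral>w. indicator A w * ((W t w - W s w) * F w) \<partial>M) = (\<integral>p. indicator (A \<times> {s<..t}) p * v p \<partial>process_measure M T)"
    using D st A unfolding dual_def Fub[OF v] by (simp add: Fub[OF u])
qed

lemma dual_is_pD:
  assumes T: "0 < T" and D: "is_pD M W T F v"
  shows "dual T F v"
proof -
  obtain F' u' v' where m: "\<And>k. malliavin_deriv M W T (F' k) (u' k)" "\<And>k. predictable_projection M W T (u' k) (v' k)"
    and F: "L2_tendsto M F' F" and v: "L2_tendsto (process_measure M T) v' v"
    using D unfolding is_pD_def by blast
  have "dual T (F' k) (v' k)" for k by (rule dual_projection[OF dual_malliavin[OF T m(1)] m(2)])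
  from dual_limit[OF this F v] show ?thesis .
qed

section \<open>Uniqueness of the predictable integrand\<close>

definition pred_gen :: "real \<Rightarrow> ('a \<times> real) set set" where
  "pred_gen T = {A \<times> {s<..t} | A s t. 0 \<le> s \<and> s < t \<and> t \<le> T \<and> A \<in> sets (\<F> s)} \<union> {A \<times> {0} | A. A \<in> sets (\<F> 0)}"

lemma F_sets_into_space: "A \<in> sets (\<F> s) \<Longrightarrow> A \<subseteq> space M"
  using sets.sets_into_space[of A "\<F> s"] by simp

lemma pred_gen_subset: "0 < T \<Longrightarrow> pred_gen T \<subseteq> Pow (space M \<times> {0..T})"
  by (fastforce simp: pred_gen_def dest: F_sets_into_space)

lemma predictable_sets: "0 < T \<Longrightarrow> sets (predictable_sigma M W T) = sigma_sets (space M \<times> {0..T}) (pred_gen T)"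
  unfolding predictable_sigma_def pred_gen_def[symmetric] by (rule sets_measure_of[OF pred_gen_subset])

lemma predictable_space [simp]: "space (predictable_sigma M W T) = space M \<times> {0..T}"
  unfolding predictable_sigma_def by (rule space_measure_of_conv)

lemma predictable_subalgebra:
  assumes T: "0 < T"
  shows "subalgebra (process_measure M T) (predictable_sigma M W T)"
proof -
  have sp: "space (process_measure M T) = space M \<times> {0..T}"
    by (simp add: space_pair_measure space_restrict_space)
  have "pred_gen T \<subseteq> sets (process_measure M T)"
  proof
    fix E assume "E \<in> pred_gen T"
    then consider A s t where "E = A \<times> {s<..t}" "0 \<le> s" "t \<le> T" "A \<in> sets (\<F> s)" | A where "E = A \<times> {0}" "A \<in> sets (\<F> 0)"
      unfolding pred_gen_def by blast
    then show "E \<in> sets (process_measure M T)"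
      using F_subalgebra T by cases (auto intro!: pair_measureI simp: sets_restrict_space_iff subalgebra_def)
  qed
  then have "sets (predictable_sigma M W T) \<subseteq> sets (process_measure M T)"
    unfolding predictable_sets[OF T] sp[symmetric] by (rule sets.sigma_sets_subset)
  then show ?thesis by (simp add: subalgebra_def sp)
qed

lemma pred_gen_Int_stable: "0 < T \<Longrightarrow> Int_stable (pred_gen T)"
proof (rule Int_stableI)
  assume T: "0 < T"
  have e: "{} \<in> pred_gen T" unfolding pred_gen_def by (intro UnI2 CollectI exI[of _ "{}"]) auto
  fix X Y assume "X \<in> pred_gen T" "Y \<in> pred_gen T"
  then consider A s t A' s' t' where "X = A \<times> {s<..t}" "0 \<le> s" "s < t" "t \<le> T" "A \<in> sets (\<F> s)"
      "Y = A' \<times> {s'<..t'}" "0 \<le> s'" "s' < t'" "t' \<le> T" "A' \<in> sets (\<F> s')"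
    | A A' where "X = A \<times> {0}" "Y = A' \<times> {0}" "A \<in> sets (\<F> 0)" "A' \<in> sets (\<F> 0)"
    | "X \<inter> Y = {}"
    unfolding pred_gen_def by fastforce
  then show "X \<inter> Y \<in> pred_gen T"
  proof cases
    case 1
    show ?thesis
    proof (cases "max s s' < min t t'")
      case True
      have "X \<inter> Y = (A \<inter> A') \<times> {max s s'<..min t t'}" using 1 by auto
      moreover have "A \<inter> A' \<in> sets (\<F> (max s s'))" using 1 F_mono[of s "max s s'"] F_mono[of s' "max s s'"] by auto
      ultimately show ?thesis unfolding pred_gen_def using 1 True
        by (intro UnI1 CollectI exI[of _ "A \<inter> A'"] exI[of _ "max s s'"] exI[of _ "min t t'"]) auto
    next
      case False
      then have "X \<inter> Y = {}" using 1 by auto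
      then show ?thesis using e by simp
    qed
  next
    case 2
    then have "X \<inter> Y = (A \<inter> A') \<times> {0}" "A \<inter> A' \<in> sets (\<F> 0)" by auto
    then show ?thesis unfolding pred_gen_def by blast
  next
    case 3
    then show ?thesis using e by simp
  qed
qed

lemma AE_process_time_neq: "AE p in process_measure M T. snd p \<noteq> c"
proof (rule proc.AE_pair_measure)
  show "{x \<in> space (process_measure M T). snd x \<noteq> c} \<in> sets (process_measure M T)"
  proof -
    have [measurable]: "snd \<in> measurable (process_measure M T) borel"
      by (rule measurable_compose[OF measurable_snd]) (rule measurable_restrict_space1, simp)
    show ?thesis by measurable
  qed
  show "AE x in M. AE y in time_measure T. snd (x, y) \<noteq> c" using AE_time_measure_neq by simp
qed

text \<open>The difference \<open>D\<close> integrates to 0 over the generating rectangles, hence by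
  Dynkin's lemma over all predictable sets. Since \<open>D\<close> is predictable, the sets where it
  is positive or negative are among them.\<close>

lemma dual_unique:
  assumes T: "0 < T" and v: "dual T F v" "v \<in> borel_measurable (predictable_sigma M W T)"
    and w: "dual T F w" "w \<in> borel_measurable (predictable_sigma M W T)"
  shows "AE p in process_measure M T. v p = w p"
proof -
  let ?P = "process_measure M T" and ?S = "predictable_sigma M W T"
  have sp: "space ?P = space M \<times> {0..T}" by (simp add: space_pair_measure space_restrict_space)
  note sub = predictable_subalgebra[OF T]
  have subs: "E \<in> sets ?S \<Longrightarrow> E \<in> sets ?P" for E using sub by (auto simp: subalgebra_def)
  define D where "D p = v p - w p" for p
  have vw: "v \<in> L2_space ?P" "w \<in> L2_space ?P" using v w by (auto simp: dual_def)
  have DS: "D \<in> borel_measurable ?S" unfolding D_def[abs_def] using v w by simp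
  have Di: "integrable ?P D" unfolding D_def[abs_def]
    by (rule proc.L2_space_integrable[OF L2_space_diff[OF vw]])
  have EDi: "integrable ?P (\<lambda>p. indicator E p * D p)" if "E \<in> sets ?P" for E
    using integrable_mult_indicator[OF that Di] by simp
  have gen: "(\<integral>p. indicator (A \<times> {s<..t}) p * D p \<partial>?P) = 0" if "0 \<le> s" "s \<le> t" "t \<le> T" "A \<in> sets (\<F> s)" for A s t
  proof -
    have E: "A \<times> {s<..t} \<in> sets ?P"
      using that F_subalgebra by (auto intro!: pair_measureI simp: sets_restrict_space_iff subalgebra_def)
    have i: "integrable ?P (\<lambda>p. indicator (A \<times> {s<..t}) p * u p)" if "u \<in> L2_space ?P" for u
      using integrable_mult_indicator[OF E proc.L2_space_integrable[OF that]] by simp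
    have "(\<integral>p. indicator (A \<times> {s<..t}) p * D p \<partial>?P)
      = (\<integral>p. indicator (A \<times> {s<..t}) p * v p \<partial>?P) - (\<integral>p. indicator (A \<times> {s<..t}) p * w p \<partial>?P)"
      unfolding D_def using i vw by (simp add: right_diff_distrib)
    then show ?thesis using v(1) w(1) that unfolding dual_def by simp
  qed
  \<comment> \<open>Generators at time 0 are null sets of the product measure, so duality is not
    called upon for them.\<close>
  have z: "(\<integral>p. indicator (A \<times> {0}) p * D p \<partial>?P) = 0" if "A \<in> sets (\<F> 0)" for A
  proof -
    have E: "A \<times> {0} \<in> sets ?P"
      using that F_subalgebra T by (auto intro!: pair_measureI simp: sets_restrict_space_iff subalgebra_def)
    have "(\<integral>p. indicator (A \<times> {0}) p * D p \<partial>?P) = (\<integral>p. 0 \<partial>?P)"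
    proof (rule integral_cong_AE)
      show "AE p in ?P. indicator (A \<times> {0}) p * D p = 0"
        using AE_process_time_neq[where c=0 and T=T] by eventually_elim (auto split: split_indicator)
      show "(\<lambda>p. indicator (A \<times> {0}) p * D p) \<in> borel_measurable ?P" using EDi[OF E] by simp
    qed simp
    then show ?thesis by simp
  qed
  have all: "(\<integral>p. indicator E p * D p \<partial>?P) = 0" if "E \<in> sets ?S" for E
  proof -
    have "E \<in> sigma_sets (space M \<times> {0..T}) (pred_gen T)" using that predictable_sets[OF T] by simp
    with pred_gen_Int_stable[OF T] pred_gen_subset[OF T] show ?thesis
    proof (induction rule: sigma_sets_induct_disjoint)
      case (basic E)
      then show ?case using gen z unfolding pred_gen_def by fastforce
    next
      case empty
      show ?case by simp
    next
      case (compl E)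
      have E: "E \<in> sets ?P" using compl(1) subs predictable_sets[OF T] by simp
      have tot: "(\<integral>p. D p \<partial>?P) = 0"
      proof -
        have "(\<integral>p. D p \<partial>?P) = (\<integral>p. indicator (space M \<times> {0<..T}) p * D p \<partial>?P)"
        proof (rule integral_cong_AE)
          show "AE p in ?P. D p = indicator (space M \<times> {0<..T}) p * D p"
            using AE_process_time_neq[where c=0 and T=T] AE_space
          proof eventually_elim
            case (elim p)
            then have "p \<in> space M \<times> {0<..T}" using sp by (cases p) auto
            then show ?case by simp
          qed
          have "space M \<times> {0<..T} \<in> sets ?P"
            by (auto intro!: pair_measureI simp: sets_restrict_space_iff)
          then show "(\<lambda>p. indicator (space M \<times> {0<..T}) p * D p) \<in> borel_measurable ?P" using EDi by simp
        qed (use Di in simp)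
        also have "\<dots> = 0" using T sets.top[of "\<F> 0"] by (intro gen) auto
        finally show ?thesis .
      qed
      have "(\<integral>p. indicator (space M \<times> {0..T} - E) p * D p \<partial>?P) = (\<integral>p. D p - indicator E p * D p \<partial>?P)"
        by (intro Bochner_Integration.integral_cong refl) (auto simp: sp split: split_indicator)
      also have "\<dots> = 0" using tot compl(2) Di EDi[OF E] by simp
      finally show ?case .
    next
      case (union A)
      have A: "A i \<in> sets ?P" for i using union(2) subs predictable_sets[OF T] by auto
      have "(\<Union>i. A i) \<in> sets ?P" using A by auto
      then have "(LINT p:(\<Union>i. A i)|?P. D p) = (\<Sum>i. LINT p:A i|?P. D p)"
        using union(1) A EDi by (intro lebesgue_integral_countable_add) (auto simp: disjoint_family_on_def set_integrable_def)
      then show ?case using union(3) by (simp add: set_lebesgue_integral_def)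
    qed
  qed
  \<comment> \<open>Both signs are treated at once by the factor \<open>c\<close>, which makes the
    integrand non-negative.\<close>
  have half: "AE p in ?P. indicator {p \<in> space ?S. 0 < c * D p} p * D p = 0" if c: "c = 1 \<or> c = - 1" for c :: real
  proof -
    have E: "{p \<in> space ?S. 0 < c * D p} \<in> sets ?S" using DS by measurable
    have "(\<integral>p. c * (indicator {p \<in> space ?S. 0 < c * D p} p * D p) \<partial>?P) = 0"
      using all[OF E] by simp
    moreover have "integrable ?P (\<lambda>p. c * (indicator {p \<in> space ?S. 0 < c * D p} p * D p))"
      by (intro integrable_mult_right EDi subs E)
    ultimately have "AE p in ?P. c * (indicator {p \<in> space ?S. 0 < c * D p} p * D p) = 0"
      by (subst (asm) integral_nonneg_eq_0_iff_AE) (auto split: split_indicator)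
    then show ?thesis using c by auto
  qed
  from half[of 1, simplified] half[of "-1", simplified] AE_space
  show ?thesis
  proof eventually_elim
    case (elim p)
    then have "p \<in> space ?S" using sp by simp
    then have "D p = 0" using elim(1,2) by (cases "D p" "0::real" rule: linorder_cases) auto
    then show ?case by (simp add: D_def)
  qed
qed

end

section \<open>The kernel\<close>

definition kernel :: "real \<Rightarrow> real \<Rightarrow> real \<Rightarrow> real" where
  "kernel T \<beta> t = (T - t) powr ((\<beta> - 1) / 2) * T powr (- \<beta> / 2) * sqrt \<beta>"

definition tau :: "real \<Rightarrow> real \<Rightarrow> real \<Rightarrow> real" where
  "tau T \<beta> t = 1 - ((T - t) / T) powr \<beta>"

lemma kernel_pos: "0 < \<beta> \<Longrightarrow> 0 < T \<Longrightarrow> t < T \<Longrightarrow> 0 < kernel T \<beta> t"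
  by (simp add: kernel_def)

lemma kernel_sq:
  assumes "0 < T" "0 < \<beta>" "t < T"
  shows "(kernel T \<beta> t)\<^sup>2 = \<beta> * (T - t) powr (\<beta> - 1) * T powr (- \<beta>)"
proof -
  have "((T - t) powr ((\<beta> - 1) / 2))\<^sup>2 = (T - t) powr (\<beta> - 1)"
    by (simp add: power2_eq_square powr_add[symmetric])
  moreover have "(T powr (- \<beta> / 2))\<^sup>2 = T powr (- \<beta>)"
    by (simp add: power2_eq_square powr_add[symmetric])
  ultimately show ?thesis using assms by (simp add: kernel_def power_mult_distrib)
qed

lemma DERIV_tau:
  assumes "0 < T" "0 < \<beta>" "t < T"
  shows "(tau T \<beta> has_real_derivative (kernel T \<beta> t)\<^sup>2) (at t)"
proof -
  have "((\<lambda>t. 1 - ((T - t) / T) powr \<beta>) has_real_derivative \<beta> * ((T - t) / T) powr (\<beta> - 1) / T) (at t)"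
    using assms by (auto intro!: derivative_eq_intros simp: field_simps)
  moreover have "\<beta> * ((T - t) / T) powr (\<beta> - 1) / T = (kernel T \<beta> t)\<^sup>2"
  proof -
    have "((T - t) / T) powr (\<beta> - 1) / T = (T - t) powr (\<beta> - 1) / (T powr (\<beta> - 1) * T powr 1)"
      using assms by (simp add: powr_divide)
    also have "T powr (\<beta> - 1) * T powr 1 = T powr \<beta>" unfolding powr_add[symmetric] by simp
    finally have "((T - t) / T) powr (\<beta> - 1) / T = (T - t) powr (\<beta> - 1) * T powr (- \<beta>)"
      by (simp add: powr_minus divide_inverse)
    then show ?thesis
      unfolding kernel_sq[OF assms] times_divide_eq_right[symmetric] by (simp only: mult.assoc)
  qed
  ultimately show ?thesis by (simp add: tau_def[abs_def])
qed

lemma tau_0: "0 < T \<Longrightarrow> tau T \<beta> 0 = 0"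
  by (simp add: tau_def)

lemma tau_T: "tau T \<beta> T = 1"
  by (simp add: tau_def)

lemma tau_mono: "0 < T \<Longrightarrow> 0 < \<beta> \<Longrightarrow> s \<le> t \<Longrightarrow> t \<le> T \<Longrightarrow> tau T \<beta> s \<le> tau T \<beta> t"
  unfolding tau_def by (simp add: powr_mono2 divide_right_mono)

lemma tau_range:
  assumes "0 < T" "0 < \<beta>" "0 \<le> t" "t \<le> T"
  shows "0 \<le> tau T \<beta> t" "tau T \<beta> t \<le> 1"
  using tau_mono[of T \<beta> 0 t] tau_mono[of T \<beta> t T] assms by (auto simp: tau_0 tau_T)

lemma tau_less_1: "0 < T \<Longrightarrow> t < T \<Longrightarrow> tau T \<beta> t < 1"
  by (simp add: tau_def)

lemma tau_tendsto_left:
  assumes "0 < T" "0 < \<beta>" "b \<le> T"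
  shows "(tau T \<beta> \<longlongrightarrow> tau T \<beta> b) (at_left b)"
proof -
  have "((\<lambda>t. ((T - t) / T) powr \<beta>) \<longlongrightarrow> ((T - b) / T) powr \<beta>) (at_left b)"
  proof (rule tendsto_powr'[OF _ tendsto_const])
    show "((\<lambda>t. (T - t) / T) \<longlongrightarrow> (T - b) / T) (at_left b)" by (intro tendsto_intros) (use assms in auto)
    have "\<forall>\<^sub>F t in at_left b. 0 \<le> (T - t) / T"
      using assms by (auto simp: eventually_at_filter intro!: always_eventually)
    then show "(T - b) / T \<noteq> 0 \<or> 0 < \<beta> \<and> (\<forall>\<^sub>F t in at_left b. 0 \<le> (T - t) / T)" using assms by simp
  qed
  then show ?thesis unfolding tau_def[abs_def] by (intro tendsto_diff tendsto_const)
qed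

text \<open>The integrand is the derivative of \<open>\<tau> ^ Suc k\<close>. The form of the
  fundamental theorem for non-negative integrands is used, since it asks for the derivative only
  inside the interval and yields integrability up to \<open>T\<close> as a conclusion.\<close>

lemma kernel_integral:
  assumes T: "0 < T" and \<beta>: "0 < \<beta>" and ab: "a < b" "b \<le> T" "0 \<le> a"
  shows "integrable lborel (\<lambda>t. indicator {a<..b} t * ((kernel T \<beta> t)\<^sup>2 * (real (Suc k) * tau T \<beta> t ^ k)))"
    and "(\<integral>t. indicator {a<..b} t * ((kernel T \<beta> t)\<^sup>2 * (real (Suc k) * tau T \<beta> t ^ k)) \<partial>lborel)
       = tau T \<beta> b ^ Suc k - tau T \<beta> a ^ Suc k"
proof -
  let ?f = "\<lambda>t. (kernel T \<beta> t)\<^sup>2 * (real (Suc k) * tau T \<beta> t ^ k)" and ?F = "\<lambda>t. tau T \<beta> t ^ Suc k"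
  have lim_b: "((?F \<circ> real_of_ereal) \<longlongrightarrow> tau T \<beta> b ^ Suc k) (at_left (ereal b))"
    unfolding ereal_tendsto_simps by (intro tendsto_power tau_tendsto_left T \<beta> ab)
  have lim_a: "((?F \<circ> real_of_ereal) \<longlongrightarrow> tau T \<beta> a ^ Suc k) (at_right (ereal a))"
  proof -
    have "isCont (tau T \<beta>) a" using DERIV_isCont[OF DERIV_tau[OF T \<beta>]] ab by simp
    then have "(tau T \<beta> \<longlongrightarrow> tau T \<beta> a) (at_right a)" by (simp add: isCont_def filterlim_at_split)
    then show ?thesis unfolding ereal_tendsto_simps by (intro tendsto_power)
  qed
  have D: "(?F has_real_derivative ?f x) (at x)" if "x < b" for x
  proof -
    have d: "(tau T \<beta> has_real_derivative (kernel T \<beta> x)\<^sup>2) (at x)"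
      by (rule DERIV_tau[OF T \<beta>]) (use that ab in simp)
    from DERIV_power_Suc[OF d, of k] show ?thesis by (simp add: mult_ac)
  qed
  have C: "isCont ?f x" if "x < b" for x
  proof -
    have "isCont (tau T \<beta>) x" using DERIV_isCont[OF DERIV_tau[OF T \<beta>]] that ab by simp
    moreover have "isCont (kernel T \<beta>) x"
      unfolding kernel_def[abs_def] using that ab by (intro continuous_intros) auto
    ultimately show ?thesis by (intro continuous_intros)
  qed
  have N: "0 \<le> ?f x" if "a < x" "x < b" for x
    using tau_range(1)[OF T \<beta>, of x] that ab by simp
  have e: "(ereal a < ereal b)" using ab by simp
  note I = interval_integral_FTC_nonneg[of "ereal a" "ereal b" ?F ?f, OF e _ _ _ lim_a lim_b]
  have 1: "set_integrable lborel (einterval a b) ?f" and 2: "(LBINT x=ereal a..ereal b. ?f x) = tau T \<beta> b ^ Suc k - tau T \<beta> a ^ Suc k"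
    using I D C N by auto
  have ae: "AE t in lborel. indicator {a<..b} t * ?f t = indicator {a<..<b} t * ?f t"
    using AE_lborel_singleton[of b] by eventually_elim (auto split: split_indicator)
  have i1: "integrable lborel (\<lambda>t. indicator {a<..<b} t * ?f t)" using 1 by (simp add: set_integrable_def)
  have m: "(\<lambda>t. indicator {a<..b} t * ?f t) \<in> borel_measurable lborel"
    unfolding kernel_def tau_def by measurable
  show "integrable lborel (\<lambda>t. indicator {a<..b} t * ?f t)"
    by (rule integrable_cong_AE_imp[OF i1 m]) (use ae in auto)
  have "(\<integral>t. indicator {a<..b} t * ?f t \<partial>lborel) = (\<integral>t. indicator {a<..<b} t * ?f t \<partial>lborel)"
    by (rule integral_cong_AE[OF m _ ae]) (use i1 in simp)
  also have "\<dots> = (LBINT x=ereal a..ereal b. ?f x)"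
    using ab by (simp add: interval_lebesgue_integral_def set_lebesgue_integral_def)
  finally show "(\<integral>t. indicator {a<..b} t * ?f t \<partial>lborel) = tau T \<beta> b ^ Suc k - tau T \<beta> a ^ Suc k" using 2 by simp
qed

context brownian_motion
begin

section \<open>Sections of processes\<close>

lemma process_section_measurable:
  "y \<in> borel_measurable (process_measure M T) \<Longrightarrow> t \<in> {0..T} \<Longrightarrow> (\<lambda>w. y (w, t)) \<in> borel_measurable M"
  by (rule measurable_compose[OF measurable_Pair2'[of t "time_measure T" M]]) (auto simp: space_restrict_space)

lemma process_L2I:
  assumes y: "y \<in> borel_measurable (process_measure M T)" and \<phi>: "integrable (time_measure T) \<phi>"
    and s: "AE t in time_measure T. (\<lambda>w. y (w, t)) \<in> L2_space M \<and> (\<integral>w. (y (w, t))\<^sup>2 \<partial>M) \<le> \<phi> t"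
  shows "y \<in> L2_space (process_measure M T)" "(\<integral>p. (y p)\<^sup>2 \<partial>process_measure M T) \<le> (\<integral>t. \<phi> t \<partial>time_measure T)"
proof -
  note [measurable] = y
  have p0: "AE t in time_measure T. 0 \<le> \<phi> t"
    using s
  proof eventually_elim
    case (elim t)
    have "0 \<le> (\<integral>w. (y (w, t))\<^sup>2 \<partial>M)" by simp
    then show ?case using elim by linarith
  qed
  have "(\<integral>\<^sup>+p. ennreal ((y p)\<^sup>2) \<partial>process_measure M T) = (\<integral>\<^sup>+t. (\<integral>\<^sup>+w. ennreal ((y (w, t))\<^sup>2) \<partial>M) \<partial>time_measure T)"
    by (rule proc.nn_integral_snd[symmetric]) simp
  also have "\<dots> \<le> (\<integral>\<^sup>+t. ennreal (\<phi> t) \<partial>time_measure T)"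
  proof (rule nn_integral_mono_AE)
    show "AE t in time_measure T. (\<integral>\<^sup>+w. ennreal ((y (w, t))\<^sup>2) \<partial>M) \<le> ennreal (\<phi> t)"
      using s
    proof eventually_elim
      case (elim t)
      then have "(\<integral>\<^sup>+w. ennreal ((y (w, t))\<^sup>2) \<partial>M) = ennreal (\<integral>w. (y (w, t))\<^sup>2 \<partial>M)"
        by (intro nn_integral_eq_integral) (auto simp: L2_space_def)
      then show ?case using elim by (simp add: ennreal_leI)
    qed
  qed
  also have "\<dots> = ennreal (\<integral>t. \<phi> t \<partial>time_measure T)"
    by (rule nn_integral_eq_integral[OF \<phi> p0])
  finally have le: "(\<integral>\<^sup>+p. ennreal ((y p)\<^sup>2) \<partial>process_measure M T) \<le> ennreal (\<integral>t. \<phi> t \<partial>time_measure T)" .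
  have i: "integrable (process_measure M T) (\<lambda>p. (y p)\<^sup>2)"
    by (rule integrableI_bounded) (use le in \<open>auto intro: le_less_trans\<close>)
  then show "y \<in> L2_space (process_measure M T)" using y by (simp add: L2_space_def)
  have "ennreal (\<integral>p. (y p)\<^sup>2 \<partial>process_measure M T) \<le> ennreal (\<integral>t. \<phi> t \<partial>time_measure T)"
    using le nn_integral_eq_integral[OF i] by simp
  moreover have "0 \<le> (\<integral>t. \<phi> t \<partial>time_measure T)" using p0 by (rule integral_nonneg_AE)
  ultimately show "(\<integral>p. (y p)\<^sup>2 \<partial>process_measure M T) \<le> (\<integral>t. \<phi> t \<partial>time_measure T)" by simp
qed

lemma process_section_L2:
  assumes y: "y \<in> L2_space (process_measure M T)"
  shows "AE t in time_measure T. (\<lambda>w. y (w, t)) \<in> L2_space M"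
proof -
  have "AE t in time_measure T. integrable M (\<lambda>w. (y (w, t))\<^sup>2)"
    using proc.AE_integrable_snd[where f="\<lambda>w t. (y (w, t))\<^sup>2" and T=T] L2_spaceD(2)[OF y] by (simp add: case_prod_beta')
  then show ?thesis using AE_space
  proof eventually_elim
    case (elim t)
    then show ?case using process_section_measurable[OF L2_spaceD(1)[OF y], of t]
      by (simp add: L2_space_def space_restrict_space)
  qed
qed

text \<open>Convergence in the product space says that the squared distances of the sections tend to
  0 in \<open>L1\<close> over time, so along a subsequence they do at almost every time.\<close>

lemma process_tendsto_sections:
  assumes l: "L2_tendsto (process_measure M T) f l"
  shows "\<exists>r::nat \<Rightarrow> nat. strict_mono r \<and> (AE t in time_measure T. L2_tendsto M (\<lambda>k w. f (r k) (w, t)) (\<lambda>w. l (w, t)))"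
proof -
  note a = L2_tendstoD[OF l]
  let ?e = "\<lambda>k t. \<integral>w. (f k (w, t) - l (w, t))\<^sup>2 \<partial>M"
  have i: "integrable (process_measure M T) (\<lambda>(w, t). (f k (w, t) - l (w, t))\<^sup>2)" for k
    using L2_spaceD(2)[OF L2_space_diff[OF a(1) a(2)], of k] by (simp add: case_prod_beta')
  have "(\<integral>t. norm (?e k t) \<partial>time_measure T) = (L2_norm_of (process_measure M T) (\<lambda>p. f k p - l p))\<^sup>2" for k
    using proc.integral_snd[OF i[of k]] by (simp add: L2_norm_of_power2 case_prod_beta')
  moreover have "(\<lambda>k. (L2_norm_of (process_measure M T) (\<lambda>p. f k p - l p))\<^sup>2) \<longlonglongrightarrow> 0\<^sup>2"
    by (intro tendsto_intros a(3))
  ultimately have "(\<lambda>k. \<integral>t. norm (?e k t) \<partial>time_measure T) \<longlonglongrightarrow> 0" by simp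
  from tendsto_L1_AE_subseq[OF proc.integrable_snd[OF i] this]
  obtain r :: "nat \<Rightarrow> nat" where r: "strict_mono r" "AE t in time_measure T. (\<lambda>k. ?e (r k) t) \<longlonglongrightarrow> 0" by auto
  have "AE t in time_measure T. \<forall>k. (\<lambda>w. f k (w, t)) \<in> L2_space M"
    unfolding AE_all_countable using process_section_L2[OF a(1)] by blast
  with r(2) process_section_L2[OF a(2)]
  have "AE t in time_measure T. L2_tendsto M (\<lambda>k w. f (r k) (w, t)) (\<lambda>w. l (w, t))"
  proof eventually_elim
    case (elim t)
    from tendsto_real_sqrt[OF elim(1)] have "(\<lambda>k. L2_norm_of M (\<lambda>w. f (r k) (w, t) - l (w, t))) \<longlonglongrightarrow> 0"
      by (simp add: L2_norm_of_def)
    then show ?case using elim by (simp add: L2_tendsto_def)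
  qed
  with r(1) show ?thesis by blast
qed

section \<open>Predictable processes\<close>

lemma predictable_rectangle:
  assumes T: "0 < T" and st: "0 \<le> s" "s < t" "t \<le> T" and f: "f \<in> borel_measurable (\<F> s)"
  shows "(\<lambda>p. indicator {s<..t} (snd p) * (f (fst p) :: real)) \<in> borel_measurable (predictable_sigma M W T)"
proof (rule measurableI)
  fix B :: "real set" assume B: "B \<in> sets borel"
  have gen: "A \<times> {s<..t} \<in> sets (predictable_sigma M W T)" if "A \<in> sets (\<F> s)" for A
    unfolding predictable_sets[OF T] using that st by (intro sigma_sets.Basic) (auto simp: pred_gen_def)
  have fB: "f -` B \<inter> space M \<in> sets (\<F> s)" using measurable_sets[OF f B] by simp
  let ?E = "space M \<times> {s<..t}"
  have E: "?E \<in> sets (predictable_sigma M W T)" using gen[of "space M"] sets.top[of "\<F> s"] by simp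
  \<comment> \<open>Outside the strip the function is 0, so the complement of the strip belongs to
    the preimage exactly if 0 lies in \<open>B\<close>.\<close>
  have "(\<lambda>p. indicator {s<..t} (snd p) * f (fst p)) -` B \<inter> space (predictable_sigma M W T)
    = ((f -` B \<inter> space M) \<times> {s<..t}) \<union> (if 0 \<in> B then space (predictable_sigma M W T) - ?E else {})"
    using st by (auto simp: indicator_def of_bool_def split: if_splits)
  also have "\<dots> \<in> sets (predictable_sigma M W T)"
    using gen[OF fB] sets.Un[OF gen[OF fB] sets.compl_sets[OF E]]
    by (cases "0 \<in> B") (simp_all only: if_True if_False Un_empty_right)
  finally show "(\<lambda>p. indicator {s<..t} (snd p) * f (fst p)) -` B \<inter> space (predictable_sigma M W T) \<in> sets (predictable_sigma M W T)" .
qed simp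

lemma predictable_snd:
  assumes T: "0 < T"
  shows "snd \<in> borel_measurable (predictable_sigma M W T)"
proof (rule borel_measurableI_le)
  fix y :: real
  have g0: "space M \<times> {0} \<in> sets (predictable_sigma M W T)"
    unfolding predictable_sets[OF T] using sets.top[of "\<F> 0"] by (intro sigma_sets.Basic) (auto simp: pred_gen_def)
  have g: "space M \<times> {0<..t} \<in> sets (predictable_sigma M W T)" if "0 < t" "t \<le> T" for t
    unfolding predictable_sets[OF T] using that sets.top[of "\<F> 0"] by (intro sigma_sets.Basic) (fastforce simp: pred_gen_def)
  consider "y < 0" | "y = 0" | "0 < y" "y \<le> T" | "T < y" by linarith
  then show "{x \<in> space (predictable_sigma M W T). snd x \<le> y} \<in> sets (predictable_sigma M W T)"
  proof cases
    case 1
    then have e: "{x \<in> space (predictable_sigma M W T). snd x \<le> y} = {}" by auto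
    show ?thesis unfolding e by (rule sets.empty_sets)
  next
    case 2
    then have e: "{x \<in> space (predictable_sigma M W T). snd x \<le> y} = space M \<times> {0}" using T by auto
    show ?thesis unfolding e by (rule g0)
  next
    case 3
    then have e: "{x \<in> space (predictable_sigma M W T). snd x \<le> y} = (space M \<times> {0}) \<union> (space M \<times> {0<..y})" by auto
    show ?thesis unfolding e by (rule sets.Un[OF g0 g[OF 3]])
  next
    case 4
    then have e: "{x \<in> space (predictable_sigma M W T). snd x \<le> y} = space (predictable_sigma M W T)" by auto
    show ?thesis unfolding e by (rule sets.top)
  qed
qed

end

section \<open>Derivatives of Hermite polynomials\<close>

definition dherm :: "nat \<Rightarrow> real \<Rightarrow> real \<Rightarrow> real" where
  "dherm k s x = poly (pderiv (herm k s)) x / sqrt (fact k)"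

text \<open>The second moment of \<open>dherm k s\<close> under the centred Gaussian law of variance \<open>s\<close>.\<close>

definition dherm_norm2 :: "nat \<Rightarrow> real \<Rightarrow> real" where
  "dherm_norm2 k s = real k * s ^ (k - 1)"

lemma dherm_norm2_nonneg: "0 \<le> s \<Longrightarrow> 0 \<le> dherm_norm2 k s"
  by (simp add: dherm_norm2_def)

text \<open>\<open>k * s ^ (k - 1)\<close> is at most the sum of the first \<open>k\<close> powers
  of \<open>s\<close>, hence at most the geometric series. The bound is uniform in \<open>k\<close>,
  so square summable coefficients suffice for the martingale of the integrand to exist before time
  \<open>T\<close>.\<close>

lemma dherm_norm2_le:
  assumes "0 \<le> s" "s < 1"
  shows "dherm_norm2 k s \<le> 1 / (1 - s)"
proof (cases k)
  case (Suc j)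
  have "real (Suc j) * s ^ j = (\<Sum>i<Suc j. s ^ j)" by simp
  also have "\<dots> \<le> (\<Sum>i<Suc j. s ^ i)" using assms by (intro sum_mono power_decreasing) auto
  finally have "(1 - s) * (real (Suc j) * s ^ j) \<le> (1 - s) * (\<Sum>i<Suc j. s ^ i)"
    using assms by (intro mult_left_mono) auto
  also have "\<dots> = 1 - s ^ Suc j" by (rule one_diff_power_eq[symmetric])
  also have "\<dots> \<le> 1" using assms by simp
  finally show ?thesis using assms Suc by (simp add: dherm_norm2_def field_simps)
qed (use assms in \<open>simp add: dherm_norm2_def\<close>)

text \<open>\<open>pderiv_herm\<close> reduces this to \<open>herm_orthogonal\<close> one degree
  lower; in degree 0 the derivative vanishes.\<close>

lemma dherm_orthogonal:
  "(\<integral>z. dherm j (\<sigma>\<^sup>2) (\<sigma> * z) * dherm k (\<sigma>\<^sup>2) (\<sigma> * z) \<partial>std_gauss) = (if j = k then dherm_norm2 k (\<sigma>\<^sup>2) else 0)"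
proof (cases "j = 0 \<or> k = 0")
  case True
  then show ?thesis by (auto simp: dherm_def dherm_norm2_def)
next
  case False
  then obtain j' k' where jk: "j = Suc j'" "k = Suc k'" by (metis not0_implies_Suc)
  let ?c = "real (Suc j') * real (Suc k') / (sqrt (fact j) * sqrt (fact k))"
  have "(\<integral>z. dherm j (\<sigma>\<^sup>2) (\<sigma> * z) * dherm k (\<sigma>\<^sup>2) (\<sigma> * z) \<partial>std_gauss)
    = (\<integral>z. ?c * (poly (herm j' (\<sigma>\<^sup>2)) (\<sigma> * z) * poly (herm k' (\<sigma>\<^sup>2)) (\<sigma> * z)) \<partial>std_gauss)"
    unfolding dherm_def jk pderiv_herm poly_smult
    by (intro Bochner_Integration.integral_cong refl) (simp only: times_divide_times_eq mult_ac times_divide_eq_left times_divide_eq_right divide_divide_eq_left)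
  also have "\<dots> = ?c * (if k' = j' then fact j' * (\<sigma>\<^sup>2) ^ j' else 0)"
    by (simp only: integral_mult_right_zero herm_orthogonal)
  also have "\<dots> = (if j = k then dherm_norm2 k (\<sigma>\<^sup>2) else 0)"
  proof (cases "j' = k'")
    case True
    have "sqrt (fact k) * sqrt (fact k) = real (Suc k') * fact k'" unfolding jk by simp
    then have c: "?c * fact j' = real (Suc k')" using True unfolding jk by (simp del: of_nat_Suc fact_Suc)
    have "?c * (fact j' * (\<sigma>\<^sup>2) ^ j') = real (Suc k') * (\<sigma>\<^sup>2) ^ j'"
      unfolding mult.assoc[symmetric] c ..
    then show ?thesis using True jk by (simp add: dherm_norm2_def del: of_nat_Suc fact_Suc)
  qed (use jk in auto)
  finally show ?thesis .
qed

lemma smooth_poly_growth_poly: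
  fixes p :: "real poly" and x :: "nat \<Rightarrow> real"
  shows "smooth_poly_growth 1 (\<lambda>x. poly p (x 0))"
    and "partial_deriv 0 (\<lambda>x. poly p (x 0)) x = poly (pderiv p) (x 0)"
proof -
  have pd: "partial_deriv 0 (\<lambda>x. poly q (x 0)) = (\<lambda>x. poly (pderiv q) (x 0))" for q :: "real poly"
  proof
    fix x :: "nat \<Rightarrow> real"
    have "deriv (\<lambda>y. poly q y) (x 0) = poly (pderiv q) (x 0)" by (rule DERIV_imp_deriv) (rule poly_DERIV)
    then show "partial_deriv 0 (\<lambda>x. poly q (x 0)) x = poly (pderiv q) (x 0)"
      by (simp add: partial_deriv_def)
  qed
  then show "partial_deriv 0 (\<lambda>x. poly p (x 0)) x = poly (pderiv p) (x 0)" by simp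
  have it: "foldr partial_deriv ks (\<lambda>x. poly p (x 0)) = (\<lambda>x. poly ((pderiv ^^ length ks) p) (x 0))"
    if "set ks \<subseteq> {..<1}" for ks
    using that by (induction ks) (auto simp: pd)
  show "smooth_poly_growth 1 (\<lambda>x. poly p (x 0))"
    unfolding smooth_poly_growth_def
  proof (intro conjI allI impI)
    fix ks :: "nat list" assume ks: "set ks \<subseteq> {..<1}"
    let ?q = "(pderiv ^^ length ks) p"
    show "continuous_on UNIV (foldr partial_deriv ks (\<lambda>x. poly p (x 0)))"
      unfolding it[OF ks] by (rule continuous_on_poly) simp
    obtain C d where "\<And>x. \<bar>poly ?q x\<bar> \<le> C * (1 + \<bar>x\<bar>) ^ d" using poly_growth[of ?q] by blast
    then show "\<exists>C d. \<forall>x. \<bar>foldr partial_deriv ks (\<lambda>x. poly p (x 0)) x\<bar> \<le> C * (1 + (\<Sum>j<1. \<bar>x j\<bar>)) ^ d"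
      unfolding it[OF ks] by auto
    fix i :: nat and x :: "nat \<Rightarrow> real" assume "i < 1"
    then show "(\<lambda>y. foldr partial_deriv ks (\<lambda>x. poly p (x 0)) (x(i := y))) differentiable at (x i)"
      unfolding it[OF ks] by (auto simp: real_differentiable_def intro!: exI poly_DERIV)
  qed simp
qed

text \<open>The polynomial itself varies with its variance parameter \<open>S p\<close>, so
  measurability of a fixed polynomial is not enough. The recursion gives joint measurability, with
  the derivative carried along.\<close>

lemma herm_joint_measurable:
  assumes "S \<in> borel_measurable N" "X \<in> borel_measurable N"
  shows "(\<lambda>p. poly (herm k (S p)) (X p)) \<in> borel_measurable N" "(\<lambda>p. dherm k (S p) (X p)) \<in> borel_measurable N"
proof -
  note [measurable] = assms
  have "(\<lambda>p. poly (herm k (S p)) (X p)) \<in> borel_measurable N \<and> (\<lambda>p. poly (pderiv (herm k (S p))) (X p)) \<in> borel_measurable N"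
  proof (induction k)
    case (Suc k)
    then have [measurable]: "(\<lambda>p. poly (herm k (S p)) (X p)) \<in> borel_measurable N"
      "(\<lambda>p. poly (pderiv (herm k (S p))) (X p)) \<in> borel_measurable N" by auto
    have "(\<lambda>p. X p * poly (herm k (S p)) (X p) - S p * poly (pderiv (herm k (S p))) (X p)) \<in> borel_measurable N"
      by measurable
    moreover have "(\<lambda>p. real (Suc k) * poly (herm k (S p)) (X p)) \<in> borel_measurable N" by measurable
    ultimately show ?case by (simp only: pderiv_herm poly_smult) simp
  qed simp
  then show "(\<lambda>p. poly (herm k (S p)) (X p)) \<in> borel_measurable N" "(\<lambda>p. dherm k (S p) (X p)) \<in> borel_measurable N"
    unfolding dherm_def by auto
qed

text \<open>The two fractions of the total lie between 0 and 1, so each is at most its power of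
  exponent \<beta>, and they add up to 1.\<close>

lemma powr_subadditive:
  fixes x y :: real
  assumes "0 \<le> x" "0 \<le> y" "0 < \<beta>" "\<beta> \<le> 1"
  shows "(x + y) powr \<beta> \<le> x powr \<beta> + y powr \<beta>"
proof (cases "x + y = 0")
  case False
  then have s: "0 < x + y" using assms by simp
  have ge: "z / (x + y) \<le> z powr \<beta> / (x + y) powr \<beta>" if z: "0 \<le> z" "z \<le> x + y" for z
  proof (cases "z = 0")
    case False
    then have "(z / (x + y)) powr 1 \<le> (z / (x + y)) powr \<beta>"
      using assms z s by (intro powr_mono') auto
    then show ?thesis using z s by (simp add: powr_divide)
  qed simp
  have "1 = x / (x + y) + y / (x + y)" using s by (simp add: add_divide_distrib[symmetric])
  also have "\<dots> \<le> x powr \<beta> / (x + y) powr \<beta> + y powr \<beta> / (x + y) powr \<beta>"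
    using assms by (intro add_mono ge) auto
  also have "\<dots> = (x powr \<beta> + y powr \<beta>) / (x + y) powr \<beta>" by (simp add: add_divide_distrib)
  finally show ?thesis using s by (simp add: field_simps)
qed (use assms in auto)

lemma dherm_measurable [measurable]: "dherm k s \<in> borel_measurable borel"
  unfolding dherm_def[abs_def] by measurable

lemma dherm_smoothing:
  "(\<integral>z. dherm k (s + \<sigma>\<^sup>2) (x + \<sigma> * z) \<partial>std_gauss) = dherm k s x"
  unfolding dherm_def by (simp only: integral_divide_zero herm_smoothing_aux[THEN conjunct2])

context brownian_motion
begin

lemma gauss_indep_cong_AE:
  assumes V: "gauss_indep M (\<F> a) V \<sigma>" and U: "U \<in> borel_measurable M" "AE w in M. U w = V w"
  shows "gauss_indep M (\<F> a) U \<sigma>"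
  unfolding gauss_indep_def
proof (intro conjI U ballI)
  fix A and B :: "real set" assume A: "A \<in> sets (\<F> a)" and B: "B \<in> sets borel"
  have Vm: "V \<in> borel_measurable M" using V by (simp add: gauss_indep_def)
  have AM: "A \<in> events" using A F_subalgebra by (auto simp: subalgebra_def)
  have "prob (A \<inter> (U -` B \<inter> space M)) = prob (A \<inter> (V -` B \<inter> space M))"
  proof (rule measure_eq_AE)
    show "AE w in M. w \<in> A \<inter> (U -` B \<inter> space M) \<longleftrightarrow> w \<in> A \<inter> (V -` B \<inter> space M)"
      using U(2) by eventually_elim auto
  qed (use AM measurable_sets[OF U(1) B] measurable_sets[OF Vm B] in auto)
  then show "prob (A \<inter> (U -` B \<inter> space M)) = prob A * measure std_gauss ((\<lambda>z. \<sigma> * z) -` B)"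
    using V A B by (simp add: gauss_indep_def)
qed

lemma gauss_poly_L2:
  fixes q :: "real poly"
  assumes V: "gauss_indep M (\<F> a) V \<sigma>"
  shows "(\<lambda>w. poly q (V w)) \<in> L2_space M"
proof -
  have Vm[measurable]: "V \<in> borel_measurable M" using V by (simp add: gauss_indep_def)
  have "integrable std_gauss (\<lambda>z. (poly q (\<sigma> * z))\<^sup>2)"
    using L2_spaceD(2)[OF poly_L2_std_gauss[of q 0 \<sigma>]] by simp
  then have "integrable M (\<lambda>w. (poly q (V w))\<^sup>2)"
    by (subst gauss_indep_integral(2)[OF F_subalgebra V, of "\<lambda>x. (poly q x)\<^sup>2"]) auto
  then show ?thesis by (simp add: L2_space_def)
qed

lemma gauss_dherm_L2:
  assumes V: "gauss_indep M (\<F> a) V \<sigma>"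
  shows "(\<lambda>w. dherm k s (V w)) \<in> L2_space M"
  using L2_space_cmult[OF gauss_poly_L2[OF V, of "pderiv (herm k s)"], of "1 / sqrt (fact k)"]
  by (simp add: dherm_def)

end

section \<open>The fractional kernel\<close>

locale fractional_kernel = brownian_motion M W
  for M :: "'a measure" and W :: "real \<Rightarrow> 'a \<Rightarrow> real" +
  fixes T \<beta> :: real and \<eta> :: "real \<Rightarrow> real"
  assumes T: "0 < T" and \<beta>: "0 < \<beta>" "\<beta> < 1"
    and eta: "\<And>t. 0 \<le> t \<Longrightarrow> t < T \<Longrightarrow> \<eta> t = kernel T \<beta> t"
begin

abbreviation \<tau> :: "real \<Rightarrow> real" where "\<tau> \<equiv> tau T \<beta>"
abbreviation X :: "real \<Rightarrow> 'a \<Rightarrow> real" where "X t \<equiv> winc T \<eta> 0 t"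
abbreviation WI :: "'a \<Rightarrow> real" where "WI \<equiv> wiener_integral M W T \<eta>"
abbreviation PM :: "('a \<times> real) measure" where "PM \<equiv> process_measure M T"
abbreviation TM :: "real measure" where "TM \<equiv> time_measure T"

text \<open>The hypothesis on \<open>\<eta>\<close> says nothing about the value at \<open>T\<close>.\<close>

definition eta_ext :: "real \<Rightarrow> real" where
  "eta_ext t = (if t < T then kernel T \<beta> t else \<eta> T)"

lemma eta_ext_measurable [measurable]: "eta_ext \<in> borel_measurable borel"
  unfolding eta_ext_def[abs_def] kernel_def by measurable

lemma eta_ext: "t \<in> {0..T} \<Longrightarrow> eta_ext t = \<eta> t"
  using eta by (cases "t = T") (auto simp: eta_ext_def)

lemma eta_measurable: "\<eta> \<in> borel_measurable TM"
proof -
  have "eta_ext \<in> borel_measurable TM" by (rule measurable_restrict_space1) simp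
  then show ?thesis
    by (rule measurable_cong[THEN iffD1, rotated]) (simp add: space_restrict_space eta_ext)
qed

lemma tau_measurable [measurable]: "\<tau> \<in> borel_measurable borel"
  unfolding tau_def[abs_def] by measurable

lemma AE_interior: "AE t in TM. 0 < t \<and> t < T"
  using AE_time_measure_neq[where c=0 and T=T] AE_time_measure_neq[where c=T and T=T] AE_space
  by eventually_elim (auto simp: space_restrict_space)

text \<open>The case \<open>k = 0\<close> gives the variances of the Wiener integrals of \<eta>,
  general \<open>k\<close> the squared norm of the integrand belonging to degree
  \<open>Suc k\<close>.\<close>

lemma eta_integral:
  assumes ab: "0 \<le> a" "a \<le> b" "b \<le> T"
  shows "integrable TM (\<lambda>t. indicator {a<..b} t * ((\<eta> t)\<^sup>2 * (real (Suc k) * \<tau> t ^ k)))"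
    and "(\<integral>t. indicator {a<..b} t * ((\<eta> t)\<^sup>2 * (real (Suc k) * \<tau> t ^ k)) \<partial>TM) = \<tau> b ^ Suc k - \<tau> a ^ Suc k"
proof -
  let ?f = "\<lambda>h t. indicator {a<..b} t * ((h t)\<^sup>2 * (real (Suc k) * \<tau> t ^ k)) :: real"
  have "integrable TM (?f \<eta>) \<and> (\<integral>t. ?f \<eta> t \<partial>TM) = \<tau> b ^ Suc k - \<tau> a ^ Suc k"
  proof (cases "a = b")
    case True
    then show ?thesis by simp
  next
    case False
    then have lt: "a < b" using ab by simp
    note K = kernel_integral[OF T \<beta>(1) lt ab(3,1), of k]
    have km: "?f (kernel T \<beta>) \<in> borel_measurable borel"
      unfolding kernel_def by measurable
    have em: "?f \<eta> \<in> borel_measurable TM"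
      using eta_measurable by (intro borel_measurable_times borel_measurable_power borel_measurable_const)
        (auto intro!: measurable_restrict_space1)
    have ae: "AE t in TM. ?f (kernel T \<beta>) t = ?f \<eta> t"
      using AE_interior by eventually_elim (simp add: eta)
    have e: "(\<lambda>t. indicator {0..T} t *\<^sub>R ?f (kernel T \<beta>) t) = ?f (kernel T \<beta>)"
      using ab by (auto split: split_indicator)
    have "integrable TM (?f (kernel T \<beta>)) = integrable lborel (\<lambda>t. indicator {0..T} t *\<^sub>R ?f (kernel T \<beta>) t)"
      by (rule integrable_restrict_space) simp
    then have "integrable TM (?f (kernel T \<beta>))" unfolding e using K(1) by simp
    from integrable_cong_AE_imp[OF this em] ae have i: "integrable TM (?f \<eta>)" by auto
    have "(\<integral>t. ?f \<eta> t \<partial>TM) = (\<integral>t. ?f (kernel T \<beta>) t \<partial>TM)"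
      by (rule integral_cong_AE[OF em]) (use km ae in \<open>auto intro: measurable_restrict_space1 elim!: eventually_mono\<close>)
    also have "\<dots> = (\<integral>t. ?f (kernel T \<beta>) t \<partial>lborel)"
      by (rule interval_lborel_time[OF ab(1,3), symmetric])
    finally show ?thesis using i K(2) by simp
  qed
  then show "integrable TM (?f \<eta>)" "(\<integral>t. ?f \<eta> t \<partial>TM) = \<tau> b ^ Suc k - \<tau> a ^ Suc k" by auto
qed

lemma eta_L2: "\<eta> \<in> L2_space TM"
proof -
  have em: "(\<lambda>t. (\<eta> t)\<^sup>2) \<in> borel_measurable TM" using eta_measurable by measurable
  have i: "integrable TM (\<lambda>t. indicator {0<..T} t * (\<eta> t)\<^sup>2)"
    using eta_integral(1)[OF order_refl _ order_refl, of 0] T by simp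
  have "AE t in TM. indicator {0<..T} t * (\<eta> t)\<^sup>2 = (\<eta> t)\<^sup>2"
    using AE_interior by eventually_elim simp
  from integrable_cong_AE_imp[OF i em] this have "integrable TM (\<lambda>t. (\<eta> t)\<^sup>2)" by auto
  then show ?thesis using eta_measurable by (simp add: L2_space_def)
qed

section \<open>The Gaussian martingale of partial Wiener integrals\<close>

lemma wvar_eta: "0 \<le> a \<Longrightarrow> a \<le> b \<Longrightarrow> b \<le> T \<Longrightarrow> wvar T \<eta> a b = \<tau> b - \<tau> a"
  using eta_integral(2)[of a b 0] by (simp add: wvar_def)

lemma increment_gauss:
  "0 \<le> a \<Longrightarrow> a \<le> b \<Longrightarrow> b \<le> T \<Longrightarrow> gauss_indep M (\<F> a) (winc T \<eta> a b) (sqrt (\<tau> b - \<tau> a))"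
  using winc_gauss_indep[OF T eta_L2] wvar_eta by simp

lemma X_gauss: "0 \<le> t \<Longrightarrow> t \<le> T \<Longrightarrow> gauss_indep M (\<F> 0) (X t) (sqrt (\<tau> t))"
  using increment_gauss[of 0 t] tau_0[OF T] by simp

lemma X_F: "0 \<le> t \<Longrightarrow> t \<le> T \<Longrightarrow> X t \<in> borel_measurable (\<F> t)"
  by (rule winc_F[OF T eta_L2]) auto

lemma WI_measurable: "WI \<in> borel_measurable M"
  using L2_tendstoD(2)[OF wiener_integral_tendsto[OF T eta_L2]] L2_spaceD(1) by blast

lemma WI_gauss: "gauss_indep M (\<F> 0) WI 1"
  using gauss_indep_cong_AE[OF X_gauss[of T] WI_measurable wiener_integral_winc[OF T eta_L2]] T tau_T[of T \<beta>] by simp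

lemma dherm_X_L2: "0 \<le> t \<Longrightarrow> t \<le> T \<Longrightarrow> (\<lambda>w. dherm k s (X t w)) \<in> L2_space M"
  by (rule gauss_dherm_L2[OF X_gauss])

lemma dherm_WI_L2: "(\<lambda>w. dherm k s (WI w)) \<in> L2_space M"
  by (rule gauss_dherm_L2[OF WI_gauss])

text \<open>The terminal integral is \<open>X a\<close> plus an independent Gaussian variable of
  variance \<open>1 - \<tau> a\<close>. Averaging over the latter lowers the variance parameter from
  1 to \<open>\<tau> a\<close>, by \<open>dherm_smoothing\<close>.\<close>

lemma dherm_terminal:
  assumes a: "0 \<le> a" "a \<le> T" and A: "A \<in> sets (\<F> a)"
  shows "(\<integral>w. indicator A w * dherm k 1 (WI w) \<partial>M) = (\<integral>w. indicator A w * dherm k (\<tau> a) (X a w) \<partial>M)"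
proof -
  let ?Y = "winc T \<eta> a T" and ?s = "sqrt (1 - \<tau> a)"
  have Y: "gauss_indep M (\<F> a) ?Y ?s" using increment_gauss[of a T] a tau_T[of T \<beta>] by simp
  have Ym: "?Y \<in> borel_measurable M" using Y by (simp add: gauss_indep_def)
  have AM[measurable]: "A \<in> events" using A F_subalgebra by (auto simp: subalgebra_def)
  have Xm: "X a \<in> borel_measurable M" by (rule F_measurable_M[OF X_F[OF a]])
  note [measurable] = WI_measurable Ym Xm
  have ae: "AE w in M. WI w = X a w + ?Y w"
    using wiener_integral_winc[OF T eta_L2] winc_split[OF T eta_L2 a order_refl] by eventually_elim simp
  let ?\<Phi> = "\<lambda>(w, y). indicator A w * dherm k 1 (X a w + y)"
  have i0: "integrable M (\<lambda>w. indicator A w * dherm k 1 (WI w))"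
    by (rule L2_space_integrable[OF indicator_F_mult_L2[OF A dherm_WI_L2]])
  have e: "AE w in M. indicator A w * dherm k 1 (WI w) = ?\<Phi> (w, ?Y w)"
    using ae by eventually_elim simp
  have m: "(\<lambda>w. ?\<Phi> (w, ?Y w)) \<in> borel_measurable M" by simp
  have "integrable M (\<lambda>w. ?\<Phi> (w, ?Y w))" by (rule integrable_cong_AE_imp[OF i0 m]) (use e in auto)
  moreover have "?\<Phi> \<in> borel_measurable (\<F> a \<Otimes>\<^sub>M borel)"
  proof -
    note [measurable] = X_F[OF a] A
    show ?thesis by measurable
  qed
  ultimately have "(\<integral>w. ?\<Phi> (w, ?Y w) \<partial>M) = (\<integral>w. (\<integral>z. ?\<Phi> (w, ?s * z) \<partial>std_gauss) \<partial>M)"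
    by (intro gauss_indep_Fubini(1)[OF F_subalgebra Y])
  also have "\<dots> = (\<integral>w. indicator A w * dherm k (\<tau> a) (X a w) \<partial>M)"
  proof (intro Bochner_Integration.integral_cong refl)
    fix w
    have "\<tau> a + ?s\<^sup>2 = 1" using tau_range(2)[OF T \<beta>(1) a] by simp
    then show "(\<integral>z. ?\<Phi> (w, ?s * z) \<partial>std_gauss) = indicator A w * dherm k (\<tau> a) (X a w)"
      using dherm_smoothing[of k "\<tau> a" ?s "X a w"] by simp
  qed
  finally show ?thesis using integral_cong_AE[OF _ m e] i0 by simp
qed

text \<open>Both sides equal the integral of the same terminal variable.\<close>

lemma dherm_martingale:
  assumes a: "0 \<le> a" "a \<le> b" "b \<le> T" and A: "A \<in> sets (\<F> a)"
  shows "(\<integral>w. indicator A w * dherm k (\<tau> b) (X b w) \<partial>M) = (\<integral>w. indicator A w * dherm k (\<tau> a) (X a w) \<partial>M)"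
  using dherm_terminal[of a A k] dherm_terminal[of b A k] a A F_mono[OF a(2)] by auto

lemma dherm_X_orthogonal:
  assumes a: "0 \<le> a" "a \<le> T"
  shows "(\<integral>w. dherm j (\<tau> a) (X a w) * dherm k (\<tau> a) (X a w) \<partial>M) = (if j = k then dherm_norm2 k (\<tau> a) else 0)"
proof -
  have "(\<integral>w. dherm j (\<tau> a) (X a w) * dherm k (\<tau> a) (X a w) \<partial>M)
    = (\<integral>z. dherm j (\<tau> a) (sqrt (\<tau> a) * z) * dherm k (\<tau> a) (sqrt (\<tau> a) * z) \<partial>std_gauss)"
    by (rule gauss_indep_integral(1)[OF F_subalgebra X_gauss[OF a], of "\<lambda>x. dherm j (\<tau> a) x * dherm k (\<tau> a) x"]) simp
  also have "\<dots> = (if j = k then dherm_norm2 k (\<tau> a) else 0)"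
    using dherm_orthogonal[of j "sqrt (\<tau> a)" k] tau_range(1)[OF T \<beta>(1) a] by simp
  finally show ?thesis .
qed

lemma dherm_X_sum_norm:
  assumes a: "0 \<le> a" "a \<le> T" and I: "finite I"
  shows "(\<integral>w. (\<Sum>k\<in>I. c k * dherm k (\<tau> a) (X a w))\<^sup>2 \<partial>M) = (\<Sum>k\<in>I. (c k)\<^sup>2 * dherm_norm2 k (\<tau> a))"
proof -
  have i: "integrable M (\<lambda>w. dherm k (\<tau> a) (X a w) * dherm j (\<tau> a) (X a w))" for j k
    by (intro L2_mult_integrable dherm_X_L2 a)
  have "(\<integral>w. (\<Sum>k\<in>I. c k * dherm k (\<tau> a) (X a w))\<^sup>2 \<partial>M)
    = (\<integral>w. (\<Sum>k\<in>I. \<Sum>j\<in>I. (c k * c j) * (dherm k (\<tau> a) (X a w) * dherm j (\<tau> a) (X a w))) \<partial>M)"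
    by (simp add: power2_eq_square sum_product mult_ac)
  also have "\<dots> = (\<Sum>k\<in>I. \<Sum>j\<in>I. (c k * c j) * (if k = j then dherm_norm2 j (\<tau> a) else 0))"
    using i by (simp add: dherm_X_orthogonal[OF a])
  also have "\<dots> = (\<Sum>k\<in>I. (c k)\<^sup>2 * dherm_norm2 k (\<tau> a))"
    using I by (simp add: power2_eq_square if_distrib cong: if_cong)
  finally show ?thesis .
qed

lemma dherm_X_sum_L2: "0 \<le> a \<Longrightarrow> a \<le> T \<Longrightarrow> (\<lambda>w. \<Sum>k\<in>I. c k * dherm k s (X a w)) \<in> L2_space M"
  by (intro L2_space_sum L2_space_cmult dherm_X_L2)

lemma dherm_X_sum_F: "0 \<le> a \<Longrightarrow> a \<le> T \<Longrightarrow> (\<lambda>w. \<Sum>k\<in>I. c k * dherm k s (X a w)) \<in> borel_measurable (\<F> a)"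
  by (intro borel_measurable_sum borel_measurable_times borel_measurable_const measurable_compose[OF X_F dherm_measurable])

section \<open>The integrand of a Hermite expansion\<close>

text \<open>Subadditivity of the power of exponent \<beta>, applied to the distance from
  \<open>a\<close> to \<open>T\<close> as a sum of two distances.\<close>

lemma tau_increment_le: "0 \<le> a \<Longrightarrow> a \<le> b \<Longrightarrow> b \<le> T \<Longrightarrow> \<tau> b - \<tau> a \<le> ((b - a) / T) powr \<beta>"
  using powr_subadditive[of "(T - b) / T" "(b - a) / T" \<beta>] T \<beta> by (simp add: tau_def add_divide_distrib[symmetric])

lemma X_L2: "0 \<le> t \<Longrightarrow> t \<le> T \<Longrightarrow> X t \<in> L2_space M"
  using gauss_poly_L2[OF X_gauss, of t "[:0, 1:]"] by simp

lemma winc_norm2: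
  assumes "0 \<le> s" "s \<le> t" "t \<le> T"
  shows "(\<integral>w. (winc T \<eta> s t w)\<^sup>2 \<partial>M) = \<tau> t - \<tau> s"
  using gauss_indep_integral(1)[OF F_subalgebra increment_gauss[OF assms], of "\<lambda>x. x\<^sup>2"] tau_mono[OF T \<beta>(1) assms(2,3)]
  by (simp add: power_mult_distrib std_gauss_moments)

lemma X_diff_norm:
  assumes st: "0 \<le> s" "s \<le> t" "t \<le> T"
  shows "L2_norm_of M (\<lambda>w. X s w - X t w) = sqrt (\<tau> t - \<tau> s)"
proof -
  have "(\<integral>w. (X s w - X t w)\<^sup>2 \<partial>M) = (\<integral>w. (winc T \<eta> s t w)\<^sup>2 \<partial>M)"
  proof (rule integral_cong_AE)
    show "AE w in M. (X s w - X t w)\<^sup>2 = (winc T \<eta> s t w)\<^sup>2"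
      using winc_split[OF T eta_L2 st] by eventually_elim simp
  qed (use F_measurable_M[OF winc_F[OF T eta_L2]] st in \<open>auto intro!: borel_measurable_power borel_measurable_diff\<close>)
  then show ?thesis by (simp add: L2_norm_of_def winc_norm2[OF st])
qed

text \<open>The variables \<open>X t\<close> are chosen separately for each \<open>t\<close>, so
  nothing is known about them jointly in \<open>t\<close>. Freezing \<open>X\<close> at the left end
  of each cell gives predictable processes; their sections approach \<open>X t\<close> at a rate
  uniform in \<open>t\<close>, and the limit in the complete space of predictable processes is the
  desired version.\<close>

lemma predictable_X: "\<exists>X'. X' \<in> borel_measurable (predictable_sigma M W T) \<and> (AE t in TM. AE w in M. X' (w, t) = X t w)"
proof -
  define Z where "Z N p = (\<Sum>i<Suc N. indicator (cell T (Suc N) i) (snd p) * X (grid T (Suc N) i) (fst p))" for N and p :: "'a \<times> real"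
  \<comment> \<open>The uniform rate, from the increment bound for \<tau> on a cell of length
    \<open>T / Suc N\<close>; \<open>Suc N\<close> keeps the grid nonempty.\<close>
  define b where "b N = sqrt ((1 / real (Suc N)) powr \<beta>)" for N
  have Zp: "Z N \<in> borel_measurable (predictable_sigma M W T)" for N
    unfolding Z_def[abs_def]
  proof (rule borel_measurable_sum)
    fix i assume "i \<in> {..<Suc N}"
    then have g: "0 \<le> grid T (Suc N) i" "grid T (Suc N) i < grid T (Suc N) (Suc i)" "grid T (Suc N) (Suc i) \<le> T"
      using T by (auto intro!: grid_nonneg grid_strict grid_le)
    then show "(\<lambda>p. indicator (cell T (Suc N) i) (snd p) * X (grid T (Suc N) i) (fst p)) \<in> borel_measurable (predictable_sigma M W T)"
      by (intro predictable_rectangle T X_F) auto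
  qed
  have ZM: "Z N \<in> borel_measurable PM" for N
    by (rule measurable_from_subalg[OF predictable_subalgebra[OF T] Zp])
  have Z: "\<exists>s. 0 \<le> s \<and> s \<le> t \<and> t - s \<le> T / real (Suc N) \<and> (\<forall>w. Z N (w, t) = X s w)" if t: "0 < t" "t < T" for N t
  proof -
    obtain i where i: "i < Suc N" "t \<in> cell T (Suc N) i" using cell_cover[OF T, of t "Suc N"] t by auto
    have "Z N (w, t) = (\<Sum>j<Suc N. if j = i then X (grid T (Suc N) i) w else 0)" for w
      unfolding Z_def
    proof (rule sum.cong[OF refl])
      fix j
      show "indicator (cell T (Suc N) j) (snd (w, t)) * X (grid T (Suc N) j) (fst (w, t)) = (if j = i then X (grid T (Suc N) i) w else 0)"
        using cell_disjoint[of T t "Suc N" i j] i T by (cases "j = i") (auto simp: indicator_def)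
    qed
    then have "Z N (w, t) = X (grid T (Suc N) i) w" for w using i(1) by simp
    then show ?thesis using i(2) grid_nonneg[of T "Suc N" i] T
      by (intro exI[of _ "grid T (Suc N) i"]) (auto simp: grid_Suc)
  qed
  have ZL: "(\<lambda>w. Z N (w, t)) \<in> L2_space M" "(\<integral>w. (Z N (w, t))\<^sup>2 \<partial>M) \<le> 1" "L2_norm_of M (\<lambda>w. Z N (w, t) - X t w) \<le> b N"
    if t: "0 < t" "t < T" for N t
  proof -
    obtain s where s: "0 \<le> s" "s \<le> t" "t - s \<le> T / real (Suc N)" and e: "\<And>w. Z N (w, t) = X s w" using Z[OF t] by blast
    show "(\<lambda>w. Z N (w, t)) \<in> L2_space M" unfolding e using s t by (intro X_L2) auto
    show "(\<integral>w. (Z N (w, t))\<^sup>2 \<partial>M) \<le> 1"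
      unfolding e using winc_norm2[of 0 s] tau_range(2)[OF T \<beta>(1), of s] s t by (simp add: tau_0[OF T])
    have "(t - s) / T \<le> 1 / real (Suc N)" using divide_right_mono[OF s(3), of T] T by simp
    then have "((t - s) / T) powr \<beta> \<le> (1 / real (Suc N)) powr \<beta>" using s T \<beta> by (intro powr_mono2) auto
    moreover have "\<tau> t - \<tau> s \<le> ((t - s) / T) powr \<beta>" using s t by (intro tau_increment_le) auto
    ultimately show "L2_norm_of M (\<lambda>w. Z N (w, t) - X t w) \<le> b N"
      unfolding e b_def using s t by (subst X_diff_norm) (auto intro: real_sqrt_le_mono)
  qed
  have b0: "b \<longlonglongrightarrow> 0"
  proof -
    have "(\<lambda>N. sqrt ((1 / real (Suc N)) powr \<beta>)) \<longlonglongrightarrow> sqrt (0 powr \<beta>)"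
      using \<beta> by (intro tendsto_real_sqrt tendsto_powr' LIMSEQ_Suc[OF lim_const_over_n] tendsto_const) auto
    then show ?thesis by (simp add: b_def[abs_def])
  qed
  have Z2: "Z N \<in> L2_space PM" for N
    by (rule process_L2I(1)[OF ZM _ eventually_mono[OF AE_interior], where \<phi>="\<lambda>_. 1"]) (use ZL in auto)
  have "\<exists>X'. L2_tendsto PM Z X' \<and> X' \<in> borel_measurable (predictable_sigma M W T)"
  proof (rule proc.L2_complete_subalgebra[OF predictable_subalgebra[OF T] Z2 Zp])
    fix e :: real assume e: "e > 0"
    \<comment> \<open>Two rates then add up to at most \<open>e / sqrt T\<close>, whose square
      integrates to \<open>e\<^sup>2\<close> over the time interval.\<close>
    then obtain K where K: "\<And>k. k \<ge> K \<Longrightarrow> \<bar>b k\<bar> < e / (2 * sqrt T)"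
      using LIMSEQ_D[OF b0, of "e / (2 * sqrt T)"] T by auto
    have "L2_norm_of PM (\<lambda>p. Z m p - Z n p) \<le> e" if mn: "m \<ge> K" "n \<ge> K" for m n
    proof (rule power2_le_imp_le)
      have s: "AE t in TM. (\<lambda>w. Z m (w, t) - Z n (w, t)) \<in> L2_space M \<and> (\<integral>w. (Z m (w, t) - Z n (w, t))\<^sup>2 \<partial>M) \<le> (e / sqrt T)\<^sup>2"
        using AE_interior
      proof eventually_elim
        case (elim t)
        then have t: "0 < t" "t < T" by auto
        have "L2_norm_of M (\<lambda>w. Z m (w, t) - Z n (w, t)) \<le> b m + b n"
          using L2_norm_of_triangle3[OF ZL(1)[OF t, of m] X_L2 ZL(1)[OF t, of n], of t] ZL(3)[OF t, of m] ZL(3)[OF t, of n]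
            L2_norm_of_minus_commute[of M "X t" "\<lambda>w. Z n (w, t)"] t by simp
        also have "\<dots> \<le> e / sqrt T" using K[OF mn(1)] K[OF mn(2)] by (simp add: field_simps)
        finally show ?case unfolding L2_norm_of_power2[symmetric] using ZL(1)[OF t] by (auto intro: power_mono L2_space_diff)
      qed
      have "(L2_norm_of PM (\<lambda>p. Z m p - Z n p))\<^sup>2 \<le> (\<integral>t. (e / sqrt T)\<^sup>2 \<partial>TM)"
        unfolding L2_norm_of_power2 by (rule process_L2I(2)[OF _ _ s]) (use ZM in auto)
      also have "\<dots> = e\<^sup>2" by (subst time_measure_integral) (use T in \<open>simp add: power_divide\<close>)
      finally show "(L2_norm_of PM (\<lambda>p. Z m p - Z n p))\<^sup>2 \<le> e\<^sup>2" .
    qed (use e in simp)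
    then show "\<exists>K. \<forall>m\<ge>K. \<forall>n\<ge>K. L2_norm_of PM (\<lambda>p. Z m p - Z n p) \<le> e" by blast
  qed
  then obtain X' where X': "L2_tendsto PM Z X'" "X' \<in> borel_measurable (predictable_sigma M W T)" by blast
  obtain r :: "nat \<Rightarrow> nat" where r: "strict_mono r" "AE t in TM. L2_tendsto M (\<lambda>k w. Z (r k) (w, t)) (\<lambda>w. X' (w, t))"
    using process_tendsto_sections[OF X'(1)] by blast
  have "AE t in TM. AE w in M. X' (w, t) = X t w"
    using r(2) AE_interior
  proof eventually_elim
    case (elim t)
    then have "L2_tendsto M (\<lambda>k w. Z k (w, t)) (X t)" by (intro L2_tendstoI_le[OF _ _ _ b0] ZL X_L2) auto
    from L2_tendsto_unique[OF elim(1) L2_tendsto_subseq[OF this r(1)]] show ?case .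
  qed
  with X'(2) show ?thesis by blast
qed

definition XP :: "'a \<times> real \<Rightarrow> real" where
  "XP = (SOME X'. X' \<in> borel_measurable (predictable_sigma M W T) \<and> (AE t in TM. AE w in M. X' (w, t) = X t w))"

lemma XP_predictable: "XP \<in> borel_measurable (predictable_sigma M W T)"
  and XP_eq: "AE t in TM. AE w in M. XP (w, t) = X t w"
  using someI_ex[OF predictable_X] unfolding XP_def[symmetric] by auto

text \<open>The integrand in the Ito representation of \<open>hermn k\<close> of the terminal
  integral. \<open>XP\<close> is used instead of \<open>X\<close> to make it predictable.\<close>

definition V :: "nat \<Rightarrow> 'a \<times> real \<Rightarrow> real" where
  "V k p = \<eta> (snd p) * dherm k (\<tau> (snd p)) (XP p)"

lemma V_predictable: "V k \<in> borel_measurable (predictable_sigma M W T)"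
proof -
  note [measurable] = predictable_snd[OF T] XP_predictable
  have [measurable]: "(\<lambda>p. dherm k (\<tau> (snd p)) (XP p)) \<in> borel_measurable (predictable_sigma M W T)"
    by (rule herm_joint_measurable(2)) measurable
  have "(\<lambda>p. eta_ext (snd p) * dherm k (\<tau> (snd p)) (XP p)) \<in> borel_measurable (predictable_sigma M W T)"
    by measurable
  then show ?thesis
    by (rule measurable_cong[THEN iffD1, rotated]) (auto simp: V_def eta_ext)
qed

lemma V_measurable: "V k \<in> borel_measurable PM"
  by (rule measurable_from_subalg[OF predictable_subalgebra[OF T] V_predictable])

lemma V_sum_section:
  "AE t in TM. 0 < t \<and> t < T \<and> (AE w in M. (\<Sum>k\<in>I. c k * V k (w, t)) = \<eta> t * (\<Sum>k\<in>I. c k * dherm k (\<tau> t) (X t w)))"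
  using XP_eq AE_interior
proof eventually_elim
  case (elim t)
  have "AE w in M. (\<Sum>k\<in>I. c k * V k (w, t)) = \<eta> t * (\<Sum>k\<in>I. c k * dherm k (\<tau> t) (X t w))"
    using elim(1) by eventually_elim (simp add: V_def sum_distrib_left mult_ac)
  with elim show ?case by simp
qed

lemma V_sum_measurable: "(\<lambda>p. \<Sum>k\<in>I. c k * V k p) \<in> borel_measurable PM"
  by (intro borel_measurable_sum borel_measurable_times borel_measurable_const V_measurable)

text \<open>By orthogonality the second moment at time \<open>t\<close> is \<open>\<eta> t\<close>
  squared times the sum of the \<open>(c k)\<^sup>2 * dherm_norm2 k (\<tau> t)\<close>. For
  \<open>k > 0\<close> the integral over time of the \<open>k\<close>-th weight is
  \<open>\<tau> T ^ k - \<tau> 0 ^ k\<close>, which is 1; for \<open>k = 0\<close> it is 0, whence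
  an inequality.\<close>

lemma V_sum_norm:
  assumes I: "finite I"
  shows "(\<lambda>p. \<Sum>k\<in>I. c k * V k p) \<in> L2_space PM"
    and "(\<integral>p. (\<Sum>k\<in>I. c k * V k p)\<^sup>2 \<partial>PM) \<le> (\<Sum>k\<in>I. (c k)\<^sup>2)"
proof -
  define \<phi> where "\<phi> t = (\<Sum>k\<in>I. (c k)\<^sup>2 * (indicator {0<..T} t * ((\<eta> t)\<^sup>2 * dherm_norm2 k (\<tau> t))))" for t
  have n: "integrable TM (\<lambda>t. indicator {0<..T} t * ((\<eta> t)\<^sup>2 * dherm_norm2 k (\<tau> t)))
     \<and> (\<integral>t. indicator {0<..T} t * ((\<eta> t)\<^sup>2 * dherm_norm2 k (\<tau> t)) \<partial>TM) \<le> 1" for k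
  proof (cases k)
    case (Suc j)
    then show ?thesis using eta_integral[OF order_refl less_imp_le[OF T] order_refl, of j] T
      by (simp add: dherm_norm2_def tau_0 tau_T del: of_nat_Suc)
  qed (simp add: dherm_norm2_def)
  have i: "integrable TM \<phi>" unfolding \<phi>_def using n by (intro Bochner_Integration.integrable_sum integrable_mult_right) auto
  have "(\<integral>t. \<phi> t \<partial>TM) = (\<Sum>k\<in>I. (c k)\<^sup>2 * (\<integral>t. indicator {0<..T} t * ((\<eta> t)\<^sup>2 * dherm_norm2 k (\<tau> t)) \<partial>TM))"
    unfolding \<phi>_def
    by (subst Bochner_Integration.integral_sum) (use n in \<open>auto intro!: integrable_mult_right\<close>)
  also have "\<dots> \<le> (\<Sum>k\<in>I. (c k)\<^sup>2 * 1)" using n by (intro sum_mono mult_left_mono) auto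
  finally have le: "(\<integral>t. \<phi> t \<partial>TM) \<le> (\<Sum>k\<in>I. (c k)\<^sup>2)" by simp
  have s: "AE t in TM. (\<lambda>w. \<Sum>k\<in>I. c k * V k (w, t)) \<in> L2_space M \<and> (\<integral>w. (\<Sum>k\<in>I. c k * V k (w, t))\<^sup>2 \<partial>M) \<le> \<phi> t"
    using V_sum_section[of c I]
  proof eventually_elim
    case (elim t)
    then have t: "0 \<le> t" "t \<le> T" "0 < t" and ae: "AE w in M. \<eta> t * (\<Sum>k\<in>I. c k * dherm k (\<tau> t) (X t w)) = (\<Sum>k\<in>I. c k * V k (w, t))"
      by (auto elim!: eventually_mono)
    have m: "(\<lambda>w. \<Sum>k\<in>I. c k * V k (w, t)) \<in> borel_measurable M"
      using process_section_measurable[OF V_sum_measurable, of t] t by simp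
    have L: "(\<lambda>w. \<eta> t * (\<Sum>k\<in>I. c k * dherm k (\<tau> t) (X t w))) \<in> L2_space M"
      by (intro L2_space_cmult dherm_X_sum_L2 t)
    have "(\<integral>w. (\<Sum>k\<in>I. c k * V k (w, t))\<^sup>2 \<partial>M) = (L2_norm_of M (\<lambda>w. \<eta> t * (\<Sum>k\<in>I. c k * dherm k (\<tau> t) (X t w))))\<^sup>2"
      unfolding L2_norm_of_cong_AE[OF ae L2_spaceD(1)[OF L] m] by (rule L2_norm_of_power2[symmetric])
    also have "\<dots> = (\<eta> t)\<^sup>2 * (\<Sum>k\<in>I. (c k)\<^sup>2 * dherm_norm2 k (\<tau> t))"
      by (simp add: L2_norm_of_power2 power_mult_distrib dherm_X_sum_norm[OF t(1,2) I])
    also have "\<dots> = \<phi> t" using t by (simp add: \<phi>_def sum_distrib_left mult_ac)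
    finally show ?case using L2_space_cong_AE[OF L ae m] by simp
  qed
  note P = process_L2I[OF V_sum_measurable i s]
  show "(\<lambda>p. \<Sum>k\<in>I. c k * V k p) \<in> L2_space PM" by (rule P(1))
  show "(\<integral>p. (\<Sum>k\<in>I. c k * V k p)\<^sup>2 \<partial>PM) \<le> (\<Sum>k\<in>I. (c k)\<^sup>2)" using P(2) le by linarith
qed

text \<open>The finite Hermite sums on which everything is explicit: \<open>MN\<close> below is the
  Malliavin derivative of \<open>FN\<close>, \<open>VN\<close> its predictable projection, and
  \<open>pN\<close> the polynomial that exhibits \<open>FN\<close> as a smooth functional of one
  Wiener integral.\<close>

definition FN :: "(nat \<Rightarrow> real) \<Rightarrow> nat \<Rightarrow> 'a \<Rightarrow> real" where
  "FN c N w = (\<Sum>k<N. c k * hermn k (WI w))"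

definition VN :: "(nat \<Rightarrow> real) \<Rightarrow> nat \<Rightarrow> 'a \<times> real \<Rightarrow> real" where
  "VN c N p = (\<Sum>k<N. c k * V k p)"

definition MN :: "(nat \<Rightarrow> real) \<Rightarrow> nat \<Rightarrow> 'a \<times> real \<Rightarrow> real" where
  "MN c N p = (\<Sum>k<N. c k * dherm k 1 (WI (fst p))) * \<eta> (snd p)"

definition pN :: "(nat \<Rightarrow> real) \<Rightarrow> nat \<Rightarrow> real poly" where
  "pN c N = (\<Sum>k<N. smult (c k / sqrt (fact k)) (herm k 1))"

lemma poly_pN: "poly (pN c N) x = (\<Sum>k<N. c k * hermn k x)" "poly (pderiv (pN c N)) x = (\<Sum>k<N. c k * dherm k 1 x)"
proof -
  show "poly (pN c N) x = (\<Sum>k<N. c k * hermn k x)"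
    by (simp add: pN_def poly_sum hermn_def)
  have "pderiv (pN c N) = (\<Sum>k<N. smult (c k / sqrt (fact k)) (pderiv (herm k 1)))"
    unfolding pN_def by (induction N) (simp_all add: pderiv_add pderiv_smult)
  then show "poly (pderiv (pN c N)) x = (\<Sum>k<N. c k * dherm k 1 x)"
    by (simp add: poly_sum dherm_def)
qed

lemma FN_L2: "FN c N \<in> L2_space M"
  using gauss_poly_L2[OF WI_gauss, of "pN c N"] by (simp add: poly_pN FN_def[abs_def])

lemma DN_L2: "(\<lambda>w. \<Sum>k<N. c k * dherm k 1 (WI w)) \<in> L2_space M"
  by (intro L2_space_sum L2_space_cmult dherm_WI_L2)

lemma MN_L2: "MN c N \<in> L2_space PM"
proof -
  let ?d = "\<lambda>w. \<Sum>k<N. c k * dherm k 1 (WI w)"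
  have m: "MN c N \<in> borel_measurable PM"
    unfolding MN_def[abs_def] using L2_spaceD(1)[OF DN_L2, of c N] eta_measurable
    by (intro borel_measurable_times) (auto intro: measurable_compose[OF measurable_fst] measurable_compose[OF measurable_snd])
  have "integrable PM (\<lambda>p. (?d (fst p))\<^sup>2 * (\<eta> (snd p))\<^sup>2)"
    by (rule proc.integral_product_function(1)[OF L2_spaceD(2)[OF DN_L2] L2_spaceD(2)[OF eta_L2]])
  then show ?thesis using m by (simp add: L2_space_def MN_def power_mult_distrib)
qed

lemma malliavin_FN: "malliavin_deriv M W T (FN c N) (MN c N)"
proof -
  have "smooth_functional_deriv M W T (FN c N) (MN c N)"
    unfolding smooth_functional_deriv_def
  proof (intro exI conjI)
    show "smooth_poly_growth 1 (\<lambda>x. poly (pN c N) (x 0))" by (rule smooth_poly_growth_poly)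
    show "\<forall>j<1. (\<lambda>_. \<eta>) j \<in> L2_space TM" using eta_L2 by simp
    show "FN c N = (\<lambda>w. poly (pN c N) (wiener_integral M W T \<eta> w))"
      by (simp add: FN_def[abs_def] poly_pN)
    show "MN c N = (\<lambda>(w, t). \<Sum>i<1. partial_deriv i (\<lambda>x. poly (pN c N) (x 0)) (\<lambda>j. wiener_integral M W T \<eta> w) * \<eta> t)"
      using smooth_poly_growth_poly(2)[of "pN c N"] by (auto simp: MN_def fun_eq_iff poly_pN)
  qed
  then show ?thesis
    unfolding malliavin_deriv_def using L2_tendsto_const[OF FN_L2] L2_tendsto_const[OF MN_L2]
    by (intro exI[of _ "\<lambda>_. FN c N"] exI[of _ "\<lambda>_. MN c N"]) auto
qed

lemma VN_L2: "VN c N \<in> L2_space PM"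
  unfolding VN_def[abs_def] by (rule V_sum_norm(1)) simp

lemma VN_predictable: "VN c N \<in> borel_measurable (predictable_sigma M W T)"
  unfolding VN_def[abs_def] by (intro borel_measurable_sum borel_measurable_times borel_measurable_const V_predictable)

text \<open>The sections of \<open>VN\<close> are recognised as conditional expectations by testing
  on events of \<open>\<F> t\<close>, where \<open>dherm_terminal\<close> replaces terminal values
  by values at time \<open>t\<close>.\<close>

lemma projection_FN: "predictable_projection M W T (MN c N) (VN c N)"
  unfolding predictable_projection_def
proof (intro conjI VN_L2 VN_predictable)
  show "AE t in TM. AE w in M. VN c N (w, t) = real_cond_exp M (\<F> t) (\<lambda>w'. MN c N (w', t)) w"
    using V_sum_section[of c "{..<N}"]
  proof eventually_elim
    case (elim t)
    then have t: "0 \<le> t" "t \<le> T" by auto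
    let ?f = "\<lambda>w. \<eta> t * (\<Sum>k<N. c k * dherm k (\<tau> t) (X t w))"
    interpret S: sigma_finite_subalgebra M "\<F> t" by (rule F_sigma_finite_subalgebra)
    have "AE w in M. real_cond_exp M (\<F> t) (\<lambda>w'. MN c N (w', t)) w = ?f w"
    proof (rule S.real_cond_exp_charact)
      have U: "(\<lambda>w. MN c N (w, t)) \<in> L2_space M"
        using L2_space_cmult[OF DN_L2, of "\<eta> t" c N] by (simp add: MN_def mult.commute)
      show "integrable M (\<lambda>w. MN c N (w, t))" by (rule L2_space_integrable[OF U])
      show "integrable M ?f" by (intro L2_space_integrable L2_space_cmult dherm_X_sum_L2 t)
      show "?f \<in> borel_measurable (\<F> t)" by (intro borel_measurable_times borel_measurable_const dherm_X_sum_F t)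
      fix A assume A: "A \<in> sets (\<F> t)"
      have i1: "integrable M (\<lambda>w. indicator A w * dherm k 1 (WI w))" for k
        by (rule L2_space_integrable[OF indicator_F_mult_L2[OF A dherm_WI_L2]])
      have i2: "integrable M (\<lambda>w. indicator A w * dherm k (\<tau> t) (X t w))" for k
        by (rule L2_space_integrable[OF indicator_F_mult_L2[OF A dherm_X_L2[OF t]]])
      have "(\<integral>w. indicator A w * MN c N (w, t) \<partial>M) = (\<integral>w. \<eta> t * (\<Sum>k<N. c k * (indicator A w * dherm k 1 (WI w))) \<partial>M)"
        by (simp add: MN_def sum_distrib_left sum_distrib_right mult_ac)
      also have "\<dots> = \<eta> t * (\<Sum>k<N. c k * (\<integral>w. indicator A w * dherm k 1 (WI w) \<partial>M))"
        using i1 by (simp add: integral_mult_right_zero)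
      also have "\<dots> = \<eta> t * (\<Sum>k<N. c k * (\<integral>w. indicator A w * dherm k (\<tau> t) (X t w) \<partial>M))"
        by (simp only: dherm_terminal[OF t A])
      also have "\<dots> = (\<integral>w. \<eta> t * (\<Sum>k<N. c k * (indicator A w * dherm k (\<tau> t) (X t w))) \<partial>M)"
        using i2 by (simp add: integral_mult_right_zero)
      also have "\<dots> = (\<integral>w. indicator A w * ?f w \<partial>M)"
        by (simp add: sum_distrib_left mult_ac)
      finally show "(\<integral>w\<in>A. MN c N (w, t) \<partial>M) = (\<integral>w\<in>A. ?f w \<partial>M)"
        by (simp only: set_lebesgue_integral_def real_scaleR_def)
    qed
    moreover have "AE w in M. VN c N (w, t) = ?f w" using elim by (simp add: VN_def)
    ultimately show ?case by eventually_elim simp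
  qed
qed

lemma dual_FN: "dual T (FN c N) (VN c N)"
  by (rule dual_projection[OF dual_malliavin[OF T malliavin_FN] projection_FN])

text \<open>The terminal integral is standard Gaussian, so composition with it preserves
  \<open>L2\<close> norms and the Hermite expansion of \<open>g\<close> carries over.\<close>

lemma FN_tendsto:
  assumes g: "g \<in> L2_space std_gauss"
  shows "L2_tendsto M (\<lambda>N. FN (hcoeff g) N) (\<lambda>w. g (WI w))"
proof -
  have gm[measurable]: "g \<in> borel_measurable borel" using L2_spaceD(1)[OF g] by simp
  have i: "integrable M (\<lambda>w. f (WI w)) \<longleftrightarrow> integrable std_gauss f" "(\<integral>w. f (WI w) \<partial>M) = (\<integral>z. f z \<partial>std_gauss)"
    if "f \<in> borel_measurable borel" for f :: "real \<Rightarrow> real"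
    using gauss_indep_integral[OF F_subalgebra WI_gauss that] by auto
  have "(\<lambda>w. g (WI w)) \<in> L2_space M"
    using i(1)[of "\<lambda>x. (g x)\<^sup>2"] L2_spaceD(2)[OF g] WI_measurable by (simp add: L2_space_def)
  moreover have "L2_norm_of M (\<lambda>w. FN (hcoeff g) N w - g (WI w)) = L2_norm_of std_gauss (\<lambda>z. (\<Sum>k<N. hcoeff g k * hermn k z) - g z)" for N
    unfolding L2_norm_of_def FN_def using i(2)[of "\<lambda>z. ((\<Sum>k<N. hcoeff g k * hermn k z) - g z)\<^sup>2"] by simp
  ultimately show ?thesis using FN_L2 L2_tendstoD(3)[OF Hermite_expansion[OF g]] by (simp add: L2_tendsto_def)
qed

lemma VN_limit:
  assumes c: "summable (\<lambda>k. (c k)\<^sup>2)"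
  shows "\<exists>v. L2_tendsto PM (VN c) v \<and> v \<in> borel_measurable (predictable_sigma M W T)"
proof (rule proc.L2_complete_subalgebra[OF predictable_subalgebra[OF T] VN_L2 VN_predictable])
  fix e :: real assume e: "e > 0"
  show "\<exists>K. \<forall>m\<ge>K. \<forall>n\<ge>K. L2_norm_of PM (\<lambda>p. VN c m p - VN c n p) \<le> e"
    unfolding VN_def
    by (rule orthogonal_series_Cauchy[OF _ V_sum_norm(2) c _ e]) (use V_sum_norm(1)[of "{_}"] in auto)
qed

text \<open>The limit \<open>v\<close> witnesses that \<open>is_pD\<close> is satisfiable, so the
  chosen process satisfies it too. Both have the duality property and are predictable, and
  \<open>dual_unique\<close> makes them agree.\<close>

lemma pD_spec:
  assumes g: "g \<in> L2_space std_gauss" and v: "L2_tendsto PM (VN (hcoeff g)) v" "v \<in> borel_measurable (predictable_sigma M W T)"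
  shows "AE p in PM. pD M W T (\<lambda>w. g (WI w)) p = v p"
    and "pD M W T (\<lambda>w. g (WI w)) \<in> borel_measurable (predictable_sigma M W T)"
proof -
  let ?F = "\<lambda>w. g (WI w)"
  have "is_pD M W T ?F v"
    unfolding is_pD_def using v malliavin_FN projection_FN FN_tendsto[OF g] by blast
  then have ex: "\<exists>v. is_pD M W T ?F v" by blast
  have d: "dual T ?F v" by (rule dual_is_pD[OF T \<open>is_pD M W T ?F v\<close>])
  have s: "is_pD M W T ?F (pD M W T ?F)" unfolding pD_def by (rule someI_ex[OF ex])
  then show m: "pD M W T ?F \<in> borel_measurable (predictable_sigma M W T)" by (simp add: is_pD_def)
  show "AE p in PM. pD M W T ?F p = v p"
    by (rule dual_unique[OF T dual_is_pD[OF T s] m d v(2)])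
qed

section \<open>The discretised integrand\<close>

definition mN :: "(nat \<Rightarrow> real) \<Rightarrow> real \<Rightarrow> nat \<Rightarrow> 'a \<Rightarrow> real" where
  "mN c a N w = (\<Sum>k<N. c k * dherm k (\<tau> a) (X a w))"

lemma mN_L2: "0 \<le> a \<Longrightarrow> a \<le> T \<Longrightarrow> mN c a N \<in> L2_space M"
  unfolding mN_def[abs_def] by (rule dherm_X_sum_L2)

lemma mN_F: "0 \<le> a \<Longrightarrow> a \<le> T \<Longrightarrow> mN c a N \<in> borel_measurable (\<F> a)"
  unfolding mN_def[abs_def] by (rule dherm_X_sum_F)

lemma mN_norm: "0 \<le> a \<Longrightarrow> a \<le> T \<Longrightarrow> (\<integral>w. (mN c a N w)\<^sup>2 \<partial>M) = (\<Sum>k<N. (c k)\<^sup>2 * dherm_norm2 k (\<tau> a))"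
  unfolding mN_def by (rule dherm_X_sum_norm) auto

lemma mN_martingale:
  assumes a: "0 \<le> a" "a \<le> b" "b \<le> T" and A: "A \<in> sets (\<F> a)"
  shows "(\<integral>w. indicator A w * mN c b N w \<partial>M) = (\<integral>w. indicator A w * mN c a N w \<partial>M)"
proof -
  have e: "(\<integral>w. indicator A w * mN c s N w \<partial>M) = (\<Sum>k<N. c k * (\<integral>w. indicator A w * dherm k (\<tau> s) (X s w) \<partial>M))"
    if s: "0 \<le> s" "s \<le> T" for s
  proof -
    have "integrable M (\<lambda>w. indicator A w * dherm k (\<tau> s) (X s w))" for k
      by (rule L2_space_integrable[OF indicator_F_mult_L2[OF A dherm_X_L2[OF s]]])
    then show ?thesis
      by (subst integral_mult_right_zero[symmetric], subst Bochner_Integration.integral_sum[symmetric])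
         (auto simp: mN_def sum_distrib_left mult_ac)
  qed
  show ?thesis using a by (simp add: e dherm_martingale[OF a A])
qed

text \<open>The martingale of the overview at a time \<open>a\<close> before \<open>T\<close>, in a
  version known at time \<open>a\<close>. At \<open>T\<close> itself the squared norm of the
  \<open>k\<close>-th term would be \<open>k * (c k)\<^sup>2\<close>, which need not be
  summable.\<close>

definition mlim :: "(nat \<Rightarrow> real) \<Rightarrow> real \<Rightarrow> 'a \<Rightarrow> real" where
  "mlim c a = (SOME l. L2_tendsto M (mN c a) l \<and> l \<in> borel_measurable (\<F> a))"

lemma mlim:
  assumes c: "summable (\<lambda>k. (c k)\<^sup>2)" and a: "0 \<le> a" "a < T"
  shows "L2_tendsto M (mN c a) (mlim c a)" "mlim c a \<in> borel_measurable (\<F> a)"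
proof -
  have t: "0 \<le> \<tau> a" "\<tau> a < 1" using tau_range[OF T \<beta>(1), of a] tau_less_1[OF T] a by auto
  have "\<exists>l. L2_tendsto M (mN c a) l \<and> l \<in> borel_measurable (\<F> a)"
  proof (rule L2_complete_subalgebra[OF F_subalgebra mN_L2 mN_F])
    fix e :: real assume e: "e > 0"
    have "summable (\<lambda>k. (c k)\<^sup>2 * dherm_norm2 k (\<tau> a))"
    proof (rule summable_comparison_test'[where N=0])
      show "summable (\<lambda>k. (c k)\<^sup>2 * (1 / (1 - \<tau> a)))" by (rule summable_mult2[OF c])
      fix k show "norm ((c k)\<^sup>2 * dherm_norm2 k (\<tau> a)) \<le> (c k)\<^sup>2 * (1 / (1 - \<tau> a))"
        unfolding real_norm_def abs_mult
        using dherm_norm2_le[OF t, of k] dherm_norm2_nonneg[OF t(1), of k] by (intro mult_mono) auto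
    qed
    then show "\<exists>K. \<forall>m\<ge>K. \<forall>n\<ge>K. L2_norm_of M (\<lambda>w. mN c a m w - mN c a n w) \<le> e"
      unfolding mN_def using a t
      by (intro orthogonal_series_Cauchy[OF _ _ _ _ e, where a="\<lambda>k. (c k)\<^sup>2 * dherm_norm2 k (\<tau> a)"])
         (auto intro!: L2_space_cmult dherm_X_L2 mult_nonneg_nonneg dherm_norm2_nonneg simp: dherm_X_sum_norm)
  qed (use a in auto)
  from someI_ex[OF this] show "L2_tendsto M (mN c a) (mlim c a)" "mlim c a \<in> borel_measurable (\<F> a)"
    unfolding mlim_def[symmetric] by auto
qed

text \<open>For finite sums the section at time \<open>s\<close> is \<open>\<eta> s\<close> times a
  martingale, which may be moved back to time \<open>a\<close> when tested on events of
  \<open>\<F> a\<close>. Both sides converge in \<open>L2\<close> along a subsequence.\<close>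

lemma section_cond_exp:
  assumes c: "summable (\<lambda>k. (c k)\<^sup>2)" and p: "L2_tendsto PM (VN c) p" and a: "0 \<le> a" "a < T"
  shows "AE s in TM. a < s \<longrightarrow> (AE w in M. \<eta> s * mlim c a w = real_cond_exp M (\<F> a) (\<lambda>w'. p (w', s)) w)"
proof -
  obtain r :: "nat \<Rightarrow> nat" where r: "strict_mono r"
    and l: "AE s in TM. L2_tendsto M (\<lambda>k w. VN c (r k) (w, s)) (\<lambda>w. p (w, s))"
    using process_tendsto_sections[OF p] by blast
  \<comment> \<open>Countably many exceptional sets of times, one for each index of the subsequence,
    are merged.\<close>
  have V: "AE s in TM. \<forall>k. 0 < s \<and> s < T \<and> (AE w in M. VN c (r k) (w, s) = \<eta> s * mN c s (r k) w)"
    unfolding AE_all_countable VN_def mN_def using V_sum_section[of c] by blast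
  show ?thesis using l V
  proof eventually_elim
    case (elim s)
    show ?case
    proof
    assume "a < s"
    with elim have s: "0 \<le> s" "s \<le> T" and as: "a \<le> s" by auto
    note m = mlim[OF c a]
    interpret S: sigma_finite_subalgebra M "\<F> a" by (rule F_sigma_finite_subalgebra)
    have "AE w in M. real_cond_exp M (\<F> a) (\<lambda>w'. p (w', s)) w = \<eta> s * mlim c a w"
    proof (rule S.real_cond_exp_charact)
      show "integrable M (\<lambda>w. p (w, s))" by (rule L2_space_integrable[OF L2_tendstoD(2)[OF elim(1)]])
      show "integrable M (\<lambda>w. \<eta> s * mlim c a w)"
        by (intro L2_space_integrable L2_space_cmult L2_tendstoD(2)[OF m(1)])
      show "(\<lambda>w. \<eta> s * mlim c a w) \<in> borel_measurable (\<F> a)" using m(2) by simp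
      fix A assume A: "A \<in> sets (\<F> a)"
      then have AM: "A \<in> events" using F_subalgebra by (auto simp: subalgebra_def)
      have I: "L2_tendsto M (\<lambda>k::nat. indicator A) (indicator A)"
        by (rule L2_tendsto_const, rule L2_space_bounded[of _ 1]) (use AM in \<open>auto split: split_indicator\<close>)
      have e: "(\<integral>w. indicator A w * VN c (r k) (w, s) \<partial>M) = \<eta> s * (\<integral>w. indicator A w * mN c a (r k) w \<partial>M)" for k
      proof -
        have mm: "mN c s (r k) \<in> borel_measurable M" by (rule L2_spaceD(1)[OF mN_L2[OF s]])
        have "(\<integral>w. indicator A w * VN c (r k) (w, s) \<partial>M) = (\<integral>w. \<eta> s * (indicator A w * mN c s (r k) w) \<partial>M)"
        proof (rule integral_cong_AE)
          show "(\<lambda>w. indicator A w * VN c (r k) (w, s)) \<in> borel_measurable M"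
            using L2_spaceD(1)[OF L2_tendstoD(1)[OF elim(1), of k]] AM by simp
          show "AE w in M. indicator A w * VN c (r k) (w, s) = \<eta> s * (indicator A w * mN c s (r k) w)"
            using elim(2) by (auto elim!: allE[of _ k] eventually_mono)
        qed (use mm AM in simp)
        then show ?thesis by (simp add: mN_martingale[OF a(1) as s(2) A])
      qed
      have "(\<lambda>k. \<eta> s * (\<integral>w. indicator A w * mN c a (r k) w \<partial>M)) \<longlonglongrightarrow> (\<integral>w. indicator A w * p (w, s) \<partial>M)"
        using L2_tendsto_inner[OF I elim(1)] by (simp only: e)
      moreover have "(\<lambda>k. \<eta> s * (\<integral>w. indicator A w * mN c a (r k) w \<partial>M)) \<longlonglongrightarrow> \<eta> s * (\<integral>w. indicator A w * mlim c a w \<partial>M)"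
        by (intro tendsto_mult tendsto_const L2_tendsto_inner[OF I] L2_tendsto_subseq[OF m(1) r])
      ultimately have "(\<integral>w. indicator A w * p (w, s) \<partial>M) = \<eta> s * (\<integral>w. indicator A w * mlim c a w \<partial>M)"
        by (rule LIMSEQ_unique)
      also have "\<dots> = (\<integral>w. \<eta> s * (indicator A w * mlim c a w) \<partial>M)" by simp
      also have "\<dots> = (\<integral>w. indicator A w * (\<eta> s * mlim c a w) \<partial>M)" by (simp only: mult.left_commute)
      finally show "(\<integral>w\<in>A. p (w, s) \<partial>M) = (\<integral>w\<in>A. \<eta> s * mlim c a w \<partial>M)"
        by (simp only: set_lebesgue_integral_def real_scaleR_def)
    qed
    then show "AE w in M. \<eta> s * mlim c a w = real_cond_exp M (\<F> a) (\<lambda>w'. p (w', s)) w"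
      by eventually_elim simp
    qed
  qed
qed

text \<open>A predictable process is progressively measurable: up to time \<open>a\<close> it is
  jointly measurable for \<open>\<F> a\<close> and time. Stopping the clock at \<open>a\<close>
  states this on the whole time interval.\<close>

lemma predictable_stopped_time:
  assumes a: "0 \<le> a" "a < T" and p: "p \<in> borel_measurable (predictable_sigma M W T)"
  shows "(\<lambda>(w, s). p (w, min s a)) \<in> borel_measurable (\<F> a \<Otimes>\<^sub>M TM)"
proof -
  have sp: "space (\<F> a \<Otimes>\<^sub>M TM) = space M \<times> {0..T}" by (simp add: space_pair_measure space_restrict_space)
  have TS: "B \<inter> {0..T} \<in> sets TM" if "B \<in> sets borel" for B :: "real set"
    using that by (auto simp: sets_restrict_space Int_commute)
  have "(\<lambda>q. (fst q, min (snd q) a)) \<in> measurable (\<F> a \<Otimes>\<^sub>M TM) (predictable_sigma M W T)"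
  proof (rule measurable_sigma_sets[OF predictable_sets[OF T] pred_gen_subset[OF T]])
    show "(\<lambda>q. (fst q, min (snd q) a)) \<in> space (\<F> a \<Otimes>\<^sub>M TM) \<rightarrow> space M \<times> {0..T}"
      using a unfolding sp by auto
    fix Y assume "Y \<in> pred_gen T"
    then consider A s t where "Y = A \<times> {s<..t}" "0 \<le> s" "s < t" "A \<in> sets (\<F> s)" | A where "Y = A \<times> {0}" "A \<in> sets (\<F> 0)"
      unfolding pred_gen_def by blast
    then show "(\<lambda>q. (fst q, min (snd q) a)) -` Y \<inter> space (\<F> a \<Otimes>\<^sub>M TM) \<in> sets (\<F> a \<Otimes>\<^sub>M TM)"
    proof cases
      case 1
      show ?thesis
      proof (cases "s < a")
        case True
        have A: "A \<in> sets (\<F> a)" using 1 F_mono[of s a] True by auto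
        \<comment> \<open>For \<open>s < a\<close> the stopped time exceeds \<open>s\<close> exactly
          if the time itself does. It never exceeds \<open>t\<close> if \<open>a \<le> t\<close>,
          and otherwise exactly the times beyond \<open>t\<close> violate the upper bound.\<close>
        have "(\<lambda>q. (fst q, min (snd q) a)) -` Y \<inter> space (\<F> a \<Otimes>\<^sub>M TM) = A \<times> ((if a \<le> t then {s<..} else {s<..t}) \<inter> {0..T})"
          unfolding sp using 1 True F_sets_into_space[OF A] by auto
        also have "\<dots> \<in> sets (\<F> a \<Otimes>\<^sub>M TM)" using A TS by (intro pair_measureI) auto
        finally show ?thesis .
      next
        case False
        then have "(\<lambda>q. (fst q, min (snd q) a)) -` Y \<inter> space (\<F> a \<Otimes>\<^sub>M TM) = {}" unfolding 1(1) by auto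
        then show ?thesis by simp
      qed
    next
      case 2
      have A: "A \<in> sets (\<F> a)" using 2 F_mono[of 0 a] a by auto
      have "(\<lambda>q. (fst q, min (snd q) a)) -` Y \<inter> space (\<F> a \<Otimes>\<^sub>M TM) = A \<times> ((if a = 0 then UNIV else {0}) \<inter> {0..T})"
        unfolding sp using 2 a F_sets_into_space[OF A] by (auto simp: min_def split: if_splits)
      also have "\<dots> \<in> sets (\<F> a \<Otimes>\<^sub>M TM)" using A TS by (intro pair_measureI) auto
      finally show ?thesis .
    qed
  qed
  from measurable_compose[OF this p] show ?thesis by (simp add: case_prod_beta')
qed

text \<open>The choice in \<open>cond_exp_process\<close> has the stated properties as soon as one
  jointly measurable version exists, so the work is to construct one.\<close>

lemma cond_exp_process_spec:
  assumes c: "summable (\<lambda>k. (c k)\<^sup>2)" and p: "L2_tendsto PM (VN c) p" "p \<in> borel_measurable (predictable_sigma M W T)"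
    and a: "0 \<le> a" "a < T"
  defines "v \<equiv> cond_exp_process M (\<F> a) T p"
  shows "v \<in> borel_measurable (\<F> a \<Otimes>\<^sub>M TM)"
    and "AE s in TM. AE w in M. v (w, s) = real_cond_exp M (\<F> a) (\<lambda>w'. p (w', s)) w"
proof -
  let ?P = "\<lambda>v. v \<in> borel_measurable (\<F> a \<Otimes>\<^sub>M TM) \<and>
     (AE s in TM. AE w in M. v (w, s) = real_cond_exp M (\<F> a) (\<lambda>w'. p (w', s)) w)"
  \<comment> \<open>Up to time \<open>a\<close> the process is already known to
    \<open>\<F> a\<close> and is its own conditional expectation; after \<open>a\<close> the
    conditional expectation is the product found in \<open>section_cond_exp\<close>.\<close>
  define y where "y q = (if snd q \<le> a then p (fst q, min (snd q) a) else eta_ext (snd q) * mlim c a (fst q))" for q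
  note [measurable] = mlim(2)[OF c a] predictable_stopped_time[OF a p(2)]
  have ps: "(\<lambda>q. p (fst q, min (snd q) a)) \<in> borel_measurable (\<F> a \<Otimes>\<^sub>M TM)"
    using predictable_stopped_time[OF a p(2)] by (simp add: case_prod_beta')
  have id: "(\<lambda>t. t) \<in> borel_measurable TM" by (rule measurable_restrict_space1) simp
  have sn[measurable]: "snd \<in> borel_measurable (\<F> a \<Otimes>\<^sub>M TM)"
    by (rule measurable_compose[OF measurable_snd id])
  have wm: "y \<in> borel_measurable (\<F> a \<Otimes>\<^sub>M TM)"
    unfolding y_def[abs_def] by (rule measurable_If[OF ps]) measurable
  have "AE s in TM. AE w in M. y (w, s) = real_cond_exp M (\<F> a) (\<lambda>w'. p (w', s)) w"
    using section_cond_exp[OF c p(1) a] process_section_L2[OF L2_tendstoD(2)[OF p(1)]] AE_space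
  proof eventually_elim
    case (elim s)
    then have s: "s \<in> {0..T}" by (simp add: space_restrict_space)
    show ?case
    proof (cases "s \<le> a")
      case True
      interpret S: sigma_finite_subalgebra M "\<F> a" by (rule F_sigma_finite_subalgebra)
      have "(\<lambda>w. p (w, min s a)) \<in> borel_measurable (\<F> a)"
        using measurable_compose[OF measurable_Pair2'[of s TM "\<F> a"] predictable_stopped_time[OF a p(2)]] s
        by (simp add: space_restrict_space)
      then have "AE w in M. real_cond_exp M (\<F> a) (\<lambda>w'. p (w', s)) w = p (w, s)"
        using True by (intro S.real_cond_exp_F_meas L2_space_integrable elim) (simp add: min_def)
      then show ?thesis by eventually_elim (simp add: y_def True min_def)
    next
      case False
      then show ?thesis using elim(1) by (auto simp: y_def eta_ext[OF s])
    qed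
  qed
  with wm have "?P y" by blast
  then have "?P v" unfolding v_def cond_exp_process_def by (rule someI[where P="?P"])
  then show "v \<in> borel_measurable (\<F> a \<Otimes>\<^sub>M TM)"
    "AE s in TM. AE w in M. v (w, s) = real_cond_exp M (\<F> a) (\<lambda>w'. p (w', s)) w" by auto
qed

definition eta_mass :: "real \<Rightarrow> real \<Rightarrow> real" where
  "eta_mass a b = (\<integral>s. indicator {a<..b} s * \<eta> s \<partial>TM)"

text \<open>After time \<open>a\<close> the chosen conditional expectations factorise into a
  function of time and a random variable known at \<open>a\<close>, so averaging over the interval
  only averages \<eta>. The end point \<open>a\<close>, at which the factorisation is not asserted,
  is a null set.\<close>

lemma hedge_coeff_eq:
  assumes c: "summable (\<lambda>k. (c k)\<^sup>2)" and p: "L2_tendsto PM (VN c) (pD M W T F)" "pD M W T F \<in> borel_measurable (predictable_sigma M W T)"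
    and a: "0 \<le> a" "a < b" "b \<le> T"
  shows "hedge_coeff M W T F a b \<in> borel_measurable M"
    and "AE w in M. hedge_coeff M W T F a b w = eta_mass a b / (b - a) * mlim c a w"
proof -
  have aT: "a < T" using a by simp
  note m = mlim[OF c a(1) aT] and C = cond_exp_process_spec[OF c p a(1) aT]
  let ?v = "cond_exp_process M (\<F> a) T (pD M W T F)"
  have sub: "measurable (\<F> a \<Otimes>\<^sub>M TM) borel \<subseteq> measurable PM (borel :: real measure)"
  proof
    fix f :: "'a \<times> real \<Rightarrow> real" assume f: "f \<in> borel_measurable (\<F> a \<Otimes>\<^sub>M TM)"
    have "(\<lambda>q. q) \<in> measurable PM (\<F> a \<Otimes>\<^sub>M TM)"
      by (rule measurable_pair) (simp_all add: comp_def measurable_compose[OF measurable_fst F_measurable_M[OF measurable_ident[of "\<F> a"], unfolded id_def]])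
    from measurable_compose[OF this f] show "f \<in> borel_measurable PM" .
  qed
  have vm[measurable]: "?v \<in> borel_measurable PM" using C(1) sub by blast
  have [measurable]: "mlim c a \<in> borel_measurable M" by (rule F_measurable_M[OF m(2)])
  have id: "(\<lambda>t. t) \<in> borel_measurable TM" by (rule measurable_restrict_space1) simp
  have [measurable]: "(\<lambda>q. snd q) \<in> borel_measurable PM"
    by (rule measurable_compose[OF measurable_snd id])
  have h: "hedge_coeff M W T F a b w = inverse (b - a) * (\<integral>s. indicator {a..b} s * ?v (w, s) \<partial>TM)" for w
  proof -
    have "indicator {0..T} s * (indicator {a..b} s * ?v (w, s)) = indicator {a..b} s *\<^sub>R ?v (w, s)" for s
      using a by (auto split: split_indicator)
    then show ?thesis
      by (simp only: hedge_coeff_def set_lebesgue_integral_def time_measure_integral)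
  qed
  have jm: "(\<lambda>(w, s). indicator {a..b} s * ?v (w, s)) \<in> borel_measurable PM"
    by (simp add: case_prod_beta')
  show "hedge_coeff M W T F a b \<in> borel_measurable M"
    unfolding h[abs_def] by (intro borel_measurable_times borel_measurable_const time.borel_measurable_lebesgue_integral jm)
  have "AE s in TM. AE w in M. a < s \<longrightarrow> ?v (w, s) = eta_ext s * mlim c a w"
    using section_cond_exp[OF c p(1) a(1) aT] C(2) AE_space
  proof eventually_elim
    case (elim s)
    then have "eta_ext s = \<eta> s" by (intro eta_ext) (simp add: space_restrict_space)
    then show ?case using elim(1,2) by (cases "a < s") (auto elim: eventually_elim2)
  qed
  moreover have "{q \<in> space PM. case q of (w, s) \<Rightarrow> a < s \<longrightarrow> ?v (w, s) = eta_ext s * mlim c a w} \<in> sets PM"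
    unfolding case_prod_beta' by measurable
  \<comment> \<open>The quantifiers are exchanged by Fubini, for which the exceptional set must be
    measurable; this is why \<open>eta_ext\<close> stands in place of \<open>\<eta>\<close>.\<close>
  ultimately have "AE w in M. AE s in TM. a < s \<longrightarrow> ?v (w, s) = eta_ext s * mlim c a w"
    using proc.AE_commute[where P="\<lambda>w s. a < s \<longrightarrow> ?v (w, s) = eta_ext s * mlim c a w"] by (simp add: case_prod_beta')
  then show "AE w in M. hedge_coeff M W T F a b w = eta_mass a b / (b - a) * mlim c a w"
    using AE_space
  proof eventually_elim
    case (elim w)
    have "(\<integral>s. indicator {a..b} s * ?v (w, s) \<partial>TM) = (\<integral>s. (indicator {a<..b} s * \<eta> s) * mlim c a w \<partial>TM)"
    proof (rule integral_cong_AE)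
      show "(\<lambda>s. indicator {a..b} s * ?v (w, s)) \<in> borel_measurable TM"
        using measurable_compose[OF measurable_Pair1'[OF elim(2)] jm] by simp
      show "(\<lambda>s. indicator {a<..b} s * \<eta> s * mlim c a w) \<in> borel_measurable TM"
        using L2_spaceD(1)[OF interval_mult_L2[OF eta_L2]] by simp
      show "AE s in TM. indicator {a..b} s * ?v (w, s) = indicator {a<..b} s * \<eta> s * mlim c a w"
        using elim(1) AE_time_measure_neq[where c=a and T=T] AE_space
      proof eventually_elim
        case (elim s)
        then have "eta_ext s = \<eta> s" by (intro eta_ext) (simp add: space_restrict_space)
        then show ?case using elim by (auto simp: indicator_def)
      qed
    qed
    then have "(\<integral>s. indicator {a..b} s * ?v (w, s) \<partial>TM) = eta_mass a b * mlim c a w"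
      unfolding eta_mass_def by (simp only: integral_mult_left_zero)
    then show ?case by (simp add: h divide_inverse)
  qed
qed

section \<open>Products with Brownian increments\<close>

lemma mult_increment:
  assumes a: "0 \<le> a" "a < b" and Z: "Z \<in> L2_space M" "Z \<in> borel_measurable (\<F> a)"
  shows "(\<lambda>w. Z w * (W b w - W a w)) \<in> L2_space M"
    and "(\<integral>w. (Z w * (W b w - W a w))\<^sup>2 \<partial>M) = (b - a) * (\<integral>w. (Z w)\<^sup>2 \<partial>M)"
proof -
  have i: "integrable std_gauss (\<lambda>z. (sqrt (b - a) * z)\<^sup>2)"
    using std_gauss_moments(3) by (simp add: power_mult_distrib)
  have e: "(\<integral>z. (sqrt (b - a) * z)\<^sup>2 \<partial>std_gauss) = b - a"
    using std_gauss_moments(4) a by (simp add: power_mult_distrib)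
  have Z2: "(\<lambda>w. (Z w)\<^sup>2) \<in> borel_measurable (\<F> a)" using Z(2) by simp
  note P = gauss_indep_product[OF F_subalgebra increment_F[OF a] Z2 L2_spaceD(2)[OF Z(1)], of "\<lambda>x. x\<^sup>2"]
  have "Z \<in> borel_measurable M" "(\<lambda>w. W b w - W a w) \<in> borel_measurable M"
    using L2_spaceD(1)[OF Z(1)] L2_spaceD(1)[OF increment_L2[of a b]] a by auto
  then show "(\<lambda>w. Z w * (W b w - W a w)) \<in> L2_space M"
    using P(1) i by (simp add: L2_space_def power_mult_distrib)
  show "(\<integral>w. (Z w * (W b w - W a w))\<^sup>2 \<partial>M) = (b - a) * (\<integral>w. (Z w)\<^sup>2 \<partial>M)"
    using P(2) i e by (simp add: power_mult_distrib)
qed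

text \<open>The earlier product and both coefficients are known when the later increment begins, and
  that increment is independent of them with mean 0.\<close>

lemma mult_increment_orthogonal:
  assumes a: "0 \<le> a" "a < b" "b \<le> a'" "a' < b'" and Z: "Z \<in> L2_space M" "Z \<in> borel_measurable (\<F> a)"
    and Z': "Z' \<in> L2_space M" "Z' \<in> borel_measurable (\<F> a')"
  shows "(\<integral>w. (Z w * (W b w - W a w)) * (Z' w * (W b' w - W a' w)) \<partial>M) = 0"
proof -
  let ?Y = "\<lambda>w. (Z w * (W b w - W a w)) * Z' w"
  have Y: "?Y \<in> borel_measurable (\<F> a')"
    using a Z'(2) F_measurable_mono[OF _ Z(2), of a'] W_F[of a a'] W_F[of b a'] by (intro borel_measurable_times borel_measurable_diff) auto
  have iY: "integrable M ?Y" by (rule L2_mult_integrable[OF mult_increment(1)[OF a(1,2) Z] Z'(1)])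
  have a': "0 \<le> a'" using a by simp
  have i: "integrable std_gauss (\<lambda>z. sqrt (b' - a') * z)" by (intro integrable_mult_right std_gauss_moments)
  have "(\<integral>w. ?Y w * (W b' w - W a' w) \<partial>M) = (\<integral>w. ?Y w \<partial>M) * (\<integral>z. sqrt (b' - a') * z \<partial>std_gauss)"
    by (rule gauss_indep_product(2)[OF F_subalgebra increment_F[OF a' a(4)] Y iY _ i]) simp
  then have "(\<integral>w. ?Y w * (W b' w - W a' w) \<partial>M) = 0"
    by (simp only: integral_mult_right_zero std_gauss_moments mult_zero_right)
  then show ?thesis by (simp add: mult_ac)
qed

lemma mult_increment_tendsto:
  assumes a: "0 \<le> a" "a < b" and Z: "L2_tendsto M Z Z'" "\<And>k. Z k \<in> borel_measurable (\<F> a)" "Z' \<in> borel_measurable (\<F> a)"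
  shows "L2_tendsto M (\<lambda>k w. Z k w * (W b w - W a w)) (\<lambda>w. Z' w * (W b w - W a w))"
proof (rule L2_tendstoI_le[where e="\<lambda>k. sqrt (b - a) * L2_norm_of M (\<lambda>w. Z k w - Z' w)"])
  note L = L2_tendstoD[OF Z(1)]
  show "(\<lambda>w. Z k w * (W b w - W a w)) \<in> L2_space M" for k by (rule mult_increment(1)[OF a L(1) Z(2)])
  show "(\<lambda>w. Z' w * (W b w - W a w)) \<in> L2_space M" by (rule mult_increment(1)[OF a L(2) Z(3)])
  show "L2_norm_of M (\<lambda>w. Z k w * (W b w - W a w) - Z' w * (W b w - W a w))
    \<le> sqrt (b - a) * L2_norm_of M (\<lambda>w. Z k w - Z' w)" for k
    using mult_increment(2)[OF a L2_space_diff[OF L(1) L(2)] borel_measurable_diff[OF Z(2) Z(3)], of k]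
    unfolding L2_norm_of_def left_diff_distrib[symmetric] by (simp only: real_sqrt_mult order_refl)
  show "(\<lambda>k. sqrt (b - a) * L2_norm_of M (\<lambda>w. Z k w - Z' w)) \<longlonglongrightarrow> 0"
    using tendsto_mult[OF tendsto_const L(3)] by simp
qed

text \<open>The duality property turns the increment into a rectangle integral of \<open>VN\<close>;
  at each time after \<open>a\<close> the martingale property replaces the section by
  \<open>\<eta> s\<close> times the value of \<open>mN\<close> at \<open>a\<close>.\<close>

lemma FN_increment_test:
  assumes a: "0 \<le> a" "a < b" "b \<le> T" and A: "A \<in> sets (\<F> a)"
  shows "(\<integral>w. indicator A w * ((W b w - W a w) * FN c N w) \<partial>M) = eta_mass a b * (\<integral>w. indicator A w * mN c a N w \<partial>M)"
proof -
  have AM: "A \<in> events" using A F_subalgebra by (auto simp: subalgebra_def)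
  have "(\<integral>w. indicator A w * ((W b w - W a w) * FN c N w) \<partial>M) = (\<integral>q. indicator (A \<times> {a<..b}) q * VN c N q \<partial>PM)"
    using dual_FN[of c N] a A by (simp add: dual_def)
  also have "\<dots> = (\<integral>s. indicator {a<..b} s * (\<integral>w. indicator A w * VN c N (w, s) \<partial>M) \<partial>TM)"
    by (rule rectangle_integral(1)[OF VN_L2 a(1,3) AM])
  also have "\<dots> = (\<integral>s. (indicator {a<..b} s * \<eta> s) * (\<integral>w. indicator A w * mN c a N w \<partial>M) \<partial>TM)"
  proof (rule integral_cong_AE)
    show "(\<lambda>s. indicator {a<..b} s * (\<integral>w. indicator A w * VN c N (w, s) \<partial>M)) \<in> borel_measurable TM"
      by (rule rectangle_integral(2)[OF VN_L2 a(1,3) AM])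
    show "(\<lambda>s. indicator {a<..b} s * \<eta> s * (\<integral>w. indicator A w * mN c a N w \<partial>M)) \<in> borel_measurable TM"
      using L2_spaceD(1)[OF interval_mult_L2[OF eta_L2]] by simp
    show "AE s in TM. indicator {a<..b} s * (\<integral>w. indicator A w * VN c N (w, s) \<partial>M)
        = indicator {a<..b} s * \<eta> s * (\<integral>w. indicator A w * mN c a N w \<partial>M)"
      using V_sum_section[of c "{..<N}"] process_section_L2[OF VN_L2[of c N]]
    proof eventually_elim
      case (elim s)
      then have s: "0 \<le> s" "s \<le> T" by auto
      show ?case
      proof (cases "s \<in> {a<..b}")
        case True
        have "(\<integral>w. indicator A w * VN c N (w, s) \<partial>M) = (\<integral>w. \<eta> s * (indicator A w * mN c s N w) \<partial>M)"
        proof (rule integral_cong_AE)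
          show "(\<lambda>w. indicator A w * VN c N (w, s)) \<in> borel_measurable M"
            using L2_spaceD(1)[OF elim(2)] AM by simp
          show "(\<lambda>w. \<eta> s * (indicator A w * mN c s N w)) \<in> borel_measurable M"
            using L2_spaceD(1)[OF mN_L2[OF s]] AM by simp
          have "AE w in M. VN c N (w, s) = \<eta> s * mN c s N w"
            using elim(1) unfolding VN_def mN_def by blast
          then show "AE w in M. indicator A w * VN c N (w, s) = \<eta> s * (indicator A w * mN c s N w)"
            by eventually_elim simp
        qed
        moreover have "a \<le> s" using True by simp
        ultimately show ?thesis using True by (simp add: mN_martingale[OF a(1) _ s(2) A])
      qed simp
    qed
  qed
  finally show ?thesis unfolding eta_mass_def by (simp only: integral_mult_left_zero)
qed

text \<open>By \<open>FN_increment_test\<close>, the conditional expectation of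
  \<open>(W b - W a) * FN\<close> given \<open>\<F> a\<close> is \<open>eta_mass a b\<close> times
  \<open>mN\<close>; the factor \<open>mN\<close>, known at \<open>a\<close>, is taken out of the
  conditional expectation.\<close>

lemma FN_increment_mN:
  assumes a: "0 \<le> a" "a < b" "b \<le> T"
  shows "(\<integral>w. FN c N w * (mN c a N w * (W b w - W a w)) \<partial>M) = eta_mass a b * (\<integral>w. (mN c a N w)\<^sup>2 \<partial>M)"
proof -
  interpret S: sigma_finite_subalgebra M "\<F> a" by (rule F_sigma_finite_subalgebra)
  let ?f = "\<lambda>w. (W b w - W a w) * FN c N w"
  have aT: "0 \<le> a" "a \<le> T" using a by auto
  note m = mN_L2[OF aT, of c N] mN_F[OF aT, of c N]
  have f: "integrable M ?f" using a by (intro L2_mult_integrable FN_L2 increment_L2) auto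
  have ce: "AE w in M. real_cond_exp M (\<F> a) ?f w = eta_mass a b * mN c a N w"
  proof (rule S.real_cond_exp_charact[OF _ f])
    show "integrable M (\<lambda>w. eta_mass a b * mN c a N w)"
      by (intro L2_space_integrable L2_space_cmult m)
    show "(\<lambda>w. eta_mass a b * mN c a N w) \<in> borel_measurable (\<F> a)" using m by simp
    fix A assume A: "A \<in> sets (\<F> a)"
    have "(\<integral>w. indicator A w * ?f w \<partial>M) = (\<integral>w. eta_mass a b * (indicator A w * mN c a N w) \<partial>M)"
      using FN_increment_test[OF a A] by simp
    also have "\<dots> = (\<integral>w. indicator A w * (eta_mass a b * mN c a N w) \<partial>M)" by (simp only: mult.left_commute)
    finally show "(\<integral>w\<in>A. ?f w \<partial>M) = (\<integral>w\<in>A. eta_mass a b * mN c a N w \<partial>M)"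
      by (simp only: set_lebesgue_integral_def real_scaleR_def)
  qed
  have i: "integrable M (\<lambda>w. mN c a N w * ?f w)"
    using L2_mult_integrable[OF mult_increment(1)[OF a(1,2) m] FN_L2[of c N]] by (simp only: mult.assoc)
  have fm: "?f \<in> borel_measurable M" using f by simp
  have "(\<integral>w. FN c N w * (mN c a N w * (W b w - W a w)) \<partial>M) = (\<integral>w. mN c a N w * ?f w \<partial>M)"
    by (simp add: mult_ac)
  also have "\<dots> = (\<integral>w. mN c a N w * real_cond_exp M (\<F> a) ?f w \<partial>M)"
    using S.real_cond_exp_intg(2)[OF i m(2) fm] by simp
  also have "\<dots> = (\<integral>w. eta_mass a b * (mN c a N w)\<^sup>2 \<partial>M)"
  proof (rule integral_cong_AE)
    show "AE w in M. mN c a N w * real_cond_exp M (\<F> a) ?f w = eta_mass a b * (mN c a N w)\<^sup>2"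
      using ce by eventually_elim (simp add: power2_eq_square)
  qed (use L2_spaceD(1)[OF m(1)] in auto)
  finally show ?thesis by simp
qed

section \<open>The error of the hedge\<close>

text \<open>The points of \<open>grid\<close>, written in the form in which they occur in the
  theorem.\<close>

definition gd :: "nat \<Rightarrow> nat \<Rightarrow> real" where "gd n i = real i / real n * T"

lemma gd:
  assumes "i < n"
  shows "0 \<le> gd n i" "gd n i < gd n (Suc i)" "gd n (Suc i) \<le> T" "gd n i < T" "gd n (Suc i) - gd n i = T / real n"
proof -
  have n: "0 < real n" using assms by simp
  show "0 \<le> gd n i" using T by (simp add: gd_def)
  show "gd n (Suc i) - gd n i = T / real n" using n by (simp add: gd_def field_simps)
  then show lt: "gd n i < gd n (Suc i)" using divide_pos_pos[OF T n] by linarith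
  have "real (Suc i) / real n \<le> 1" using assms by simp
  then show le: "gd n (Suc i) \<le> T" using mult_right_mono[of "real (Suc i) / real n" 1 T] T by (simp add: gd_def)
  show "gd n i < T" using lt le by simp
qed

definition weight :: "nat \<Rightarrow> nat \<Rightarrow> real" where
  "weight n i = eta_mass (gd n i) (gd n (Suc i)) / (T / real n)"

text \<open>The error of the hedge for a finite Hermite sum. Setting the coefficient of degree 0 to
  0 subtracts the expectation.\<close>

definition RN :: "nat \<Rightarrow> (nat \<Rightarrow> real) \<Rightarrow> nat \<Rightarrow> 'a \<Rightarrow> real" where
  "RN n c N w = FN (c(0 := 0)) N w
     - (\<Sum>i<n. weight n i * (mN c (gd n i) N w * (W (gd n (Suc i)) w - W (gd n i) w)))"

text \<open>The number \<open>r k\<close> of the overview: the squared norm of the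
  \<open>k\<close>-th Hermite term after subtracting the expectation, minus the squared norm of its
  hedge.\<close>

definition defect :: "nat \<Rightarrow> nat \<Rightarrow> real" where
  "defect n k = (if k = 0 then 0 else 1) - (\<Sum>i<n. (weight n i)\<^sup>2 * (T / real n) * dherm_norm2 k (\<tau> (gd n i)))"

lemma mN_upd0: "mN (c(0 := x)) a N = mN c a N"
  unfolding mN_def fun_eq_iff by (intro allI sum.cong) (auto simp: dherm_def)

lemma FN_norm: "(\<integral>w. (FN c N w)\<^sup>2 \<partial>M) = (\<Sum>k<N. (c k)\<^sup>2)"
proof -
  have "(\<integral>w. (FN c N w)\<^sup>2 \<partial>M) = (\<integral>z. (\<Sum>k<N. c k * hermn k (1 * z))\<^sup>2 \<partial>std_gauss)"
    unfolding FN_def by (rule gauss_indep_integral(1)[OF F_subalgebra WI_gauss]) simp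
  then show ?thesis by (simp add: hermn_sum_norm)
qed

lemma RN_L2: "RN n c N \<in> L2_space M"
  unfolding RN_def[abs_def]
  by (intro L2_space_diff FN_L2 L2_space_sum L2_space_cmult mult_increment mN_L2 mN_F) (use gd in \<open>auto intro: less_imp_le\<close>)

text \<open>The inner product of the variable with its hedge equals the squared norm of the hedge,
  by \<open>FN_increment_mN\<close> and the orthogonality of the increments, so expanding the square
  leaves the difference of the two squared norms. Orthogonality of the polynomials then separates
  the degrees.\<close>

lemma RN_norm: "(L2_norm_of M (RN n c N))\<^sup>2 = (\<Sum>k<N. (c k)\<^sup>2 * defect n k)"
proof -
  let ?c = "c(0 := 0)" and ?D = "T / real n"
  let ?Y = "\<lambda>i w. mN c (gd n i) N w * (W (gd n (Suc i)) w - W (gd n i) w)"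
  let ?S = "\<lambda>w. \<Sum>i<n. weight n i * ?Y i w"
  let ?m = "\<lambda>i. \<integral>w. (mN c (gd n i) N w)\<^sup>2 \<partial>M"
  have m: "mN c (gd n i) N \<in> L2_space M" "mN c (gd n i) N \<in> borel_measurable (\<F> (gd n i))" if "i < n" for i
    using gd[OF that] by (auto intro: mN_L2 mN_F)
  have Y: "?Y i \<in> L2_space M" if "i < n" for i using gd[OF that] m[OF that] by (intro mult_increment)
  have S: "?S \<in> L2_space M" using Y by (intro L2_space_sum L2_space_cmult) auto
  have e: "eta_mass (gd n i) (gd n (Suc i)) = weight n i * ?D" if "i < n" for i
    using that T by (simp add: weight_def)
  have YY: "(\<integral>w. ?Y i w * ?Y j w \<partial>M) = (if j = i then ?D * ?m i else 0)" if ij: "i < n" "j < n" for i j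
  proof -
    have le: "gd n (Suc i) \<le> gd n j" if "i < j" for i j
      unfolding gd_def using that T by (intro mult_right_mono divide_right_mono) auto
    consider "i < j" | "j < i" | "i = j" by linarith
    then show ?thesis
    proof cases
      case 1
      then show ?thesis using mult_increment_orthogonal[OF gd(1,2)[OF ij(1)] le[OF 1] gd(2)[OF ij(2)] m[OF ij(1)] m[OF ij(2)]] by simp
    next
      case 2
      then show ?thesis using mult_increment_orthogonal[OF gd(1,2)[OF ij(2)] le[OF 2] gd(2)[OF ij(1)] m[OF ij(2)] m[OF ij(1)]]
        by (simp add: mult_ac)
    next
      case 3
      then show ?thesis using mult_increment(2)[OF gd(1,2)[OF ij(1)] m[OF ij(1)]] gd(5)[OF ij(1)] by (simp add: power2_eq_square)
    qed
  qed
  have FY: "(\<integral>w. FN ?c N w * ?Y i w \<partial>M) = weight n i * ?D * ?m i" if "i < n" for i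
    using FN_increment_mN[OF gd(1-3)[OF that], of ?c N] e[OF that] by (simp add: mN_upd0)
  have "(L2_norm_of M (RN n c N))\<^sup>2 = (\<integral>w. (FN ?c N w - ?S w)\<^sup>2 \<partial>M)"
    by (simp add: L2_norm_of_power2 RN_def)
  also have "\<dots> = (\<integral>w. FN ?c N w * FN ?c N w \<partial>M) - 2 * (\<integral>w. FN ?c N w * ?S w \<partial>M) + (\<integral>w. ?S w * ?S w \<partial>M)"
    by (rule L2_diff_expand[OF FN_L2 S])
  also have "(\<integral>w. FN ?c N w * FN ?c N w \<partial>M) = (\<Sum>k<N. (c k)\<^sup>2 * (if k = 0 then 0 else 1))"
    using FN_norm[of ?c N] by (simp add: power2_eq_square[symmetric]) (auto intro!: sum.cong)
  also have "(\<integral>w. FN ?c N w * ?S w \<partial>M) = (\<integral>w. (\<Sum>i<n. weight n i * (FN ?c N w * ?Y i w)) \<partial>M)"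
    by (simp only: sum_distrib_left mult.left_commute)
  also have "\<dots> = (\<Sum>i<n. weight n i * (\<integral>w. FN ?c N w * ?Y i w \<partial>M))"
    by (subst Bochner_Integration.integral_sum) (auto intro!: integrable_mult_right L2_mult_integrable FN_L2 Y simp del: of_nat_Suc)
  also have "\<dots> = (\<Sum>i<n. (weight n i)\<^sup>2 * ?D * ?m i)"
    by (intro sum.cong refl) (simp add: FY power2_eq_square)
  also have "(\<integral>w. ?S w * ?S w \<partial>M) = (\<integral>w. (\<Sum>i<n. \<Sum>j<n. (weight n i * weight n j) * (?Y i w * ?Y j w)) \<partial>M)"
    by (simp only: sum_product mult_ac)
  also have "\<dots> = (\<Sum>i<n. \<Sum>j<n. (weight n i * weight n j) * (\<integral>w. ?Y i w * ?Y j w \<partial>M))"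
    by (subst Bochner_Integration.integral_sum, (intro Bochner_Integration.integrable_sum integrable_mult_right L2_mult_integrable Y; simp),
        intro sum.cong refl, subst Bochner_Integration.integral_sum)
       (auto intro!: integrable_mult_right L2_mult_integrable Y simp del: of_nat_Suc)
  also have "\<dots> = (\<Sum>i<n. \<Sum>j<n. if j = i then (weight n i)\<^sup>2 * ?D * ?m i else 0)"
    by (intro sum.cong refl) (auto simp: YY power2_eq_square)
  also have "\<dots> = (\<Sum>i<n. (weight n i)\<^sup>2 * ?D * ?m i)" by simp
  finally have "(L2_norm_of M (RN n c N))\<^sup>2 = (\<Sum>k<N. (c k)\<^sup>2 * (if k = 0 then 0 else 1)) - (\<Sum>i<n. (weight n i)\<^sup>2 * ?D * ?m i)"
    by simp
  also have "(\<Sum>i<n. (weight n i)\<^sup>2 * ?D * ?m i) = (\<Sum>i<n. \<Sum>k<N. (c k)\<^sup>2 * ((weight n i)\<^sup>2 * ?D * dherm_norm2 k (\<tau> (gd n i))))"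
    by (intro sum.cong refl) (use gd in \<open>auto simp: mN_norm sum_distrib_left mult_ac less_imp_le simp del: of_nat_Suc\<close>)
  also have "\<dots> = (\<Sum>k<N. (c k)\<^sup>2 * (\<Sum>i<n. (weight n i)\<^sup>2 * ?D * dherm_norm2 k (\<tau> (gd n i))))"
    by (subst sum.swap) (simp add: sum_distrib_left)
  finally show ?thesis by (simp only: defect_def right_diff_distrib sum_subtractf)
qed

end

lemma power_diff_le:
  fixes a b :: real
  assumes "0 \<le> a" "a \<le> b"
  shows "b ^ Suc j - a ^ Suc j \<le> real (Suc j) * (b - a) * b ^ j"
proof (induction j)
  case (Suc j)
  have "b ^ Suc (Suc j) - a ^ Suc (Suc j) = b * (b ^ Suc j - a ^ Suc j) + (b - a) * a ^ Suc j"
    by (simp add: algebra_simps)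
  also have "\<dots> \<le> b * (real (Suc j) * (b - a) * b ^ j) + (b - a) * b ^ Suc j"
    using assms by (intro add_mono mult_left_mono Suc power_mono) auto
  also have "\<dots> = real (Suc (Suc j)) * (b - a) * b ^ Suc j" by (simp add: algebra_simps)
  finally show ?case .
qed simp

context fractional_kernel
begin

section \<open>Monotonicity of the kernel and the bound on the defect\<close>

lemma eta_pos: "0 \<le> t \<Longrightarrow> t < T \<Longrightarrow> 0 < \<eta> t"
  using eta[of t] kernel_pos[OF \<beta>(1) T] by simp

lemma eta_mono:
  assumes "0 \<le> s" "s \<le> t" "t < T"
  shows "\<eta> s \<le> \<eta> t"
proof -
  have "(T - s) powr ((\<beta> - 1) / 2) \<le> (T - t) powr ((\<beta> - 1) / 2)"
    using assms \<beta> by (intro powr_mono2') auto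
  then show ?thesis using assms \<beta> by (simp add: eta kernel_def mult_right_mono)
qed

text \<open>The mean value theorem for \<tau>, followed by monotonicity of \<eta>. The interval has
  to end before \<open>T\<close>, where \<eta> is not controlled.\<close>

lemma tau_increment_le_eta:
  assumes "0 \<le> a" "a < b" "b < T"
  shows "\<tau> b - \<tau> a \<le> (b - a) * (\<eta> b)\<^sup>2"
proof -
  obtain z where z: "a < z" "z < b" "\<tau> b - \<tau> a = (b - a) * (kernel T \<beta> z)\<^sup>2"
    using MVT2[of a b \<tau> "\<lambda>z. (kernel T \<beta> z)\<^sup>2"] DERIV_tau[OF T \<beta>(1)] assms by auto
  have "(\<eta> z)\<^sup>2 \<le> (\<eta> b)\<^sup>2" using z assms eta_mono[of z b] eta_pos[of z] by (intro power_mono) auto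
  then show ?thesis using z assms eta[of z] by (simp add: mult_left_mono)
qed

lemma eta_mass_ge:
  assumes "0 \<le> a" "a < b" "b \<le> T"
  shows "(b - a) * \<eta> a \<le> eta_mass a b"
proof -
  have "(b - a) * \<eta> a = (\<integral>s. indicator {a<..b} s * \<eta> a \<partial>TM)"
    using time_measure_interval[of a b T] assms by (simp only: integral_mult_left_zero)
  also have "\<dots> \<le> eta_mass a b" unfolding eta_mass_def
  proof (rule integral_mono_AE)
    show "integrable TM (\<lambda>s. indicator {a<..b} s * \<eta> a)"
      by (intro integrable_mult_left time.L2_space_integrable indicator_L2_time) simp
    show "integrable TM (\<lambda>s. indicator {a<..b} s * \<eta> s)"
      by (intro time.L2_space_integrable interval_mult_L2 eta_L2)
    show "AE s in TM. indicator {a<..b} s * \<eta> a \<le> indicator {a<..b} s * \<eta> s"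
      using AE_interior by eventually_elim (use assms in \<open>auto simp: indicator_def intro: eta_mono\<close>)
  qed
  finally show ?thesis .
qed

lemma defect_le_1: "defect n k \<le> 1"
proof -
  have "0 \<le> (\<Sum>i<n. (weight n i)\<^sup>2 * (T / real n) * dherm_norm2 k (\<tau> (gd n i)))"
    using T by (intro sum_nonneg mult_nonneg_nonneg dherm_norm2_nonneg tau_range(1)[OF T \<beta>(1)] gd(1) less_imp_le[OF gd(4)]) auto
  moreover have "(if k = 0 then 0 else 1 :: real) \<le> 1" by simp
  ultimately show ?thesis unfolding defect_def by linarith
qed

text \<open>With \<open>x i\<close> the value of \<tau> at the grid points, 1 is the telescoping sum
  of the increments of \<open>x i ^ k\<close>. On each interval such an increment differs from the
  term of the hedge by an error from the power, controlled by the increment of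
  \<open>x i ^ j\<close>, and an error from replacing the increment of \<tau> by the squared mean of
  \<eta>, controlled by \<open>D i\<close>. Both bounds can be summed.\<close>

lemma defect_le:
  assumes n: "0 < n"
  shows "defect n k \<le> 3 * real k * real n powr (- \<beta>)"
proof (cases k)
  case 0
  then show ?thesis by (simp add: defect_def dherm_norm2_def)
next
  case (Suc j)
  define d q x where "d = T / real n" and "q = real n powr (- \<beta>)" and "x i = \<tau> (gd n i)" for i
  obtain m where m: "n = Suc m" using n by (cases n) auto
  have d: "0 < d" using T n by (simp add: d_def)
  have x0: "x 0 = 0" and xn: "x n = 1" using n by (simp_all add: x_def gd_def tau_0[OF T] tau_T)
  have gT: "gd n i \<le> T" if "i \<le> n" for i
    using that n T mult_right_mono[of "real i / real n" 1 T] by (simp add: gd_def)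
  have g0: "0 \<le> gd n i" for i using T by (simp add: gd_def)
  have xr: "0 \<le> x i" "x i \<le> 1" if "i \<le> n" for i
    unfolding x_def using tau_range[OF T \<beta>(1) g0 gT[OF that]] by auto
  have xm: "x i \<le> x (Suc i)" if "i < n" for i
    unfolding x_def using gd[OF that] by (intro tau_mono[OF T \<beta>(1)]) auto
  have xq: "x (Suc i) - x i \<le> q" if "i < n" for i
  proof -
    have "x (Suc i) - x i \<le> ((gd n (Suc i) - gd n i) / T) powr \<beta>"
      unfolding x_def using gd[OF that] by (intro tau_increment_le) auto
    also have "\<dots> = q" using gd(5)[OF that] T n by (simp add: q_def powr_divide powr_minus_divide)
    finally show ?thesis .
  qed
  have w: "(\<eta> (gd n i))\<^sup>2 \<le> (weight n i)\<^sup>2" if "i < n" for i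
  proof (rule power_mono)
    show "\<eta> (gd n i) \<le> weight n i"
      using eta_mass_ge[OF gd(1-3)[OF that]] gd(5)[OF that] d by (simp add: weight_def d_def[symmetric] field_simps)
    show "0 \<le> \<eta> (gd n i)" by (rule less_imp_le[OF eta_pos[OF gd(1,4)[OF that]]])
  qed
  \<comment> \<open>Before the last interval the increment of \<tau> is compared with \<eta> at the
    right end and the weight with \<eta> at the left end. On the last interval the hedge is dropped
    and the increment of \<tau> alone is at most \<open>q\<close>.\<close>
  define D where "D i = (if i < m then d * ((\<eta> (gd n (Suc i)))\<^sup>2 - (\<eta> (gd n i))\<^sup>2) else q)" for i
  have D: "(x (Suc i) - x i - (weight n i)\<^sup>2 * d) * x i ^ j \<le> D i" if i: "i < n" for i
  proof -
    have p: "0 \<le> x i ^ j" "x i ^ j \<le> 1" using xr[of i] i by (auto intro: power_le_one)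
    have le: "x (Suc i) - x i - (weight n i)\<^sup>2 * d \<le> D i \<and> 0 \<le> D i"
    proof (cases "i < m")
      case True
      then have s: "Suc i < n" using m by simp
      have "x (Suc i) - x i \<le> d * (\<eta> (gd n (Suc i)))\<^sup>2"
        using tau_increment_le_eta[OF gd(1,2)[OF i] gd(4)[OF s]] gd(5)[OF i] by (simp add: x_def d_def)
      moreover have "d * (\<eta> (gd n i))\<^sup>2 \<le> (weight n i)\<^sup>2 * d" unfolding mult.commute[of _ d] using w[OF i] d by (intro mult_left_mono) auto
      moreover have "(\<eta> (gd n i))\<^sup>2 \<le> (\<eta> (gd n (Suc i)))\<^sup>2"
        using eta_mono[OF gd(1)[OF i] less_imp_le[OF gd(2)[OF i]] gd(4)[OF s]] eta_pos[OF gd(1,4)[OF i]] by (intro power_mono) auto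
      then have "0 \<le> D i" using True d by (simp add: D_def)
      moreover have "D i = d * (\<eta> (gd n (Suc i)))\<^sup>2 - d * (\<eta> (gd n i))\<^sup>2"
        using True by (simp only: D_def if_True right_diff_distrib)
      ultimately show ?thesis by linarith
    next
      case False
      have "0 \<le> (weight n i)\<^sup>2 * d" using d by simp
      then show ?thesis using False xq[OF i] by (simp add: D_def q_def)
    qed
    then have "(x (Suc i) - x i - (weight n i)\<^sup>2 * d) * x i ^ j \<le> D i * x i ^ j"
      using p by (intro mult_right_mono) auto
    also have "\<dots> \<le> D i" using le p mult_left_le[of "x i ^ j" "D i"] by simp
    finally show ?thesis .
  qed
  have Dsum: "(\<Sum>i<n. D i) \<le> 2 * q"
  proof -
    have "(\<Sum>i<n. D i) = (\<Sum>i<m. D i) + D m" by (subst m) simp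
    also have "\<dots> = d * (\<Sum>i<m. (\<eta> (gd n (Suc i)))\<^sup>2 - (\<eta> (gd n i))\<^sup>2) + q"
      unfolding sum_distrib_left by (simp add: D_def)
    also have "\<dots> = d * ((\<eta> (gd n m))\<^sup>2 - (\<eta> (gd n 0))\<^sup>2) + q"
      unfolding sum_lessThan_telescope[of "\<lambda>i. (\<eta> (gd n i))\<^sup>2"] ..
    also have "\<dots> \<le> d * (\<eta> (gd n m))\<^sup>2 + q" using d by simp
    \<comment> \<open>The last grid point before \<open>T\<close> has distance \<open>d\<close> from
      it, so the square of the kernel is \<beta> times
      \<open>d powr (\<beta> - 1) * T powr (- \<beta>)\<close>.\<close>
    also have "d * (\<eta> (gd n m))\<^sup>2 = \<beta> * q"
    proof -
      have mn: "m < n" using m by simp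
      have "gd n (Suc m) = T" using m by (simp add: gd_def)
      then have "T - gd n m = d" using gd(5)[OF mn] by (simp add: d_def)
      then have "d * (\<eta> (gd n m))\<^sup>2 = \<beta> * (d * d powr (\<beta> - 1)) * T powr (- \<beta>)"
        using kernel_sq[OF T \<beta>(1) gd(4)[OF mn]] eta[OF gd(1,4)[OF mn]] by simp
      also have "d * d powr (\<beta> - 1) = d powr \<beta>" using powr_mult_base[of d "\<beta> - 1"] d by simp
      also have "\<beta> * d powr \<beta> * T powr (- \<beta>) = \<beta> * q"
        using T n by (simp add: d_def q_def powr_divide powr_minus_divide)
      finally show ?thesis .
    qed
    also have "\<beta> * q + q \<le> 2 * q" using \<beta> mult_right_mono[of \<beta> 1 q] by (simp add: q_def)
    finally show ?thesis .
  qed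
  have "defect n k = (\<Sum>i<n. x (Suc i) ^ k - x i ^ k) - (\<Sum>i<n. (weight n i)\<^sup>2 * d * (real (Suc j) * x i ^ j))"
    unfolding sum_lessThan_telescope[of "\<lambda>i. x i ^ k"] using Suc by (simp add: defect_def dherm_norm2_def d_def x_def x0[unfolded x_def] xn[unfolded x_def])
  also have "\<dots> = (\<Sum>i<n. (x (Suc i) ^ Suc j - x i ^ Suc j) - (weight n i)\<^sup>2 * d * (real (Suc j) * x i ^ j))"
    by (simp only: sum_subtractf Suc)
  also have "\<dots> \<le> (\<Sum>i<n. real (Suc j) * (q * (x (Suc i) ^ j - x i ^ j) + D i))"
  proof (rule sum_mono)
    fix i assume "i \<in> {..<n}"
    then have i: "i < n" by simp
    have "(x (Suc i) ^ Suc j - x i ^ Suc j) - (weight n i)\<^sup>2 * d * (real (Suc j) * x i ^ j)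
      \<le> real (Suc j) * (x (Suc i) - x i) * x (Suc i) ^ j - (weight n i)\<^sup>2 * d * (real (Suc j) * x i ^ j)"
      using power_diff_le[of "x i" "x (Suc i)" j] xr[of i] xm[OF i] i by simp
    \<comment> \<open>Writing \<open>x (Suc i) ^ j\<close> as \<open>x i ^ j\<close> plus the
      increment separates the error from the power from the error bounded by
      \<open>D i\<close>.\<close>
    also have "\<dots> = real (Suc j) * ((x (Suc i) - x i) * (x (Suc i) ^ j - x i ^ j) + (x (Suc i) - x i - (weight n i)\<^sup>2 * d) * x i ^ j)"
      by (simp only: algebra_simps)
    also have "\<dots> \<le> real (Suc j) * (q * (x (Suc i) ^ j - x i ^ j) + D i)"
      using xr[of i] xm[OF i] xq[OF i] i D[OF i] power_mono[of "x i" "x (Suc i)" j]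
      by (intro mult_left_mono add_mono mult_right_mono) auto
    finally show "(x (Suc i) ^ Suc j - x i ^ Suc j) - (weight n i)\<^sup>2 * d * (real (Suc j) * x i ^ j)
      \<le> real (Suc j) * (q * (x (Suc i) ^ j - x i ^ j) + D i)" .
  qed
  also have "\<dots> = real (Suc j) * (q * (\<Sum>i<n. x (Suc i) ^ j - x i ^ j) + (\<Sum>i<n. D i))"
    by (simp only: sum_distrib_left[of q] sum.distrib[symmetric] sum_distrib_left[of "real (Suc j)"])
  also have "\<dots> \<le> real (Suc j) * (q * 1 + 2 * q)"
  proof (intro mult_left_mono add_mono Dsum)
    show "(\<Sum>i<n. x (Suc i) ^ j - x i ^ j) \<le> 1"
      unfolding sum_lessThan_telescope[of "\<lambda>i. x i ^ j"] x0 xn by simp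
  qed (auto simp: q_def)
  finally show ?thesis by (simp add: Suc q_def algebra_simps)
qed

lemma RN_add: "RN n (\<lambda>k. a k + b k) N w = RN n a N w + RN n b N w"
proof -
  have 1: "FN ((\<lambda>k. a k + b k)(0 := 0)) N w = FN (a(0 := 0)) N w + FN (b(0 := 0)) N w"
    unfolding FN_def sum.distrib[symmetric] by (intro sum.cong) (auto simp: distrib_right)
  have 2: "mN (\<lambda>k. a k + b k) s N w = mN a s N w + mN b s N w" for s
    by (simp add: mN_def distrib_right sum.distrib)
  show ?thesis by (simp add: RN_def 1 2 distrib_left distrib_right sum.distrib)
qed

text \<open>The error is linear in the coefficients, so each part of the decomposition is estimated
  on its own: \<open>g0\<close> with \<open>defect_le_1\<close> and Bessel's inequality,
  \<open>g1\<close> with \<open>defect_le\<close> and the weighted form of Bessel's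
  inequality.\<close>

lemma RN_le:
  assumes n: "0 < n" and g: "g \<in> L2_space std_gauss" and g0: "g0 \<in> L2_space std_gauss" and w: "gauss_weak_deriv g1 d"
    and e: "AE x in std_gauss. g x = g0 x + g1 x"
  shows "L2_norm_of M (RN n (hcoeff g) N) \<le> L2_norm_of std_gauss g0 + sqrt 3 * real n powr (- \<beta> / 2) * L2_norm_of std_gauss d"
proof -
  have g1: "g1 \<in> L2_space std_gauss" using w by (simp add: gauss_weak_deriv_def)
  have "hcoeff g k = hcoeff g0 k + hcoeff g1 k" for k
  proof -
    have "hcoeff g k = (\<integral>z. g0 z * hermn k z + g1 z * hermn k z \<partial>std_gauss)" unfolding hcoeff_def
    proof (rule integral_cong_AE)
      show "AE z in std_gauss. g z * hermn k z = g0 z * hermn k z + g1 z * hermn k z"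
        using e by eventually_elim (simp add: distrib_right)
    qed (use L2_spaceD(1)[OF g] L2_spaceD(1)[OF g0] L2_spaceD(1)[OF g1] L2_spaceD(1)[OF hermn_L2] in auto)
    then show ?thesis unfolding hcoeff_def using L2_mult_integrable[OF g0 hermn_L2] L2_mult_integrable[OF g1 hermn_L2] by simp
  qed
  then have c: "hcoeff g = (\<lambda>k. hcoeff g0 k + hcoeff g1 k)" by auto
  have "(L2_norm_of M (RN n (hcoeff g0) N))\<^sup>2 \<le> (\<Sum>k<N. (hcoeff g0 k)\<^sup>2 * 1)"
    unfolding RN_norm by (intro sum_mono mult_left_mono defect_le_1) auto
  also have "\<dots> \<le> (L2_norm_of std_gauss g0)\<^sup>2" using hcoeff_Bessel[OF g0] by simp
  finally have 1: "L2_norm_of M (RN n (hcoeff g0) N) \<le> L2_norm_of std_gauss g0" by (rule power2_le_imp_le) simp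
  have "(L2_norm_of M (RN n (hcoeff g1) N))\<^sup>2 \<le> (\<Sum>k<N. (hcoeff g1 k)\<^sup>2 * (3 * real k * real n powr (- \<beta>)))"
    unfolding RN_norm by (intro sum_mono mult_left_mono defect_le n) auto
  also have "\<dots> = 3 * real n powr (- \<beta>) * (\<Sum>k<N. real k * (hcoeff g1 k)\<^sup>2)"
    by (simp add: sum_distrib_left mult_ac)
  also have "\<dots> \<le> 3 * real n powr (- \<beta>) * (L2_norm_of std_gauss d)\<^sup>2"
    by (intro mult_left_mono hcoeff_weak_deriv_Bessel[OF w]) auto
  also have "\<dots> = (sqrt 3 * real n powr (- \<beta> / 2) * L2_norm_of std_gauss d)\<^sup>2"
  proof -
    have q: "real n powr (- \<beta>) = (real n powr (- \<beta> / 2))\<^sup>2"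
      by (simp add: power2_eq_square powr_add[symmetric])
    show ?thesis unfolding q power_mult_distrib by simp
  qed
  finally have 2: "L2_norm_of M (RN n (hcoeff g1) N) \<le> sqrt 3 * real n powr (- \<beta> / 2) * L2_norm_of std_gauss d"
    by (rule power2_le_imp_le) simp
  show ?thesis
    using L2_norm_of_triangle[OF RN_L2 RN_L2, of n "hcoeff g0" N n "hcoeff g1" N] 1 2 by (simp add: c RN_add[abs_def])
qed

text \<open>The sums run to \<open>Suc N\<close> so that the term of degree 0, which is the
  expectation, is always present and can be split off.\<close>

lemma RN_tendsto:
  assumes g: "g \<in> L2_space std_gauss"
  shows "L2_tendsto M (\<lambda>N. RN n (hcoeff g) (Suc N)) (\<lambda>w. (g (WI w) - (\<integral>w'. g (WI w') \<partial>M))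
     - (\<Sum>i<n. weight n i * (mlim (hcoeff g) (gd n i) w * (W (gd n (Suc i)) w - W (gd n i) w))))"
proof -
  let ?c = "hcoeff g"
  have gm: "g \<in> borel_measurable borel" using L2_spaceD(1)[OF g] by simp
  have E: "(\<integral>w. g (WI w) \<partial>M) = ?c 0"
    using gauss_indep_integral(1)[OF F_subalgebra WI_gauss gm] by (simp add: hcoeff_def hermn_def)
  have F0: "FN (?c(0 := 0)) (Suc N) w = FN ?c (Suc N) w - ?c 0" for N w
    unfolding FN_def sum.lessThan_Suc_shift by (simp add: hermn_def)
  have "L2_tendsto M (\<lambda>N. FN (?c(0 := 0)) (Suc N)) (\<lambda>w. g (WI w) - (\<integral>w'. g (WI w') \<partial>M))"
    unfolding F0 E
    by (intro L2_tendsto_diff L2_tendsto_subseq[OF FN_tendsto[OF g], of Suc] L2_tendsto_const L2_space_bounded[of _ "\<bar>?c 0\<bar>"])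
       (auto simp: strict_mono_Suc_iff)
  moreover have "L2_tendsto M (\<lambda>N w. \<Sum>i<n. weight n i * (mN ?c (gd n i) (Suc N) w * (W (gd n (Suc i)) w - W (gd n i) w)))
     (\<lambda>w. \<Sum>i<n. weight n i * (mlim ?c (gd n i) w * (W (gd n (Suc i)) w - W (gd n i) w)))"
  proof (intro L2_tendsto_sum L2_tendsto_cmult)
    fix i assume "i \<in> {..<n}"
    then have i: "i < n" by simp
    note m = mlim[OF hcoeff_summable[OF g] gd(1,4)[OF i]]
    show "L2_tendsto M (\<lambda>N w. mN ?c (gd n i) (Suc N) w * (W (gd n (Suc i)) w - W (gd n i) w))
      (\<lambda>w. mlim ?c (gd n i) w * (W (gd n (Suc i)) w - W (gd n i) w))"
      by (rule mult_increment_tendsto[OF gd(1,2)[OF i] L2_tendsto_subseq[OF m(1)] mN_F m(2)])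
         (use gd[OF i] in \<open>auto simp: strict_mono_Suc_iff\<close>)
  qed
  ultimately show ?thesis unfolding RN_def by (rule L2_tendsto_diff)
qed

end

section \<open>The K-functional\<close>

lemma gauss_weak_deriv_zero: "gauss_weak_deriv (\<lambda>_. 0) (\<lambda>_. 0)"
  by (simp add: gauss_weak_deriv_def L2_space_zero)

definition K_set :: "(real \<Rightarrow> real) \<Rightarrow> real \<Rightarrow> real set" where
  "K_set g t = {L2_norm_of std_gauss g0 +
        t * sqrt ((L2_norm_of std_gauss g1)\<^sup>2 + (L2_norm_of std_gauss d)\<^sup>2) | g0 g1 d.
      g0 \<in> L2_space std_gauss \<and> gauss_weak_deriv g1 d \<and> (AE x in std_gauss. g x = g0 x + g1 x)}"

lemma K_set_nonempty:
  assumes "g \<in> L2_space std_gauss"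
  shows "K_set g t \<noteq> {}"
proof -
  have "AE x in std_gauss. g x = g x + 0" by simp
  then show ?thesis unfolding K_set_def using assms gauss_weak_deriv_zero by blast
qed

lemma K_set_nonneg: "0 \<le> t \<Longrightarrow> x \<in> K_set g t \<Longrightarrow> 0 \<le> x"
  by (auto simp: K_set_def intro!: add_nonneg_nonneg mult_nonneg_nonneg)

lemma gauss_K_mono:
  assumes g: "g \<in> L2_space std_gauss" and st: "0 \<le> s" "s \<le> t"
  shows "gauss_K g s \<le> gauss_K g t"
  unfolding gauss_K_def K_set_def[symmetric]
proof (rule cInf_mono[OF K_set_nonempty[OF g]])
  show "bdd_below (K_set g s)" using K_set_nonneg[OF st(1)] by (rule bdd_belowI)
  fix x assume "x \<in> K_set g t"
  then obtain g0 g1 d where x: "x = L2_norm_of std_gauss g0 + t * sqrt ((L2_norm_of std_gauss g1)\<^sup>2 + (L2_norm_of std_gauss d)\<^sup>2)"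
    and h: "g0 \<in> L2_space std_gauss" "gauss_weak_deriv g1 d" "AE x in std_gauss. g x = g0 x + g1 x"
    unfolding K_set_def by blast
  let ?y = "L2_norm_of std_gauss g0 + s * sqrt ((L2_norm_of std_gauss g1)\<^sup>2 + (L2_norm_of std_gauss d)\<^sup>2)"
  have "?y \<in> K_set g s" using h unfolding K_set_def by blast
  moreover have "?y \<le> x" unfolding x using st by (intro add_left_mono mult_right_mono) auto
  ultimately show "\<exists>y\<in>K_set g s. y \<le> x" by blast
qed

lemma gauss_K_nonneg: "g \<in> L2_space std_gauss \<Longrightarrow> 0 \<le> t \<Longrightarrow> 0 \<le> gauss_K g t"
  unfolding gauss_K_def K_set_def[symmetric]
  by (rule cInf_greatest[OF K_set_nonempty]) (auto intro: K_set_nonneg)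

text \<open>The K-functional increases in \<open>t\<close>, so the part of the Besov integral from
  \<open>t\<close> to \<open>2 * t\<close> already controls its value at \<open>t\<close>.\<close>

lemma gauss_K_besov:
  assumes g: "g \<in> gauss_besov_2_2 \<theta>" and \<theta>: "0 < \<theta>"
  shows "\<exists>C\<ge>0. \<forall>t>0. gauss_K g t \<le> C * t powr \<theta>"
proof -
  have gL: "g \<in> L2_space std_gauss" using g by (simp add: gauss_besov_2_2_def)
  define I where "I = (\<integral>\<^sup>+t. ennreal ((t powr (- \<theta>) * gauss_K g t)\<^sup>2 / t) * indicator {0<..} t \<partial>lborel)"
  have I: "I < \<infinity>" using g by (simp add: gauss_besov_2_2_def I_def)
  let ?C = "2 powr \<theta> * sqrt (2 * enn2real I)"
  have "gauss_K g t \<le> ?C * t powr \<theta>" if t: "0 < t" for t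
  proof -
    \<comment> \<open>A lower bound of the integrand on \<open>{t..2*t}\<close>: the K-functional is
      taken at the left end, the decreasing powers of the variable at the right end. The factors 2
      in \<open>?C\<close> come from this right end.\<close>
    let ?L = "((2 * t) powr (- \<theta>) * gauss_K g t)\<^sup>2 / (2 * t)"
    have K0: "0 \<le> gauss_K g t" using gauss_K_nonneg[OF gL] t by simp
    have "ennreal ?L * ennreal t = (\<integral>\<^sup>+u. ennreal ?L * indicator {t..2*t} u \<partial>lborel)"
      using t by (simp add: nn_integral_cmult_indicator)
    also have "\<dots> \<le> I" unfolding I_def
    proof (intro nn_integral_mono)
      fix u
      show "ennreal ?L * indicator {t..2*t} u \<le> ennreal ((u powr (- \<theta>) * gauss_K g u)\<^sup>2 / u) * indicator {0<..} u"
      proof (cases "u \<in> {t..2*t}")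
        case True
        then have u: "t \<le> u" "u \<le> 2 * t" "0 < u" using t by auto
        have "(2 * t) powr (- \<theta>) * gauss_K g t \<le> u powr (- \<theta>) * gauss_K g u"
          using u t \<theta> K0 by (intro mult_mono powr_mono2' gauss_K_mono gL) auto
        then have "?L \<le> (u powr (- \<theta>) * gauss_K g u)\<^sup>2 / u"
          using u t K0 by (intro frac_le power_mono mult_nonneg_nonneg) auto
        then show ?thesis using True u by (simp add: ennreal_leI)
      qed simp
    qed
    finally have "ennreal (?L * t) \<le> I" using t ennreal_mult[of ?L t] by simp
    from enn2real_mono[OF this] have "?L * t \<le> enn2real I" using I t by simp
    then have "((2 * t) powr (- \<theta>) * gauss_K g t)\<^sup>2 \<le> 2 * enn2real I" using t by (simp add: field_simps)
    then have "(2 * t) powr (- \<theta>) * gauss_K g t \<le> sqrt (2 * enn2real I)" by (rule real_le_rsqrt)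
    then have "gauss_K g t \<le> sqrt (2 * enn2real I) * (2 * t) powr \<theta>"
      using t by (simp add: powr_minus field_simps)
    then show ?thesis using t by (simp add: powr_mult mult_ac)
  qed
  then show ?thesis by (intro exI[of _ ?C]) auto
qed

text \<open>\<open>RN_le\<close> bounds the error by \<open>sqrt 3\<close> times the value of every
  decomposition, where the term of \<open>g0\<close> is enlarged by \<open>sqrt 3 \<ge> 1\<close>.
  Dividing by \<open>sqrt 3\<close> makes the error a lower bound of the set whose infimum is
  taken.\<close>

lemma (in fractional_kernel) RN_le_K:
  assumes n: "0 < n" and g: "g \<in> L2_space std_gauss"
  shows "L2_norm_of M (RN n (hcoeff g) N) \<le> sqrt 3 * gauss_K g (real n powr (- \<beta> / 2))"
proof -
  let ?t = "real n powr (- \<beta> / 2)" and ?R = "L2_norm_of M (RN n (hcoeff g) N)"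
  have s3: "1 \<le> sqrt 3" by simp
  have "?R / sqrt 3 \<le> gauss_K g ?t" unfolding gauss_K_def K_set_def[symmetric]
  proof (rule cInf_greatest[OF K_set_nonempty[OF g]])
    fix x assume "x \<in> K_set g ?t"
    then obtain g0 g1 d where x: "x = L2_norm_of std_gauss g0 + ?t * sqrt ((L2_norm_of std_gauss g1)\<^sup>2 + (L2_norm_of std_gauss d)\<^sup>2)"
      and h: "g0 \<in> L2_space std_gauss" "gauss_weak_deriv g1 d" "AE x in std_gauss. g x = g0 x + g1 x"
      unfolding K_set_def by blast
    have "L2_norm_of std_gauss d \<le> sqrt ((L2_norm_of std_gauss g1)\<^sup>2 + (L2_norm_of std_gauss d)\<^sup>2)"
      by (rule real_le_rsqrt) simp
    then have "L2_norm_of std_gauss g0 + sqrt 3 * ?t * L2_norm_of std_gauss d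
      \<le> sqrt 3 * L2_norm_of std_gauss g0 + sqrt 3 * ?t * sqrt ((L2_norm_of std_gauss g1)\<^sup>2 + (L2_norm_of std_gauss d)\<^sup>2)"
      using mult_right_mono[OF s3 L2_norm_of_nonneg[of std_gauss g0]] by (intro add_mono mult_left_mono) auto
    also have "\<dots> = sqrt 3 * x" by (simp add: x algebra_simps)
    finally have "?R \<le> sqrt 3 * x" using RN_le[OF n g h, of N] by linarith
    then show "?R / sqrt 3 \<le> x" by (simp add: field_simps)
  qed
  then show ?thesis by (simp add: field_simps)
qed

theorem theorem3p1:
  fixes M :: "'a measure" and W :: "real \<Rightarrow> 'a \<Rightarrow> real"
    and T \<beta> \<theta> :: real and \<eta> g :: "real \<Rightarrow> real" and F :: "'a \<Rightarrow> real"
  assumes "complete_measure M"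
    and "standard_brownian_motion M W"
    and "T > 0"
    and "0 < \<beta>" and "\<beta> < 1"
    and "\<And>t. 0 \<le> t \<Longrightarrow> t < T \<Longrightarrow> \<eta> t = (T - t) powr ((\<beta> - 1) / 2) * T powr (- \<beta> / 2) * sqrt \<beta>"
    and "g \<in> L2_space std_gauss"
    and "F = (\<lambda>\<omega>. g (wiener_integral M W T \<eta> \<omega>))"
    and "0 < \<theta>" and "\<theta> < 1"
    and "g \<in> gauss_besov_2_2 \<theta>"
  shows "\<exists>c2>0. \<forall>n::nat. n \<ge> 1 \<longrightarrow>
    (let t = (\<lambda>i::nat. real i / real n * T);
         \<nu> = (\<lambda>i. hedge_coeff M W T F (t (i - 1)) (t i));
         R = (\<lambda>\<omega>. F \<omega> - (\<integral>\<omega>'. F \<omega>' \<partial>M)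
                - (\<Sum>i=1..n. \<nu> i \<omega> * (W (t i) \<omega> - W (t (i - 1)) \<omega>)))
     in R \<in> L2_space M \<and> L2_norm_of M R \<le> c2 * real n powr (- (\<beta> * \<theta>) / 2))"
proof -
  interpret fractional_kernel M W T \<beta> \<eta>
    using assms(2-6) by unfold_locales (auto simp: kernel_def)
  note g = assms(7) and F = assms(8)
  obtain C where C: "C \<ge> 0" "\<And>t. t > 0 \<Longrightarrow> gauss_K g t \<le> C * t powr \<theta>"
    using gauss_K_besov[OF assms(11,9)] by auto
  let ?c = "hcoeff g"
  have cs: "summable (\<lambda>k. (?c k)\<^sup>2)" by (rule hcoeff_summable[OF g])
  obtain v where v: "L2_tendsto PM (VN ?c) v" "v \<in> borel_measurable (predictable_sigma M W T)"
    using VN_limit[OF cs] by blast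
  have pm: "pD M W T F \<in> borel_measurable (predictable_sigma M W T)" and pv: "AE p in PM. pD M W T F p = v p"
    unfolding F using pD_spec[OF g v] by auto
  \<comment> \<open>The convergence to the constructed limit \<open>v\<close> is transferred to the
    chosen process \<open>pD\<close>, on which the hedge coefficients depend.\<close>
  have pt: "L2_tendsto PM (VN ?c) (pD M W T F)"
  proof (rule L2_tendsto_cong_AE[OF v(1)])
    show "AE p in PM. v p = pD M W T F p" using pv by eventually_elim simp
    show "pD M W T F \<in> borel_measurable PM" by (rule measurable_from_subalg[OF predictable_subalgebra[OF T] pm])
  qed (auto intro: L2_spaceD(1) VN_L2)
  have main: "R \<in> L2_space M \<and> L2_norm_of M R \<le> (sqrt 3 * C + 1) * real n powr (- (\<beta> * \<theta>) / 2)"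
    if n: "n \<ge> 1" and R: "R = (\<lambda>\<omega>. F \<omega> - (\<integral>\<omega>'. F \<omega>' \<partial>M)
        - (\<Sum>i<n. hedge_coeff M W T F (gd n i) (gd n (Suc i)) \<omega> * (W (gd n (Suc i)) \<omega> - W (gd n i) \<omega>)))" for n R
  proof -
    let ?h = "\<lambda>i. hedge_coeff M W T F (gd n i) (gd n (Suc i))" and ?W = "\<lambda>i \<omega>. W (gd n (Suc i)) \<omega> - W (gd n i) \<omega>"
    let ?R = "\<lambda>\<omega>. F \<omega> - (\<integral>\<omega>'. F \<omega>' \<partial>M) - (\<Sum>i<n. weight n i * (mlim ?c (gd n i) \<omega> * ?W i \<omega>))"
    have l: "L2_tendsto M (\<lambda>N. RN n ?c (Suc N)) ?R" using RN_tendsto[OF g, of n] by (simp only: F)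
    note h = hedge_coeff_eq[OF cs pt pm gd(1-3)]
    have "AE \<omega> in M. \<forall>i<n. ?h i \<omega> = weight n i * mlim ?c (gd n i) \<omega>"
      unfolding AE_all_countable using h(2) by (auto simp: weight_def gd(5))
    then have ae: "AE \<omega> in M. ?R \<omega> = R \<omega>"
      by eventually_elim (simp add: R mult_ac)
    have Fm: "F \<in> borel_measurable M" using L2_tendstoD(2)[OF FN_tendsto[OF g]] L2_spaceD(1) by (auto simp: F)
    have Rm: "R \<in> borel_measurable M" unfolding R
      using Fm h(1) W_measurable gd by (intro borel_measurable_diff borel_measurable_sum borel_measurable_times)
        (auto intro!: W_measurable simp: gd_def T[THEN less_imp_le])
    have RL: "R \<in> L2_space M" by (rule L2_space_cong_AE[OF L2_tendstoD(2)[OF l] ae Rm])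
    have t: "real n powr (- \<beta> / 2) > 0" using n by simp
    have "sqrt 3 * gauss_K g (real n powr (- \<beta> / 2)) \<le> sqrt 3 * (C * (real n powr (- \<beta> / 2)) powr \<theta>)"
      using C(2)[OF t] by (intro mult_left_mono) auto
    also have "\<dots> = sqrt 3 * C * real n powr (- (\<beta> * \<theta>) / 2)" by (simp add: powr_powr)
    also have "\<dots> \<le> (sqrt 3 * C + 1) * real n powr (- (\<beta> * \<theta>) / 2)" (is "_ \<le> ?B") by (intro mult_right_mono) auto
    \<comment> \<open>The bound is uniform in the number \<open>N\<close> of Hermite terms and
      therefore survives the limit.\<close>
    finally have B: "L2_norm_of M (RN n ?c N) \<le> ?B" for N
      using RN_le_K[OF _ g, of n N] n by linarith
    have "(\<lambda>N. (L2_norm_of M (RN n ?c (Suc N)))\<^sup>2) \<longlonglongrightarrow> (L2_norm_of M ?R)\<^sup>2"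
      unfolding L2_norm_of_power2 by (rule L2_tendsto_norm2[OF l])
    then have "(L2_norm_of M ?R)\<^sup>2 \<le> ?B\<^sup>2"
      by (rule LIMSEQ_le_const2) (intro exI[of _ 0] allI impI power_mono B L2_norm_of_nonneg)
    then have "L2_norm_of M ?R \<le> ?B" by (rule power2_le_imp_le) (use C(1) in simp)
    then show ?thesis using RL L2_norm_of_cong_AE[OF ae L2_spaceD(1)[OF L2_tendstoD(2)[OF l]] Rm] by simp
  qed
  show ?thesis
  proof (intro exI[of _ "sqrt 3 * C + 1"] conjI allI impI)
    \<comment> \<open>\<open>C\<close> may be 0; the added 1 makes the constant positive.\<close>
    show "0 < sqrt 3 * C + 1" using C(1) by (simp add: add_nonneg_pos)
    fix n :: nat assume n: "n \<ge> 1"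
    show "let t = (\<lambda>i::nat. real i / real n * T);
         \<nu> = (\<lambda>i. hedge_coeff M W T F (t (i - 1)) (t i));
         R = (\<lambda>\<omega>. F \<omega> - (\<integral>\<omega>'. F \<omega>' \<partial>M)
                - (\<Sum>i=1..n. \<nu> i \<omega> * (W (t i) \<omega> - W (t (i - 1)) \<omega>)))
     in R \<in> L2_space M \<and> L2_norm_of M R \<le> (sqrt 3 * C + 1) * real n powr (- (\<beta> * \<theta>) / 2)"
      \<comment> \<open>The sum from 1 to \<open>n\<close> is shifted to start at 0, so that the
        interval number \<open>i\<close> runs from \<open>gd n i\<close> to
        \<open>gd n (Suc i)\<close>.\<close>
      unfolding Let_def gd_def[symmetric] One_nat_def sum.atLeast1_atMost_eq diff_Suc_Suc diff_zero
      by (rule main[OF n refl])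
  qed
qed

end
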